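(* Let $q$ be an odd prime power and $g\ge 1$ an integer. Let $N\ge 1$ be an integer and let $\phi(\theta)=\sum_{|n|\le N}\widehat{\phi}(n)e(n\theta)$ be a real, even trigonometric polynomial, where $e(x)=e^{2\pi i x}$. Put $\Phi(x)=\phi(x/(2g))$, and for real $y$ with $2gy\in\mathbb{Z}$ put $\widehat{\Phi}(y)=2g\,\widehat{\phi}(2gy)$ (with $\widehat{\phi}(m)=0$ for $|m|>N$), so that $\Phi(2g\theta)=\frac{1}{2g}\sum_{|n|\le N}\widehat{\Phi}\big(\frac{n}{2g}\big)e(n\theta)$. Let $$\Sigma_1(\Phi,g,D)=\sum_{j=1}^{2g}\Phi(2g\theta_{j,D}),\qquad c(\Phi,g)=\frac{1}{g}\sum_{1\le n\le \frac N2}\widehat{\Phi}\Big(\frac ng\Big)\sum_{\substack{r\ge 1,\ r\mid n\\ P\in\mathcal{P}_{n/r}}}\frac{d(P)}{|P|^{r}(|P|+1)}.$$ (i) If $\frac{2g}{2K+1}\le N\le \frac{2g-1}{2K-1}$ for some integer $K\ge 1$, then for any integer $K'$ with $K\le K'\le g$, \begin{align*} \big\langle \Sigma_1(\Phi,g,D)\big\rangle_{\mathcal{H}_{2g+1}}=&\ \widehat{\Phi}(0)-\frac1g\sum_{1\le n\le \frac N2}\widehat{\Phi}\Big(\frac ng\Big)+c(\Phi,g)-\sum_{k=K}^{K'}\frac{\mathbb{1}_{(2k+1)\mid g}}{g(q-1)}\widehat{\Phi}\Big(\frac{1}{2k+1}\Big)q^{-\frac{4kg}{2k+1}}\\ &+\frac1g\sum_{k=K}^{K'}\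 \sum_{\frac{g+1}{2k+1}\le n\le \min\{\frac N2,\frac{g-1}{2k}\}}\widehat{\Phi}\Big(\frac ng\Big)q^{-4kn}\\ &+O\big(q^{\min\{\frac N2,\frac{g-1}{2K}\}-2g-\frac12}/K\big)+O\big(q^{\frac{g-1}{K'+1}-2g}/g\big). \end{align*} (ii) If $2g\le N<4g$, then $$\big\langle \Sigma_1(\Phi,g,D)\big\rangle_{\mathcal{H}_{2g+1}}=\widehat{\Phi}(0)-\frac1g\sum_{1\le n\le g}\widehat{\Phi}\Big(\frac ng\Big)+c(\Phi,g)-\frac{\widehat{\Phi}(1)}{g(q-1)}+O\big(q^{\frac N2-2g-\frac12}\big).$$
   Context: Work in $\mathbb{F}_q[x]$ with $q$ odd. $\mathcal{M}$ denotes the monic polynomials, $\mathcal{P}$ the monic irreducible polynomials, $\mathcal{P}_m$ those of degree $m$; $d(f)$ is the degree of $f$ and $|f|=q^{d(f)}$. $\mathcal{H}_{2g+1}$ is the set of monic square-free polynomials of degree $2g+1$, and for a function $F$ on it, $\langle F\rangle_{\mathcal{H}_{2g+1}}=\frac{1}{|\mathcal{H}_{2g+1}|}\sum_{D\in\mathcal{H}_{2g+1}}F(D)$. For $P\in\mathcal{P}$, $\big(\frac fP\big)\in\{0,\pm1\}$ is defined by $\big(\frac fP\big)\equiv f^{(|P|-1)/2}\pmod P$, extended multiplicatively in the bottom argument to the Jacobi symbol $\big(\frac fQ\big)$ for monic $Q$; $\chi_D(f)=\big(\frac Df\big)$. For $D\in\mathcal{H}_{2g+1}$, $\mathcal{L}(u,\chi_D)=\sum_{f\in\mathcal{M}}\chi_D(f)u^{d(f)}$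 is a polynomial of degree $2g$ all of whose zeros lie on $|u|=q^{-1/2}$; write $\mathcal{L}(u,\chi_D)=\prod_{j=1}^{2g}(1-uq^{1/2}e^{-2\pi i\theta_{j,D}})$ with $\theta_{j,D}$ real. $\mathbb{1}_{a\mid g}$ is $1$ if $a$ divides $g$ and $0$ otherwise. Sums over $n$ are over positive integers in the indicated range. The implied constants in the $O$-terms do not depend on $q,g,N,K,K'$ (they may depend on the size of the coefficients $\widehat\phi(n)$).
   Formalization: The implied constants depend on a bound for |Φ̂(n/2g)| = 2g|φ̂(n)| rather than for |φ̂(n)|; with |φ̂(n)| alone, (i) fails, e.g. for φ = 2cos(8πθ), N = 5, q = 3 and large g ≡ 1 mod 4. *)

theory Defs
  imports Complex_Main "HOL-Algebra.Polynomial_Divisibility"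
begin

text \<open>
  Finite fields are HOL-Algebra structures \<open>R\<close>, not types of class \<open>field\<close>: the constants in the
  error terms are uniform in \<open>q\<close>, so the field has to be quantified after the constant. At a type
  such as \<^typ>\<open>nat\<close>, every finite field occurs up to isomorphism as some \<open>R\<close>. Polynomials are the
  elements of \<open>poly_ring R\<close>, i.e. coefficient lists with the leading coefficient first and \<open>[]\<close>
  for zero.
\<close>

definition monic_polys :: "'a ring \<Rightarrow> 'a list set" where
  "monic_polys R = {f \<in> carrier (poly_ring R). f \<noteq> [] \<and> lead_coeff f = \<one>\<^bsub>R\<^esub>}"

definition monic_polys_deg :: "'a ring \<Rightarrow> nat \<Rightarrow> 'a list set" where
  "monic_polys_deg R n = {f \<in> monic_polys R. degree f = n}"

definition prime_polys :: "'a ring \<Rightarrow> 'a list set" where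
  "prime_polys R = {P \<in> monic_polys R. pirreducible\<^bsub>R\<^esub> (carrier R) P}"

definition prime_polys_deg :: "'a ring \<Rightarrow> nat \<Rightarrow> 'a list set" where
  "prime_polys_deg R m = {P \<in> prime_polys R. degree P = m}"

definition poly_norm :: "'a ring \<Rightarrow> 'a list \<Rightarrow> nat" where
  "poly_norm R f = order R ^ degree f"

definition squarefree_poly :: "'a ring \<Rightarrow> 'a list \<Rightarrow> bool" where
  "squarefree_poly R f \<longleftrightarrow>
     (\<forall>h \<in> carrier (poly_ring R).
        (h \<otimes>\<^bsub>poly_ring R\<^esub> h) pdivides\<^bsub>R\<^esub> f \<longrightarrow> h \<in> Units (poly_ring R))"

definition hyperelliptic :: "'a ring \<Rightarrow> nat \<Rightarrow> 'a list set" where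
  "hyperelliptic R n = {D \<in> monic_polys_deg R n. squarefree_poly R D}"

definition ensemble_avg :: "'a ring \<Rightarrow> nat \<Rightarrow> ('a list \<Rightarrow> real) \<Rightarrow> real" where
  "ensemble_avg R n F = (\<Sum>D \<in> hyperelliptic R n. F D) / real (card (hyperelliptic R n))"


text \<open>For \<open>P\<close> irreducible and \<open>q\<close> odd, \<open>-1, 0, 1\<close> are pairwise incongruent modulo \<open>P\<close> and
  \<open>f\<^sup>(\<^sup>|\<^sup>P\<^sup>|\<^sup>-\<^sup>1\<^sup>)\<^sup>/\<^sup>2\<close> is congruent to one of them, so the description is proper.\<close>

definition legendre_poly :: "'a ring \<Rightarrow> 'a list \<Rightarrow> 'a list \<Rightarrow> int" where
  "legendre_poly R f P =
     (THE s. s \<in> {-1, 0, 1} \<and>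
        P pdivides\<^bsub>R\<^esub>
          (f [^]\<^bsub>poly_ring R\<^esub> ((poly_norm R P - 1) div 2)
             \<ominus>\<^bsub>poly_ring R\<^esub> add_pow (poly_ring R) s \<one>\<^bsub>poly_ring R\<^esub>))"

definition poly_mult_order :: "'a ring \<Rightarrow> 'a list \<Rightarrow> 'a list \<Rightarrow> nat" where
  "poly_mult_order R P Q = Max {k::nat. (P [^]\<^bsub>poly_ring R\<^esub> k) pdivides\<^bsub>R\<^esub> Q}"

definition jacobi_poly :: "'a ring \<Rightarrow> 'a list \<Rightarrow> 'a list \<Rightarrow> int" where
  "jacobi_poly R f Q =
     (\<Prod>P \<in> {P \<in> prime_polys R. P pdivides\<^bsub>R\<^esub> Q}. legendre_poly R f P ^ poly_mult_order R P Q)"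

definition quad_char :: "'a ring \<Rightarrow> 'a list \<Rightarrow> 'a list \<Rightarrow> int" where
  "quad_char R D f = jacobi_poly R D f"

text \<open>The sum over all monic \<open>f\<close> is taken degree by degree; for \<open>D \<in> hyperelliptic R (2 * g + 1)\<close>
  the coefficients vanish beyond degree \<open>2 * g\<close>, so the series is a polynomial in \<open>u\<close>.\<close>

definition quad_L :: "'a ring \<Rightarrow> 'a list \<Rightarrow> complex \<Rightarrow> complex" where
  "quad_L R D u = (\<Sum>n. (\<Sum>f \<in> monic_polys_deg R n. of_int (quad_char R D f)) * u ^ n)"

definition e :: "real \<Rightarrow> complex" where
  "e x = exp (2 * pi * \<i> * x)"

text \<open>\<open>\<theta> D j\<close> is the angle \<open>\<theta>\<^sub>j\<^sub>,\<^sub>D\<close>. It is determined up to order and integer shifts; a real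
  choice exists for every finite field of odd order by Weil's theorem.\<close>

definition zero_angles :: "'a ring \<Rightarrow> nat \<Rightarrow> ('a list \<Rightarrow> nat \<Rightarrow> real) \<Rightarrow> bool" where
  "zero_angles R g \<theta> \<longleftrightarrow>
     (\<forall>D \<in> hyperelliptic R (2 * g + 1). \<forall>u.
        quad_L R D u =
          (\<Prod>j = 1..2 * g. 1 - u * complex_of_real (sqrt (real (order R))) * e (- \<theta> D j)))"


text \<open>The coefficients \<open>a n\<close> stand for the Fourier coefficients of \<open>\<phi>\<close>.\<close>

definition even_trig_poly :: "nat \<Rightarrow> (int \<Rightarrow> complex) \<Rightarrow> (real \<Rightarrow> real) \<Rightarrow> bool" where
  "even_trig_poly N a \<phi> \<longleftrightarrow>
     (\<forall>n. \<bar>n\<bar> > int N \<longrightarrow> a n = 0) \<and>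
     (\<forall>\<theta>. complex_of_real (\<phi> \<theta>) = (\<Sum>n = - int N..int N. a n * e (real_of_int n * \<theta>))) \<and>
     (\<forall>\<theta>. \<phi> (- \<theta>) = \<phi> \<theta>)"

definition Phi :: "nat \<Rightarrow> (real \<Rightarrow> real) \<Rightarrow> real \<Rightarrow> real" where
  "Phi g \<phi> x = \<phi> (x / (2 * real g))"

text \<open>Only meaningful for \<open>2 * g * y\<close> an integer, where the floor does nothing.
  It is the size of \<open>Phi_hat g a (n / (2 * g)) = 2 * g * a n\<close>, not of \<open>a n\<close>, that error constants
  uniform in \<open>g\<close> can depend on: for the fixed function \<open>\<phi> \<theta> = 2 * cos (8 * pi * \<theta>)\<close> with \<open>N = 5\<close> and
  \<open>g = 4 * k + 1\<close>, the summand for \<open>k\<close>, \<open>n = 2\<close> of the secondary main term is \<open>2 * q powr (2 - 2 * g)\<close>,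
  larger by a factor of order \<open>g\<close> than the error terms allow when the sum stops at \<open>K' = k - 1\<close>.\<close>

definition Phi_hat :: "nat \<Rightarrow> (int \<Rightarrow> complex) \<Rightarrow> real \<Rightarrow> complex" where
  "Phi_hat g a y = 2 * of_nat g * a \<lfloor>2 * real g * y\<rfloor>"

definition Sigma1 ::
    "(real \<Rightarrow> real) \<Rightarrow> nat \<Rightarrow> ('a list \<Rightarrow> nat \<Rightarrow> real) \<Rightarrow> 'a list \<Rightarrow> real" where
  "Sigma1 \<phi> g \<theta> D = (\<Sum>j = 1..2 * g. Phi g \<phi> (2 * real g * \<theta> D j))"

definition c_term :: "'a ring \<Rightarrow> nat \<Rightarrow> nat \<Rightarrow> (int \<Rightarrow> complex) \<Rightarrow> complex" where
  "c_term R g N a =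
     1 / of_nat g *
     (\<Sum>n | 1 \<le> n \<and> real n \<le> real N / 2.
        Phi_hat g a (real n / real g) *
        (\<Sum>r | 1 \<le> r \<and> r dvd n. \<Sum>P \<in> prime_polys_deg R (n div r).
           of_nat (degree P) / (of_nat (poly_norm R P) ^ r * (of_nat (poly_norm R P) + 1))))"

end

theory Submission
  imports Defs "HOL-Algebra.Multiplicative_Group" "HOL-Algebra.Sylow"
    "HOL-Computational_Algebra.Formal_Power_Series"
begin

text \<open>
  By the explicit formula, the mean of \<open>\<Sum>\<^sub>j e(n\<theta>\<^sub>j)\<close> is a weighted sum, over prime powers \<open>P\<^sup>r\<close> of degree \<open>n\<close>, of the
  averages of \<open>\<chi>\<^sub>D(P\<^sup>r)\<close> over square-free \<open>D\<close>. Even powers only see whether \<open>P\<close> divides \<open>D\<close> and produce the first main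
  terms and \<open>c(\<Phi>,g)\<close>. For odd powers, primes of odd degree cancel under \<open>x \<mapsto> cx\<close> with \<open>c\<close> a nonresidue. For a prime of
  degree \<open>2\<delta>\<close>, the sum of \<open>(D/P)\<close> over square-free \<open>D\<close> of degree \<open>2g+1\<close> depends only on \<open>g\<close> modulo \<open>2\<delta>\<close>, and the functional
  equation turns it into a short sum of symbols \<open>(f/P)\<close>. Summed over \<open>P\<close>, the squares \<open>f\<close> give the secondary main
  terms, whose shape depends on whether \<open>g mod 2\<delta>\<close> is less than, equal to or greater than \<open>\<delta>\<close>; all other \<open>f\<close> are
  bounded by the Riemann hypothesis for curves \<open>y\<^sup>2 = f(x)\<close>, proved by the method of Stepanov and Bombieri.
\<close>

section \<open>The quadratic character of a finite field\<close>

text \<open>The Riemann hypothesis is needed only on average over primes of degree 2\<delta>, that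
  is, for point counts over the field of order s^2 with s = q^\<delta>. A square order suits the
  Bombieri argument: the s-th power is half of the Frobenius and turns the vanishing condition into
  an additive one of small degree. Its upper bound, applied to both signs of the symbol, yields the
  lower bound by complement, because almost all elements of that field have exact degree 2\<delta>.

  The error terms reflect how primes of degree 2\<nu> enter. They contribute nothing at all if g mod
  2\<nu> exceeds \<nu>; the surviving \<nu> satisfy 2K\<nu> \<le> g, whence the minimum in the
  exponent. For each of them the non-squares cost \<nu> q^(2\<nu>), while the normalization is
  q^(\<nu> + 2g) times q - 1. This leaves \<nu> q^(\<nu> - 2g - 1), and the weight \<nu>, at most
  g/K, becomes the factor 1/K after division by g. Passing from g/(2K) to (g - 1)/(2K) costs at most
  the remaining square root of q.\<close>

locale odd_finite_field = field R for R (structure) +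
  assumes fin: "finite (carrier R)" and odd_order: "odd (order R)"
begin

text \<open>Euler's criterion as a definition. Any nonzero \<open>x\<close> whose power is not one
  gets -1; that the power is then minus one is \<open>pow_half\<close>.\<close>

definition qc :: "'a \<Rightarrow> int" where
  "qc x = (if x = \<zero> then 0 else if x [^] ((order R - 1) div 2) = \<one> then 1 else -1)"

lemma order_ge_3: "order R \<ge> 3"
proof -
  have "card {\<zero>, \<one>} \<le> order R"
    unfolding order_def by (rule card_mono[OF fin]) auto
  then have "order R \<ge> 2" by simp
  with odd_order show ?thesis by (cases "order R = 2") auto
qed

lemma half: "2 * ((order R - 1) div 2) = order R - 1"
  using odd_order by auto

lemma pow_order_minus_1: "x \<in> carrier R \<Longrightarrow> x \<noteq> \<zero> \<Longrightarrow> x [^] (order R - 1) = \<one>"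
proof -
  assume x: "x \<in> carrier R" "x \<noteq> \<zero>"
  interpret M: group "Multiplicative_Group.mult_of R" by (rule field_mult_group)
  have "x [^]\<^bsub>Multiplicative_Group.mult_of R\<^esub> order (Multiplicative_Group.mult_of R) = \<one>\<^bsub>Multiplicative_Group.mult_of R\<^esub>"
    by (rule M.pow_order_eq_1) (use x fin in auto)
  moreover have "order (Multiplicative_Group.mult_of R) = order R - 1" using fin by (rule order_mult_of)
  ultimately show ?thesis by (simp add: Multiplicative_Group.nat_pow_mult_of)
qed

lemma pow_order: "x \<in> carrier R \<Longrightarrow> x [^] order R = x"
proof -
  assume x: "x \<in> carrier R"
  obtain k where k: "order R = Suc k" using order_ge_3 by (cases "order R") auto
  show ?thesis using pow_order_minus_1[OF x] x k by (cases "x = \<zero>") auto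
qed

text \<open>By Lagrange in the additive group, an odd multiple of one vanishes, namely
  \<open>order R\<close> times one. If two vanished as well, so would one.\<close>

lemma one_neq_minus_one: "\<one> \<noteq> \<ominus> \<one>"
proof
  assume eq: "\<one> = \<ominus> \<one>"
  have two: "\<one> \<oplus> \<one> = \<zero>" using eq r_neg[of \<one>] by simp
  have "add_pow R (2 * k) \<one> = \<zero>" for k :: nat
  proof (induction k)
    case (Suc k)
    have "add_pow R (2 * Suc k) \<one> = add_pow R (2 * k) \<one> \<oplus> (\<one> \<oplus> \<one>)"
      by (simp add: a_assoc)
    then show ?case using Suc two by simp
  qed simp
  moreover obtain k where k: "order R = 2 * k + 1" using odd_order by (auto elim: oddE)
  moreover have "add_pow R (order R) \<one> = \<zero>"
    using add.pow_order_eq_1[of \<one>] fin by (simp add: order_def)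
  ultimately show False by simp
qed

lemma square_eq_one: "x \<in> carrier R \<Longrightarrow> x \<otimes> x = \<one> \<Longrightarrow> x = \<one> \<or> x = \<ominus> \<one>"
proof -
  assume x: "x \<in> carrier R" "x \<otimes> x = \<one>"
  have "(x \<ominus> \<one>) \<otimes> (x \<oplus> \<one>) = (x \<otimes> x) \<ominus> \<one>"
    using x(1) by (simp add: a_minus_def l_distr r_distr a_ac r_neg1 r_neg2 l_minus r_minus)
  also have "\<dots> = \<zero>" using x by (simp add: a_minus_def r_neg)
  finally have "x \<ominus> \<one> = \<zero> \<or> x \<oplus> \<one> = \<zero>" using x by (simp add: integral_iff)
  then show ?thesis using x by (metis minus_equality r_right_minus_eq one_closed)
qed

lemma pow_half:
  assumes "x \<in> carrier R" "x \<noteq> \<zero>"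
  shows "x [^] ((order R - 1) div 2) = (if qc x = 1 then \<one> else \<ominus> \<one>)"
proof -
  let ?y = "x [^] ((order R - 1) div 2)"
  have "?y \<otimes> ?y = \<one>" using assms pow_order_minus_1[OF assms] half
    by (simp add: nat_pow_mult mult_2[symmetric])
  then have "?y = \<one> \<or> ?y = \<ominus> \<one>" using square_eq_one assms by simp
  then show ?thesis using assms by (auto simp: qc_def)
qed

lemma qc_cases: "qc x \<in> {-1, 0, 1}" by (auto simp: qc_def)

lemma qc_zero_iff: "qc x = 0 \<longleftrightarrow> x = \<zero>" by (auto simp: qc_def)

lemma qc_zero [simp]: "qc \<zero> = 0" by (auto simp: qc_def)

lemma qc_mult: "x \<in> carrier R \<Longrightarrow> y \<in> carrier R \<Longrightarrow> qc (x \<otimes> y) = qc x * qc y"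
proof -
  assume xy: "x \<in> carrier R" "y \<in> carrier R"
  show ?thesis
  proof (cases "x = \<zero> \<or> y = \<zero>")
    case True then show ?thesis using xy by auto
  next
    case False
    let ?e = "(order R - 1) div 2"
    have nz: "x \<otimes> y \<noteq> \<zero>" using False xy by (simp add: integral_iff)
    have "(x \<otimes> y) [^] ?e = x [^] ?e \<otimes> y [^] ?e" using xy by (rule nat_pow_distrib)
    then have "(if qc (x \<otimes> y) = 1 then \<one> else \<ominus> \<one>) =
       (if qc x = 1 then \<one> else \<ominus> \<one>) \<otimes> (if qc y = 1 then \<one> else \<ominus> \<one>)"
      using pow_half[OF m_closed[OF xy] nz] pow_half[of x] pow_half[of y] xy False by simp
    then have "qc (x \<otimes> y) = 1 \<longleftrightarrow> (qc x = 1 \<longleftrightarrow> qc y = 1)"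
      using one_neq_minus_one by (auto split: if_splits simp: l_minus r_minus)
    moreover have "qc x \<noteq> 0" "qc y \<noteq> 0" "qc (x \<otimes> y) \<noteq> 0" using False nz by (auto simp: qc_zero_iff)
    ultimately show ?thesis using qc_cases[of x] qc_cases[of y] qc_cases[of "x \<otimes> y"] by auto
  qed
qed

lemma qc_one: "qc \<one> = 1" by (simp add: qc_def)

text \<open>Otherwise all q - 1 nonzero elements would be roots of x^((q - 1)/2) - 1, more than its
  degree allows.\<close>

lemma exists_nonresidue: "\<exists>c \<in> carrier R. qc c = -1"
proof (rule ccontr)
  assume "\<not> ?thesis"
  then have "qc c = 1" if "c \<in> carrier R" "c \<noteq> \<zero>" for c using that qc_cases[of c] qc_zero_iff[of c] by auto
  then have sub: "carrier R - {\<zero>} \<subseteq> {x \<in> carrier R. x [^] ((order R - 1) div 2) = \<one>}"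
    using pow_half by auto
  have "order R - 1 = card (carrier R - {\<zero>})" using fin by (simp add: order_def)
  also have "\<dots> \<le> card {x \<in> carrier R. x [^] ((order R - 1) div 2) = \<one>}"
    using fin by (intro card_mono sub) simp
  also have "\<dots> \<le> (order R - 1) div 2" using order_ge_3 by (intro num_roots_le_deg fin) simp
  finally show False using order_ge_3 by simp
qed

text \<open>Multiplication by a nonresidue permutes the field and negates the character.\<close>

lemma sum_qc: "(\<Sum>x\<in>carrier R. qc x) = 0"
proof -
  obtain c where c: "c \<in> carrier R" "qc c = -1" using exists_nonresidue by blast
  have cn: "c \<noteq> \<zero>" using c by auto
  have inj: "inj_on ((\<otimes>) c) (carrier R)" using c cn m_lcancel by (auto simp: inj_on_def)
  have img: "(\<otimes>) c ` carrier R = carrier R"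
    using c fin endo_inj_surj[OF fin _ inj] by blast
  have "(\<Sum>x\<in>carrier R. qc x) = (\<Sum>x\<in>(\<otimes>) c ` carrier R. qc x)" using img by simp
  also have "\<dots> = (\<Sum>x\<in>carrier R. qc (c \<otimes> x))" by (simp add: sum.reindex[OF inj])
  also have "\<dots> = - (\<Sum>x\<in>carrier R. qc x)" using c by (simp add: qc_mult sum_negf)
  finally show ?thesis by simp
qed

text \<open>The inequality "at most" holds for each \<open>w\<close>. Summed over the field both
  sides give its order, the left because every \<open>y\<close> has exactly one square, the right by
  \<open>sum_qc\<close>; so equality holds throughout, without exhibiting a root of any
  residue.\<close>

lemma card_square_roots:
  assumes w: "w \<in> carrier R" shows "int (card {y \<in> carrier R. y \<otimes> y = w}) = 1 + qc w"
proof -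
  let ?r = "\<lambda>w. {y \<in> carrier R. y \<otimes> y = w}"
  let ?N = "carrier R - {\<zero>}"
  have zero: "?r \<zero> = {\<zero>}" by (auto simp: integral_iff)
  have cancel: "b \<oplus> (a \<oplus> (c \<oplus> \<ominus> b)) = a \<oplus> c"
    if "b \<in> carrier R" "a \<in> carrier R" "c \<in> carrier R" for a b c
  proof -
    have "b \<oplus> (a \<oplus> (c \<oplus> \<ominus> b)) = (a \<oplus> c) \<oplus> (b \<oplus> \<ominus> b)" using that by (simp add: a_ac)
    then show ?thesis using that by (simp add: r_neg)
  qed
  have two: "card (?r w) \<le> 2" if w: "w \<in> carrier R" for w
  proof (cases "?r w = {}")
    case False
    then obtain y where y: "y \<in> carrier R" "y \<otimes> y = w" by auto
    have "?r w \<subseteq> {y, \<ominus> y}"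
    proof
      fix z assume z: "z \<in> ?r w"
      then have zc: "z \<in> carrier R" by simp
      have "(z \<ominus> y) \<otimes> (z \<oplus> y) = (z \<otimes> z) \<ominus> (y \<otimes> y)"
        using zc y(1) cancel[of "y \<otimes> z" "z \<otimes> z" "\<ominus> (y \<otimes> y)"]
        by (simp add: a_minus_def l_distr r_distr a_ac l_minus r_minus m_comm)
      also have "\<dots> = \<zero>" using z y w by (simp add: a_minus_def r_neg)
      finally have "z \<ominus> y = \<zero> \<or> z \<oplus> y = \<zero>" using zc y by (simp add: integral_iff)
      moreover have "z = y" if "z \<ominus> y = \<zero>" using that zc y(1) by (simp add: r_right_minus_eq)
      moreover have "z = \<ominus> y" if "z \<oplus> y = \<zero>" using minus_equality[OF that y(1) zc] by simp
      ultimately show "z \<in> {y, \<ominus> y}" by blast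
    qed
    then have "card (?r w) \<le> card {y, \<ominus> y}" by (intro card_mono) auto
    also have "\<dots> \<le> 2" by (simp add: card_insert_if)
    finally show ?thesis .
  next
    case True
    show ?thesis unfolding True by simp
  qed
  have nonres: "card (?r w) = 0" if w: "w \<in> carrier R" "qc w = -1" for w
  proof -
    have "?r w = {}"
    proof (rule ccontr)
      assume "?r w \<noteq> {}"
      then obtain y where y: "y \<in> carrier R" "y \<otimes> y = w" by auto
      then have "qc w = qc y * qc y" using qc_mult by auto
      then show False using w qc_cases[of y] by auto
    qed
    then show ?thesis by (simp only: card.empty)
  qed
  have le: "int (card (?r w)) \<le> 1 + qc w" if "w \<in> carrier R" for w
  proof (cases "w = \<zero>")
    case True
    show ?thesis unfolding True zero by simp
  next
    case False
    then have "qc w \<noteq> 0" by (simp add: qc_zero_iff)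
    then consider "qc w = 1" | "qc w = -1" using qc_cases[of w] by blast
    then show ?thesis
    proof cases
      case 1 then show ?thesis using two[OF that] by linarith
    next
      case 2 then show ?thesis using nonres[OF that 2] by linarith
    qed
  qed
  have "(\<Sum>w\<in>carrier R. 1 + qc w - int (card (?r w))) =
      int (card (carrier R)) + (\<Sum>w\<in>carrier R. qc w) - (\<Sum>w\<in>carrier R. int (card (?r w)))"
    by (simp add: sum.distrib sum_subtractf)
  also have "(\<Sum>w\<in>carrier R. int (card (?r w))) = int (card (carrier R))"
  proof -
    have "(\<Sum>w\<in>carrier R. sum (\<lambda>_. 1::nat) (?r w)) = sum (\<lambda>_. 1) (carrier R)"
      by (rule sum.group) (use fin in auto)
    then show ?thesis by (simp flip: of_nat_sum)
  qed
  finally have "(\<Sum>w\<in>carrier R. 1 + qc w - int (card (?r w))) = 0" using sum_qc by simp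
  then have "\<forall>w\<in>carrier R. 1 + qc w - int (card (?r w)) = 0"
    using le fin by (subst (asm) sum_nonneg_eq_0_iff) auto
  then show ?thesis using w by auto
qed

end

section \<open>Polynomials over a finite field of odd order\<close>

locale poly_over_odd_field = odd_finite_field R for R :: "'a ring" (structure)
begin

abbreviation S where "S \<equiv> poly_ring R"
abbreviation q where "q \<equiv> order R"
abbreviation pmul (infixl "\<boxtimes>" 70) where "f \<boxtimes> h \<equiv> f \<otimes>\<^bsub>S\<^esub> h"
abbreviation padd (infixl "\<boxplus>" 65) where "f \<boxplus> h \<equiv> f \<oplus>\<^bsub>S\<^esub> h"
abbreviation psub (infixl "\<boxminus>" 65) where "f \<boxminus> h \<equiv> f \<ominus>\<^bsub>S\<^esub> h"
abbreviation ppow :: "'a list \<Rightarrow> nat \<Rightarrow> 'a list" (infixr "\<up>" 75) where "f \<up> n \<equiv> f [^]\<^bsub>S\<^esub> n"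

sublocale S: principal_domain S
  by (rule univ_poly_is_principal[OF carrier_is_subfield])

lemma zero_S [simp]: "\<zero>\<^bsub>S\<^esub> = []" by (rule univ_poly_zero)
lemma one_S: "\<one>\<^bsub>S\<^esub> = [\<one>]" by (rule univ_poly_one)
lemma nil_closed [simp]: "[] \<in> carrier S" using S.zero_closed by simp
lemma one_S_neq [simp]: "\<one>\<^bsub>S\<^esub> \<noteq> []" by (simp add: one_S)
lemma degree_one_S [simp]: "degree \<one>\<^bsub>S\<^esub> = 0" by (simp add: one_S)

lemma mult_eq_nil_iff [simp]:
  "f \<in> carrier S \<Longrightarrow> h \<in> carrier S \<Longrightarrow> f \<boxtimes> h = [] \<longleftrightarrow> f = [] \<or> h = []"
  using S.integral_iff[of f h] by simp

lemma pow_eq_nil_iff: "f \<in> carrier S \<Longrightarrow> f \<noteq> [] \<Longrightarrow> f \<up> n \<noteq> []"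
  by (rule polynomial_pow_not_zero)

lemma degree_mult:
  assumes "f \<in> carrier S" "h \<in> carrier S" "f \<noteq> []" "h \<noteq> []"
  shows "degree (f \<boxtimes> h) = degree f + degree h"
  using poly_mult_degree_eq[OF carrier_is_subring, of f h] assms
  by (simp add: univ_poly_mult univ_poly_carrier[symmetric])

lemma length_mult:
  assumes "f \<in> carrier S" "h \<in> carrier S" "f \<noteq> []" "h \<noteq> []"
  shows "length (f \<boxtimes> h) = length f + length h - 1"
proof -
  have "f \<boxtimes> h \<noteq> []" using assms by simp
  then have "length (f \<boxtimes> h) > 0" "length f > 0" "length h > 0" using assms by auto
  with degree_mult[OF assms] show ?thesis by linarith
qed

lemma lead_coeff_mult:
  assumes "f \<in> carrier S" "h \<in> carrier S" "f \<noteq> []" "h \<noteq> []"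
  shows "lead_coeff (f \<boxtimes> h) = lead_coeff f \<otimes> lead_coeff h"
  using poly_mult_lead_coeff[OF carrier_is_subring, of f h] assms
  by (simp add: univ_poly_mult univ_poly_carrier[symmetric])

lemma degree_pow: "f \<in> carrier S \<Longrightarrow> degree (f \<up> n) = n * degree f"
  by (rule polynomial_pow_degree)

lemma length_add_le: "length (f \<boxplus> h) \<le> max (length f) (length h)"
  by (simp add: univ_poly_add poly_add_length_le del: poly_add.simps)

lemma length_minus [simp]: "f \<in> carrier S \<Longrightarrow> length (\<ominus>\<^bsub>S\<^esub> f) = length f"
  by (rule univ_poly_a_inv_length[OF carrier_is_subring])

lemma length_sub_le: "h \<in> carrier S \<Longrightarrow> length (f \<boxminus> h) \<le> max (length f) (length h)"
  unfolding a_minus_def using length_add_le[of f "\<ominus>\<^bsub>S\<^esub> h"] by simp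

lemma set_closed: "f \<in> carrier S \<Longrightarrow> set f \<subseteq> carrier R"
  using polynomial_incl by (auto simp: univ_poly_carrier[symmetric])

lemma coeff_closed [simp]: "f \<in> carrier S \<Longrightarrow> coeff f i \<in> carrier R"
  by (rule coeff_in_carrier[OF set_closed])

lemma coeff_add: "f \<in> carrier S \<Longrightarrow> h \<in> carrier S \<Longrightarrow> coeff (f \<boxplus> h) i = coeff f i \<oplus> coeff h i"
  using poly_add_coeff[of f h] set_closed by (simp add: univ_poly_add)

lemma coeff_mult: "f \<in> carrier S \<Longrightarrow> h \<in> carrier S \<Longrightarrow>
    coeff (f \<boxtimes> h) i = (\<Oplus>k\<in>{..i}. coeff f k \<otimes> coeff h (i - k))"
  using poly_mult_coeff[of f h] set_closed by (simp add: univ_poly_mult)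

lemma coeff_eqI: "f \<in> carrier S \<Longrightarrow> h \<in> carrier S \<Longrightarrow> (\<And>i. coeff f i = coeff h i) \<Longrightarrow> f = h"
  using coeff_iff_polynomial_cond[of "carrier R" f h] by (auto simp: univ_poly_carrier[symmetric])

lemma const_closed: "c \<in> carrier R \<Longrightarrow> c \<noteq> \<zero> \<Longrightarrow> [c] \<in> carrier S"
  by (simp add: univ_poly_carrier[symmetric] polynomial_def)

lemma const_mult: "c \<in> carrier R \<Longrightarrow> c \<noteq> \<zero> \<Longrightarrow> f \<in> carrier S \<Longrightarrow> [c] \<boxtimes> f = map ((\<otimes>) c) f"
  using poly_mult_const[OF carrier_is_subring, of f c]
  by (simp add: univ_poly_mult univ_poly_carrier)

lemma Units_S: "f \<in> Units S \<longleftrightarrow> f \<in> carrier S \<and> f \<noteq> [] \<and> degree f = 0"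
  by (rule univ_poly_units'[OF carrier_is_subfield])

lemma hd_closed: "f \<in> carrier S \<Longrightarrow> f \<noteq> [] \<Longrightarrow> hd f \<in> carrier R \<and> hd f \<noteq> \<zero>"
  using set_closed[of f] by (auto simp: univ_poly_carrier[symmetric] polynomial_def)

text \<open>The bound on the length says degree less than \<open>n\<close> and, unlike a bound on
  \<open>degree\<close>, treats zero like any other polynomial. So this is a vector space of
  dimension \<open>n\<close> over the constants.\<close>

definition V :: "nat \<Rightarrow> 'a list set" where "V n = {f \<in> carrier S. length f \<le> n}"

lemma V_carrier: "f \<in> V n \<Longrightarrow> f \<in> carrier S" by (simp add: V_def)

lemma V_mono: "m \<le> n \<Longrightarrow> V m \<subseteq> V n" by (auto simp: V_def)

lemma V_0 [simp]: "V 0 = {[]}" by (auto simp: V_def)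

lemma nil_V [simp]: "[] \<in> V n" by (simp add: V_def)

lemma V_add: "f \<in> V n \<Longrightarrow> h \<in> V n \<Longrightarrow> f \<boxplus> h \<in> V n"
  using length_add_le[of f h] by (auto simp: V_def)

lemma V_sub: "f \<in> V n \<Longrightarrow> h \<in> V n \<Longrightarrow> f \<boxminus> h \<in> V n"
  using length_sub_le[of h f] by (auto simp: V_def)

section \<open>Monic polynomials\<close>

lemma monic_iff: "f \<in> monic_polys R \<longleftrightarrow> f \<in> carrier S \<and> f \<noteq> [] \<and> hd f = \<one>"
  by (simp add: monic_polys_def)

lemma monic_carrier: "f \<in> monic_polys R \<Longrightarrow> f \<in> carrier S" by (simp add: monic_iff)
lemma monic_nonnil: "f \<in> monic_polys R \<Longrightarrow> f \<noteq> []" by (simp add: monic_iff)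

lemma monic_mult: "f \<in> monic_polys R \<Longrightarrow> h \<in> monic_polys R \<Longrightarrow> f \<boxtimes> h \<in> monic_polys R"
  by (simp add: monic_iff lead_coeff_mult)

lemma monic_one: "\<one>\<^bsub>S\<^esub> \<in> monic_polys R"
  using S.one_closed by (simp add: monic_iff one_S)

lemma monic_pow: "f \<in> monic_polys R \<Longrightarrow> f \<up> n \<in> monic_polys R"
  by (induction n) (auto intro: monic_mult monic_one)

lemma monic_cancel:
  assumes "f \<boxtimes> h \<in> monic_polys R" "f \<in> monic_polys R" "h \<in> carrier S"
  shows "h \<in> monic_polys R"
proof -
  have "h \<noteq> []" "hd h \<in> carrier R" using assms hd_closed[of h] by (auto simp: monic_iff)
  then show ?thesis using assms lead_coeff_mult[of f h] by (auto simp: monic_iff)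
qed

lemma monic_degree_0: "f \<in> monic_polys R \<Longrightarrow> degree f = 0 \<Longrightarrow> f = \<one>\<^bsub>S\<^esub>"
  by (cases f) (auto simp: monic_iff one_S)

lemma monic_deg_iff: "f \<in> monic_polys_deg R n \<longleftrightarrow> f \<in> monic_polys R \<and> degree f = n"
  by (simp add: monic_polys_deg_def)

lemma monic_deg_eq: "monic_polys_deg R n = (#) \<one> ` {xs. set xs \<subseteq> carrier R \<and> length xs = n}"
proof (intro equalityI subsetI)
  fix f assume "f \<in> monic_polys_deg R n"
  then show "f \<in> (#) \<one> ` {xs. set xs \<subseteq> carrier R \<and> length xs = n}"
    using set_closed[of f] by (cases f) (auto simp: monic_deg_iff monic_iff)
next
  fix f assume "f \<in> (#) \<one> ` {xs. set xs \<subseteq> carrier R \<and> length xs = n}"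
  then show "f \<in> monic_polys_deg R n"
    by (auto simp: monic_deg_iff monic_iff univ_poly_carrier[symmetric] polynomial_def)
qed

lemma finite_monic_deg [simp]: "finite (monic_polys_deg R n)"
  unfolding monic_deg_eq using finite_lists_length_eq[OF fin] by simp

lemma card_monic_deg: "card (monic_polys_deg R n) = q ^ n"
  unfolding monic_deg_eq by (subst card_image) (auto simp: card_lists_length_eq[OF fin] order_def)

text \<open>A polynomial of degree exactly \<open>n\<close> is a nonzero constant times a monic one,
  uniquely by \<open>V_Suc_inj\<close>. This is the bridge between sums over a linear space and sums
  over monic polynomials.\<close>

lemma V_Suc: "V (Suc n) = V n \<union> (\<lambda>(c, f). [c] \<boxtimes> f) ` ((carrier R - {\<zero>}) \<times> monic_polys_deg R n)"
proof (intro equalityI subsetI)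
  fix f assume f: "f \<in> V (Suc n)"
  show "f \<in> V n \<union> (\<lambda>(c, f). [c] \<boxtimes> f) ` ((carrier R - {\<zero>}) \<times> monic_polys_deg R n)"
  proof (cases "length f \<le> n")
    case True then show ?thesis using f by (auto simp: V_def)
  next
    case False
    define c where "c = hd f"
    have fc: "f \<in> carrier S" "f \<noteq> []" "length f = Suc n" using f False by (auto simp: V_def)
    have c: "c \<in> carrier R" "c \<noteq> \<zero>" using hd_closed[OF fc(1,2)] by (auto simp: c_def)
    have ci: "inv c \<in> carrier R" "inv c \<noteq> \<zero>" using c
      using field_Units Units_inv_closed Units_r_inv by (blast, metis Diff_iff insertCI r_null zero_not_one singletonD field_Units)
    define h where "h = [inv c] \<boxtimes> f"
    have h: "h = map ((\<otimes>) (inv c)) f" using const_mult[OF ci fc(1)] by (simp add: h_def)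
    have "length h = Suc n" "hd h = \<one>" "h \<noteq> []"
      using fc c by (simp_all add: h hd_map c_def[symmetric] field_Units)
    then have hm: "h \<in> monic_polys_deg R n"
      using fc const_closed[OF ci] by (simp add: monic_deg_iff monic_iff h_def)
    have cc: "[c] \<boxtimes> [inv c] = \<one>\<^bsub>S\<^esub>"
      using const_mult[OF c const_closed[OF ci]] c by (simp add: one_S field_Units)
    have "[c] \<boxtimes> h = f"
      unfolding h_def using S.m_assoc[OF const_closed[OF c] const_closed[OF ci] fc(1)] cc fc(1) by simp
    then show ?thesis using hm c by force
  qed
next
  fix f assume "f \<in> V n \<union> (\<lambda>(c, f). [c] \<boxtimes> f) ` ((carrier R - {\<zero>}) \<times> monic_polys_deg R n)"
  then show "f \<in> V (Suc n)"
  proof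
    assume "f \<in> V n" then show ?thesis by (auto simp: V_def)
  next
    assume "f \<in> (\<lambda>(c, f). [c] \<boxtimes> f) ` ((carrier R - {\<zero>}) \<times> monic_polys_deg R n)"
    then obtain c h where ch: "c \<in> carrier R" "c \<noteq> \<zero>" "h \<in> monic_polys_deg R n" "f = [c] \<boxtimes> h" by auto
    have hc: "h \<in> carrier S" "h \<noteq> []" using ch by (auto simp: monic_deg_iff monic_iff)
    have "length f = length h" using const_mult[OF ch(1,2) hc(1)] ch by simp
    then show ?thesis using ch hc const_closed[OF ch(1,2)] by (auto simp: V_def monic_deg_iff)
  qed
qed

lemma V_Suc_disj: "V n \<inter> (\<lambda>(c, f). [c] \<boxtimes> f) ` ((carrier R - {\<zero>}) \<times> monic_polys_deg R n) = {}"
proof -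
  have "f \<notin> V n" if "c \<in> carrier R" "c \<noteq> \<zero>" "h \<in> monic_polys_deg R n" "f = [c] \<boxtimes> h" for c h f
  proof -
    have hc: "h \<in> carrier S" "h \<noteq> []" using that by (auto simp: monic_deg_iff monic_iff)
    then have "length h = Suc n" using that by (cases h) (auto simp: monic_deg_iff)
    moreover have "length f = length h" using const_mult[OF that(1,2) hc(1)] that by simp
    ultimately show ?thesis by (auto simp: V_def)
  qed
  then show ?thesis by auto
qed

lemma V_Suc_inj: "inj_on (\<lambda>(c, f). [c] \<boxtimes> f) ((carrier R - {\<zero>}) \<times> monic_polys_deg R n)"
proof -
  have "c = c' \<and> h = h'" if c: "c \<in> carrier R" "c \<noteq> \<zero>" "c' \<in> carrier R" "c' \<noteq> \<zero>"
    and h: "h \<in> monic_polys_deg R n" "h' \<in> monic_polys_deg R n" and eq: "[c] \<boxtimes> h = [c'] \<boxtimes> h'" for c h c' h'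
  proof -
  have hc: "h \<in> carrier S" "h \<noteq> []" "h' \<in> carrier S" "h' \<noteq> []" "hd h = \<one>" "hd h' = \<one>"
    using h by (auto simp: monic_deg_iff monic_iff)
  have "hd ([c] \<boxtimes> h) = c" "hd ([c'] \<boxtimes> h') = c'"
    using lead_coeff_mult[OF const_closed] c hc by auto
  then have "c = c'" using eq by simp
  then show "c = c' \<and> h = h'" using eq S.m_lcancel[of "[c]" h h'] hc const_closed c by simp
  qed
  then show ?thesis by (auto simp: inj_on_def)
qed

lemma sum_V_Suc:
  fixes F :: "'a list \<Rightarrow> 'b::comm_monoid_add"
  assumes "finite (V n)"
  shows "sum F (V (Suc n)) = sum F (V n) + (\<Sum>c\<in>carrier R - {\<zero>}. \<Sum>f\<in>monic_polys_deg R n. F ([c] \<boxtimes> f))"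
proof -
  have "sum F (V (Suc n)) = sum F (V n) + sum F ((\<lambda>(c, f). [c] \<boxtimes> f) ` ((carrier R - {\<zero>}) \<times> monic_polys_deg R n))"
    unfolding V_Suc by (rule sum.union_disjoint) (use assms fin V_Suc_disj in auto)
  also have "sum F ((\<lambda>(c, f). [c] \<boxtimes> f) ` ((carrier R - {\<zero>}) \<times> monic_polys_deg R n)) =
    (\<Sum>c\<in>carrier R - {\<zero>}. \<Sum>f\<in>monic_polys_deg R n. F ([c] \<boxtimes> f))"
    by (subst sum.reindex[OF V_Suc_inj]) (simp add: sum.cartesian_product case_prod_unfold comp_def)
  finally show ?thesis .
qed

lemma finite_V [simp]: "finite (V n)"
  by (induction n) (auto simp: V_Suc fin)

lemma card_V: "card (V n) = q ^ n"
proof (induction n)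
  case (Suc n)
  have "card (V (Suc n)) = card (V n) + (q - 1) * q ^ n"
    using sum_V_Suc[of n "\<lambda>_. 1::nat"] fin by (simp add: card_monic_deg order_def)
  also have "\<dots> = q ^ Suc n"
    using Suc order_ge_3 by (cases q) (auto simp: algebra_simps)
  finally show ?case .
qed simp

section \<open>Prime factorization\<close>

lemma length_one_S [simp]: "length \<one>\<^bsub>S\<^esub> = Suc 0" by (simp add: one_S)

lemma prime_iff: "P \<in> prime_polys R \<longleftrightarrow> P \<in> monic_polys R \<and> pirreducible (carrier R) P"
  by (simp add: prime_polys_def)

lemma prime_monic: "P \<in> prime_polys R \<Longrightarrow> P \<in> monic_polys R" by (simp add: prime_iff)
lemma prime_carrier: "P \<in> prime_polys R \<Longrightarrow> P \<in> carrier S" by (simp add: prime_iff monic_iff)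
lemma prime_nonnil: "P \<in> prime_polys R \<Longrightarrow> P \<noteq> []" by (simp add: prime_iff monic_iff)

lemma prime_degree: "P \<in> prime_polys R \<Longrightarrow> degree P \<ge> 1"
  using pirreducible_degree[OF carrier_is_subfield] by (auto simp: prime_iff monic_iff)

lemma prime_deg_iff: "P \<in> prime_polys_deg R d \<longleftrightarrow> P \<in> prime_polys R \<and> degree P = d"
  by (simp add: prime_polys_deg_def)

lemma prime_deg_subset: "prime_polys_deg R d \<subseteq> monic_polys_deg R d"
  by (auto simp: prime_deg_iff monic_deg_iff prime_iff)

lemma finite_prime_deg [simp]: "finite (prime_polys_deg R d)"
  using finite_subset[OF prime_deg_subset] by simp

lemma pdividesI: "h \<in> carrier S \<Longrightarrow> f = k \<boxtimes> h \<Longrightarrow> k pdivides f"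
  by (auto simp: pdivides_def factor_def)

lemma pdividesE:
  assumes "k pdivides f" obtains h where "h \<in> carrier S" "f = k \<boxtimes> h"
  using assms by (auto simp: pdivides_def factor_def)

lemma pdivides_degree_le: "k pdivides f \<Longrightarrow> k \<in> carrier S \<Longrightarrow> f \<in> carrier S \<Longrightarrow> f \<noteq> [] \<Longrightarrow> degree k \<le> degree f"
  by (rule pdivides_imp_degree_le[OF carrier_is_subring])

lemma pdivides_trans: "a pdivides b \<Longrightarrow> b pdivides c \<Longrightarrow> a \<in> carrier S \<Longrightarrow> a pdivides c"
  unfolding pdivides_def by (rule S.divides_trans)

lemma prime_pdivides_mult:
  assumes "P \<in> prime_polys R" "f \<in> carrier S" "h \<in> carrier S"
  shows "P pdivides f \<boxtimes> h \<longleftrightarrow> P pdivides f \<or> P pdivides h"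
proof
  have "pprime (carrier R) P"
    using pprime_iff_pirreducible[OF carrier_is_subfield] assms by (simp add: prime_iff monic_iff)
  then show "P pdivides f \<boxtimes> h \<Longrightarrow> P pdivides f \<or> P pdivides h"
    using pprimeE(3)[OF carrier_is_subfield] assms prime_carrier by blast
  show "P pdivides f \<or> P pdivides h \<Longrightarrow> P pdivides f \<boxtimes> h"
    using assms prime_carrier[OF assms(1)] unfolding pdivides_def
    by (metis S.divides_prod_l S.divides_prod_r S.m_comm)
qed

lemma prime_pdivides_pow:
  assumes "P \<in> prime_polys R" "f \<in> carrier S" "P pdivides f \<up> n"
  shows "P pdivides f"
  using assms(3)
proof (induction n)
  case 0
  then have "degree P \<le> 0" using pdivides_degree_le[of P "\<one>\<^bsub>S\<^esub>"] prime_carrier[OF assms(1)] by simp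
  then show ?case using prime_degree[OF assms(1)] by simp
next
  case (Suc n)
  then show ?case using prime_pdivides_mult[OF assms(1), of "f \<up> n" f] assms(2) by auto
qed

lemma monic_associated:
  assumes "f \<in> monic_polys R" "h \<in> monic_polys R" "f \<sim>\<^bsub>S\<^esub> h" shows "f = h"
proof -
  obtain k where k: "k \<in> carrier R - {\<zero>}" "f = [k] \<boxtimes> h"
    using associated_polynomials_iff[OF carrier_is_subfield, of f h] assms by (auto simp: monic_iff)
  then have "hd f = k \<otimes> \<one>"
    using lead_coeff_mult[of "[k]" h] const_closed[of k] assms by (auto simp: monic_iff)
  then have "k = \<one>" using assms k by (auto simp: monic_iff)
  then show ?thesis using k assms by (simp add: one_S[symmetric] monic_iff)
qed

lemma prime_pdivides_prime:
  assumes "P \<in> prime_polys R" "P' \<in> prime_polys R" "P pdivides P'" shows "P = P'"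
proof -
  have "P \<in> Units S \<or> P \<sim>\<^bsub>S\<^esub> P'"
    using divides_pirreducible_condition[of "carrier R" P' P] assms
    by (auto simp: prime_iff monic_iff pdivides_def)
  moreover have "P \<notin> Units S" using prime_degree[OF assms(1)] by (auto simp: Units_S)
  ultimately show ?thesis using monic_associated assms by (auto simp: prime_iff)
qed

lemma exists_prime_factor:
  assumes "f \<in> carrier S" "degree f \<ge> 1"
  shows "\<exists>P \<in> prime_polys R. P pdivides f"
  using assms
proof (induction "degree f" arbitrary: f rule: less_induct)
  case less
  have fn: "f \<noteq> []" using less.prems by auto
  define c where "c = hd f"
  have c: "c \<in> carrier R" "c \<noteq> \<zero>" using hd_closed[OF less.prems(1) fn] by (auto simp: c_def)
  show ?case
  proof (cases "pirreducible (carrier R) f")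
    case True
    \<comment> \<open>\<open>f\<close> need not be monic. Its monic associate \<open>h\<close> is
      extracted with \<open>V_Suc\<close> and is irreducible because the constant is a unit.\<close>
    obtain n where n: "length f = Suc n" using fn by (cases f) auto
    then have "f \<in> V (Suc n)" "f \<notin> V n" using less.prems by (auto simp: V_def)
    then obtain k h where kh: "k \<in> carrier R" "k \<noteq> \<zero>" "h \<in> monic_polys_deg R n" "f = [k] \<boxtimes> h"
      unfolding V_Suc by auto
    have hc: "h \<in> carrier S" "h \<in> monic_polys R" using kh by (auto simp: monic_deg_iff monic_iff)
    have hf: "h \<sim>\<^bsub>S\<^esub> f"
      using associated_polynomials_iff[OF carrier_is_subfield less.prems(1) hc(1)] kh
        S.associated_sym by blast
    have hdvd: "h pdivides f" using hf by (simp add: pdivides_def associated_def)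
    have "pirreducible (carrier R) h"
    proof (rule pirreducibleI[OF carrier_is_subring hc(1)])
      show "h \<noteq> []" using hc(2) by (rule monic_nonnil)
      have "degree h = n" using kh by (simp add: monic_deg_iff)
      then show "h \<notin> Units S" using less.prems n by (simp add: Units_S)
      fix a b assume ab: "a \<in> carrier S" "b \<in> carrier S" "h = a \<boxtimes> b"
      have kc: "[k] \<in> carrier S" by (rule const_closed[OF kh(1,2)])
      have "f = ([k] \<boxtimes> a) \<boxtimes> b" using kh ab kc by (simp add: S.m_assoc)
      then have "[k] \<boxtimes> a \<in> Units S \<or> b \<in> Units S"
        using pirreducibleE(3)[OF carrier_is_subring less.prems(1) True] ab kc S.m_closed by blast
      moreover have ku: "[k] \<in> Units S" using kc by (simp add: Units_S)
      moreover have "a \<in> Units S" if "[k] \<boxtimes> a \<in> Units S"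
        by (rule S.prod_unit_l[OF that ku kc ab(1)])
      ultimately show "a \<in> Units S \<or> b \<in> Units S" by (elim disjE) simp_all
    qed
    then show ?thesis using hdvd hc by (auto simp: prime_iff)
  next
    case False
    have fnu: "f \<notin> Units S" using less.prems by (auto simp: Units_S)
    have "\<exists>a b. a \<in> carrier S \<and> b \<in> carrier S \<and> f = a \<boxtimes> b \<and> a \<notin> Units S \<and> b \<notin> Units S"
    proof (rule ccontr)
      assume *: "\<not> ?thesis"
      have "pirreducible (carrier R) f"
        by (rule pirreducibleI[OF carrier_is_subring less.prems(1) fn fnu]) (use * in blast)
      then show False using False by simp
    qed
    then obtain a b where ab: "a \<in> carrier S" "b \<in> carrier S" "f = a \<boxtimes> b" "a \<notin> Units S" "b \<notin> Units S"
      by blast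
    have abn: "a \<noteq> []" "b \<noteq> []" using ab fn by auto
    have da: "degree a \<ge> 1" "degree b \<ge> 1"
      using ab(1,2,4,5) abn unfolding Units_S by linarith+
    have "degree f = degree a + degree b" using degree_mult ab abn by simp
    then have "degree a < degree f" using da by linarith
    then obtain P where "P \<in> prime_polys R" "P pdivides a" using less.hyps[OF _ ab(1) da(1)] by blast
    moreover have "a pdivides f" using ab by (auto intro: pdividesI)
    ultimately show ?thesis using pdivides_trans prime_carrier by blast
  qed
qed

section \<open>Valuations at primes and unique factorization\<close>

abbreviation v where "v P f \<equiv> poly_mult_order R P f"

text \<open>The exponents form a finite set, bounded by \<open>degree f\<close>, that contains 0, so
  the \<open>Max\<close> in the definition of the order is attained; divisibility by lower powers is
  then automatic.\<close>

lemma pow_pdivides_iff: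
  assumes "P \<in> prime_polys R" "f \<in> carrier S" "f \<noteq> []"
  shows "P \<up> k pdivides f \<longleftrightarrow> k \<le> v P f"
proof -
  let ?A = "{k::nat. P \<up> k pdivides f}"
  have Pc: "P \<in> carrier S" by (rule prime_carrier[OF assms(1)])
  have bd: "k \<le> degree f" if "k \<in> ?A" for k
  proof -
    have "degree (P \<up> k) \<le> degree f" using that pdivides_degree_le[of "P \<up> k" f] assms Pc by simp
    then have "k * degree P \<le> degree f" using degree_pow[OF Pc] by simp
    moreover have "k * 1 \<le> k * degree P" by (rule mult_le_mono2[OF prime_degree[OF assms(1)]])
    ultimately show ?thesis by linarith
  qed
  then have finA: "finite ?A" by (meson finite_nat_set_iff_bounded_le)
  have "0 \<in> ?A" using assms by (auto intro!: pdividesI[of f])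
  then have max: "Max ?A \<in> ?A" using finA by (intro Max_in) blast+
  have "k \<in> ?A" if "k \<le> Max ?A"
    using max polynomial_pow_division[OF Pc that] pdivides_trans Pc by blast
  moreover have "k \<le> Max ?A" if "k \<in> ?A" using that finA by simp
  ultimately show ?thesis unfolding poly_mult_order_def by blast
qed

lemma v_factor:
  assumes "P \<in> prime_polys R" "f \<in> carrier S" "f \<noteq> []"
  obtains h where "h \<in> carrier S" "h \<noteq> []" "f = (P \<up> v P f) \<boxtimes> h" "\<not> P pdivides h"
proof -
  have Pc: "P \<in> carrier S" by (rule prime_carrier[OF assms(1)])
  obtain h where h: "h \<in> carrier S" "f = (P \<up> v P f) \<boxtimes> h"
    using pow_pdivides_iff[OF assms, of "v P f"] by (auto elim: pdividesE)
  have "\<not> P pdivides h"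
  proof
    assume "P pdivides h"
    then obtain k where k: "k \<in> carrier S" "h = P \<boxtimes> k" by (auto elim: pdividesE)
    have "f = (P \<up> Suc (v P f)) \<boxtimes> k" using h(2) k Pc by (simp add: S.m_assoc)
    then have "Suc (v P f) \<le> v P f" using pow_pdivides_iff[OF assms] k(1) pdividesI by blast
    then show False by simp
  qed
  moreover have "h \<noteq> []"
  proof
    assume "h = []"
    then have "f = (P \<up> v P f) \<boxtimes> \<zero>\<^bsub>S\<^esub>" using h by simp
    also have "\<dots> = []" using Pc by (subst S.r_null) auto
    finally show False using assms(3) by simp
  qed
  ultimately show ?thesis using that h by blast
qed

lemma v_unique:
  assumes "P \<in> prime_polys R" "h \<in> carrier S" "h \<noteq> []" "\<not> P pdivides h"
  shows "v P ((P \<up> n) \<boxtimes> h) = n"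
proof -
  have Pc: "P \<in> carrier S" "P \<noteq> []" using prime_carrier prime_nonnil assms(1) by auto
  let ?f = "(P \<up> n) \<boxtimes> h"
  have fc: "?f \<in> carrier S" "?f \<noteq> []" using Pc assms pow_eq_nil_iff by auto
  have "P \<up> n pdivides ?f" using assms by (auto intro: pdividesI)
  then have ge: "n \<le> v P ?f" using pow_pdivides_iff[OF assms(1) fc] by simp
  have "\<not> Suc n \<le> v P ?f"
  proof
    assume "Suc n \<le> v P ?f"
    then obtain k where k: "k \<in> carrier S" "?f = (P \<up> Suc n) \<boxtimes> k"
      using pow_pdivides_iff[OF assms(1) fc, of "Suc n"] by (auto elim: pdividesE)
    then have "(P \<up> n) \<boxtimes> h = (P \<up> n) \<boxtimes> (P \<boxtimes> k)" using Pc by (simp add: S.m_assoc)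
    then have "h = P \<boxtimes> k" using S.m_lcancel[of "P \<up> n" h "P \<boxtimes> k"] pow_eq_nil_iff[OF Pc] Pc k assms by simp
    then show False using assms(4) k(1) pdividesI by blast
  qed
  with ge show ?thesis by simp
qed

lemma v_mult:
  assumes P: "P \<in> prime_polys R" and "f \<in> carrier S" "f \<noteq> []" "h \<in> carrier S" "h \<noteq> []"
  shows "v P (f \<boxtimes> h) = v P f + v P h"
proof -
  have Pc: "P \<in> carrier S" by (rule prime_carrier[OF P])
  obtain a where a: "a \<in> carrier S" "a \<noteq> []" "f = (P \<up> v P f) \<boxtimes> a" "\<not> P pdivides a"
    using v_factor[OF P assms(2,3)] .
  obtain b where b: "b \<in> carrier S" "b \<noteq> []" "h = (P \<up> v P h) \<boxtimes> b" "\<not> P pdivides b"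
    using v_factor[OF P assms(4,5)] .
  have "f \<boxtimes> h = ((P \<up> v P f) \<boxtimes> a) \<boxtimes> ((P \<up> v P h) \<boxtimes> b)" using a(3) b(3) by simp
  also have "\<dots> = ((P \<up> v P f) \<boxtimes> (P \<up> v P h)) \<boxtimes> (a \<boxtimes> b)"
    using a(1) b(1) Pc by (simp add: S.m_ac)
  also have "\<dots> = (P \<up> (v P f + v P h)) \<boxtimes> (a \<boxtimes> b)" using Pc by (simp add: S.nat_pow_mult)
  finally show ?thesis
    using v_unique[OF P, of "a \<boxtimes> b" "v P f + v P h"] a b prime_pdivides_mult[OF P] by simp
qed

lemma v_pos_iff: "P \<in> prime_polys R \<Longrightarrow> f \<in> carrier S \<Longrightarrow> f \<noteq> [] \<Longrightarrow> v P f > 0 \<longleftrightarrow> P pdivides f"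
  using pow_pdivides_iff[of P f 1] prime_carrier by (simp add: Suc_le_eq)

lemma v_self: "P \<in> prime_polys R \<Longrightarrow> P' \<in> prime_polys R \<Longrightarrow> v P P' = of_bool (P = P')"
proof -
  assume P: "P \<in> prime_polys R" "P' \<in> prime_polys R"
  have "\<not> P pdivides \<one>\<^bsub>S\<^esub>"
    using pdivides_degree_le[of P "\<one>\<^bsub>S\<^esub>"] prime_carrier[OF P(1)] prime_degree[OF P(1)] by auto
  then have "v P P = 1" using v_unique[OF P(1), of "\<one>\<^bsub>S\<^esub>" 1] prime_carrier[OF P(1)] by simp
  moreover have "v P P' = 0" if "P \<noteq> P'"
    using that v_pos_iff[OF P(1), of P'] prime_carrier[OF P(2)] prime_nonnil[OF P(2)] prime_pdivides_prime[OF P] by auto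
  ultimately show ?thesis by (cases "P = P'") auto
qed

lemma v_one: "P \<in> prime_polys R \<Longrightarrow> v P \<one>\<^bsub>S\<^esub> = 0"
  using v_mult[of P "\<one>\<^bsub>S\<^esub>" "\<one>\<^bsub>S\<^esub>"] by simp

lemma v_pow: "P \<in> prime_polys R \<Longrightarrow> f \<in> carrier S \<Longrightarrow> f \<noteq> [] \<Longrightarrow> v P (f \<up> n) = n * v P f"
  by (induction n) (simp_all add: v_one v_mult pow_eq_nil_iff)

lemma v_degree_0: "P \<in> prime_polys R \<Longrightarrow> f \<in> carrier S \<Longrightarrow> f \<noteq> [] \<Longrightarrow> degree f = 0 \<Longrightarrow> v P f = 0"
  using v_pos_iff[of P f] pdivides_degree_le[of P f] prime_degree[of P] prime_carrier[of P] by force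

lemma monic_factor:
  assumes "k \<in> monic_polys R" "f \<in> monic_polys R" "k pdivides f"
  obtains h where "h \<in> monic_polys R" "f = k \<boxtimes> h" "degree f = degree k + degree h"
proof -
  obtain h where h: "h \<in> carrier S" "f = k \<boxtimes> h" using assms(3) by (auto elim: pdividesE)
  have hm: "h \<in> monic_polys R" using monic_cancel[of k h] assms h by simp
  then show ?thesis using that h assms degree_mult[of k h] by (auto simp: monic_iff)
qed

lemma monic_induct [consumes 1, case_names one prime_mult]:
  assumes "f \<in> monic_polys R" "Q \<one>\<^bsub>S\<^esub>"
    "\<And>P f. P \<in> prime_polys R \<Longrightarrow> f \<in> monic_polys R \<Longrightarrow> Q f \<Longrightarrow> Q (P \<boxtimes> f)"
  shows "Q f"
  using assms(1)
proof (induction "degree f" arbitrary: f rule: less_induct)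
  case less
  show ?case
  proof (cases "degree f = 0")
    case True then show ?thesis using monic_degree_0 less assms(2) by auto
  next
    case False
    then have "degree f \<ge> 1" by linarith
    then obtain P where P: "P \<in> prime_polys R" "P pdivides f"
      using exists_prime_factor[of f] less.prems by (auto simp: monic_iff)
    obtain h where h: "h \<in> monic_polys R" "f = P \<boxtimes> h" "degree f = degree P + degree h"
      using monic_factor[OF prime_monic[OF P(1)] less.prems P(2)] .
    then show ?thesis using assms(3)[OF P(1) h(1)] less.hyps[of h] prime_degree[OF P(1)] by simp
  qed
qed

lemma finite_prime_divisors:
  assumes "f \<in> carrier S" "f \<noteq> []" shows "finite {P \<in> prime_polys R. P pdivides f}"
proof (rule finite_subset)
  show "{P \<in> prime_polys R. P pdivides f} \<subseteq> (\<Union>d\<le>degree f. prime_polys_deg R d)"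
    using pdivides_degree_le assms prime_carrier by (auto simp: prime_deg_iff)
qed simp

lemma degree_eq_sum_v:
  assumes "f \<in> monic_polys R" "finite A" "{P \<in> prime_polys R. P pdivides f} \<subseteq> A" "A \<subseteq> prime_polys R"
  shows "degree f = (\<Sum>P\<in>A. v P f * degree P)"
  using assms
proof (induction f arbitrary: A rule: monic_induct)
  case one then show ?case using v_one by (auto intro!: sum.neutral[symmetric])
next
  case (prime_mult P f)
  note Pc = prime_carrier[OF prime_mult(1)] prime_nonnil[OF prime_mult(1)]
  note fc = monic_carrier[OF prime_mult(2)] monic_nonnil[OF prime_mult(2)]
  have PA: "P \<in> A" using prime_mult.prems prime_mult(1) fc by (auto intro: pdividesI)
  have sub: "{P \<in> prime_polys R. P pdivides f} \<subseteq> A"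
  proof
    fix Q assume "Q \<in> {P \<in> prime_polys R. P pdivides f}"
    then have "Q \<in> prime_polys R" "Q pdivides P \<boxtimes> f" using prime_pdivides_mult[of Q P f] Pc fc by auto
    then show "Q \<in> A" using prime_mult.prems(2) by blast
  qed
  have "v Q (P \<boxtimes> f) = of_bool (Q = P) + v Q f" if "Q \<in> A" for Q
  proof -
    have Q: "Q \<in> prime_polys R" using that prime_mult.prems(3) by blast
    show ?thesis using v_mult[OF Q Pc fc] v_self[OF Q prime_mult(1)] by simp
  qed
  then have "(\<Sum>Q\<in>A. v Q (P \<boxtimes> f) * degree Q) = (\<Sum>Q\<in>A. of_bool (Q = P) * degree Q + v Q f * degree Q)"
    by (intro sum.cong refl) (simp only: distrib_right)
  also have "\<dots> = (\<Sum>Q\<in>A. if Q = P then degree P else 0) + degree f"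
    unfolding sum.distrib prime_mult.IH[OF prime_mult.prems(1) sub prime_mult.prems(3)]
    by (intro arg_cong2[of _ _ _ _ "(+)"] sum.cong refl) simp
  also have "\<dots> = degree P + degree f" using PA prime_mult.prems(1) by simp
  finally show ?case using degree_mult Pc fc by simp
qed

text \<open>Unique factorization in terms of valuations: a prime of \<open>f\<close> divides
  \<open>h\<close> because its valuation there is positive, and can be cancelled on both
  sides.\<close>

lemma monic_eqI_v:
  assumes "f \<in> monic_polys R" "h \<in> monic_polys R" "\<And>P. P \<in> prime_polys R \<Longrightarrow> v P f = v P h"
  shows "f = h"
  using assms
proof (induction f arbitrary: h rule: monic_induct)
  case one
  have "degree h = (\<Sum>P\<in>{P \<in> prime_polys R. P pdivides h}. v P h * degree P)"
    by (rule degree_eq_sum_v) (use one finite_prime_divisors in \<open>auto simp: monic_iff\<close>)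
  also have "\<dots> = 0" using one v_one by (auto intro: sum.neutral)
  finally show ?case using monic_degree_0 one by simp
next
  case (prime_mult P f)
  note Pc = prime_carrier[OF prime_mult(1)] prime_nonnil[OF prime_mult(1)]
  note fc = monic_carrier[OF prime_mult(2)] monic_nonnil[OF prime_mult(2)]
  note hc = monic_carrier[OF prime_mult(4)] monic_nonnil[OF prime_mult(4)]
  have "v P h = v P P + v P f" using prime_mult(5)[OF prime_mult(1)] v_mult prime_mult(1) Pc fc by simp
  then have "v P h > 0" using v_self prime_mult(1) by simp
  then have "P pdivides h" using v_pos_iff prime_mult(1) hc by simp
  then obtain k where k: "k \<in> monic_polys R" "h = P \<boxtimes> k"
    using monic_factor[OF prime_monic[OF prime_mult(1)] prime_mult(4)] by metis
  have "f = k"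
  proof (rule prime_mult.IH[OF k(1)])
    fix Q assume Q: "Q \<in> prime_polys R"
    show "v Q f = v Q k"
      using prime_mult(5)[OF Q] v_mult[OF Q Pc fc] v_mult[OF Q Pc monic_carrier[OF k(1)] monic_nonnil[OF k(1)]] k(2)
      by simp
  qed
  then show ?case using k by simp
qed

text \<open>Distinct primes dividing \<open>f\<close> can be divided out one after another. In the
  Stepanov argument this bound plays the role of counting zeros: a prime of degree d stands for d
  conjugate zeros.\<close>

lemma sum_degree_prime_divisors_le:
  assumes "f \<in> carrier S" "f \<noteq> []" "A \<subseteq> prime_polys R" "finite A" "\<And>P. P \<in> A \<Longrightarrow> P pdivides f"
  shows "(\<Sum>P\<in>A. degree P) \<le> degree f"
  using assms(4,3,1,2,5)
proof (induction A arbitrary: f rule: finite_induct)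
  case (insert P A)
  have P: "P \<in> prime_polys R" and A: "A \<subseteq> prime_polys R" using insert.prems by auto
  obtain h where h: "h \<in> carrier S" "f = P \<boxtimes> h" using insert.prems(4)[of P] by (auto elim: pdividesE)
  have hn: "h \<noteq> []" using h insert.prems prime_carrier[OF P] by auto
  have "Q pdivides h" if "Q \<in> A" for Q
    using insert.prems(4)[of Q] prime_pdivides_mult[of Q P h] prime_pdivides_prime[of Q P] that A P h
      prime_carrier[OF P] insert.hyps by auto
  then have "(\<Sum>P\<in>A. degree P) \<le> degree h" using insert.IH[OF A h(1) hn] by blast
  then show ?case using insert.hyps h hn degree_mult[of P h] prime_carrier[OF P] prime_nonnil[OF P] by simp
qed simp

section \<open>Sums over monic, square-free and prime polynomials\<close>

definition msum :: "('a list \<Rightarrow> 'c::comm_ring_1) \<Rightarrow> nat \<Rightarrow> 'c" where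
  "msum \<psi> n = (\<Sum>f\<in>monic_polys_deg R n. \<psi> f)"

definition hsum :: "('a list \<Rightarrow> 'c::comm_ring_1) \<Rightarrow> nat \<Rightarrow> 'c" where
  "hsum \<psi> n = (\<Sum>D\<in>hyperelliptic R n. \<psi> D)"

text \<open>The sum of degree P times the value at P^r over prime powers P^r of degree
  \<open>n\<close>. For completely multiplicative \<open>\<psi>\<close> it is the n-th coefficient
  of u L'(u)/L(u), where L(u) has the coefficients \<open>msum \<psi>\<close>.\<close>

definition psum :: "('a list \<Rightarrow> 'c::comm_ring_1) \<Rightarrow> nat \<Rightarrow> 'c" where
  "psum \<psi> n = (\<Sum>d | d dvd n. \<Sum>P\<in>prime_polys_deg R d. of_nat d * \<psi> P ^ (n div d))"

definition cmult :: "('a list \<Rightarrow> 'c::comm_ring_1) \<Rightarrow> bool" where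
  "cmult \<psi> \<longleftrightarrow> \<psi> \<one>\<^bsub>S\<^esub> = 1 \<and>
     (\<forall>f\<in>monic_polys R. \<forall>h\<in>monic_polys R. \<psi> (f \<boxtimes> h) = \<psi> f * \<psi> h)"

lemma cmult_pow: "cmult \<psi> \<Longrightarrow> f \<in> monic_polys R \<Longrightarrow> \<psi> (f \<up> n) = \<psi> f ^ n"
  by (induction n) (auto simp: cmult_def monic_pow)

lemma prime_deg_0 [simp]: "prime_polys_deg R 0 = {}"
  using prime_degree by (fastforce simp: prime_deg_iff)

lemma prime_deg_disj: "d \<noteq> d' \<Longrightarrow> prime_polys_deg R d \<inter> prime_polys_deg R d' = {}"
  by (auto simp: prime_deg_iff)

lemma msum_multiples:
  fixes \<psi> :: "'a list \<Rightarrow> 'c::comm_ring_1"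
  assumes "cmult \<psi>" "k \<in> monic_polys R"
  shows "(\<Sum>f | f \<in> monic_polys_deg R n \<and> k pdivides f. \<psi> f) =
    (if degree k \<le> n then \<psi> k * msum \<psi> (n - degree k) else 0)"
proof (cases "degree k \<le> n")
  case True
  have kc: "k \<in> carrier S" "k \<noteq> []" using assms(2) by (auto simp: monic_iff)
  have "(\<Sum>f | f \<in> monic_polys_deg R n \<and> k pdivides f. \<psi> f) =
    sum \<psi> ((\<lambda>h. k \<boxtimes> h) ` monic_polys_deg R (n - degree k))"
  proof (intro sum.cong refl equalityI subsetI)
    fix f assume "f \<in> {f. f \<in> monic_polys_deg R n \<and> k pdivides f}"
    then have f: "f \<in> monic_polys R" "degree f = n" "k pdivides f" by (auto simp: monic_deg_iff)
    obtain h where h: "h \<in> monic_polys R" "f = k \<boxtimes> h" "degree f = degree k + degree h"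
      using monic_factor[OF assms(2) f(1,3)] .
    then have "degree h = n - degree k" using f(2) by linarith
    then show "f \<in> (\<lambda>h. k \<boxtimes> h) ` monic_polys_deg R (n - degree k)"
      using h by (auto simp: monic_deg_iff)
  next
    fix f assume "f \<in> (\<lambda>h. k \<boxtimes> h) ` monic_polys_deg R (n - degree k)"
    then obtain h where h: "h \<in> monic_polys R" "degree h = n - degree k" "f = k \<boxtimes> h"
      by (auto simp: monic_deg_iff)
    have hc: "h \<in> carrier S" "h \<noteq> []" using h by (auto simp: monic_iff)
    have "degree f = degree k + degree h" using degree_mult[OF kc(1) hc(1) kc(2) hc(2)] h by simp
    then have "degree f = n" using h True by linarith
    then show "f \<in> {f. f \<in> monic_polys_deg R n \<and> k pdivides f}"
      using h hc monic_mult[OF assms(2) h(1)] by (auto simp: monic_deg_iff intro: pdividesI)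
  qed
  also have "\<dots> = (\<Sum>h\<in>monic_polys_deg R (n - degree k). \<psi> (k \<boxtimes> h))"
    using kc S.m_lcancel[of k] by (subst sum.reindex) (auto simp: inj_on_def monic_deg_iff monic_iff)
  also have "\<dots> = \<psi> k * msum \<psi> (n - degree k)"
    using assms unfolding msum_def sum_distrib_left by (intro sum.cong refl) (auto simp: cmult_def monic_deg_iff)
  finally show ?thesis using True by simp
next
  case False
  have *: "{f. f \<in> monic_polys_deg R n \<and> k pdivides f} = {}"
    using False pdivides_degree_le[of k] assms(2) by (auto simp: monic_deg_iff monic_iff)
  show ?thesis unfolding * using False by simp
qed

text \<open>The coefficient form of u L' = (u L'/L) L. The degree of \<open>f\<close> counts degree
  P once for each r \<ge> 1 with P^r dividing \<open>f\<close>; exchanging the sums leaves sums over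
  the multiples of P^r, which are then collected by the degree of P^r.\<close>

lemma log_derivative:
  fixes \<psi> :: "'a list \<Rightarrow> 'c::comm_ring_1"
  assumes "cmult \<psi>"
  shows "of_nat n * msum \<psi> n = (\<Sum>i=1..n. psum \<psi> i * msum \<psi> (n - i))"
proof -
  let ?A = "\<Union>d\<in>{1..n}. prime_polys_deg R d"
  have A: "finite ?A" "?A \<subseteq> prime_polys R" by (auto simp: prime_deg_iff)
  have deg: "degree f = (\<Sum>P\<in>?A. v P f * degree P)" if f: "f \<in> monic_polys_deg R n" for f
  proof (rule degree_eq_sum_v[OF _ A(1) _ A(2)])
    show fm: "f \<in> monic_polys R" using f by (simp add: monic_deg_iff)
    show "{P \<in> prime_polys R. P pdivides f} \<subseteq> ?A"
    proof
      fix P assume "P \<in> {P \<in> prime_polys R. P pdivides f}"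
      then have P: "P \<in> prime_polys R" "P pdivides f" by auto
      then have "degree P \<le> n" using pdivides_degree_le[of P f] prime_carrier fm f
        by (auto simp: monic_iff monic_deg_iff)
      then show "P \<in> ?A" using P prime_degree[OF P(1)] by (auto simp: prime_deg_iff)
    qed
  qed
  have vcard: "of_nat (v P f) = (\<Sum>r=1..n. if P \<up> r pdivides f then 1 else (0::'c))"
    if f: "f \<in> monic_polys_deg R n" and P: "P \<in> prime_polys R" for f P
  proof -
    have fc: "f \<in> carrier S" "f \<noteq> []" "degree f = n" using f by (auto simp: monic_deg_iff monic_iff)
    have "v P f * degree P \<le> n"
    proof -
      have "degree (P \<up> v P f) \<le> degree f"
        using pdivides_degree_le[of "P \<up> v P f" f] pow_pdivides_iff[OF P fc(1,2), of "v P f"] fc prime_carrier[OF P] by simp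
      then show ?thesis using fc degree_pow[OF prime_carrier[OF P], of "v P f"] by simp
    qed
    moreover have "v P f * 1 \<le> v P f * degree P" by (rule mult_le_mono2[OF prime_degree[OF P]])
    ultimately have le: "v P f \<le> n" by linarith
    have "(\<Sum>r=1..n. if P \<up> r pdivides f then 1 else (0::'c)) = (\<Sum>r\<in>{1..n} \<inter> {r. r \<le> v P f}. 1)"
      using pow_pdivides_iff[OF P fc(1,2)] by (subst sum.inter_restrict) (auto simp: sum.inter_restrict)
    also have "{1..n} \<inter> {r. r \<le> v P f} = {1..v P f}" using le by auto
    finally show ?thesis by simp
  qed
  have "of_nat n * msum \<psi> n = (\<Sum>f\<in>monic_polys_deg R n. \<Sum>P\<in>?A. of_nat (v P f) * of_nat (degree P) * \<psi> f)"
    unfolding msum_def sum_distrib_left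
  proof (intro sum.cong refl)
    fix f assume f: "f \<in> monic_polys_deg R n"
    have "of_nat n = of_nat (\<Sum>P\<in>?A. v P f * degree P)" using deg[OF f] f by (simp add: monic_deg_iff)
    also have "\<dots> = (\<Sum>P\<in>?A. of_nat (v P f) * (of_nat (degree P) :: 'c))" by (simp only: of_nat_sum of_nat_mult)
    finally show "of_nat n * \<psi> f = (\<Sum>P\<in>?A. of_nat (v P f) * of_nat (degree P) * \<psi> f)"
      by (simp only: sum_distrib_right)
  qed
  also have "\<dots> = (\<Sum>f\<in>monic_polys_deg R n. \<Sum>P\<in>?A. \<Sum>r=1..n.
      of_nat (degree P) * (if P \<up> r pdivides f then \<psi> f else 0))"
  proof (intro sum.cong refl)
    fix f P assume f: "f \<in> monic_polys_deg R n" and "P \<in> ?A"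
    then have P: "P \<in> prime_polys R" using A(2) by blast
    show "of_nat (v P f) * of_nat (degree P) * \<psi> f =
      (\<Sum>r=1..n. of_nat (degree P) * (if P \<up> r pdivides f then \<psi> f else 0))"
      unfolding vcard[OF f P] sum_distrib_right by (intro sum.cong refl) simp
  qed
  also have "\<dots> = (\<Sum>P\<in>?A. \<Sum>r=1..n. of_nat (degree P) *
      (\<Sum>f | f \<in> monic_polys_deg R n \<and> P \<up> r pdivides f. \<psi> f))"
    by (subst sum.swap, intro sum.cong refl, subst sum.swap, intro sum.cong refl)
       (simp add: sum_distrib_left[symmetric] sum.inter_filter[symmetric])
  also have "\<dots> = (\<Sum>P\<in>?A. \<Sum>r=1..n. of_nat (degree P) *
      (if r * degree P \<le> n then \<psi> P ^ r * msum \<psi> (n - r * degree P) else 0))"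
  proof (intro sum.cong refl)
    fix P and r :: nat assume "P \<in> ?A"
    then have P: "P \<in> prime_polys R" using A(2) by blast
    show "of_nat (degree P) * (\<Sum>f | f \<in> monic_polys_deg R n \<and> P \<up> r pdivides f. \<psi> f) =
      of_nat (degree P) * (if r * degree P \<le> n then \<psi> P ^ r * msum \<psi> (n - r * degree P) else 0)"
      using msum_multiples[OF assms monic_pow[OF prime_monic[OF P], of r], of n]
        cmult_pow[OF assms prime_monic[OF P], of r] degree_pow[OF prime_carrier[OF P], of r]
      by (simp only:)
  qed
  also have "\<dots> = (\<Sum>d\<in>{1..n}. \<Sum>P\<in>prime_polys_deg R d. \<Sum>r=1..n. of_nat d *
      (if r * d \<le> n then \<psi> P ^ r * msum \<psi> (n - r * d) else 0))"
    by (subst sum.UNION_disjoint) (auto simp: prime_deg_disj prime_deg_iff intro!: sum.cong)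
  also have "\<dots> = (\<Sum>d\<in>{1..n}. \<Sum>r=1..n. if r * d \<le> n
      then (\<Sum>P\<in>prime_polys_deg R d. of_nat d * \<psi> P ^ r) * msum \<psi> (n - r * d) else 0)"
    by (intro sum.cong refl, subst sum.swap, intro sum.cong refl) (simp add: sum_distrib_right mult.assoc)
  also have "\<dots> = (\<Sum>(d,r)\<in>{(d,r). d \<in> {1..n} \<and> r \<in> {1..n} \<and> r * d \<le> n}.
      (\<Sum>P\<in>prime_polys_deg R d. of_nat d * \<psi> P ^ r) * msum \<psi> (n - r * d))"
    unfolding sum.cartesian_product by (rule sum.mono_neutral_cong_right) (auto split: if_splits)
  also have "\<dots> = (\<Sum>(i,d)\<in>(SIGMA i:{1..n}. {d. d dvd i}).
      (\<Sum>P\<in>prime_polys_deg R d. of_nat d * \<psi> P ^ (i div d)) * msum \<psi> (n - i))"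
  proof (rule sum.reindex_bij_witness[of _ "\<lambda>(i,d). (d, i div d)" "\<lambda>(d,r). (r * d, d)"], goal_cases)
    case (4 a)
    then obtain i d where a: "a = (i, d)" "1 \<le> i" "i \<le> n" "d dvd i" by auto
    then obtain r where r: "i = d * r" by auto
    have "d \<ge> 1" "r \<ge> 1" using r a by (auto simp: Suc_le_eq)
    moreover have "d * 1 \<le> d * r" "1 * r \<le> d * r" using calculation by (intro mult_le_mono; simp)+
    then have "d \<le> n" "r \<le> n" using a(3) r by linarith+
    ultimately show ?case using a r by (auto simp: mult.commute)
  qed auto
  also have "\<dots> = (\<Sum>i=1..n. psum \<psi> i * msum \<psi> (n - i))"
    unfolding psum_def sum_distrib_right by (subst sum.Sigma) auto
  finally show ?thesis .
qed

section \<open>Square-free polynomials\<close>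

lemma hyper_iff: "D \<in> hyperelliptic R n \<longleftrightarrow>
    D \<in> monic_polys R \<and> degree D = n \<and> (\<forall>P\<in>prime_polys R. v P D \<le> 1)"
proof -
  have "squarefree_poly R D \<longleftrightarrow> (\<forall>P\<in>prime_polys R. v P D \<le> 1)" if D: "D \<in> monic_polys R"
  proof
    have Dc: "D \<in> carrier S" "D \<noteq> []" using D by (auto simp: monic_iff)
    assume sq: "squarefree_poly R D"
    show "\<forall>P\<in>prime_polys R. v P D \<le> 1"
    proof (rule ballI, rule ccontr)
      fix P assume P: "P \<in> prime_polys R" and "\<not> v P D \<le> 1"
      then have "P \<up> 2 pdivides D" using pow_pdivides_iff[OF P Dc, of 2] by simp
      then have "P \<boxtimes> P pdivides D" using prime_carrier[OF P] by (simp add: numeral_2_eq_2)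
      then have "P \<in> Units S" using sq prime_carrier[OF P] by (simp add: squarefree_poly_def)
      then show False using prime_degree[OF P] unfolding Units_S by linarith
    qed
  next
    have Dc: "D \<in> carrier S" "D \<noteq> []" using D by (auto simp: monic_iff)
    assume vP: "\<forall>P\<in>prime_polys R. v P D \<le> 1"
    show "squarefree_poly R D"
      unfolding squarefree_poly_def
    proof (intro ballI impI, rule ccontr)
      fix h assume h: "h \<in> carrier S" "h \<boxtimes> h pdivides D" "h \<notin> Units S"
      obtain k where k: "k \<in> carrier S" "D = (h \<boxtimes> h) \<boxtimes> k" using h(2) by (auto elim: pdividesE)
      have hn: "h \<noteq> []" "k \<noteq> []" using k h Dc by auto
      then have "degree h \<ge> 1" using h unfolding Units_S by linarith
      then obtain P where P: "P \<in> prime_polys R" "P pdivides h" using exists_prime_factor[OF h(1)] by blast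
      have "v P D = v P h + v P h + v P k" using k h hn v_mult[OF P(1)] by simp
      moreover have "v P h > 0" using v_pos_iff[OF P(1) h(1) hn(1)] P(2) by simp
      ultimately show False using vP P(1) by force
    qed
  qed
  then show ?thesis by (auto simp: hyperelliptic_def monic_deg_iff)
qed

lemma hyper_subset: "hyperelliptic R n \<subseteq> monic_polys_deg R n"
  by (auto simp: hyperelliptic_def)

lemma finite_hyper [simp]: "finite (hyperelliptic R n)"
  using finite_subset[OF hyper_subset] by simp

text \<open>Induction on prime factors: a further prime is cancelled from \<open>D\<close> and moved
  into \<open>h\<close> if it divides \<open>D\<close>, and becomes a factor of \<open>D\<close>
  otherwise.\<close>

lemma square_decomposition:
  assumes "f \<in> monic_polys R"
  shows "\<exists>D h. h \<in> monic_polys R \<and> D \<in> hyperelliptic R (degree D) \<and> f = D \<boxtimes> (h \<boxtimes> h)"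
  using assms
proof (induction f rule: monic_induct)
  case one
  then show ?case using monic_one v_one by (intro exI[of _ "\<one>\<^bsub>S\<^esub>"]) (auto simp: hyper_iff)
next
  case (prime_mult P f)
  note Pc = prime_carrier[OF prime_mult(1)] prime_nonnil[OF prime_mult(1)]
  obtain D h where Dh: "h \<in> monic_polys R" "D \<in> hyperelliptic R (degree D)" "f = D \<boxtimes> (h \<boxtimes> h)"
    using prime_mult by blast
  have Dm: "D \<in> monic_polys R" "\<And>P. P \<in> prime_polys R \<Longrightarrow> v P D \<le> 1" using Dh by (auto simp: hyper_iff)
  have Dc: "D \<in> carrier S" "D \<noteq> []" and hc: "h \<in> carrier S" "h \<noteq> []"
    using Dm Dh by (auto simp: monic_iff)
  show ?case
  proof (cases "P pdivides D")
    case True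
    obtain D' where D': "D' \<in> monic_polys R" "D = P \<boxtimes> D'"
      using monic_factor[OF prime_monic[OF prime_mult(1)] Dm(1) True] by metis
    have D'c: "D' \<in> carrier S" "D' \<noteq> []" using D' by (auto simp: monic_iff)
    have "v Q D' \<le> 1" if "Q \<in> prime_polys R" for Q
      using Dm(2)[OF that] v_mult[OF that Pc D'c] D'(2) by simp
    then have "D' \<in> hyperelliptic R (degree D')" using D' by (simp add: hyper_iff)
    moreover have "P \<boxtimes> f = D' \<boxtimes> ((P \<boxtimes> h) \<boxtimes> (P \<boxtimes> h))"
      unfolding Dh(3) D'(2) using Pc D'c hc by (simp add: S.m_ac)
    ultimately show ?thesis using monic_mult[OF prime_monic[OF prime_mult(1)] Dh(1)] by blast
  next
    case False
    have "v Q (P \<boxtimes> D) \<le> 1" if Q: "Q \<in> prime_polys R" for Q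
      using Dm(2)[OF Q] v_mult[OF Q Pc Dc] v_self[OF Q prime_mult(1)] v_pos_iff[OF Q Dc] False by auto
    then have "P \<boxtimes> D \<in> hyperelliptic R (degree (P \<boxtimes> D))"
      using monic_mult[OF prime_monic[OF prime_mult(1)] Dm(1)] by (simp add: hyper_iff)
    moreover have "P \<boxtimes> f = (P \<boxtimes> D) \<boxtimes> (h \<boxtimes> h)"
      unfolding Dh(3) using Pc Dc hc by (simp add: S.m_assoc)
    ultimately show ?thesis using Dh(1) by blast
  qed
qed

lemma square_decomposition_unique:
  assumes "D \<in> hyperelliptic R n" "D' \<in> hyperelliptic R n'" "h \<in> monic_polys R" "h' \<in> monic_polys R"
    "D \<boxtimes> (h \<boxtimes> h) = D' \<boxtimes> (h' \<boxtimes> h')"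
  shows "D = D' \<and> h = h'"
proof -
  have c: "D \<in> monic_polys R" "D' \<in> monic_polys R" using assms by (auto simp: hyper_iff)
  have cc: "D \<in> carrier S" "D \<noteq> []" "D' \<in> carrier S" "D' \<noteq> []" "h \<in> carrier S" "h \<noteq> []"
    "h' \<in> carrier S" "h' \<noteq> []"
    using c assms(3,4) by (auto simp: monic_iff)
  have vv: "v P (D \<boxtimes> (h \<boxtimes> h)) = v P D + 2 * v P h" "v P (D' \<boxtimes> (h' \<boxtimes> h')) = v P D' + 2 * v P h'"
    "v P D \<le> 1" "v P D' \<le> 1"
    if P: "P \<in> prime_polys R" for P
    using assms(1,2) P v_mult[OF P cc(1,2)] v_mult[OF P cc(3,4)] v_mult[OF P cc(5,6,5,6)]
      v_mult[OF P cc(7,8,7,8)] cc by (auto simp: hyper_iff)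
  have eq: "v P D = v P D' \<and> v P h = v P h'" if P: "P \<in> prime_polys R" for P
    using vv[OF P] assms(5) by simp presburger
  show ?thesis
    using monic_eqI_v[OF c] monic_eqI_v[OF assms(3,4)] eq by blast
qed

text \<open>The factorization into a square-free part and a square is a bijection. So the series of
  \<open>msum \<psi>\<close> in u is that of \<open>hsum \<psi>\<close> in u times that of the sums
  of \<psi>^2 in u^2.\<close>

lemma msum_eq_hsum:
  fixes \<psi> :: "'a list \<Rightarrow> 'c::comm_ring_1"
  assumes "cmult \<psi>"
  shows "msum \<psi> m = (\<Sum>k\<le>m div 2. msum (\<lambda>h. \<psi> h ^ 2) k * hsum \<psi> (m - 2 * k))"
proof -
  let ?B = "SIGMA k:{..m div 2}. monic_polys_deg R k \<times> hyperelliptic R (m - 2 * k)"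
  let ?F = "\<lambda>(k, h, D). D \<boxtimes> (h \<boxtimes> h)"
  have img: "?F ` ?B = monic_polys_deg R m"
  proof (intro equalityI subsetI)
    fix f assume "f \<in> ?F ` ?B"
    then obtain k h D where *: "k \<le> m div 2" "h \<in> monic_polys_deg R k" "D \<in> hyperelliptic R (m - 2 * k)"
      "f = D \<boxtimes> (h \<boxtimes> h)" by auto
    have c: "h \<in> monic_polys R" "D \<in> monic_polys R" "degree h = k" "degree D = m - 2 * k"
      using * by (auto simp: monic_deg_iff hyper_iff)
    then have cc: "h \<in> carrier S" "h \<noteq> []" "D \<in> carrier S" "D \<noteq> []" by (auto simp: monic_iff)
    have "degree f = degree D + (degree h + degree h)"
      using *(4) cc degree_mult[of D "h \<boxtimes> h"] degree_mult[of h h] by simp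
    then have "degree f = m" using c *(1) by linarith
    then show "f \<in> monic_polys_deg R m" using monic_mult[OF c(2) monic_mult[OF c(1) c(1)]] *(4)
      by (simp add: monic_deg_iff)
  next
    fix f assume "f \<in> monic_polys_deg R m"
    then have f: "f \<in> monic_polys R" "degree f = m" by (auto simp: monic_deg_iff)
    obtain D h where Dh: "h \<in> monic_polys R" "D \<in> hyperelliptic R (degree D)" "f = D \<boxtimes> (h \<boxtimes> h)"
      using square_decomposition[OF f(1)] by blast
    have cc: "h \<in> carrier S" "h \<noteq> []" "D \<in> carrier S" "D \<noteq> []" using Dh by (auto simp: hyper_iff monic_iff)
    have "degree f = degree D + (degree h + degree h)"
      using Dh(3) cc degree_mult[of D "h \<boxtimes> h"] degree_mult[of h h] by simp
    then have "degree h \<le> m div 2" "degree D = m - 2 * degree h" using f by linarith+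
    then have "(degree h, h, D) \<in> ?B" using Dh by (auto simp: monic_deg_iff)
    then show "f \<in> ?F ` ?B" using Dh(3) by force
  qed
  have inj: "inj_on ?F ?B"
  proof (rule inj_onI)
    fix x y assume xy: "x \<in> ?B" "y \<in> ?B" "?F x = ?F y"
    obtain k h D where x: "x = (k, h, D)" by (cases x)
    obtain k' h' D' where y: "y = (k', h', D')" by (cases y)
    have "D = D' \<and> h = h'"
      using xy x y by (intro square_decomposition_unique[of D "m - 2 * k" D' "m - 2 * k'"]) (auto simp: monic_deg_iff)
    then show "x = y" using xy x y by (auto simp: monic_deg_iff)
  qed
  have "msum \<psi> m = sum \<psi> (?F ` ?B)" unfolding img msum_def ..
  also have "\<dots> = (\<Sum>(k,h,D)\<in>?B. \<psi> (D \<boxtimes> (h \<boxtimes> h)))"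
    by (subst sum.reindex[OF inj]) (simp add: case_prod_unfold)
  also have "\<dots> = (\<Sum>(k,h,D)\<in>?B. \<psi> h ^ 2 * \<psi> D)"
    using assms by (intro sum.cong refl)
      (auto simp: cmult_def monic_deg_iff hyper_iff monic_mult power2_eq_square algebra_simps)
  also have "\<dots> = (\<Sum>k\<le>m div 2. \<Sum>(h,D)\<in>monic_polys_deg R k \<times> hyperelliptic R (m - 2 * k). \<psi> h ^ 2 * \<psi> D)"
    by (subst sum.Sigma) auto
  also have "\<dots> = (\<Sum>k\<le>m div 2. msum (\<lambda>h. \<psi> h ^ 2) k * hsum \<psi> (m - 2 * k))"
    unfolding msum_def hsum_def sum_product sum.cartesian_product ..
  finally show ?thesis .
qed

lemma monic_deg_0: "monic_polys_deg R 0 = {\<one>\<^bsub>S\<^esub>}"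
  unfolding monic_deg_eq one_S by auto

text \<open>Let W(x) be the series of the sums of \<psi>^2. The hypothesis says that (1 - c x) W(x)
  is 1 minus the sum of all b(k) x^k. Multiplying the identity of \<open>msum_eq_hsum\<close> by 1 -
  c u^2 leaves a recursion whose only corrections come from \<open>b\<close>: none for \<psi> = 1, a
  single one for a Legendre symbol.\<close>

lemma hsum_recursion:
  fixes \<psi> :: "'a list \<Rightarrow> 'c::comm_ring_1"
  assumes "cmult \<psi>" and w: "\<And>k. msum (\<lambda>h. \<psi> h ^ 2) (Suc k) = c * msum (\<lambda>h. \<psi> h ^ 2) k - b (Suc k)"
    and "m \<ge> 2"
  shows "msum \<psi> m - c * msum \<psi> (m - 2) = hsum \<psi> m - (\<Sum>k=1..m div 2. b k * hsum \<psi> (m - 2 * k))"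
proof -
  let ?w = "msum (\<lambda>h. \<psi> h ^ 2)"
  have "monic_polys_deg R 0 = {\<one>\<^bsub>S\<^esub>}" by (rule monic_deg_0)
  then have w0: "?w 0 = 1" using assms(1) by (simp add: msum_def cmult_def)
  obtain j where j: "m div 2 = Suc j" using assms(3) by (cases "m div 2") auto
  have j2: "(m - 2) div 2 = j" using j by linarith
  have "msum \<psi> m = hsum \<psi> m + (\<Sum>k\<le>j. ?w (Suc k) * hsum \<psi> (m - 2 * Suc k))"
    using msum_eq_hsum[OF assms(1), of m] unfolding j sum.atMost_Suc_shift by (simp add: w0)
  also have "(\<Sum>k\<le>j. ?w (Suc k) * hsum \<psi> (m - 2 * Suc k)) =
     (\<Sum>k\<le>j. c * (?w k * hsum \<psi> (m - 2 - 2 * k)) - b (Suc k) * hsum \<psi> (m - 2 * Suc k))"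
    unfolding w by (intro sum.cong refl) (simp add: algebra_simps)
  also have "\<dots> = c * msum \<psi> (m - 2) - (\<Sum>k\<le>j. b (Suc k) * hsum \<psi> (m - 2 * Suc k))"
    using msum_eq_hsum[OF assms(1), of "m - 2"] unfolding j2 by (simp add: sum_subtractf sum_distrib_left)
  also have "(\<Sum>k\<le>j. b (Suc k) * hsum \<psi> (m - 2 * Suc k)) = (\<Sum>k=1..m div 2. b k * hsum \<psi> (m - 2 * k))"
    unfolding j by (subst sum.atLeast_Suc_atMost_Suc_shift[of _ 0 j, simplified One_nat_def[symmetric]]) (simp add: atMost_atLeast0)
  finally show ?thesis by simp
qed

lemma hsum_small: "cmult \<psi> \<Longrightarrow> m < 2 \<Longrightarrow> hsum \<psi> m = msum \<psi> m"
proof -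
  assume a: "cmult \<psi>" "m < 2"
  have "monic_polys_deg R 0 = {\<one>\<^bsub>S\<^esub>}" by (rule monic_deg_0)
  then have w0: "msum (\<lambda>h. \<psi> h ^ 2) 0 = 1" using a by (simp add: msum_def cmult_def)
  have "m div 2 = 0" using a by simp
  then show ?thesis using msum_eq_hsum[OF a(1), of m] w0 by simp
qed

section \<open>Counting square-free and prime polynomials\<close>

lemma cmult_1: "cmult (\<lambda>_. 1)" by (simp add: cmult_def)

lemma msum_1: "msum (\<lambda>_. 1) n = of_nat q ^ n"
  by (simp add: msum_def card_monic_deg)

lemma card_hyper: "m \<ge> 2 \<Longrightarrow> int (card (hyperelliptic R m)) = int q ^ m - int q ^ (m - 1)"
proof -
  assume m: "m \<ge> 2"
  have "msum (\<lambda>_. 1) m - int q * msum (\<lambda>_. 1) (m - 2) =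
     hsum (\<lambda>_. 1) m - (\<Sum>k=1..m div 2. 0 * hsum (\<lambda>_. 1) (m - 2 * k))"
    by (rule hsum_recursion[OF cmult_1 _ m]) (simp add: msum_1)
  then show ?thesis using m by (simp add: msum_1 hsum_def power_Suc[symmetric] Suc_diff_Suc numeral_2_eq_2 del: power_Suc)
qed

text \<open>For \<psi> = 1 every \<open>msum\<close> is a power of q. In
  \<open>log_derivative\<close> each of the n - 1 earlier terms equals q^n by induction, which
  leaves q^n for the last.\<close>

lemma prime_poly_count: "n \<ge> 1 \<Longrightarrow> (\<Sum>d | d dvd n. d * card (prime_polys_deg R d)) = q ^ n"
proof (induction n rule: less_induct)
  case (less n)
  have ps: "psum (\<lambda>_. 1::int) i = int (\<Sum>d | d dvd i. d * card (prime_polys_deg R d))" for i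
    by (simp add: psum_def mult.commute)
  have "int n * int q ^ n = (\<Sum>i=1..n. psum (\<lambda>_. 1) i * int q ^ (n - i))"
    using log_derivative[OF cmult_1, of n, where 'c=int] by (simp add: msum_1)
  also have "\<dots> = (\<Sum>i\<in>{1..<n}. psum (\<lambda>_. 1) i * int q ^ (n - i)) + psum (\<lambda>_. 1) n"
    using less.prems by (subst atLeastLessThanSuc_atLeastAtMost[symmetric], subst sum.atLeastLessThan_Suc) auto
  also have "(\<Sum>i\<in>{1..<n}. psum (\<lambda>_. 1) i * int q ^ (n - i)) = (\<Sum>i\<in>{1..<n}. int q ^ n)"
    using less.IH by (intro sum.cong refl) (simp add: ps power_add[symmetric] del: of_nat_sum of_nat_mult)
  finally have "psum (\<lambda>_. 1::int) n = int q ^ n"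
    using less.prems by (simp add: of_nat_diff algebra_simps)
  then show ?case unfolding ps by (metis of_nat_eq_iff of_nat_power)
qed

lemma card_prime_le: "d * card (prime_polys_deg R d) \<le> q ^ d"
proof (cases "d = 0")
  case False
  have "d * card (prime_polys_deg R d) \<le> (\<Sum>d' | d' dvd d. d' * card (prime_polys_deg R d'))"
    using False by (intro member_le_sum) auto
  then show ?thesis using prime_poly_count[of d] False by simp
qed simp

text \<open>Proper divisors of 2\<delta> are at most \<delta>, so the terms of
  \<open>prime_poly_count\<close> other than the one for 2\<delta> are dominated by a geometric sum
  ending at q^\<delta>.\<close>

lemma card_prime_ge:
  assumes "\<delta> \<ge> 1"
  shows "q ^ (2 * \<delta>) \<le> 2 * \<delta> * card (prime_polys_deg R (2 * \<delta>)) + 2 * q ^ \<delta>"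
proof -
  let ?n = "2 * \<delta>"
  have div: "{d. d dvd ?n} = insert ?n {d. d dvd ?n \<and> d \<noteq> ?n}" by auto
  have sub: "{d. d dvd ?n \<and> d \<noteq> ?n} \<subseteq> {..\<delta>}"
  proof
    fix d assume "d \<in> {d. d dvd ?n \<and> d \<noteq> ?n}"
    then obtain k where k: "?n = d * k" "d \<noteq> ?n" by auto
    have "k \<noteq> 0" "k \<noteq> 1" using k assms by (intro notI, simp)+
    then have "k \<ge> 2" by simp
    then have "d * 2 \<le> 2 * \<delta>" unfolding k(1) by (rule mult_le_mono2)
    then show "d \<in> {..\<delta>}" by simp
  qed
  have "q ^ ?n = ?n * card (prime_polys_deg R ?n) + (\<Sum>d | d dvd ?n \<and> d \<noteq> ?n. d * card (prime_polys_deg R d))"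
  proof -
    have "q ^ ?n = (\<Sum>d | d dvd ?n. d * card (prime_polys_deg R d))"
      using prime_poly_count[of ?n] assms by simp
    also have "\<dots> = ?n * card (prime_polys_deg R ?n) + (\<Sum>d | d dvd ?n \<and> d \<noteq> ?n. d * card (prime_polys_deg R d))"
      unfolding div using finite_subset[OF sub] by (subst sum.insert) auto
    finally show ?thesis .
  qed
  also have "(\<Sum>d | d dvd ?n \<and> d \<noteq> ?n. d * card (prime_polys_deg R d)) \<le> (\<Sum>d\<le>\<delta>. q ^ d)"
    using sub by (intro order_trans[OF sum_mono2[of "{..\<delta>}"] sum_mono] card_prime_le) auto
  also have "(\<Sum>d\<le>\<delta>. q ^ d) \<le> 2 * q ^ \<delta>"
  proof (induction \<delta>)
    case (Suc n)
    have "2 * q ^ n \<le> q * q ^ n" using order_ge_3 by (intro mult_right_mono) auto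
    with Suc show ?case unfolding sum.atMost_Suc power_Suc by linarith
  qed simp
  finally show ?thesis by simp
qed

section \<open>The quadratic character as a completely multiplicative function\<close>

lemma jacobi_poly_superset:
  assumes "f \<in> monic_polys R" "finite A" "{P \<in> prime_polys R. P pdivides f} \<subseteq> A" "A \<subseteq> prime_polys R"
  shows "jacobi_poly R D f = (\<Prod>P\<in>A. legendre_poly R D P ^ v P f)"
  unfolding jacobi_poly_def
proof (rule prod.mono_neutral_left)
  show "\<forall>P\<in>A - {P \<in> prime_polys R. P pdivides f}. legendre_poly R D P ^ v P f = 1"
  proof
    fix P assume "P \<in> A - {P \<in> prime_polys R. P pdivides f}"
    then have "P \<in> prime_polys R" "\<not> P pdivides f" using assms(4) by auto
    then have "v P f = 0" using v_pos_iff[of P f] monic_carrier[OF assms(1)] monic_nonnil[OF assms(1)] by simp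
    then show "legendre_poly R D P ^ v P f = 1" by simp
  qed
qed (use assms in auto)

lemma cmult_quad_char: "cmult (\<lambda>f. quad_char R D f)"
proof -
  have "quad_char R D (f \<boxtimes> h) = quad_char R D f * quad_char R D h"
    if f: "f \<in> monic_polys R" and h: "h \<in> monic_polys R" for f h
  proof -
    have c: "f \<in> carrier S" "f \<noteq> []" "h \<in> carrier S" "h \<noteq> []" using f h by (auto simp: monic_iff)
    let ?A = "{P \<in> prime_polys R. P pdivides f \<boxtimes> h}"
    have A: "finite ?A" using finite_prime_divisors[of "f \<boxtimes> h"] c by simp
    have sub: "{P \<in> prime_polys R. P pdivides f} \<subseteq> ?A" "{P \<in> prime_polys R. P pdivides h} \<subseteq> ?A"
      using prime_pdivides_mult c by auto
    have "jacobi_poly R D (f \<boxtimes> h) = (\<Prod>P\<in>?A. legendre_poly R D P ^ (v P f + v P h))"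
      unfolding jacobi_poly_def using v_mult c by (intro prod.cong refl) auto
    then show ?thesis
      using jacobi_poly_superset[OF f A sub(1)] jacobi_poly_superset[OF h A sub(2)]
      by (simp add: quad_char_def power_add prod.distrib)
  qed
  moreover have "quad_char R D \<one>\<^bsub>S\<^esub> = 1"
    unfolding quad_char_def by (subst jacobi_poly_superset[where A="{}"])
      (use monic_one v_one v_pos_iff[of _ "\<one>\<^bsub>S\<^esub>"] in auto)
  ultimately show ?thesis by (simp add: cmult_def)
qed

lemma quad_char_prime: "P \<in> prime_polys R \<Longrightarrow> quad_char R D P = legendre_poly R D P"
  unfolding quad_char_def
  by (subst jacobi_poly_superset[where A="{P}"]) (use prime_monic prime_pdivides_prime v_self in auto)

section \<open>The Legendre symbol\<close>

lemma nil_arith [simp]: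
  assumes "f \<in> carrier S"
  shows "[] \<boxplus> f = f" "f \<boxplus> [] = f" "[] \<boxtimes> f = []" "f \<boxtimes> [] = []" "f \<boxminus> [] = f"
  using assms S.l_zero[of f] S.r_zero[of f] S.l_null[of f] S.r_null[of f] S.minus_zero by (auto simp: a_minus_def)

text \<open>The residue field modulo \<open>P\<close>, with \<open>\<pi> P\<close> as the reduction
  onto it; \<open>V (degree P)\<close> serves as a system of representatives.\<close>

abbreviation F where "F P \<equiv> Rupt (carrier R) P"
abbreviation \<pi> where "\<pi> P f \<equiv> rupture_surj (carrier R) P f"
abbreviation leg where "leg f P \<equiv> legendre_poly R f P"

lemma \<pi>_hom: "P \<in> prime_polys R \<Longrightarrow> ring_hom_ring S (F P) (\<pi> P)"
  by (rule rupture_surj_hom(2)[OF carrier_is_subring prime_carrier])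

lemma pmod_image: "P \<in> prime_polys R \<Longrightarrow> (\<lambda>f. f pmod P) ` carrier S = V (degree P)"
  unfolding V_def by (rule pmod_image_characterization[OF carrier_is_subfield prime_carrier prime_nonnil])

lemma \<pi>_pmod: "P \<in> prime_polys R \<Longrightarrow> f \<in> carrier S \<Longrightarrow> \<pi> P (f pmod P) = \<pi> P f"
  using rupture_surj_composed_with_pmod[OF carrier_is_subfield prime_carrier] by simp

lemma pmod_V: "P \<in> prime_polys R \<Longrightarrow> f \<in> carrier S \<Longrightarrow> f pmod P \<in> V (degree P)"
  using pmod_image by blast

lemma \<pi>_bij: "P \<in> prime_polys R \<Longrightarrow> bij_betw (\<pi> P) (V (degree P)) (carrier (F P))"
  using rupture_surj_inj_on[OF carrier_is_subfield prime_carrier]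
    rupture_carrier_as_pmod_image[OF carrier_is_subfield prime_carrier] pmod_image
  by (simp add: bij_betw_def)

lemma order_F: "P \<in> prime_polys R \<Longrightarrow> order (F P) = q ^ degree P"
  using bij_betw_same_card[OF \<pi>_bij] card_V by (simp add: order_def)

lemma F_field: assumes "P \<in> prime_polys R" shows "odd_finite_field (F P)"
proof -
  have "field (F P)"
    using rupture_is_field_iff_pirreducible[OF carrier_is_subfield prime_carrier[OF assms]] assms
    by (simp add: prime_iff)
  moreover have "finite (carrier (F P))" using bij_betw_finite[OF \<pi>_bij[OF assms]] by simp
  moreover have "odd (order (F P))" using order_F[OF assms] odd_order by simp
  ultimately show ?thesis by (simp add: odd_finite_field_def odd_finite_field_axioms_def)
qed

lemma \<pi>_closed: "P \<in> prime_polys R \<Longrightarrow> f \<in> carrier S \<Longrightarrow> \<pi> P f \<in> carrier (F P)"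
  using ring_hom_closed[OF ring_hom_ring.homh[OF \<pi>_hom]] .

lemma \<pi>_zero_iff:
  assumes P: "P \<in> prime_polys R" and f: "f \<in> carrier S"
  shows "\<pi> P f = \<zero>\<^bsub>F P\<^esub> \<longleftrightarrow> P pdivides f"
proof -
  interpret h: ring_hom_ring S "F P" "\<pi> P" by (rule \<pi>_hom[OF P])
  have z: "\<pi> P [] = \<zero>\<^bsub>F P\<^esub>" using h.hom_zero by simp
  have "\<pi> P f = \<pi> P [] \<longleftrightarrow> f pmod P = []"
  proof
    assume "\<pi> P f = \<pi> P []"
    then have "\<pi> P (f pmod P) = \<pi> P []" using \<pi>_pmod[OF P f] by simp
    then show "f pmod P = []"
      using inj_onD[OF bij_betw_imp_inj_on[OF \<pi>_bij[OF P]] _ pmod_V[OF P f] nil_V] by simp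
  next
    assume "f pmod P = []" then show "\<pi> P f = \<pi> P []" using \<pi>_pmod[OF P f] by simp
  qed
  then show ?thesis
    using z pmod_zero_iff_pdivides[OF carrier_is_subfield f prime_carrier[OF P]] by simp
qed

lemma \<pi>_eq_iff:
  assumes P: "P \<in> prime_polys R" and f: "f \<in> carrier S" "h \<in> carrier S"
  shows "\<pi> P f = \<pi> P h \<longleftrightarrow> P pdivides (f \<boxminus> h)"
proof -
  interpret h: ring_hom_ring S "F P" "\<pi> P" by (rule \<pi>_hom[OF P])
  have "\<pi> P (f \<boxminus> h) = \<pi> P f \<ominus>\<^bsub>F P\<^esub> \<pi> P h" using f by (simp add: a_minus_def)
  then show ?thesis
    using \<pi>_zero_iff[OF P, of "f \<boxminus> h"] f \<pi>_closed[OF P] h.S.r_right_minus_eq by simp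
qed

text \<open>The congruence modulo \<open>P\<close> becomes an equation in the residue field, where
  (|P| - 1)/2 is the exponent of Euler's criterion. The description is unique because -1, 0 and 1
  are distinct there.\<close>

lemma leg_qc:
  assumes P: "P \<in> prime_polys R" and f: "f \<in> carrier S"
  shows "leg f P = odd_finite_field.qc (F P) (\<pi> P f)"
proof -
  interpret F: odd_finite_field "F P" by (rule F_field[OF P])
  interpret h: ring_hom_ring S "F P" "\<pi> P" by (rule \<pi>_hom[OF P])
  let ?e = "(poly_norm R P - 1) div 2"
  have e: "?e = (order (F P) - 1) div 2" by (simp add: order_F[OF P] poly_norm_def)
  have epos: "?e \<noteq> 0" using F.order_ge_3 e by simp
  have s: "P pdivides (f \<up> ?e \<boxminus> add_pow S s \<one>\<^bsub>S\<^esub>) \<longleftrightarrow>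
      \<pi> P f [^]\<^bsub>F P\<^esub> ?e = (if s = 0 then \<zero>\<^bsub>F P\<^esub> else if s = 1 then \<one>\<^bsub>F P\<^esub> else \<ominus>\<^bsub>F P\<^esub> \<one>\<^bsub>F P\<^esub>)"
    if "s \<in> {-1, 0, 1}" for s :: int
  proof -
    have a: "add_pow S s \<one>\<^bsub>S\<^esub> = (if s = 0 then \<zero>\<^bsub>S\<^esub> else if s = 1 then \<one>\<^bsub>S\<^esub> else \<ominus>\<^bsub>S\<^esub> \<one>\<^bsub>S\<^esub>)"
      using that by (auto simp: add_pow_int_ge add_pow_int_lt)
    have b: "\<pi> P (add_pow S s \<one>\<^bsub>S\<^esub>) = (if s = 0 then \<zero>\<^bsub>F P\<^esub> else if s = 1 then \<one>\<^bsub>F P\<^esub> else \<ominus>\<^bsub>F P\<^esub> \<one>\<^bsub>F P\<^esub>)"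
      unfolding a using h.hom_zero h.hom_one h.hom_a_inv[OF S.one_closed] by auto
    have ac: "add_pow S s \<one>\<^bsub>S\<^esub> \<in> carrier S" unfolding a by simp
    show ?thesis using \<pi>_eq_iff[OF P _ ac, of "f \<up> ?e"] f b h.hom_nat_pow[OF f, of ?e] by simp
  qed
  show ?thesis
    unfolding legendre_poly_def
  proof (rule the_equality)
    have "F.qc (\<pi> P f) \<in> {-1, 0, 1}" by (rule F.qc_cases)
    moreover have "\<pi> P f [^]\<^bsub>F P\<^esub> ?e = (if F.qc (\<pi> P f) = 0 then \<zero>\<^bsub>F P\<^esub> else if F.qc (\<pi> P f) = 1 then \<one>\<^bsub>F P\<^esub> else \<ominus>\<^bsub>F P\<^esub> \<one>\<^bsub>F P\<^esub>)"
      using F.pow_half[OF \<pi>_closed[OF P f]] F.qc_zero_iff[of "\<pi> P f"] F.nat_pow_zero[OF epos] unfolding e[symmetric]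
      by auto
    ultimately show "F.qc (\<pi> P f) \<in> {-1, 0, 1} \<and> P pdivides (f \<up> ?e \<boxminus> add_pow S (F.qc (\<pi> P f)) \<one>\<^bsub>S\<^esub>)"
      using s by simp
  next
    fix t :: int assume t: "t \<in> {-1, 0, 1} \<and> P pdivides (f \<up> ?e \<boxminus> add_pow S t \<one>\<^bsub>S\<^esub>)"
    then have pe: "\<pi> P f [^]\<^bsub>F P\<^esub> ?e = (if t = 0 then \<zero>\<^bsub>F P\<^esub> else if t = 1 then \<one>\<^bsub>F P\<^esub> else \<ominus>\<^bsub>F P\<^esub> \<one>\<^bsub>F P\<^esub>)"
      using s by blast
    have m0: "\<ominus>\<^bsub>F P\<^esub> \<one>\<^bsub>F P\<^esub> \<noteq> \<zero>\<^bsub>F P\<^esub>" by (metis F.minus_minus F.minus_zero F.one_closed F.one_not_zero)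
    show "t = F.qc (\<pi> P f)"
    proof (cases "\<pi> P f = \<zero>\<^bsub>F P\<^esub>")
      case True
      then have "t = 0" using pe F.nat_pow_zero[OF epos] m0 F.one_not_zero t by (auto split: if_splits)
      then show ?thesis using True by simp
    next
      case False
      then have ne: "F.qc (\<pi> P f) \<noteq> 0" by (simp add: F.qc_zero_iff)
      have eq: "(if t = 0 then \<zero>\<^bsub>F P\<^esub> else if t = 1 then \<one>\<^bsub>F P\<^esub> else \<ominus>\<^bsub>F P\<^esub> \<one>\<^bsub>F P\<^esub>) =
          (if F.qc (\<pi> P f) = 1 then \<one>\<^bsub>F P\<^esub> else \<ominus>\<^bsub>F P\<^esub> \<one>\<^bsub>F P\<^esub>)"
        using pe F.pow_half[OF \<pi>_closed[OF P f] False] unfolding e[symmetric] by simp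
      have t0: "t \<noteq> 0"
      proof
        assume "t = 0"
        then show False using eq m0 F.one_not_zero by (cases "F.qc (\<pi> P f) = 1") simp_all
      qed
      have "t = 1 \<longleftrightarrow> F.qc (\<pi> P f) = 1"
        using eq t0 F.one_neq_minus_one by (cases "t = 1"; cases "F.qc (\<pi> P f) = 1") simp_all
      then show ?thesis using t t0 ne F.qc_cases[of "\<pi> P f"] by (cases "t = 1") simp_all
    qed
  qed
qed

lemma leg_mult:
  "P \<in> prime_polys R \<Longrightarrow> f \<in> carrier S \<Longrightarrow> h \<in> carrier S \<Longrightarrow> leg (f \<boxtimes> h) P = leg f P * leg h P"
proof -
  assume P: "P \<in> prime_polys R" and c: "f \<in> carrier S" "h \<in> carrier S"
  interpret F: odd_finite_field "F P" by (rule F_field[OF P])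
  interpret h: ring_hom_ring S "F P" "\<pi> P" by (rule \<pi>_hom[OF P])
  show ?thesis using c P \<pi>_closed[OF P] by (simp add: leg_qc F.qc_mult)
qed

lemma leg_zero_iff: "P \<in> prime_polys R \<Longrightarrow> f \<in> carrier S \<Longrightarrow> leg f P = 0 \<longleftrightarrow> P pdivides f"
  using odd_finite_field.qc_zero_iff[OF F_field] by (simp add: leg_qc \<pi>_zero_iff)

lemma leg_cases: "P \<in> prime_polys R \<Longrightarrow> f \<in> carrier S \<Longrightarrow> leg f P \<in> {-1, 0, 1}"
  unfolding leg_qc by (rule odd_finite_field.qc_cases[OF F_field])

lemma leg_square: "P \<in> prime_polys R \<Longrightarrow> f \<in> carrier S \<Longrightarrow> leg f P ^ 2 = of_bool (\<not> P pdivides f)"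
  using leg_cases[of P f] leg_zero_iff[of P f] by auto

lemma leg_one: "P \<in> prime_polys R \<Longrightarrow> leg \<one>\<^bsub>S\<^esub> P = 1"
proof -
  assume P: "P \<in> prime_polys R"
  interpret h: ring_hom_ring S "F P" "\<pi> P" by (rule \<pi>_hom[OF P])
  show ?thesis using leg_qc[OF P, of "\<one>\<^bsub>S\<^esub>"] odd_finite_field.qc_one[OF F_field[OF P]] h.hom_one by simp
qed

lemma cmult_leg: "P \<in> prime_polys R \<Longrightarrow> cmult (\<lambda>f. leg f P)"
  by (auto simp: cmult_def leg_one leg_mult monic_iff)

lemma sum_V_residues:
  fixes G :: "'a list set \<Rightarrow> 'c::comm_monoid_add"
  shows "P \<in> prime_polys R \<Longrightarrow> (\<Sum>f\<in>V (degree P). G (\<pi> P f)) = (\<Sum>x\<in>carrier (F P). G x)"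
  by (rule sum.reindex_bij_betw[OF \<pi>_bij])

lemma sum_leg_V: "P \<in> prime_polys R \<Longrightarrow> (\<Sum>f\<in>V (degree P). leg f P) = 0"
proof -
  assume P: "P \<in> prime_polys R"
  have "(\<Sum>f\<in>V (degree P). leg f P) = (\<Sum>f\<in>V (degree P). odd_finite_field.qc (F P) (\<pi> P f))"
    using leg_qc[OF P V_carrier] by simp
  then show ?thesis
    using sum_V_residues[OF P, of "odd_finite_field.qc (F P)"] odd_finite_field.sum_qc[OF F_field[OF P]]
    by (simp only:)
qed

lemma monic_add_V: "f \<in> monic_polys_deg R n \<Longrightarrow> r \<in> V n \<Longrightarrow> f \<boxplus> r \<in> monic_polys_deg R n"
proof -
  assume f: "f \<in> monic_polys_deg R n" and r: "r \<in> V n"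
  have fc: "f \<in> carrier S" "f \<noteq> []" "hd f = \<one>" and fl: "length f = Suc n"
    using f by (auto simp: monic_deg_iff monic_iff)
  have rc: "r \<in> carrier S" "length r \<le> n" using r by (auto simp: V_def)
  have len: "length (f \<boxplus> r) = Suc n"
    using poly_add_length_eq[OF carrier_is_subring, of f r] fc rc fl
    by (simp add: univ_poly_add univ_poly_carrier del: poly_add.simps)
  have "coeff (f \<boxplus> r) n = coeff f n \<oplus> coeff r n" using fc rc by (simp add: coeff_add)
  also have "coeff r n = \<zero>" using rc coeff_length by simp
  also have "coeff f n = \<one>" using lead_coeff_simp[OF fc(2)] fl fc by simp
  finally have "coeff (f \<boxplus> r) n = \<one>" by simp
  moreover have ne: "f \<boxplus> r \<noteq> []" using len by auto
  ultimately have "hd (f \<boxplus> r) = \<one>" using lead_coeff_simp[OF ne] len by simp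
  then show ?thesis using len ne fc rc by (simp add: monic_deg_iff monic_iff)
qed

text \<open>Translation by a representative of y - x has degree below that of \<open>P\<close>, so
  it keeps a polynomial of degree \<open>j\<close> monic and maps the fibre over x injectively into
  the fibre over y. All fibres are therefore equally large, and the total count gives their
  size.\<close>

lemma msum_residues:
  fixes G :: "'a list set \<Rightarrow> int"
  assumes P: "P \<in> prime_polys R" and j: "degree P \<le> j"
  shows "(\<Sum>f\<in>monic_polys_deg R j. G (\<pi> P f)) = int q ^ (j - degree P) * (\<Sum>x\<in>carrier (F P). G x)"
proof -
  interpret h: ring_hom_ring S "F P" "\<pi> P" by (rule \<pi>_hom[OF P])
  let ?M = "monic_polys_deg R j" and ?d = "degree P"
  let ?fib = "\<lambda>x. {f \<in> ?M. \<pi> P f = x}"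
  have Mc: "f \<in> carrier S" if "f \<in> ?M" for f using that by (simp add: monic_deg_iff monic_iff)
  have fin: "finite (carrier (F P))" using bij_betw_finite[OF \<pi>_bij[OF P]] by simp
  have le: "card (?fib x) \<le> card (?fib y)" if xy: "x \<in> carrier (F P)" "y \<in> carrier (F P)" for x y
  proof -
    obtain r where r: "r \<in> V ?d" "\<pi> P r = y \<ominus>\<^bsub>F P\<^esub> x"
    proof -
      have "y \<ominus>\<^bsub>F P\<^esub> x \<in> \<pi> P ` V ?d"
        unfolding bij_betw_imp_surj_on[OF \<pi>_bij[OF P]] by (rule h.S.minus_closed[OF xy(2,1)])
      then show ?thesis using that by (elim imageE) simp
    qed
    have rj: "r \<in> V j" "r \<in> carrier S" using r V_mono[OF j] by (auto simp: V_def)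
    have "(\<lambda>f. f \<boxplus> r) ` ?fib x \<subseteq> ?fib y"
    proof
      fix f' assume "f' \<in> (\<lambda>f. f \<boxplus> r) ` ?fib x"
      then obtain f where f: "f \<in> ?M" "\<pi> P f = x" "f' = f \<boxplus> r" by auto
      have "\<pi> P f' = x \<oplus>\<^bsub>F P\<^esub> (y \<ominus>\<^bsub>F P\<^esub> x)" using f r rj Mc by simp
      also have "\<dots> = y \<oplus>\<^bsub>F P\<^esub> (x \<oplus>\<^bsub>F P\<^esub> \<ominus>\<^bsub>F P\<^esub> x)"
        unfolding a_minus_def using xy by (intro h.S.a_lcomm) auto
      also have "\<dots> = y" using xy by (simp add: h.S.r_neg)
      finally show "f' \<in> ?fib y" using f monic_add_V[OF f(1) rj(1)] by simp
    qed
    moreover have "inj_on (\<lambda>f. f \<boxplus> r) (?fib x)" using rj Mc by (auto simp: inj_on_def)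
    ultimately show ?thesis by (intro card_inj_on_le[of "\<lambda>f. f \<boxplus> r"]) auto
  qed
  define c where "c = card (?fib \<zero>\<^bsub>F P\<^esub>)"
  have c: "card (?fib x) = c" if "x \<in> carrier (F P)" for x
    unfolding c_def using le[OF that h.S.zero_closed] le[OF h.S.zero_closed that] by simp
  have grp: "(\<Sum>x\<in>carrier (F P). sum H (?fib x)) = sum H ?M" for H :: "'a list \<Rightarrow> int"
    by (rule sum.group) (use fin \<pi>_closed[OF P] Mc in auto)
  have "int q ^ j = (\<Sum>x\<in>carrier (F P). int c)"
    using grp[of "\<lambda>_. 1"] c by (simp add: card_monic_deg)
  also have "\<dots> = int q ^ ?d * int c" using order_F[OF P] by (simp add: order_def)
  finally have "int q ^ ?d * int c = int q ^ ?d * int q ^ (j - ?d)"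
    using j by (simp add: power_add[symmetric])
  then have ceq: "int c = int q ^ (j - ?d)" using order_ge_3 by simp
  have "(\<Sum>f\<in>?M. G (\<pi> P f)) = (\<Sum>x\<in>carrier (F P). \<Sum>f\<in>?fib x. G (\<pi> P f))" by (rule grp[symmetric])
  also have "\<dots> = (\<Sum>x\<in>carrier (F P). int c * G x)" using c by (intro sum.cong refl) simp
  finally show ?thesis by (simp add: sum_distrib_left ceq)
qed

lemma msum_leg_0:
  assumes P: "P \<in> prime_polys R" and "degree P \<le> j" shows "msum (\<lambda>f. leg f P) j = 0"
proof -
  have "msum (\<lambda>f. leg f P) j = (\<Sum>f\<in>monic_polys_deg R j. odd_finite_field.qc (F P) (\<pi> P f))"
    unfolding msum_def using leg_qc[OF P] by (intro sum.cong refl) (simp add: monic_deg_iff monic_iff)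
  then show ?thesis using msum_residues[OF assms] odd_finite_field.sum_qc[OF F_field[OF P]] by simp
qed

lemma msum_coprime:
  assumes P: "P \<in> prime_polys R"
  shows "msum (\<lambda>f. of_bool (\<not> P pdivides f)) k =
    int q ^ k - (if degree P \<le> k then int q ^ (k - degree P) else 0)"
proof -
  have "msum (\<lambda>f. of_bool (\<not> P pdivides f)) k =
    (\<Sum>f\<in>monic_polys_deg R k. 1 - (if P pdivides f then 1 else (0::int)))"
    unfolding msum_def by (intro sum.cong refl) auto
  also have "\<dots> = int q ^ k - (\<Sum>f | f \<in> monic_polys_deg R k \<and> P pdivides f. 1)"
    by (simp only: sum_subtractf sum.inter_filter[symmetric, OF finite_monic_deg]) (simp add: card_monic_deg)
  also have "(\<Sum>f | f \<in> monic_polys_deg R k \<and> P pdivides f. 1) = (if degree P \<le> k then int q ^ (k - degree P) else 0)"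
    using msum_multiples[OF cmult_1 prime_monic[OF P], of k, where 'c=int] by (simp only: msum_1 mult_1 of_int_of_nat_eq)
  finally show ?thesis .
qed

text \<open>Here \<psi>^2 is the indicator of being prime to \<open>P\<close>. Its sums over the
  degrees k are geometric with ratio q except for one defect, at k = degree P, and that defect
  produces the last term.\<close>

lemma hsum_prime_recursion:
  assumes P: "P \<in> prime_polys R" and m: "m \<ge> 2" and \<psi>: "cmult \<psi>"
    and sq: "\<And>f. f \<in> monic_polys R \<Longrightarrow> \<psi> f ^ 2 = of_bool (\<not> P pdivides f)"
  shows "hsum \<psi> m = msum \<psi> m - int q * msum \<psi> (m - 2) +
     (if 2 * degree P \<le> m then hsum \<psi> (m - 2 * degree P) else 0)"
proof -
  let ?d = "degree P"
  have w: "msum (\<lambda>h. \<psi> h ^ 2) k = int q ^ k - (if ?d \<le> k then int q ^ (k - ?d) else 0)" for k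
  proof -
    have "msum (\<lambda>h. \<psi> h ^ 2) k = msum (\<lambda>f. of_bool (\<not> P pdivides f)) k"
      unfolding msum_def using sq by (intro sum.cong refl) (simp add: monic_deg_iff)
    then show ?thesis using msum_coprime[OF P] by simp
  qed
  have "msum (\<lambda>h. \<psi> h ^ 2) (Suc k) = int q * msum (\<lambda>h. \<psi> h ^ 2) k - of_bool (Suc k = ?d)" for k
    unfolding w by (auto simp: algebra_simps Suc_diff_le le_Suc_eq)
  from hsum_recursion[OF \<psi> this m]
  have "msum \<psi> m - int q * msum \<psi> (m - 2) = hsum \<psi> m - (\<Sum>k=1..m div 2. of_bool (k = ?d) * hsum \<psi> (m - 2 * k))" .
  also have "(\<Sum>k=1..m div 2. of_bool (k = ?d) * hsum \<psi> (m - 2 * k)) =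
      (\<Sum>k=1..m div 2. if k = ?d then hsum \<psi> (m - 2 * ?d) else 0)"
    by (intro sum.cong refl) simp
  also have "\<dots> = (if ?d \<in> {1..m div 2} then hsum \<psi> (m - 2 * ?d) else 0)" by (simp only: sum.delta finite_atLeastAtMost)
  also have "?d \<in> {1..m div 2} \<longleftrightarrow> 2 * ?d \<le> m" using prime_degree[OF P] by auto
  finally show ?thesis by simp
qed

section \<open>The functional equation of Legendre sums\<close>

lemma monic_deg_length: "f \<in> monic_polys_deg R n \<Longrightarrow> length f = Suc n"
  by (auto simp: monic_deg_eq)

lemma pmod_unique:
  assumes P: "P \<in> prime_polys R" and "f \<in> carrier S" "r \<in> V (degree P)" "\<pi> P r = \<pi> P f"
  shows "f pmod P = r"
  using inj_onD[OF bij_betw_imp_inj_on[OF \<pi>_bij[OF P]] _ pmod_V[OF P assms(2)] assms(3)]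
    \<pi>_pmod[OF P assms(2)] assms(4) by simp

lemma leg_cong: "P \<in> prime_polys R \<Longrightarrow> f \<in> carrier S \<Longrightarrow> leg (f pmod P) P = leg f P"
  using leg_qc V_carrier[OF pmod_V] \<pi>_pmod by simp

lemma const_pow: "c \<in> carrier R \<Longrightarrow> c \<noteq> \<zero> \<Longrightarrow> [c] \<up> n = [c [^] n]"
proof (induction n)
  case 0 then show ?case by (simp add: one_S)
next
  case (Suc n)
  have cn: "c [^] n \<in> carrier R" "c [^] n \<noteq> \<zero>"
    using Units_pow_closed[of c n] Suc.prems by (auto simp: field_Units)
  show ?case using Suc const_mult[OF cn const_closed[OF Suc.prems]] by simp
qed

text \<open>The exponent (|P| - 1)/2 is (q - 1)/2 times 1 + q + ... + q^(d - 1), and the latter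
  factor has the parity of the degree d because q is odd.\<close>

lemma leg_const:
  assumes P: "P \<in> prime_polys R" and c: "c \<in> carrier R" "c \<noteq> \<zero>"
  shows "leg [c] P = qc c ^ degree P"
proof -
  interpret F: odd_finite_field "F P" by (rule F_field[OF P])
  interpret h: ring_hom_ring S "F P" "\<pi> P" by (rule \<pi>_hom[OF P])
  let ?d = "degree P"
  define n where "n = (\<Sum>i<?d. q ^ i)"
  have "(q - 1) * n = q ^ ?d - 1"
    unfolding n_def using order_ge_3 power_diff_1_eq[of "int q" ?d]
    by (intro nat_int_comparison(1)[THEN iffD2]) (simp add: of_nat_diff)
  then have e: "(order (F P) - 1) div 2 = ((q - 1) div 2) * n"
    using half order_F[OF P] by (metis div_mult_swap dvd_triv_left mult.commute)
  have "odd (\<Sum>i<k. q ^ i) \<longleftrightarrow> odd k" for k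
    by (induction k) (simp_all add: odd_order)
  then have par: "odd n \<longleftrightarrow> odd ?d" unfolding n_def .
  have cc: "[c] \<in> carrier S" by (rule const_closed[OF c])
  let ?s = "if qc c = 1 then \<one> else \<ominus> \<one>"
  have s: "c [^] ((order (F P) - 1) div 2) = ?s [^] n"
    using pow_half[OF c] c nat_pow_pow[OF c(1), of "(q - 1) div 2" n] e by simp
  have sp: "?s [^] n = (if qc c = 1 \<or> even n then \<one> else \<ominus> \<one>)"
  proof (cases "qc c = 1")
    case False
    have "(\<ominus> \<one>) [^] k = (if even k then \<one> else \<ominus> \<one>)" for k :: nat
      by (induction k) (auto simp: l_minus)
    then show ?thesis using False by simp
  qed simp
  have "\<pi> P [c] [^]\<^bsub>F P\<^esub> ((order (F P) - 1) div 2) = \<pi> P [?s [^] n]"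
    by (simp only: h.hom_nat_pow[OF cc, symmetric] const_pow[OF c] s)
  also have "\<dots> = (if qc c = 1 \<or> even n then \<one>\<^bsub>F P\<^esub> else \<ominus>\<^bsub>F P\<^esub> \<one>\<^bsub>F P\<^esub>)"
  proof -
    have m1: "\<ominus> \<one> \<noteq> \<zero>" by (metis minus_minus minus_zero one_closed one_not_zero)
    have "[\<ominus> \<one>] = \<ominus>\<^bsub>S\<^esub> \<one>\<^bsub>S\<^esub>"
    proof (rule S.minus_equality[symmetric])
      show "[\<ominus> \<one>] \<boxplus> \<one>\<^bsub>S\<^esub> = \<zero>\<^bsub>S\<^esub>" by (simp add: one_S univ_poly_add l_neg)
    qed (use const_closed[OF _ m1] in auto)
    then have "\<pi> P [\<ominus> \<one>] = \<ominus>\<^bsub>F P\<^esub> \<one>\<^bsub>F P\<^esub>" using h.hom_a_inv[OF S.one_closed] h.hom_one by simp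
    moreover have "\<pi> P [\<one>] = \<one>\<^bsub>F P\<^esub>" using h.hom_one by (simp add: one_S)
    ultimately show ?thesis unfolding sp by simp
  qed
  finally have eq: "\<pi> P [c] [^]\<^bsub>F P\<^esub> ((order (F P) - 1) div 2) = (if qc c = 1 \<or> even n then \<one>\<^bsub>F P\<^esub> else \<ominus>\<^bsub>F P\<^esub> \<one>\<^bsub>F P\<^esub>)" .
  have "\<not> P pdivides [c]"
    using pdivides_degree_le[OF _ prime_carrier[OF P] cc] prime_degree[OF P] by auto
  then have nz: "\<pi> P [c] \<noteq> \<zero>\<^bsub>F P\<^esub>" using \<pi>_zero_iff[OF P cc] by simp
  have "F.qc (\<pi> P [c]) = (if qc c = 1 \<or> even n then 1 else -1)"
    using eq nz F.one_neq_minus_one by (auto simp: F.qc_def)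
  also have "\<dots> = qc c ^ ?d"
    using qc_cases[of c] qc_zero_iff[of c] c par by auto
  finally show ?thesis using leg_qc[OF P cc] by simp
qed

text \<open>Summing over a full linear space rather than over monic polynomials gives the functional
  equation without boundary terms. \<open>C_Suc\<close> translates between the two when
  \<open>degree P\<close> is even, since all nonzero constants are then squares modulo
  \<open>P\<close>.\<close>

definition C :: "'a list \<Rightarrow> nat \<Rightarrow> int" where "C P j = (\<Sum>f\<in>V j. leg f P)"

lemma C_Suc:
  assumes P: "P \<in> prime_polys R" and ev: "even (degree P)"
  shows "C P (Suc j) = C P j + (int q - 1) * msum (\<lambda>f. leg f P) j"
proof -
  have "leg ([c] \<boxtimes> f) P = leg f P" if "c \<in> carrier R - {\<zero>}" "f \<in> monic_polys_deg R j" for c f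
  proof -
    have "qc c ^ degree P = 1" using that qc_cases[of c] qc_zero_iff[of c] ev by auto
    then show ?thesis using that leg_mult[OF P const_closed] leg_const[OF P] by (auto simp: monic_deg_iff monic_iff)
  qed
  then have "(\<Sum>c\<in>carrier R - {\<zero>}. \<Sum>f\<in>monic_polys_deg R j. leg ([c] \<boxtimes> f) P) =
     (\<Sum>c\<in>carrier R - {\<zero>}. msum (\<lambda>f. leg f P) j)"
    unfolding msum_def by (intro sum.cong refl) auto
  also have "\<dots> = (int q - 1) * msum (\<lambda>f. leg f P) j"
    using fin order_ge_3 by (simp add: order_def of_nat_diff)
  finally show ?thesis unfolding C_def sum_V_Suc[OF finite_V] by simp
qed

text \<open>For \<open>P\<close> of degree \<open>2 * \<delta>\<close>, the form \<open>(f, h) \<mapsto> lam P (f h)\<close> is a nondegenerate symmetric bilinear form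
  on the residues modulo \<open>P\<close>, for which \<open>V j\<close> and \<open>V (2 * \<delta> - j)\<close> are orthogonal complements of each other;
  in particular \<open>V \<delta>\<close> is a maximal isotropic subspace. It takes the place of the additive character and of
  the Gauss sum in the usual proof of the functional equation.\<close>

definition lam :: "'a list \<Rightarrow> 'a list \<Rightarrow> 'a" where "lam P f = coeff (f pmod P) (degree P - 1)"

lemma pmod_id: "P \<in> prime_polys R \<Longrightarrow> f \<in> V (degree P) \<Longrightarrow> f pmod P = f"
  by (rule pmod_unique) (auto simp: V_def)

lemma lam_closed: "P \<in> prime_polys R \<Longrightarrow> f \<in> carrier S \<Longrightarrow> lam P f \<in> carrier R"
  using V_carrier[OF pmod_V] by (simp add: lam_def)

lemma lam_add: "P \<in> prime_polys R \<Longrightarrow> f \<in> carrier S \<Longrightarrow> h \<in> carrier S \<Longrightarrow> lam P (f \<boxplus> h) = lam P f \<oplus> lam P h"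
  using V_carrier[OF pmod_V]
  by (simp add: lam_def long_division_add[OF carrier_is_subfield _ _ prime_carrier] coeff_add)

lemma coeff_const_mult: "c \<in> carrier R \<Longrightarrow> c \<noteq> \<zero> \<Longrightarrow> f \<in> carrier S \<Longrightarrow> coeff ([c] \<boxtimes> f) i = c \<otimes> coeff f i"
  using scalar_coeff[of c f] by (simp add: const_mult)

lemma length_const_mult: "c \<in> carrier R \<Longrightarrow> c \<noteq> \<zero> \<Longrightarrow> f \<in> carrier S \<Longrightarrow> length ([c] \<boxtimes> f) = length f"
  by (simp add: const_mult)

lemma V_const_mult: "c \<in> carrier R \<Longrightarrow> c \<noteq> \<zero> \<Longrightarrow> f \<in> V n \<Longrightarrow> [c] \<boxtimes> f \<in> V n"
  using length_const_mult const_closed by (auto simp: V_def)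

lemma lam_const_mult:
  assumes P: "P \<in> prime_polys R" and c: "c \<in> carrier R" "c \<noteq> \<zero>" and f: "f \<in> carrier S"
  shows "lam P ([c] \<boxtimes> f) = c \<otimes> lam P f"
proof -
  interpret h: ring_hom_ring S "F P" "\<pi> P" by (rule \<pi>_hom[OF P])
  have r: "f pmod P \<in> V (degree P)" by (rule pmod_V[OF P f])
  have "([c] \<boxtimes> f) pmod P = [c] \<boxtimes> (f pmod P)"
  proof (rule pmod_unique[OF P])
    show "\<pi> P ([c] \<boxtimes> (f pmod P)) = \<pi> P ([c] \<boxtimes> f)"
      using \<pi>_pmod[OF P f] const_closed[OF c] f V_carrier[OF r] by simp
  qed (use const_closed[OF c] f V_const_mult[OF c r] in auto)
  then show ?thesis using coeff_const_mult[OF c V_carrier[OF r]] by (simp add: lam_def)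
qed

lemma lam_zero_iff:
  assumes P: "P \<in> prime_polys R" and f: "f \<in> carrier S"
  shows "lam P f = \<zero> \<longleftrightarrow> f pmod P \<in> V (degree P - 1)"
proof -
  let ?r = "f pmod P" and ?d = "degree P"
  have r: "?r \<in> carrier S" "length ?r \<le> ?d" using pmod_V[OF P f] by (auto simp: V_def)
  show ?thesis
  proof
    assume z: "lam P f = \<zero>"
    show "?r \<in> V (?d - 1)"
    proof (rule ccontr)
      assume "?r \<notin> V (?d - 1)"
      then have l: "length ?r = ?d" using r by (simp add: V_def)
      then have ne: "?r \<noteq> []" using prime_degree[OF P] by auto
      then have "coeff ?r (?d - 1) = hd ?r" using lead_coeff_simp[OF ne] l by simp
      then show False using z hd_closed[OF r(1) ne] by (simp add: lam_def)
    qed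
  next
    assume "?r \<in> V (?d - 1)"
    then show "lam P f = \<zero>" unfolding lam_def V_def using coeff_length by simp
  qed
qed

text \<open>A nonzero linear functional is equidistributed: scaling \<open>h0\<close> reaches every
  nonzero value, and shifting by an element of value t - s maps the fibre over s injectively into
  the fibre over t.\<close>

lemma fiber_count:
  assumes add: "\<And>f h. f \<in> V n \<Longrightarrow> h \<in> V n \<Longrightarrow> \<phi> (f \<boxplus> h) = \<phi> f \<oplus> \<phi> h"
    and scal: "\<And>c f. c \<in> carrier R \<Longrightarrow> c \<noteq> \<zero> \<Longrightarrow> f \<in> V n \<Longrightarrow> \<phi> ([c] \<boxtimes> f) = c \<otimes> \<phi> f"
    and cl: "\<And>f. f \<in> V n \<Longrightarrow> \<phi> f \<in> carrier R"
    and h0: "h0 \<in> V n" "\<phi> h0 \<noteq> \<zero>" and t: "t \<in> carrier R" and n: "n \<ge> 1"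
  shows "card {h \<in> V n. \<phi> h = t} = q ^ (n - 1)"
proof -
  have hit: "\<exists>h\<in>V n. \<phi> h = t" if t: "t \<in> carrier R" "t \<noteq> \<zero>" for t
  proof -
    let ?c = "t \<otimes> inv (\<phi> h0)"
    have u: "\<phi> h0 \<in> Units R" using cl[OF h0(1)] h0(2) by (simp add: field_Units)
    have i: "inv (\<phi> h0) \<in> Units R" using u by simp
    have c: "?c \<in> carrier R" "?c \<noteq> \<zero>"
      using t i field_Units by (auto simp: integral_iff)
    have "\<phi> ([?c] \<boxtimes> h0) = t"
      using scal[OF c h0(1)] u t cl[OF h0(1)] by (simp add: m_assoc)
    then show ?thesis using V_const_mult[OF c h0(1)] by blast
  qed
  have zero: "\<phi> [] = \<zero>"
    using add[of "[]" "[]"] cl[of "[]"] by (simp add: add.l_cancel_one')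
  have le: "card {h \<in> V n. \<phi> h = s} \<le> card {h \<in> V n. \<phi> h = t}" if st: "s \<in> carrier R" "t \<in> carrier R" for s t
  proof -
    obtain k where k: "k \<in> V n" "\<phi> k = t \<ominus> s"
    proof (cases "t \<ominus> s = \<zero>")
      case True then show ?thesis using that[of "[]"] zero by simp
    next
      case False then show ?thesis using hit[OF _ False] st that by blast
    qed
    have kc: "k \<in> carrier S" by (rule V_carrier[OF k(1)])
    have "(\<lambda>h. h \<boxplus> k) ` {h \<in> V n. \<phi> h = s} \<subseteq> {h \<in> V n. \<phi> h = t}"
    proof
      fix x assume "x \<in> (\<lambda>h. h \<boxplus> k) ` {h \<in> V n. \<phi> h = s}"
      then obtain h where h: "h \<in> V n" "\<phi> h = s" "x = h \<boxplus> k" by blast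
      have "\<phi> x = s \<oplus> (t \<ominus> s)" using add[OF h(1) k(1)] h k by simp
      also have "\<dots> = t \<oplus> (s \<oplus> \<ominus> s)" unfolding a_minus_def using st by (intro a_lcomm) auto
      also have "\<dots> = t" using st by (simp add: r_neg)
      finally show "x \<in> {h \<in> V n. \<phi> h = t}" using h V_add[OF h(1) k(1)] by simp
    qed
    moreover have "inj_on (\<lambda>h. h \<boxplus> k) {h \<in> V n. \<phi> h = s}"
    proof (rule inj_onI)
      fix a b assume "a \<in> {h \<in> V n. \<phi> h = s}" "b \<in> {h \<in> V n. \<phi> h = s}" "a \<boxplus> k = b \<boxplus> k"
      then show "a = b" using S.add.r_cancel[of a k b] kc by (simp add: V_def)
    qed
    ultimately show ?thesis by (intro card_inj_on_le[of "\<lambda>h. h \<boxplus> k"]) auto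
  qed
  have eq: "card {h \<in> V n. \<phi> h = s} = card {h \<in> V n. \<phi> h = t}" if "s \<in> carrier R" for s
    using le[OF that t] le[OF t that] by simp
  have "(\<Sum>s\<in>carrier R. sum (\<lambda>_. 1::nat) {h \<in> V n. \<phi> h = s}) = sum (\<lambda>_. 1) (V n)"
    by (rule sum.group) (use cl fin in auto)
  then have "(\<Sum>s\<in>carrier R. card {h \<in> V n. \<phi> h = s}) = q ^ n" by (simp add: card_V)
  then have "q * card {h \<in> V n. \<phi> h = t} = q ^ n" using eq by (simp add: order_def)
  also have "\<dots> = q * q ^ (n - 1)" using n by (cases n) auto
  finally show ?thesis using order_ge_3 by simp
qed

lemma mult_V:
  assumes "f \<in> V i" "h \<in> V j" shows "f \<boxtimes> h \<in> V (i + j - 1)"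
proof (cases "f = [] \<or> h = []")
  case True then show ?thesis using assms V_carrier by auto
next
  case False
  then show ?thesis using assms length_mult[of f h] by (auto simp: V_def)
qed

text \<open>For \<open>f\<close> in \<open>V j\<close> the product has degree below degree P - 1, so
  no reduction takes place and the coefficient read off is zero. Otherwise a monic factor of
  complementary degree brings the product to degree exactly degree P - 1, so the functional is
  nonzero and \<open>fiber_count\<close> applies.\<close>

lemma lam_orth:
  assumes P: "P \<in> prime_polys R" and j: "j < degree P" and f: "f \<in> V (degree P)" and t: "t \<in> carrier R"
  shows "card {h \<in> V (degree P - j). lam P (f \<boxtimes> h) = t} =
    (if f \<in> V j then (if t = \<zero> then q ^ (degree P - j) else 0) else q ^ (degree P - j - 1))"
proof (cases "f \<in> V j")
  case True
  have "lam P (f \<boxtimes> h) = \<zero>" if h: "h \<in> V (degree P - j)" for h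
  proof -
    have m: "f \<boxtimes> h \<in> V (degree P - 1)" using mult_V[OF True h] j by simp
    then have "f \<boxtimes> h \<in> V (degree P)" by (rule subsetD[OF V_mono[OF diff_le_self]])
    then have "(f \<boxtimes> h) pmod P = f \<boxtimes> h" by (rule pmod_id[OF P])
    then show ?thesis using lam_zero_iff[OF P V_carrier[OF m]] m by simp
  qed
  then have "{h \<in> V (degree P - j). lam P (f \<boxtimes> h) = t} = (if t = \<zero> then V (degree P - j) else {})" by auto
  then show ?thesis using True by (simp add: card_V)
next
  case False
  let ?d = "degree P"
  have fc: "f \<in> carrier S" "length f \<le> ?d" "length f > j" using f False by (auto simp: V_def)
  then have fne: "f \<noteq> []" by auto
  have "card (monic_polys_deg R (?d - length f)) > 0" using card_monic_deg order_ge_3 by simp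
  then obtain h0 where h0: "h0 \<in> monic_polys_deg R (?d - length f)" by (metis card_gt_0_iff ex_in_conv)
  have hc: "h0 \<in> carrier S" "h0 \<noteq> []" using h0 by (auto simp: monic_deg_iff monic_iff)
  have hl: "length h0 = ?d - length f + 1" using monic_deg_length[OF h0] by simp
  have h0V: "h0 \<in> V (?d - j)" using hc hl fc by (simp add: V_def)
  have l: "length (f \<boxtimes> h0) = ?d" using length_mult[OF fc(1) hc(1) fne hc(2)] hl fc by simp
  have "lam P (f \<boxtimes> h0) \<noteq> \<zero>"
  proof
    assume "lam P (f \<boxtimes> h0) = \<zero>"
    moreover have "(f \<boxtimes> h0) pmod P = f \<boxtimes> h0" using l fc hc by (intro pmod_id[OF P]) (simp add: V_def)
    ultimately have "f \<boxtimes> h0 \<in> V (?d - 1)" using lam_zero_iff[OF P, of "f \<boxtimes> h0"] fc hc by simp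
    then have "length (f \<boxtimes> h0) \<le> ?d - 1" by (simp only: V_def mem_Collect_eq)
    then show False using l prime_degree[OF P] by linarith
  qed
  then have "card {h \<in> V (?d - j). lam P (f \<boxtimes> h) = t} = q ^ (?d - j - 1)"
  proof (intro fiber_count[of _ "\<lambda>h. lam P (f \<boxtimes> h)" h0])
    fix a b assume "a \<in> V (?d - j)" "b \<in> V (?d - j)"
    then show "lam P (f \<boxtimes> (a \<boxplus> b)) = lam P (f \<boxtimes> a) \<oplus> lam P (f \<boxtimes> b)"
      using fc V_carrier by (simp add: S.r_distr lam_add[OF P])
  next
    fix c a assume c: "c \<in> carrier R" "c \<noteq> \<zero>" and a: "a \<in> V (?d - j)"
    have "f \<boxtimes> ([c] \<boxtimes> a) = [c] \<boxtimes> (f \<boxtimes> a)"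
      using fc V_carrier[OF a] const_closed[OF c] by (simp add: S.m_lcomm)
    then show "lam P (f \<boxtimes> ([c] \<boxtimes> a)) = c \<otimes> lam P (f \<boxtimes> a)"
      using fc V_carrier[OF a] lam_const_mult[OF P c] by simp
  next
    fix a assume "a \<in> V (?d - j)"
    then show "lam P (f \<boxtimes> a) \<in> carrier R" using lam_closed[OF P] fc V_carrier by simp
  qed (use h0V t j in auto)
  then show ?thesis using False by simp
qed

lemma sum_V_shift:
  fixes G :: "'a list \<Rightarrow> 'c::comm_monoid_add"
  assumes v: "k \<in> V n" shows "(\<Sum>y\<in>V n. G (y \<boxplus> k)) = (\<Sum>y\<in>V n. G y)"
proof (rule sum.reindex_bij_witness[of _ "\<lambda>y. y \<boxminus> k" "\<lambda>y. y \<boxplus> k"])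
  have kc: "k \<in> carrier S" by (rule V_carrier[OF v])
  fix y assume y: "y \<in> V n"
  have yc: "y \<in> carrier S" by (rule V_carrier[OF y])
  show "y \<boxplus> k \<boxminus> k = y" using yc kc by (simp add: a_minus_def S.a_assoc S.r_neg)
  show "y \<boxminus> k \<boxplus> k = y" using yc kc by (simp add: a_minus_def S.a_assoc S.l_neg)
  show "y \<boxplus> k \<in> V n" by (rule V_add[OF y v])
  show "y \<boxminus> k \<in> V n" by (rule V_sub[OF y v])
  show "G (y \<boxplus> k) = G (y \<boxplus> k)" ..
qed

lemma lam_V:
  assumes P: "P \<in> prime_polys R" and "f \<in> V i" "h \<in> V j" "i + j \<le> degree P"
  shows "lam P (f \<boxtimes> h) = \<zero>"
proof -
  have m: "f \<boxtimes> h \<in> V (degree P - 1)"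
    by (rule subsetD[OF V_mono mult_V[OF assms(2,3)]]) (use assms(4) in linarith)
  then have "f \<boxtimes> h \<in> V (degree P)" by (rule subsetD[OF V_mono[OF diff_le_self]])
  then have "(f \<boxtimes> h) pmod P = f \<boxtimes> h" by (rule pmod_id[OF P])
  then show ?thesis using lam_zero_iff[OF P V_carrier[OF m]] m by simp
qed

text \<open>Two is a nonzero constant because the order is odd. This is needed for the polarization
  in \<open>isotropic_count\<close>.\<close>

lemma double_V_iff: "y \<in> carrier S \<Longrightarrow> y \<boxplus> y \<in> V n \<longleftrightarrow> y \<in> V n"
proof -
  assume y: "y \<in> carrier S"
  have two: "\<one> \<oplus> \<one> \<in> carrier R" "\<one> \<oplus> \<one> \<noteq> \<zero>"
    using one_neq_minus_one minus_equality[of \<one> \<one>] by auto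
  have "y \<boxplus> y = [\<one> \<oplus> \<one>] \<boxtimes> y"
  proof -
    have "[\<one> \<oplus> \<one>] = \<one>\<^bsub>S\<^esub> \<boxplus> \<one>\<^bsub>S\<^esub>" using two by (simp add: one_S univ_poly_add)
    then show ?thesis using y by (simp add: S.l_distr)
  qed
  then show ?thesis using length_const_mult[OF two y] const_closed[OF two] y by (simp add: V_def)
qed

text \<open>Average over translations by \<open>V \<delta>\<close>, on which the form vanishes: for
  fixed y, the value at y + k is lam(y^2) + lam(2 y k), affine in k. It is identically zero for y in
  \<open>V \<delta>\<close> and equidistributed otherwise, by \<open>lam_orth\<close>.\<close>

lemma isotropic_count:
  assumes P: "P \<in> prime_polys R" and d: "degree P = 2 * \<delta>"
  shows "int (card {y \<in> V (2 * \<delta>). lam P (y \<boxtimes> y) = \<zero>}) = int q ^ \<delta> + (int q ^ \<delta> - 1) * int q ^ (\<delta> - 1)"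
proof -
  let ?T = "{y \<in> V (2 * \<delta>). lam P (y \<boxtimes> y) = \<zero>}"
  have \<delta>: "\<delta> \<ge> 1" using prime_degree[OF P] d by linarith
  define ind where "ind y = (of_bool (lam P (y \<boxtimes> y) = \<zero>) :: int)" for y
  have T: "int (card ?T) = (\<Sum>y\<in>V (2 * \<delta>). ind y)" unfolding ind_def by (simp add: sum.If_cases of_bool_def Int_def)
  have sub: "V \<delta> \<subseteq> V (2 * \<delta>)" by (rule V_mono) simp
  have "int q ^ \<delta> * int (card ?T) = (\<Sum>k\<in>V \<delta>. \<Sum>y\<in>V (2 * \<delta>). ind (y \<boxplus> k))"
    unfolding T using sum_V_shift[OF subsetD[OF sub], of _ ind] by (simp add: card_V)
  also have "\<dots> = (\<Sum>y\<in>V (2 * \<delta>). \<Sum>k\<in>V \<delta>. ind (y \<boxplus> k))" by (rule sum.swap)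
  also have "\<dots> = (\<Sum>y\<in>V (2 * \<delta>). if y \<in> V \<delta> then int q ^ \<delta> else int q ^ (\<delta> - 1))"
  proof (intro sum.cong refl)
    fix y assume y: "y \<in> V (2 * \<delta>)"
    have yc: "y \<in> carrier S" by (rule V_carrier[OF y])
    let ?t = "\<ominus> lam P (y \<boxtimes> y)"
    have lc: "lam P (y \<boxtimes> y) \<in> carrier R" using lam_closed[OF P] yc by simp
    have "ind (y \<boxplus> k) = of_bool (lam P ((y \<boxplus> y) \<boxtimes> k) = ?t)" if k: "k \<in> V \<delta>" for k
    proof -
      have kc: "k \<in> carrier S" by (rule V_carrier[OF k])
      have "(y \<boxplus> k) \<boxtimes> (y \<boxplus> k) = y \<boxtimes> y \<boxplus> ((y \<boxplus> y) \<boxtimes> k \<boxplus> k \<boxtimes> k)"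
        using yc kc by (simp add: S.l_distr S.r_distr S.a_ac S.m_comm)
      then have "lam P ((y \<boxplus> k) \<boxtimes> (y \<boxplus> k)) = lam P (y \<boxtimes> y) \<oplus> (lam P ((y \<boxplus> y) \<boxtimes> k) \<oplus> lam P (k \<boxtimes> k))"
        using yc kc by (simp add: lam_add[OF P])
      moreover have "lam P (k \<boxtimes> k) = \<zero>" by (rule lam_V[OF P k k]) (use d in linarith)
      moreover have l2: "lam P ((y \<boxplus> y) \<boxtimes> k) \<in> carrier R" using lam_closed[OF P] yc kc by simp
      ultimately have eq: "lam P ((y \<boxplus> k) \<boxtimes> (y \<boxplus> k)) = lam P (y \<boxtimes> y) \<oplus> lam P ((y \<boxplus> y) \<boxtimes> k)" by simp
      have "lam P (y \<boxtimes> y) \<oplus> lam P ((y \<boxplus> y) \<boxtimes> k) = \<zero> \<longleftrightarrow> lam P ((y \<boxplus> y) \<boxtimes> k) = ?t"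
      proof
        assume "lam P (y \<boxtimes> y) \<oplus> lam P ((y \<boxplus> y) \<boxtimes> k) = \<zero>"
        then have "lam P ((y \<boxplus> y) \<boxtimes> k) \<oplus> lam P (y \<boxtimes> y) = \<zero>" using lc l2 by (simp add: a_comm)
        from minus_equality[OF this lc l2] show "lam P ((y \<boxplus> y) \<boxtimes> k) = ?t" by simp
      next
        assume "lam P ((y \<boxplus> y) \<boxtimes> k) = ?t"
        then show "lam P (y \<boxtimes> y) \<oplus> lam P ((y \<boxplus> y) \<boxtimes> k) = \<zero>" using lc by (simp add: r_neg)
      qed
      then show ?thesis unfolding ind_def eq by simp
    qed
    then have "(\<Sum>k\<in>V \<delta>. ind (y \<boxplus> k)) = (\<Sum>k\<in>V \<delta>. of_bool (lam P ((y \<boxplus> y) \<boxtimes> k) = ?t))" by simp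
    also have "\<dots> = int (card {k \<in> V \<delta>. lam P ((y \<boxplus> y) \<boxtimes> k) = ?t})"
      by (simp add: of_bool_def sum.If_cases Int_def)
    also have "card {k \<in> V \<delta>. lam P ((y \<boxplus> y) \<boxtimes> k) = ?t} =
        (if y \<in> V \<delta> then (if ?t = \<zero> then q ^ \<delta> else 0) else q ^ (\<delta> - 1))"
    proof -
      have dd: "2 * \<delta> - \<delta> = \<delta>" by simp
      show ?thesis
        using lam_orth[OF P, of \<delta> "y \<boxplus> y" ?t, unfolded d dd] \<delta> V_add[OF y y] lc double_V_iff[OF yc, of \<delta>] by simp
    qed
    also have "\<dots> = (if y \<in> V \<delta> then q ^ \<delta> else q ^ (\<delta> - 1))"
    proof (cases "y \<in> V \<delta>")
      case True
      have "lam P (y \<boxtimes> y) = \<zero>" by (rule lam_V[OF P True True]) (use d in linarith)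
      then show ?thesis using True by simp
    qed simp
    finally show "(\<Sum>k\<in>V \<delta>. ind (y \<boxplus> k)) = (if y \<in> V \<delta> then int q ^ \<delta> else int q ^ (\<delta> - 1))" by simp
  qed
  also have "\<dots> = int q ^ \<delta> * int q ^ \<delta> + (int q ^ (2 * \<delta>) - int q ^ \<delta>) * int q ^ (\<delta> - 1)"
  proof -
    have 1: "V (2 * \<delta>) \<inter> {y. y \<in> V \<delta>} = V \<delta>" and 2: "V (2 * \<delta>) \<inter> - {y. y \<in> V \<delta>} = V (2 * \<delta>) - V \<delta>" using sub by auto
    have "card (V (2 * \<delta>) - V \<delta>) = q ^ (2 * \<delta>) - q ^ \<delta>" using sub by (simp add: card_Diff_subset card_V)
    moreover have "q ^ \<delta> \<le> q ^ (2 * \<delta>)" using order_ge_3 by (intro power_increasing) auto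
    ultimately show ?thesis unfolding sum.If_cases[OF finite_V] 1 2 by (simp add: card_V of_nat_diff)
  qed
  also have "\<dots> = int q ^ \<delta> * (int q ^ \<delta> + (int q ^ \<delta> - 1) * int q ^ (\<delta> - 1))"
    by (simp only: mult_2 power_add) (simp add: algebra_simps)
  finally show ?thesis using order_ge_3 by simp
qed

text \<open>Sort the isotropic y by the residue w of y^2, which lies in the hyperplane
  \<open>V (2 * \<delta> - 1)\<close>. Each w has 1 + leg w P square roots, so the number of
  isotropic vectors determines the sum of the symbols over the hyperplane.\<close>

lemma C_pred_degree:
  assumes P: "P \<in> prime_polys R" and d: "degree P = 2 * \<delta>"
  shows "C P (2 * \<delta> - 1) = int q ^ \<delta> - int q ^ (\<delta> - 1)"
proof -
  interpret F: odd_finite_field "F P" by (rule F_field[OF P])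
  interpret h: ring_hom_ring S "F P" "\<pi> P" by (rule \<pi>_hom[OF P])
  have \<delta>: "\<delta> \<ge> 1" using prime_degree[OF P] d by linarith
  let ?T = "{y \<in> V (2 * \<delta>). lam P (y \<boxtimes> y) = \<zero>}"
  have Tiff: "lam P (y \<boxtimes> y) = \<zero> \<longleftrightarrow> (y \<boxtimes> y) pmod P \<in> V (2 * \<delta> - 1)" if "y \<in> V (2 * \<delta>)" for y
    using lam_zero_iff[OF P, of "y \<boxtimes> y"] V_carrier[OF that] unfolding d by simp
  have fib: "int (card {y \<in> ?T. (y \<boxtimes> y) pmod P = w}) = 1 + leg w P" if w: "w \<in> V (2 * \<delta> - 1)" for w
  proof -
    have wd: "w \<in> V (degree P)" unfolding d by (rule subsetD[OF V_mono[OF diff_le_self] w])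
    have wc: "w \<in> carrier S" by (rule V_carrier[OF w])
    have a: "{y \<in> ?T. (y \<boxtimes> y) pmod P = w} = {y \<in> V (degree P). (y \<boxtimes> y) pmod P = w}"
      using Tiff w unfolding d by blast
    have b: "\<pi> P ` {y \<in> V (degree P). (y \<boxtimes> y) pmod P = w} = {z \<in> carrier (F P). z \<otimes>\<^bsub>F P\<^esub> z = \<pi> P w}"
    proof (intro equalityI subsetI)
      fix z assume "z \<in> \<pi> P ` {y \<in> V (degree P). (y \<boxtimes> y) pmod P = w}"
      then obtain y where y: "y \<in> V (degree P)" "(y \<boxtimes> y) pmod P = w" "z = \<pi> P y" by blast
      have yc: "y \<in> carrier S" by (rule V_carrier[OF y(1)])
      have "\<pi> P w = \<pi> P (y \<boxtimes> y)" using \<pi>_pmod[OF P, of "y \<boxtimes> y"] yc y(2) by simp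
      then show "z \<in> {z \<in> carrier (F P). z \<otimes>\<^bsub>F P\<^esub> z = \<pi> P w}" using yc y(3) \<pi>_closed[OF P yc] by simp
    next
      fix z assume "z \<in> {z \<in> carrier (F P). z \<otimes>\<^bsub>F P\<^esub> z = \<pi> P w}"
      then have z: "z \<in> \<pi> P ` V (degree P)" "z \<otimes>\<^bsub>F P\<^esub> z = \<pi> P w"
        unfolding bij_betw_imp_surj_on[OF \<pi>_bij[OF P]] by auto
      then obtain y where y: "y \<in> V (degree P)" "z = \<pi> P y" by blast
      have yc: "y \<in> carrier S" by (rule V_carrier[OF y(1)])
      have "(y \<boxtimes> y) pmod P = w" by (rule pmod_unique[OF P _ wd]) (use yc y z in auto)
      then show "z \<in> \<pi> P ` {y \<in> V (degree P). (y \<boxtimes> y) pmod P = w}" using y by blast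
    qed
    have c: "inj_on (\<pi> P) {y \<in> V (degree P). (y \<boxtimes> y) pmod P = w}"
      by (rule inj_on_subset[OF bij_betw_imp_inj_on[OF \<pi>_bij[OF P]]]) auto
    have "card {y \<in> ?T. (y \<boxtimes> y) pmod P = w} = card {z \<in> carrier (F P). z \<otimes>\<^bsub>F P\<^esub> z = \<pi> P w}"
      unfolding a b[symmetric] by (rule card_image[OF c, symmetric])
    then show ?thesis using F.card_square_roots[OF \<pi>_closed[OF P wc]] leg_qc[OF P wc] by simp
  qed
  have "(\<Sum>w\<in>V (2 * \<delta> - 1). sum (\<lambda>_. 1::int) {y \<in> ?T. (y \<boxtimes> y) pmod P = w}) = sum (\<lambda>_. 1) ?T"
    by (rule sum.group) (use Tiff in auto)
  then have "int (card ?T) = (\<Sum>w\<in>V (2 * \<delta> - 1). int (card {y \<in> ?T. (y \<boxtimes> y) pmod P = w}))" by simp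
  also have "\<dots> = (\<Sum>w\<in>V (2 * \<delta> - 1). 1 + leg w P)" using fib by (intro sum.cong refl)
  also have "\<dots> = int q ^ (2 * \<delta> - 1) + C P (2 * \<delta> - 1)" by (simp add: sum.distrib card_V C_def)
  finally have "C P (2 * \<delta> - 1) = int q ^ \<delta> + (int q ^ \<delta> - 1) * int q ^ (\<delta> - 1) - int q ^ (2 * \<delta> - 1)"
    using isotropic_count[OF P d] by simp
  moreover have "int q ^ (2 * \<delta> - 1) = int q ^ \<delta> * int q ^ (\<delta> - 1)"
    using \<delta> by (simp add: power_add[symmetric] mult_2)
  ultimately show ?thesis by (simp add: algebra_simps)
qed

lemma C_0: "P \<in> prime_polys R \<Longrightarrow> C P 0 = 0"
  using leg_zero_iff[of P "[]"] pdividesI[of "[]" "[]" P] prime_carrier[of P] by (simp add: C_def)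

lemma C_degree: "P \<in> prime_polys R \<Longrightarrow> C P (degree P) = 0"
  unfolding C_def by (rule sum_leg_V)

text \<open>Evaluate in two ways the sum of leg f P over f in \<open>V (2 * \<delta>)\<close> and h
  in \<open>V (2 * \<delta> - j)\<close> with lam P (f h) = 0. For fixed h, multiplication by h
  permutes the residues and gives leg h P times \<open>C P (2 * \<delta> - 1)\<close>; for fixed f,
  \<open>lam_orth\<close> singles out the f in \<open>V j\<close>. The constant
  \<open>C P (2 * \<delta> - 1)\<close> is (q - 1) q^(\<delta> - 1), and its factor q - 1
  cancels.\<close>

lemma functional_equation:
  assumes P: "P \<in> prime_polys R" and d: "degree P = 2 * \<delta>" and j: "j \<le> 2 * \<delta>"
  shows "int q ^ \<delta> * C P (2 * \<delta> - j) = int q ^ (2 * \<delta> - j) * C P j"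
proof (cases "j = 2 * \<delta>")
  case True then show ?thesis using C_0[OF P] C_degree[OF P] d by simp
next
  case False
  then have jl: "j < degree P" using j d by linarith
  have \<delta>: "\<delta> \<ge> 1" using prime_degree[OF P] d by linarith
  interpret F: odd_finite_field "F P" by (rule F_field[OF P])
  interpret h: ring_hom_ring S "F P" "\<pi> P" by (rule \<pi>_hom[OF P])
  let ?d = "2 * \<delta>"
  let ?I = "\<lambda>f h. of_bool (lam P (f \<boxtimes> h) = \<zero>) * leg f P"
  have inner: "(\<Sum>f\<in>V ?d. ?I f h) = leg h P * C P (?d - 1)" if h: "h \<in> V (?d - j)" for h
  proof (cases "h = []")
    \<comment> \<open>For h = 0 both sides vanish: the condition on f is void, and the symbol sums
      to zero over all residues.\<close>
    case True
    have "lam P [] = \<zero>" using lam_V[OF P nil_V[of 0] nil_V[of 0]] by simp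
    then have "?I f h = leg f P" if "f \<in> V ?d" for f using True V_carrier[OF that] by simp
    then have "(\<Sum>f\<in>V ?d. ?I f h) = C P ?d" unfolding C_def by (intro sum.cong refl) 
    moreover have "leg h P = 0" using True C_0[OF P] by (simp add: C_def)
    ultimately show ?thesis using C_degree[OF P] d by simp
  next
    case False
    have hc: "h \<in> carrier S" by (rule V_carrier[OF h])
    have "degree h < degree P"
    proof -
      have "length h \<le> 2 * \<delta> - j" using h by (simp add: V_def)
      moreover have "length h > 0" using False by simp
      ultimately show ?thesis using d by linarith
    qed
    then have "\<not> P pdivides h" using pdivides_degree_le[OF _ prime_carrier[OF P] hc False] by fastforce
    then have hz: "\<pi> P h \<noteq> \<zero>\<^bsub>F P\<^esub>" and lh: "leg h P * leg h P = 1"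
      using \<pi>_zero_iff[OF P hc] leg_square[OF P hc] by (auto simp: power2_eq_square)
    let ?m = "\<lambda>f. (f \<boxtimes> h) pmod P"
    have mV: "?m f \<in> V ?d" if "f \<in> V ?d" for f using pmod_V[OF P, of "f \<boxtimes> h"] V_carrier[OF that] hc d by simp
    have inj: "inj_on ?m (V ?d)"
    proof (rule inj_onI)
      fix a b assume ab: "a \<in> V ?d" "b \<in> V ?d" "?m a = ?m b"
      have c: "a \<in> carrier S" "b \<in> carrier S" using ab V_carrier by auto
      have "\<pi> P (a \<boxtimes> h) = \<pi> P (b \<boxtimes> h)"
        using \<pi>_pmod[OF P, of "a \<boxtimes> h"] \<pi>_pmod[OF P, of "b \<boxtimes> h"] ab(3) c hc by simp
      then have "\<pi> P a \<otimes>\<^bsub>F P\<^esub> \<pi> P h = \<pi> P b \<otimes>\<^bsub>F P\<^esub> \<pi> P h" using c hc by simp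
      then have "\<pi> P a = \<pi> P b"
        using F.m_rcancel[OF hz \<pi>_closed[OF P hc] \<pi>_closed[OF P c(1)] \<pi>_closed[OF P c(2)]] by simp
      then show "a = b" using inj_onD[OF bij_betw_imp_inj_on[OF \<pi>_bij[OF P]]] ab d by simp
    qed
    have img: "?m ` V ?d = V ?d" using endo_inj_surj[OF finite_V _ inj] mV by blast
    have "(\<Sum>f\<in>V ?d. ?I f h) = (\<Sum>f\<in>V ?d. of_bool (?m f \<in> V (?d - 1)) * (leg h P * leg (?m f) P))"
    proof (intro sum.cong refl)
      fix f assume f: "f \<in> V ?d"
      have fc: "f \<in> carrier S" by (rule V_carrier[OF f])
      have "leg (?m f) P = leg f P * leg h P" using leg_cong[OF P, of "f \<boxtimes> h"] leg_mult[OF P fc hc] fc hc by simp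
      then have "leg h P * leg (?m f) P = leg f P" using lh by (simp add: mult.left_commute)
      then show "?I f h = of_bool (?m f \<in> V (?d - 1)) * (leg h P * leg (?m f) P)"
        using lam_zero_iff[OF P, of "f \<boxtimes> h", unfolded d] fc hc by simp
    qed
    also have "\<dots> = (\<Sum>f\<in>V ?d. of_bool (f \<in> V (?d - 1)) * (leg h P * leg f P))"
      using sum.reindex[OF inj, of "\<lambda>f. of_bool (f \<in> V (?d - 1)) * (leg h P * leg f P)"] unfolding img by simp
    also have "\<dots> = (\<Sum>f\<in>V (?d - 1). leg h P * leg f P)"
      by (rule sum.mono_neutral_cong_right) (use V_mono[of "?d - 1" ?d] in auto)
    finally show ?thesis by (simp add: C_def sum_distrib_left)
  qed
  have outer: "(\<Sum>h\<in>V (?d - j). ?I f h) = (if f \<in> V j then int q ^ (?d - j) * leg f P else int q ^ (?d - j - 1) * leg f P)"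
    if f: "f \<in> V ?d" for f
  proof -
    have "(\<Sum>h\<in>V (?d - j). ?I f h) = int (card {h \<in> V (?d - j). lam P (f \<boxtimes> h) = \<zero>}) * leg f P"
      by (simp add: of_bool_def sum.If_cases Int_def if_distrib[of "\<lambda>x. x * _"] cong: if_cong)
    then show ?thesis using lam_orth[OF P jl, of f \<zero>, unfolded d] f by (simp only: simp_thms if_True zero_closed of_nat_power if_distrib[of int] if_distrib[of "\<lambda>x. x * _"])
  qed
  have sub: "V j \<subseteq> V ?d" by (rule V_mono[OF j])
  have "C P (?d - 1) * C P (?d - j) = (\<Sum>h\<in>V (?d - j). leg h P * C P (?d - 1))"
    by (subst (2) C_def) (simp add: sum_distrib_left mult.commute)
  also have "\<dots> = (\<Sum>h\<in>V (?d - j). \<Sum>f\<in>V ?d. ?I f h)" using inner by (intro sum.cong refl) simp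
  also have "\<dots> = (\<Sum>f\<in>V ?d. \<Sum>h\<in>V (?d - j). ?I f h)" by (rule sum.swap)
  also have "\<dots> = (\<Sum>f\<in>V ?d. int q ^ (?d - j - 1) * leg f P + (if f \<in> V j then (int q ^ (?d - j) - int q ^ (?d - j - 1)) * leg f P else 0))"
    using outer by (intro sum.cong refl) (simp add: algebra_simps)
  also have "\<dots> = int q ^ (?d - j - 1) * C P ?d + (int q ^ (?d - j) - int q ^ (?d - j - 1)) * C P j"
  proof -
    have "(\<Sum>f\<in>V ?d. if f \<in> V j then (int q ^ (?d - j) - int q ^ (?d - j - 1)) * leg f P else 0) =
       (\<Sum>f\<in>V j. (int q ^ (?d - j) - int q ^ (?d - j - 1)) * leg f P)"
      by (rule sum.mono_neutral_cong_right) (use sub in auto)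
    then show ?thesis by (simp add: sum.distrib C_def sum_distrib_left)
  qed
  also have "C P ?d = 0" using C_degree[OF P] d by simp
  finally have eq: "C P (?d - 1) * C P (?d - j) = (int q ^ (?d - j) - int q ^ (?d - j - 1)) * C P j" by simp
  obtain n where n: "?d - j = Suc n" using jl d by (cases "?d - j") auto
  obtain m where m: "\<delta> = Suc m" using \<delta> by (cases \<delta>) auto
  have 1: "C P (?d - 1) = int q ^ Suc m - int q ^ m" using C_pred_degree[OF P d] by (simp add: m)
  have 2: "Suc n - 1 = n" by simp
  have "(int q - 1) * (int q ^ m * C P (Suc n)) = (int q - 1) * (int q ^ n * C P j)"
    using eq[unfolded 1 n 2] by (simp add: algebra_simps)
  then have "int q ^ m * C P (Suc n) = int q ^ n * C P j" using order_ge_3 by simp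
  moreover have "int q ^ \<delta> = int q * int q ^ m" by (simp add: m)
  ultimately show ?thesis unfolding n power_Suc by (simp only: mult.assoc)
qed

text \<open>Once g \<ge> 2\<delta>, both \<open>msum\<close> terms of the recursion have degree at
  least that of \<open>P\<close> and vanish. Only the shift of 2g + 1 by 4\<delta> remains, that is,
  of g by 2\<delta>.\<close>

lemma hsum_leg_mod:
  assumes P: "P \<in> prime_polys R" and d: "degree P = 2 * \<delta>"
  shows "hsum (\<lambda>f. leg f P) (2 * g + 1) = hsum (\<lambda>f. leg f P) (2 * (g mod (2 * \<delta>)) + 1)"
proof (induction g rule: less_induct)
  case (less g)
  have \<delta>: "\<delta> \<ge> 1" using prime_degree[OF P] d by linarith
  show ?case
  proof (cases "g < 2 * \<delta>")
    case False
    have "hsum (\<lambda>f. leg f P) (2 * g + 1) = msum (\<lambda>f. leg f P) (2 * g + 1) - int q * msum (\<lambda>f. leg f P) (2 * g + 1 - 2) +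
      (if 2 * degree P \<le> 2 * g + 1 then hsum (\<lambda>f. leg f P) (2 * g + 1 - 2 * degree P) else 0)"
      by (rule hsum_prime_recursion[OF P _ cmult_leg[OF P]])
         (use False \<delta> leg_square[OF P] in \<open>auto simp: monic_iff\<close>)
    also have "msum (\<lambda>f. leg f P) (2 * g + 1) = 0" by (rule msum_leg_0[OF P]) (use False d in linarith)
    also have "msum (\<lambda>f. leg f P) (2 * g + 1 - 2) = 0" by (rule msum_leg_0[OF P]) (use False d \<delta> in linarith)
    also have "2 * g + 1 - 2 * degree P = 2 * (g - 2 * \<delta>) + 1" using False d by linarith
    finally have "hsum (\<lambda>f. leg f P) (2 * g + 1) = hsum (\<lambda>f. leg f P) (2 * (g - 2 * \<delta>) + 1)" using False d by simp
    also have "\<dots> = hsum (\<lambda>f. leg f P) (2 * ((g - 2 * \<delta>) mod (2 * \<delta>)) + 1)" by (rule less.IH) (use False \<delta> in linarith)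
    also have "(g - 2 * \<delta>) mod (2 * \<delta>) = g mod (2 * \<delta>)" using False by (simp add: le_mod_geq)
    finally show ?thesis .
  qed simp
qed

text \<open>After reduction to \<rho> the recursion has no shifted term, and for \<rho> \<ge> 1 the
  value is A(2\<rho> + 1) - q A(2\<rho> - 1), where A denotes the sums over monic polynomials. Above
  \<delta> both degrees reach that of \<open>P\<close>. At \<delta> only the top coefficient
  A(2\<delta> - 1) survives, known from \<open>C_pred_degree\<close>. Below \<delta> each A is a
  difference of values of \<open>C\<close>, which the functional equation carries to lengths near
  \<epsilon>.\<close>

lemma hsum_leg_cases:
  assumes P: "P \<in> prime_polys R" and d: "degree P = 2 * \<delta>" and \<rho>: "\<rho> = g mod (2 * \<delta>)"
  shows "\<rho> > \<delta> \<Longrightarrow> hsum (\<lambda>f. leg f P) (2 * g + 1) = 0"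
    and "\<rho> = \<delta> \<Longrightarrow> hsum (\<lambda>f. leg f P) (2 * g + 1) = int q ^ \<delta>"
    and "\<rho> < \<delta> \<Longrightarrow> \<epsilon> = 2 * (\<delta> - \<rho>) \<Longrightarrow> (int q - 1) * int q ^ \<delta> * hsum (\<lambda>f. leg f P) (2 * g + 1) =
      int q ^ (2 * \<rho>) * (int q ^ 2 * C P (\<epsilon> - 2) - int q * C P (\<epsilon> - 1) - int q * C P \<epsilon> + C P (\<epsilon> + 1))"
proof -
  have \<delta>: "\<delta> \<ge> 1" using prime_degree[OF P] d by linarith
  have ev: "even (degree P)" using d by simp
  have \<rho>l: "\<rho> < 2 * \<delta>" using \<delta> \<rho> by simp
  let ?A = "msum (\<lambda>f. leg f P)"
  have H: "hsum (\<lambda>f. leg f P) (2 * g + 1) = hsum (\<lambda>f. leg f P) (2 * \<rho> + 1)"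
    unfolding \<rho> by (rule hsum_leg_mod[OF P d])
  have H0: "hsum (\<lambda>f. leg f P) (2 * \<rho> + 1) = ?A 1" if "\<rho> = 0"
    using hsum_small[OF cmult_leg[OF P], of 1] that by simp
  have H1: "hsum (\<lambda>f. leg f P) (2 * \<rho> + 1) = ?A (2 * \<rho> + 1) - int q * ?A (2 * \<rho> - 1)" if "\<rho> \<ge> 1"
  proof -
    have "hsum (\<lambda>f. leg f P) (2 * \<rho> + 1) = ?A (2 * \<rho> + 1) - int q * ?A (2 * \<rho> + 1 - 2) +
      (if 2 * degree P \<le> 2 * \<rho> + 1 then hsum (\<lambda>f. leg f P) (2 * \<rho> + 1 - 2 * degree P) else 0)"
      by (rule hsum_prime_recursion[OF P _ cmult_leg[OF P]])
         (use that leg_square[OF P] in \<open>auto simp: monic_iff\<close>)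
    moreover have "\<not> 2 * degree P \<le> 2 * \<rho> + 1" using \<rho>l d by linarith
    ultimately show ?thesis by simp
  qed
  have Cd: "C P (2 * \<delta>) = 0" using C_degree[OF P] d by simp
  have CS: "(int q - 1) * ?A j = C P (Suc j) - C P j" for j using C_Suc[OF P ev] by simp
  show "hsum (\<lambda>f. leg f P) (2 * g + 1) = 0" if "\<rho> > \<delta>"
  proof -
    have "?A (2 * \<rho> + 1) = 0" "?A (2 * \<rho> - 1) = 0"
      by (rule msum_leg_0[OF P]; use that d in linarith)+
    then show ?thesis using H H1 that by simp
  qed
  show "hsum (\<lambda>f. leg f P) (2 * g + 1) = int q ^ \<delta>" if "\<rho> = \<delta>"
  proof -
    have "?A (2 * \<rho> + 1) = 0" by (rule msum_leg_0[OF P]; use that d in linarith)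
    moreover have "?A (2 * \<delta> - 1) = - (int q ^ (\<delta> - 1))"
    proof -
      obtain m where m: "\<delta> = Suc m" using \<delta> by (cases \<delta>) auto
      have "(int q - 1) * ?A (2 * \<delta> - 1) = C P (Suc (2 * \<delta> - 1)) - C P (2 * \<delta> - 1)" by (rule CS)
      also have "Suc (2 * \<delta> - 1) = 2 * \<delta>" using \<delta> by simp
      finally have "(int q - 1) * ?A (2 * \<delta> - 1) = (int q - 1) * (- (int q ^ (\<delta> - 1)))"
        unfolding Cd C_pred_degree[OF P d] by (simp add: m algebra_simps)
      moreover have "int q - 1 \<noteq> 0" using order_ge_3 by simp
      ultimately show ?thesis by (metis mult_cancel_left)
    qed
    ultimately have "hsum (\<lambda>f. leg f P) (2 * g + 1) = int q * int q ^ (\<delta> - 1)" using H H1 that \<delta> by simp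
    then show ?thesis using \<delta> by (cases \<delta>) auto
  qed
  assume lt: "\<rho> < \<delta>" and e: "\<epsilon> = 2 * (\<delta> - \<rho>)"
  have fe: "int q ^ \<delta> * C P j = int q ^ j * C P (2 * \<delta> - j)" if "j \<le> 2 * \<delta>" for j
    using functional_equation[OF P d, of "2 * \<delta> - j"] that by simp
  have e1: "2 * \<delta> - Suc (Suc (2 * \<rho>)) = \<epsilon> - 2" "2 * \<delta> - Suc (2 * \<rho>) = \<epsilon> - 1" "2 * \<delta> - 2 * \<rho> = \<epsilon>"
    using e lt by simp_all
  have f1: "int q ^ \<delta> * C P (Suc (Suc (2 * \<rho>))) = int q ^ 2 * int q ^ (2 * \<rho>) * C P (\<epsilon> - 2)"
    using fe[of "Suc (Suc (2 * \<rho>))"] lt e1 by (simp add: power2_eq_square)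
  have f2: "int q ^ \<delta> * C P (Suc (2 * \<rho>)) = int q * int q ^ (2 * \<rho>) * C P (\<epsilon> - 1)"
    using fe[of "Suc (2 * \<rho>)"] lt e1 by simp
  show "(int q - 1) * int q ^ \<delta> * hsum (\<lambda>f. leg f P) (2 * g + 1) =
      int q ^ (2 * \<rho>) * (int q ^ 2 * C P (\<epsilon> - 2) - int q * C P (\<epsilon> - 1) - int q * C P \<epsilon> + C P (\<epsilon> + 1))"
  proof (cases "\<rho> = 0")
    \<comment> \<open>There is no term of degree 2\<rho> - 1 here. The formula still holds because
      its last two values of \<open>C\<close>, at lengths 2\<delta> and 2\<delta> + 1,
      vanish.\<close>
    case True
    have ed: "\<epsilon> = 2 * \<delta>" using True e by simp
    have "msum (\<lambda>f. leg f P) (2 * \<delta>) = 0" by (rule msum_leg_0[OF P]) (use d in linarith)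
    then have C1: "C P (\<epsilon> + 1) = 0" "C P \<epsilon> = 0" using CS[of "2 * \<delta>"] Cd ed by simp_all
    have "(int q - 1) * int q ^ \<delta> * hsum (\<lambda>f. leg f P) (2 * g + 1) = int q ^ \<delta> * ((int q - 1) * ?A 1)"
      using H H0 True by simp
    also have "\<dots> = int q ^ \<delta> * C P (Suc (Suc (2 * \<rho>))) - int q ^ \<delta> * C P (Suc (2 * \<rho>))"
      unfolding CS using True by (simp add: algebra_simps)
    finally show ?thesis unfolding f1 f2 C1 by (simp add: algebra_simps)
  next
    case False
    obtain k where k: "2 * \<rho> = Suc k" using False by (cases "2 * \<rho>") auto
    have f3: "int q ^ \<delta> * C P (2 * \<rho>) = int q ^ (2 * \<rho>) * C P \<epsilon>"
      using fe[of "2 * \<rho>"] lt e1 by simp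
    have "int q ^ \<delta> * C P k = int q ^ k * C P (2 * \<delta> - k)" using fe[of k] k lt by simp
    also have "2 * \<delta> - k = \<epsilon> + 1" using e1(3) k lt by linarith
    finally have f4: "int q * (int q ^ \<delta> * C P k) = int q ^ (2 * \<rho>) * C P (\<epsilon> + 1)" unfolding k by simp
    have h1: "hsum (\<lambda>f. leg f P) (2 * g + 1) = ?A (Suc (2 * \<rho>)) - int q * ?A k"
      using H H1 False k by simp
    have "(int q - 1) * int q ^ \<delta> * hsum (\<lambda>f. leg f P) (2 * g + 1) =
       int q ^ \<delta> * ((int q - 1) * ?A (Suc (2 * \<rho>))) - int q ^ \<delta> * int q * ((int q - 1) * ?A k)"
      unfolding h1 by (simp add: algebra_simps)
    also have "\<dots> = int q ^ \<delta> * C P (Suc (Suc (2 * \<rho>))) - int q ^ \<delta> * C P (Suc (2 * \<rho>)) -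
      int q * (int q ^ \<delta> * C P (2 * \<rho>)) + int q * (int q ^ \<delta> * C P k)"
      unfolding CS k by (simp add: algebra_simps)
    finally show ?thesis unfolding f1 f2 f3 f4 by (simp add: algebra_simps)
  qed
qed

end

section \<open>The Stepanov--Bombieri bound\<close>

lemma (in cring) binomial_expansion:
  assumes a: "a \<in> carrier R" and b: "b \<in> carrier R"
  shows "(a \<oplus> b) [^] n = (\<Oplus>k\<in>{..n}. add_pow R (n choose k) (a [^] k \<otimes> b [^] (n - k)))"
proof (induction n)
  case 0 then show ?case using a b by simp
next
  case (Suc n)
  let ?c = "\<lambda>n k. add_pow R (n choose k) (a [^] k \<otimes> b [^] (n - k))"
  have cl: "?c n k \<in> carrier R" for n k using a b by simp
  have step: "?c (Suc n) (Suc k) = ?c n k \<otimes> a \<oplus> ?c n (Suc k) \<otimes> b" if "k \<le> n" for k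
  proof -
    have 1: "?c n k \<otimes> a = add_pow R (n choose k) (a [^] Suc k \<otimes> b [^] (n - k))"
      using a b by (simp add: add_pow_ldistr add_pow_rdistr m_ac)
    have 2: "?c n (Suc k) \<otimes> b = add_pow R (n choose Suc k) (a [^] Suc k \<otimes> b [^] (n - k))"
    proof (cases "k = n")
      case True
      have z: "n choose Suc n = 0" by (rule binomial_eq_0) simp
      show ?thesis unfolding True z using a b by simp
    next
      case False
      then have "n - k = Suc (n - Suc k)" using that by simp
      then show ?thesis using a b by (simp add: add_pow_ldistr m_assoc)
    qed
    show ?thesis unfolding 1 2 using a b by (simp add: add.nat_pow_mult)
  qed
  have zero: "?c (Suc n) 0 = ?c n 0 \<otimes> b" using a b by (simp add: m_assoc)
  have z: "n choose Suc n = 0" by (rule binomial_eq_0) simp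
  have last: "?c n (Suc n) \<otimes> b = \<zero>" unfolding z using a b by simp
  have "(a \<oplus> b) [^] Suc n = (\<Oplus>k\<in>{..n}. ?c n k) \<otimes> a \<oplus> (\<Oplus>k\<in>{..n}. ?c n k) \<otimes> b"
    using Suc a b cl by (simp add: r_distr)
  also have "(\<Oplus>k\<in>{..n}. ?c n k) \<otimes> a = (\<Oplus>k\<in>{..n}. ?c n k \<otimes> a)"
    using cl a by (intro finsum_ldistr) auto
  also have "(\<Oplus>k\<in>{..n}. ?c n k) \<otimes> b = (\<Oplus>k\<in>{..n}. ?c n k \<otimes> b)"
    using cl b by (intro finsum_ldistr) auto
  also have "\<dots> = (\<Oplus>k\<in>{..Suc n}. ?c n k \<otimes> b)"
    using cl b last by (subst finsum_Suc) (auto simp del: binomial_Suc_Suc)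
  also have "\<dots> = (\<Oplus>k\<in>{..n}. ?c n (Suc k) \<otimes> b) \<oplus> ?c n 0 \<otimes> b"
    using cl b by (subst finsum_Suc2) auto
  also have "(\<Oplus>k\<in>{..n}. ?c n k \<otimes> a) \<oplus> ((\<Oplus>k\<in>{..n}. ?c n (Suc k) \<otimes> b) \<oplus> ?c n 0 \<otimes> b) =
      (\<Oplus>k\<in>{..n}. ?c n k \<otimes> a \<oplus> ?c n (Suc k) \<otimes> b) \<oplus> ?c n 0 \<otimes> b"
    using cl a b by (subst finsum_addf) (auto simp: a_assoc)
  also have "\<dots> = (\<Oplus>k\<in>{..n}. ?c (Suc n) (Suc k)) \<oplus> ?c (Suc n) 0"
    unfolding zero using cl a b step by (intro arg_cong2[of _ _ _ _ "(\<oplus>)"] finsum_cong' refl) auto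
  also have "\<dots> = (\<Oplus>k\<in>{..Suc n}. ?c (Suc n) k)"
    using cl by (subst finsum_Suc2) auto
  finally show ?case .
qed

lemma (in cring) frobenius_prime:
  assumes p: "Factorial_Ring.prime (p::nat)" and z: "add_pow R p \<one> = \<zero>"
    and a: "a \<in> carrier R" and b: "b \<in> carrier R"
  shows "(a \<oplus> b) [^] p = a [^] p \<oplus> b [^] p"
proof -
  obtain n where n: "p = Suc (Suc n)" using prime_ge_2_nat[OF p] by (metis Suc_1 Suc_le_D not0_implies_Suc Suc_le_mono old.nat.exhaust not_less_eq_eq One_nat_def)
  let ?c = "\<lambda>k. add_pow R (p choose k) (a [^] k \<otimes> b [^] (p - k))"
  have cl: "?c k \<in> carrier R" for k using a b by simp
  have mid: "?c (Suc k) = \<zero>" if "k \<le> n" for k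
  proof -
    have "p dvd (p choose Suc k)" using p that n by (intro dvd_choose_prime) auto
    then obtain j where j: "p choose Suc k = p * j" by auto
    let ?y = "a [^] Suc k \<otimes> b [^] (p - Suc k)"
    have y: "?y \<in> carrier R" using a b by simp
    have "add_pow R (p * j) ?y = add_pow R j (add_pow R p ?y)" using y by (simp add: add.nat_pow_pow mult.commute)
    also have "add_pow R p ?y = add_pow R p \<one> \<otimes> ?y" using y by (simp add: add_pow_ldistr)
    finally show ?thesis using j z y by simp
  qed
  have "(a \<oplus> b) [^] p = (\<Oplus>k\<in>{..p}. ?c k)" by (rule binomial_expansion[OF a b])
  also have "\<dots> = ?c p \<oplus> (\<Oplus>k\<in>{..Suc n}. ?c k)" unfolding n using cl[unfolded n] by (subst finsum_Suc) auto
  also have "(\<Oplus>k\<in>{..Suc n}. ?c k) = (\<Oplus>k\<in>{..n}. ?c (Suc k)) \<oplus> ?c 0" using cl by (subst finsum_Suc2) auto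
  also have "(\<Oplus>k\<in>{..n}. ?c (Suc k)) = (\<Oplus>k\<in>{..n}. \<zero>)" using mid by (intro finsum_cong') auto
  finally show ?thesis using a b by simp
qed

context odd_finite_field
begin

text \<open>The characteristic p is prime because there are no zero divisors. Any prime r dividing
  the order yields, by Sylow with exponent 1, an additive subgroup of order r; a nonzero element of
  it is killed by r, hence so is one, and p divides r.\<close>

lemma order_prime_power: "\<exists>p k. Factorial_Ring.prime (p::nat) \<and> order R = p ^ k \<and> add_pow R p \<one> = \<zero>"
proof -
  let ?Z = "\<lambda>n::nat. n > 0 \<and> add_pow R n \<one> = \<zero>"
  have mul: "add_pow R (a * b) \<one> = add_pow R a \<one> \<otimes> add_pow R b \<one>" for a b :: nat
    by (simp add: add_pow_ldistr add.nat_pow_pow mult.commute)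
  have "add_pow R (order R) \<one> = \<zero>"
    using add.pow_order_eq_1[of \<one>] fin by (simp add: order_def)
  then have ex: "?Z (order R)" using order_ge_3 by simp
  define p where "p = (LEAST n. ?Z n)"
  have Zp: "?Z p" unfolding p_def by (rule LeastI[of ?Z, OF ex])
  have min: "p \<le> n" if "?Z n" for n unfolding p_def using that by (rule Least_le)
  have pdvd: "p dvd n" if "add_pow R n \<one> = \<zero>" for n
  proof (rule ccontr)
    assume "\<not> p dvd n"
    then have m: "n mod p > 0" by (simp add: dvd_eq_mod_eq_0)
    have "add_pow R (n div p * p + n mod p) \<one> = add_pow R (n div p * p) \<one> \<oplus> add_pow R (n mod p) \<one>"
      by (rule add.nat_pow_mult[symmetric]) simp
    also have "add_pow R (n div p * p) \<one> = \<zero>" using Zp mul[of "n div p" p] by simp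
    finally have "add_pow R (n mod p) \<one> = \<zero>" using that by simp
    then have "p \<le> n mod p" using min m by simp
    moreover have "n mod p < p" using Zp by simp
    ultimately show False by simp
  qed
  have p1: "p \<noteq> 1" using Zp by auto
  have prime: "Factorial_Ring.prime p"
  proof (rule prime_natI)
    show "2 \<le> p" using p1 Zp by linarith
    fix n k assume "p dvd n * k"
    then obtain j where "n * k = p * j" by auto
    then have "add_pow R n \<one> = \<zero> \<or> add_pow R k \<one> = \<zero>"
      using mul[of n k] mul[of p j] Zp integral[of "add_pow R n \<one>" "add_pow R k \<one>"] by simp
    then show "p dvd n \<or> p dvd k" using pdvd by blast
  qed
  have only: "r = p" if r: "Factorial_Ring.prime r" "r dvd order R" for r
  proof -
    obtain m where m: "order R = r ^ 1 * m" using r by auto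
    obtain H where H: "subgroup H (add_monoid R)" "card H = r ^ 1"
      using sylow_thm[OF r(1) add.group_axioms, of 1 m] m fin by (auto simp: order_def)
    have Hc: "H \<subseteq> carrier R" using subgroup.subset[OF H(1)] by simp
    interpret H: Group.group "(add_monoid R)\<lparr>carrier := H\<rparr>"
      by (rule add.subgroup_imp_group[OF H(1)])
    have finH: "finite H" using finite_subset[OF Hc fin] .
    have "H \<noteq> {\<zero>}" using H(2) prime_gt_1_nat[OF r(1)] by auto
    then obtain x where x: "x \<in> H" "x \<noteq> \<zero>" using subgroup.one_closed[OF H(1)] by auto
    have "x [^]\<^bsub>(add_monoid R)\<lparr>carrier := H\<rparr>\<^esub> order ((add_monoid R)\<lparr>carrier := H\<rparr>) = \<zero>"
      using H.pow_order_eq_1[of x] finH x by simp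
    then have "add_pow R r x = \<zero>"
      using H(2) add.nat_pow_consistent[where x=x and n=r and H=H] by (simp add: order_def add_pow_def)
    moreover have "add_pow R r x = add_pow R r \<one> \<otimes> x" using x Hc by (simp add: add_pow_ldistr subset_iff)
    ultimately have "add_pow R r \<one> = \<zero>" using x Hc integral[of "add_pow R r \<one>" x] by auto
    then have "p dvd r" by (rule pdvd)
    then show ?thesis using r(1) p1 by (metis prime_nat_iff)
  qed
  obtain k x where kx: "order R = p ^ k * x" "\<not> p dvd x"
    using prime order_ge_3 by (metis multiplicity_decompose' not_prime_unit not_numeral_le_zero)
  have "x = 1"
  proof (rule ccontr)
    assume "x \<noteq> 1"
    then obtain r where r: "Factorial_Ring.prime r" "r dvd x" using prime_factor_nat by blast
    then have "r = p" using only kx(1) by simp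
    then show False using kx(2) r(2) by simp
  qed
  then show ?thesis using prime Zp kx by auto
qed

end

context poly_over_odd_field
begin

text \<open>Characteristic p passes from the constants to polynomials, and a power with exponent q^n
  is an iterated p-th power.\<close>

lemma frobenius_q:
  assumes "a \<in> carrier S" "b \<in> carrier S"
  shows "(a \<boxplus> b) \<up> (q ^ n) = a \<up> (q ^ n) \<boxplus> b \<up> (q ^ n)"
proof -
  obtain p k where pk: "Factorial_Ring.prime (p::nat)" "q = p ^ k" "add_pow R p \<one> = \<zero>"
    using order_prime_power by blast
  have "coeff (add_pow S j \<one>\<^bsub>S\<^esub>) i = add_pow R j (coeff \<one>\<^bsub>S\<^esub> i)" for j :: nat and i
    by (induction j) (simp_all add: coeff_add)
  then have "coeff (add_pow S p \<one>\<^bsub>S\<^esub>) i = coeff [] i" for i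
    using pk(3) by (cases "i = 0") (simp_all add: one_S)
  then have "add_pow S p \<one>\<^bsub>S\<^esub> = []" by (intro coeff_eqI) simp_all
  then have fr: "(x \<boxplus> y) \<up> p = x \<up> p \<boxplus> y \<up> p" if "x \<in> carrier S" "y \<in> carrier S" for x y
    using S.frobenius_prime[OF pk(1)] that by simp
  have "(a \<boxplus> b) \<up> (p ^ j) = a \<up> (p ^ j) \<boxplus> b \<up> (p ^ j)" for j
  proof (induction j)
    case 0 then show ?case using assms by simp
  next
    case (Suc j)
    have "(a \<boxplus> b) \<up> (p ^ Suc j) = ((a \<boxplus> b) \<up> (p ^ j)) \<up> p"
      using assms by (simp add: S.nat_pow_pow mult.commute)
    also have "\<dots> = a \<up> (p ^ Suc j) \<boxplus> b \<up> (p ^ Suc j)"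
      unfolding Suc using assms fr by (simp add: S.nat_pow_pow mult.commute)
    finally show ?case .
  qed
  then show ?thesis unfolding pk(2) power_mult[symmetric] by blast
qed

lemma frobenius_q_diff:
  assumes "a \<in> carrier S" "b \<in> carrier S"
  shows "(a \<boxminus> b) \<up> (q ^ n) = a \<up> (q ^ n) \<boxminus> b \<up> (q ^ n)"
proof -
  let ?s = "q ^ n"
  have c: "(a \<boxminus> b) \<up> ?s \<in> carrier S" "a \<up> ?s \<in> carrier S" "b \<up> ?s \<in> carrier S" using assms by auto
  have "a = (a \<boxminus> b) \<boxplus> b" using assms by (simp add: a_minus_def S.a_assoc S.l_neg)
  then have "a \<up> ?s = (a \<boxminus> b) \<up> ?s \<boxplus> b \<up> ?s" using frobenius_q[of "a \<boxminus> b" b n] assms by simp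
  then show ?thesis using c by (simp add: a_minus_def S.a_assoc S.r_neg)
qed

text \<open>A finite sum by recursion on the number of terms: degree bounds, congruences and
  Frobenius pass through it by induction, with conditions only on the indices below
  \<open>n\<close>, so coefficient families may be arbitrary beyond.\<close>

fun fs :: "(nat \<Rightarrow> 'a list) \<Rightarrow> nat \<Rightarrow> 'a list" where
  "fs c 0 = []"
| "fs c (Suc n) = fs c n \<boxplus> c n"

lemma fs_closed: "(\<And>i. i < n \<Longrightarrow> c i \<in> carrier S) \<Longrightarrow> fs c n \<in> carrier S"
  by (induction n) auto

lemma fs_V: "(\<And>i. i < n \<Longrightarrow> c i \<in> V N) \<Longrightarrow> fs c n \<in> V N"
  by (induction n) (auto intro: V_add)

lemma fs_cong: "(\<And>i. i < n \<Longrightarrow> c i = c' i) \<Longrightarrow> fs c n = fs c' n"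
  by (induction n) auto

lemma fs_diff:
  assumes "\<And>i. i < n \<Longrightarrow> c i \<in> carrier S" "\<And>i. i < n \<Longrightarrow> c' i \<in> carrier S"
  shows "fs (\<lambda>i. c i \<boxminus> c' i) n = fs c n \<boxminus> fs c' n"
  using assms
proof (induction n)
  case (Suc n)
  have cl: "fs c n \<in> carrier S" "fs c' n \<in> carrier S" "c n \<in> carrier S" "c' n \<in> carrier S"
    using Suc.prems by (auto intro!: fs_closed)
  have "fs (\<lambda>i. c i \<boxminus> c' i) (Suc n) = (fs c n \<boxminus> fs c' n) \<boxplus> (c n \<boxminus> c' n)" using Suc by simp
  also have "\<dots> = (fs c n \<boxplus> c n) \<boxminus> (fs c' n \<boxplus> c' n)"
    using cl by (simp add: a_minus_def S.minus_add S.a_ac)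
  finally show ?case by simp
qed simp

lemma fs_add:
  assumes "\<And>i. i < n \<Longrightarrow> c i \<in> carrier S" "\<And>i. i < n \<Longrightarrow> c' i \<in> carrier S"
  shows "fs (\<lambda>i. c i \<boxplus> c' i) n = fs c n \<boxplus> fs c' n"
  using assms
proof (induction n)
  case (Suc n)
  have cl: "fs c n \<in> carrier S" "fs c' n \<in> carrier S" "c n \<in> carrier S" "c' n \<in> carrier S"
    using Suc.prems by (auto intro!: fs_closed)
  then show ?case using Suc by (simp add: S.a_ac)
qed simp

lemma fs_mult:
  assumes "\<And>i. i < n \<Longrightarrow> c i \<in> carrier S" "b \<in> carrier S"
  shows "fs (\<lambda>i. b \<boxtimes> c i) n = b \<boxtimes> fs c n"
  using assms
proof (induction n)
  case (Suc n)
  have cl: "fs c n \<in> carrier S" "c n \<in> carrier S" using Suc.prems by (auto intro!: fs_closed)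
  then show ?case using Suc by (simp add: S.r_distr)
qed simp

lemma fs_frobenius:
  assumes "\<And>i. i < n \<Longrightarrow> c i \<in> carrier S"
  shows "(fs c n) \<up> (q ^ k) = fs (\<lambda>i. c i \<up> (q ^ k)) n"
  using assms
proof (induction n)
  case 0
  have "q ^ k \<noteq> 0" using order_ge_3 by simp
  then show ?case using S.nat_pow_zero[of "q ^ k"] by simp
next
  case (Suc n)
  have cl: "fs c n \<in> carrier S" "c n \<in> carrier S" using Suc.prems by (auto intro!: fs_closed)
  then show ?case using Suc by (simp add: frobenius_q)
qed

lemma fs_\<pi>_cong:
  assumes P: "P \<in> prime_polys R"
    and "\<And>i. i < n \<Longrightarrow> c i \<in> carrier S" "\<And>i. i < n \<Longrightarrow> c' i \<in> carrier S" "\<And>i. i < n \<Longrightarrow> \<pi> P (c i) = \<pi> P (c' i)"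
  shows "\<pi> P (fs c n) = \<pi> P (fs c' n)"
  using assms(2-4)
proof (induction n)
  case (Suc n)
  interpret h: ring_hom_ring S "F P" "\<pi> P" by (rule \<pi>_hom[OF P])
  have cl: "fs c n \<in> carrier S" "fs c' n \<in> carrier S" "c n \<in> carrier S" "c' n \<in> carrier S"
    using Suc.prems by (auto intro!: fs_closed)
  then show ?case using Suc by simp
qed simp

lemma fs_shift:
  assumes "\<And>i. i \<le> n \<Longrightarrow> c i \<in> carrier S"
  shows "fs c (Suc n) = c 0 \<boxplus> fs (\<lambda>i. c (Suc i)) n"
  using assms
proof (induction n)
  case (Suc n)
  have cl: "c 0 \<in> carrier S" "c (Suc n) \<in> carrier S" "fs (\<lambda>i. c (Suc i)) n \<in> carrier S"
    using Suc.prems by (auto intro!: fs_closed)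
  have "fs c (Suc (Suc n)) = fs c (Suc n) \<boxplus> c (Suc n)" by simp
  also have "fs c (Suc n) = c 0 \<boxplus> fs (\<lambda>i. c (Suc i)) n" using Suc by simp
  finally show ?case using cl by (simp add: S.a_assoc)
qed simp

text \<open>Cancel y^i0 from the relation; every remaining term except \<open>c i0\<close> still has
  a factor \<open>y\<close>.\<close>

lemma fs_lowest_term:
  assumes y: "y \<in> carrier S" "y \<noteq> []" and c: "\<And>i. i < n \<Longrightarrow> c i \<in> carrier S"
    and i0: "i0 < n" "\<And>i. i < i0 \<Longrightarrow> c i = []" and z: "fs (\<lambda>i. c i \<boxtimes> y \<up> i) n = []"
  shows "y pdivides c i0"
  using c i0 z
proof (induction i0 arbitrary: c n)
  case 0
  then obtain n' where n: "n = Suc n'" by (cases n) auto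
  have cl: "c i \<in> carrier S" if "i \<le> n'" for i using 0(1) that n by simp
  let ?r = "fs (\<lambda>i. c (Suc i) \<boxtimes> y \<up> i) n'"
  have rc: "?r \<in> carrier S" using cl y n 0(1) by (intro fs_closed) simp
  have "fs (\<lambda>i. c i \<boxtimes> y \<up> i) n = c 0 \<boxplus> fs (\<lambda>i. c (Suc i) \<boxtimes> y \<up> Suc i) n'"
    unfolding n using fs_shift[of n' "\<lambda>i. c i \<boxtimes> y \<up> i"] cl y by simp
  also have "fs (\<lambda>i. c (Suc i) \<boxtimes> y \<up> Suc i) n' = y \<boxtimes> ?r"
  proof -
    have "fs (\<lambda>i. c (Suc i) \<boxtimes> y \<up> Suc i) n' = fs (\<lambda>i. y \<boxtimes> (c (Suc i) \<boxtimes> y \<up> i)) n'"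
      using 0(1) y n by (intro fs_cong) (simp add: S.m_ac)
    also have "\<dots> = y \<boxtimes> ?r" using 0(1) y n by (intro fs_mult) auto
    finally show ?thesis .
  qed
  finally have "c 0 \<boxplus> y \<boxtimes> ?r = []" using 0 by simp
  then have "c 0 = \<ominus>\<^bsub>S\<^esub> (y \<boxtimes> ?r)" using S.minus_equality[of "c 0" "y \<boxtimes> ?r"] cl[of 0] y rc by simp
  also have "\<dots> = y \<boxtimes> (\<ominus>\<^bsub>S\<^esub> ?r)" using y rc by (simp add: S.r_minus)
  finally show ?case using rc by (intro pdividesI[of "\<ominus>\<^bsub>S\<^esub> ?r"]) auto
next
  case (Suc i0)
  then obtain n' where n: "n = Suc n'" by (cases n) auto
  have cl: "c i \<in> carrier S" if "i \<le> n'" for i using Suc.prems(1) that n by simp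
  let ?r = "fs (\<lambda>i. c (Suc i) \<boxtimes> y \<up> i) n'"
  have rc: "?r \<in> carrier S" using cl y n Suc.prems(1) by (intro fs_closed) simp
  have "fs (\<lambda>i. c i \<boxtimes> y \<up> i) n = c 0 \<boxplus> fs (\<lambda>i. c (Suc i) \<boxtimes> y \<up> Suc i) n'"
    unfolding n using fs_shift[of n' "\<lambda>i. c i \<boxtimes> y \<up> i"] cl y by simp
  also have "fs (\<lambda>i. c (Suc i) \<boxtimes> y \<up> Suc i) n' = y \<boxtimes> ?r"
  proof -
    have "fs (\<lambda>i. c (Suc i) \<boxtimes> y \<up> Suc i) n' = fs (\<lambda>i. y \<boxtimes> (c (Suc i) \<boxtimes> y \<up> i)) n'"
      using Suc.prems(1) y n by (intro fs_cong) (simp add: S.m_ac)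
    also have "\<dots> = y \<boxtimes> ?r" using Suc.prems(1) y n by (intro fs_mult) auto
    finally show ?thesis .
  qed
  finally have "y \<boxtimes> ?r = []" using Suc.prems(3)[of 0] Suc.prems(4) y rc by simp
  then have "?r = []" using y rc by simp
  then show ?case using Suc.IH[of n' "\<lambda>i. c (Suc i)"] Suc.prems n by simp
qed

lemma var_carrier [simp]: "X \<in> carrier S"
  by (rule var_closed(1)[OF carrier_is_subring])

lemma var_prime: "X \<in> prime_polys R"
  using degree_one_imp_pirreducible[OF carrier_is_subfield var_carrier]
  by (simp add: prime_iff monic_iff) (simp add: var_def)

lemma degree_var: "degree X = 1" by (simp add: var_def)

lemma var_nonnil [simp]: "X \<noteq> []" by (simp add: var_def)

lemma pow_V:
  assumes "y \<in> V a" "a \<ge> 1" shows "y \<up> n \<in> V (n * (a - 1) + 1)"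
proof (cases "y = []")
  case True
  have "[] \<up> n = (if n = 0 then \<one>\<^bsub>S\<^esub> else [])" using S.nat_pow_zero[of n] by (cases n) auto
  then show ?thesis using True by (simp add: V_def)
next
  case False
  have yc: "y \<in> carrier S" "degree y \<le> a - 1" using assms by (auto simp: V_def)
  have "degree (y \<up> n) \<le> n * (a - 1)" unfolding degree_pow[OF yc(1)] by (rule mult_le_mono2[OF yc(2)])
  then have "length (y \<up> n) \<le> n * (a - 1) + 1" by linarith
  then show ?thesis using yc by (simp add: V_def)
qed

lemma var_pow_V: "X \<up> i \<in> V (i + 1)"
proof -
  have "X \<in> V 2" by (simp add: V_def) (simp add: var_def)
  from pow_V[OF this, of i] show ?thesis by simp
qed

lemma V_monoD: "y \<in> V a \<Longrightarrow> a \<le> b \<Longrightarrow> y \<in> V b"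
  using V_mono by blast

lemma fs_extend:
  assumes "n \<le> N" "\<And>i. i < n \<Longrightarrow> c i \<in> carrier S" "\<And>i. n \<le> i \<Longrightarrow> i < N \<Longrightarrow> c i = []"
  shows "fs c N = fs c n"
  using assms(1,3)
proof (induction N)
  case (Suc N)
  show ?case
  proof (cases "n = Suc N")
    case False
    then have le: "n \<le> N" using Suc.prems by simp
    have "fs c N = fs c n" using Suc.IH[OF le] Suc.prems by simp
    moreover have "fs c n \<in> carrier S" using assms(2) by (rule fs_closed)
    ultimately show ?thesis using Suc.prems le by simp
  qed simp
qed simp

lemma sub_add_cancel:
  assumes "a \<in> carrier S" "b \<in> carrier S" "c \<in> carrier S"
  shows "(a \<boxminus> (b \<boxplus> c)) \<boxplus> c = a \<boxminus> b"
  using assms by (simp add: a_minus_def S.minus_add S.a_assoc S.l_neg)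

lemma diff_squares:
  assumes "a \<in> carrier S" "b \<in> carrier S"
  shows "(a \<boxplus> b) \<boxtimes> (a \<boxminus> b) = a \<boxtimes> a \<boxminus> b \<boxtimes> b"
  using assms by (simp add: a_minus_def S.l_distr S.r_distr S.r_minus S.a_assoc S.m_comm[of b a] S.minus_add S.r_neg1 S.r_neg2)

lemma v_le_degree:
  assumes "P \<in> prime_polys R" "f \<in> carrier S" "f \<noteq> []" shows "v P f * degree P \<le> degree f"
proof -
  have "degree (P \<up> v P f) \<le> degree f"
    using pdivides_degree_le[of "P \<up> v P f" f] pow_pdivides_iff[OF assms, of "v P f"] assms prime_carrier[OF assms(1)] by simp
  then show ?thesis using degree_pow[OF prime_carrier[OF assms(1)], of "v P f"] by simp
qed

section \<open>The auxiliary polynomial for a square-free polynomial of degree m\<close>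

context
  fixes f :: "'a list" and m \<delta> s \<alpha> :: nat and \<sigma> :: int
  assumes f: "f \<in> hyperelliptic R m" and m: "m \<ge> 1" and s_def: "s = q ^ \<delta>" and s_ge: "s \<ge> 2 * m + 1"
    and \<alpha>_def: "\<alpha> = (s + 1) div 2" and \<sigma>: "\<sigma> = 1 \<or> \<sigma> = -1"
begin

lemma s_\<alpha>: "s = 2 * \<alpha> - 1" "\<alpha> \<ge> m + 1"
proof -
  have "odd s" using odd_order s_def by simp
  then have "2 * \<alpha> = s + 1" unfolding \<alpha>_def by simp
  then show "s = 2 * \<alpha> - 1" "\<alpha> \<ge> m + 1" using s_ge by linarith+
qed

lemma fc: "f \<in> carrier S" "f \<noteq> []" "f \<in> monic_polys R" "degree f = m" "f \<in> V (m + 1)"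
  using f by (auto simp: hyper_iff monic_iff V_def)

text \<open>The auxiliary polynomial of Stepanov's method, in Bombieri's form. Modulo a prime \<open>P\<close> of degree \<open>2 * \<delta>\<close> one has \<open>X\<^bsup>s\<^sup>2\<^esup> = X\<close>, so the
  \<open>s\<close>-th power of \<open>aux a b\<close> reduces to \<open>cond a b\<close>, where \<open>f\<^bsup>(s\<^sup>2-1)/2\<^esup> = \<sigma>\<close> has been used. Since \<open>cond\<close> is additive
  in the coefficients, counting gives a nonzero choice with \<open>cond a b = 0\<close>.\<close>

definition "aux a b = fs (\<lambda>i. a i \<boxtimes> X \<up> (s * i)) (\<alpha> + 2 * m) \<boxplus>
    f \<up> \<alpha> \<boxtimes> fs (\<lambda>i. b i \<boxtimes> X \<up> (s * i)) (\<alpha> + m)"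

definition "sgnS = (if \<sigma> = 1 then \<one>\<^bsub>S\<^esub> else \<ominus>\<^bsub>S\<^esub> \<one>\<^bsub>S\<^esub>)"

definition "cond a b = fs (\<lambda>i. a i \<up> s \<boxtimes> X \<up> i) (\<alpha> + 2 * m) \<boxplus>
    sgnS \<boxtimes> (f \<up> \<alpha> \<boxtimes> fs (\<lambda>i. b i \<up> s \<boxtimes> X \<up> i) (\<alpha> + m))"

lemma sgnS_closed: "sgnS \<in> carrier S" by (simp add: sgnS_def)

lemma aux_vanishing:
  assumes P: "P \<in> prime_polys R" "degree P = 2 * \<delta>" "leg f P = \<sigma>"
    and ab: "\<And>i. i < \<alpha> + 2 * m \<Longrightarrow> a i \<in> carrier S" "\<And>i. i < \<alpha> + m \<Longrightarrow> b i \<in> carrier S"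
    and z: "cond a b = []"
  shows "P pdivides aux a b"
proof -
  interpret F: odd_finite_field "F P" by (rule F_field[OF P(1)])
  interpret h: ring_hom_ring S "F P" "\<pi> P" by (rule \<pi>_hom[OF P(1)])
  have Q: "order (F P) = s * s" unfolding order_F[OF P(1)] P(2) s_def mult_2 power_add ..
  let ?G1 = "fs (\<lambda>i. a i \<boxtimes> X \<up> (s * i)) (\<alpha> + 2 * m)" and ?G2 = "fs (\<lambda>i. b i \<boxtimes> X \<up> (s * i)) (\<alpha> + m)"
  have G: "?G1 \<in> carrier S" "?G2 \<in> carrier S" using ab by (auto intro!: fs_closed)
  have xp: "\<pi> P (X \<up> (s * i * s)) = \<pi> P (X \<up> i)" for i
  proof -
    have "\<pi> P X [^]\<^bsub>F P\<^esub> (s * s) = \<pi> P X" using F.pow_order[OF \<pi>_closed[OF P(1) var_carrier]] Q by simp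
    then have "(\<pi> P X [^]\<^bsub>F P\<^esub> (s * s)) [^]\<^bsub>F P\<^esub> i = \<pi> P X [^]\<^bsub>F P\<^esub> i" by simp
    then show ?thesis using \<pi>_closed[OF P(1) var_carrier]
      by (simp add: h.hom_nat_pow F.nat_pow_pow mult.commute mult.left_commute)
  qed
  have fp: "\<pi> P (f \<up> (\<alpha> * s)) = \<pi> P (sgnS \<boxtimes> f \<up> \<alpha>)"
  proof -
    \<comment> \<open>From s = 2\<alpha> - 1 one gets \<alpha> s = (s^2 - 1)/2 + \<alpha>, so
      Euler's criterion leaves the sign times f^\<alpha>.\<close>
    have "\<alpha> * s = (order (F P) - 1) div 2 + \<alpha>"
    proof -
      obtain k where k: "\<alpha> = Suc k" using s_\<alpha>(2) by (cases \<alpha>) auto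
      have "s = 2 * k + 1" using s_\<alpha>(1) k by simp
      then show ?thesis unfolding Q k by simp
    qed
    then have "\<pi> P f [^]\<^bsub>F P\<^esub> (\<alpha> * s) = \<pi> P f [^]\<^bsub>F P\<^esub> ((order (F P) - 1) div 2) \<otimes>\<^bsub>F P\<^esub> \<pi> P f [^]\<^bsub>F P\<^esub> \<alpha>"
      using \<pi>_closed[OF P(1) fc(1)] by (simp add: F.nat_pow_mult)
    also have "\<pi> P f [^]\<^bsub>F P\<^esub> ((order (F P) - 1) div 2) = \<pi> P sgnS"
    proof -
      have l: "F.qc (\<pi> P f) = \<sigma>" using leg_qc[OF P(1) fc(1)] P(3) by simp
      then have "\<pi> P f \<noteq> \<zero>\<^bsub>F P\<^esub>" using \<sigma> F.qc_zero_iff[of "\<pi> P f"] by auto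
      then show ?thesis
        using F.pow_half[OF \<pi>_closed[OF P(1) fc(1)]] l h.hom_one h.hom_a_inv[OF S.one_closed] by (simp add: sgnS_def)
    qed
    finally show ?thesis using fc(1) sgnS_closed by (simp add: h.hom_nat_pow)
  qed
  have "(aux a b) \<up> s = ?G1 \<up> s \<boxplus> (f \<up> \<alpha> \<boxtimes> ?G2) \<up> s"
    unfolding aux_def using frobenius_q[of ?G1 "f \<up> \<alpha> \<boxtimes> ?G2" \<delta>] G fc(1) unfolding s_def[symmetric] by simp
  also have "(f \<up> \<alpha> \<boxtimes> ?G2) \<up> s = f \<up> (\<alpha> * s) \<boxtimes> ?G2 \<up> s"
    using G fc(1) by (simp add: S.nat_pow_distrib S.nat_pow_pow)
  also have "?G1 \<up> s = fs (\<lambda>i. (a i \<boxtimes> X \<up> (s * i)) \<up> s) (\<alpha> + 2 * m)"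
    using fs_frobenius[of "\<alpha> + 2 * m" "\<lambda>i. a i \<boxtimes> X \<up> (s * i)" \<delta>] ab unfolding s_def[symmetric] by simp
  also have "?G2 \<up> s = fs (\<lambda>i. (b i \<boxtimes> X \<up> (s * i)) \<up> s) (\<alpha> + m)"
    using fs_frobenius[of "\<alpha> + m" "\<lambda>i. b i \<boxtimes> X \<up> (s * i)" \<delta>] ab unfolding s_def[symmetric] by simp
  finally have Gs: "(aux a b) \<up> s = fs (\<lambda>i. (a i \<boxtimes> X \<up> (s * i)) \<up> s) (\<alpha> + 2 * m) \<boxplus>
      f \<up> (\<alpha> * s) \<boxtimes> fs (\<lambda>i. (b i \<boxtimes> X \<up> (s * i)) \<up> s) (\<alpha> + m)" .
  have c1: "fs (\<lambda>i. (a i \<boxtimes> X \<up> (s * i)) \<up> s) (\<alpha> + 2 * m) \<in> carrier S" "fs (\<lambda>i. (b i \<boxtimes> X \<up> (s * i)) \<up> s) (\<alpha> + m) \<in> carrier S"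
    "fs (\<lambda>i. a i \<up> s \<boxtimes> X \<up> i) (\<alpha> + 2 * m) \<in> carrier S" "fs (\<lambda>i. b i \<up> s \<boxtimes> X \<up> i) (\<alpha> + m) \<in> carrier S"
    using ab by (auto intro!: fs_closed)
  have trm: "\<pi> P ((y \<boxtimes> X \<up> (s * i)) \<up> s) = \<pi> P (y \<up> s \<boxtimes> X \<up> i)" if "y \<in> carrier S" for y i
    using that xp[of i] by (simp add: S.nat_pow_distrib S.nat_pow_pow)
  have e1: "\<pi> P (fs (\<lambda>i. (a i \<boxtimes> X \<up> (s * i)) \<up> s) (\<alpha> + 2 * m)) = \<pi> P (fs (\<lambda>i. a i \<up> s \<boxtimes> X \<up> i) (\<alpha> + 2 * m))"
    by (rule fs_\<pi>_cong[OF P(1)]) (use ab trm in auto)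
  have e2: "\<pi> P (fs (\<lambda>i. (b i \<boxtimes> X \<up> (s * i)) \<up> s) (\<alpha> + m)) = \<pi> P (fs (\<lambda>i. b i \<up> s \<boxtimes> X \<up> i) (\<alpha> + m))"
    by (rule fs_\<pi>_cong[OF P(1)]) (use ab trm in auto)
  have "\<pi> P ((aux a b) \<up> s) = \<pi> P (cond a b)"
    unfolding Gs cond_def using c1 fc(1) sgnS_closed e1 e2 fp by (simp add: S.m_assoc[symmetric])
  also have "\<dots> = \<zero>\<^bsub>F P\<^esub>" using z h.hom_zero by simp
  finally have "P pdivides (aux a b) \<up> s"
    using \<pi>_zero_iff[OF P(1), of "(aux a b) \<up> s"] G fc(1) by (simp add: aux_def)
  then show ?thesis using prime_pdivides_pow[OF P(1)] G fc(1) by (simp add: aux_def)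
qed

text \<open>The second sum is shorter by m terms to make room for f^\<alpha>, whose degree \<alpha>
  m is at most m s.\<close>

lemma aux_V:
  assumes a: "\<And>i. i < \<alpha> + 2 * m \<Longrightarrow> a i \<in> V \<alpha>" and b: "\<And>i. i < \<alpha> + m \<Longrightarrow> b i \<in> V (\<alpha> - m)"
  shows "aux a b \<in> V (\<alpha> + (\<alpha> + 2 * m - 1) * s)"
proof -
  obtain k where k: "\<alpha> = m + 1 + k" using s_\<alpha>(2) le_Suc_ex by (metis add.assoc)
  have s: "s = 2 * m + 2 * k + 1" using s_\<alpha>(1) k by simp
  have 1: "fs (\<lambda>i. a i \<boxtimes> X \<up> (s * i)) (\<alpha> + 2 * m) \<in> V (\<alpha> + (\<alpha> + 2 * m - 1) * s)"
  proof (rule fs_V)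
    fix i assume i: "i < \<alpha> + 2 * m"
    then have "s * i \<le> s * (\<alpha> + 2 * m - 1)" by (intro mult_le_mono2) linarith
    then have "\<alpha> + (s * i + 1) - 1 \<le> \<alpha> + (\<alpha> + 2 * m - 1) * s" by (simp add: mult.commute)
    then show "a i \<boxtimes> X \<up> (s * i) \<in> V (\<alpha> + (\<alpha> + 2 * m - 1) * s)"
      by (rule V_monoD[OF mult_V[OF a[OF i] var_pow_V]])
  qed
  have 2: "fs (\<lambda>i. b i \<boxtimes> X \<up> (s * i)) (\<alpha> + m) \<in> V (\<alpha> - m + (\<alpha> + m - 1) * s)"
  proof (rule fs_V)
    fix i assume i: "i < \<alpha> + m"
    then have "s * i \<le> s * (\<alpha> + m - 1)" by (intro mult_le_mono2) linarith
    then have "\<alpha> - m + (s * i + 1) - 1 \<le> \<alpha> - m + (\<alpha> + m - 1) * s" by (simp add: mult.commute)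
    then show "b i \<boxtimes> X \<up> (s * i) \<in> V (\<alpha> - m + (\<alpha> + m - 1) * s)"
      by (rule V_monoD[OF mult_V[OF b[OF i] var_pow_V]])
  qed
  have "f \<up> \<alpha> \<in> V (\<alpha> * m + 1)" using pow_V[OF fc(5), of \<alpha>] by simp
  from mult_V[OF this 2] have "f \<up> \<alpha> \<boxtimes> fs (\<lambda>i. b i \<boxtimes> X \<up> (s * i)) (\<alpha> + m) \<in> V (\<alpha> * m + 1 + (\<alpha> - m + (\<alpha> + m - 1) * s) - 1)" .
  moreover have "\<alpha> * m + 1 + (\<alpha> - m + (\<alpha> + m - 1) * s) - 1 \<le> \<alpha> + (\<alpha> + 2 * m - 1) * s"
  proof -
    have "\<alpha> + 2 * m - 1 = (\<alpha> + m - 1) + m" using k by simp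
    then have "(\<alpha> + 2 * m - 1) * s = (\<alpha> + m - 1) * s + m * s" by (simp add: distrib_right)
    moreover have "\<alpha> * m \<le> m * s" unfolding k s by (simp add: algebra_simps)
    ultimately show ?thesis by linarith
  qed
  ultimately show ?thesis unfolding aux_def by (intro V_add 1) (rule V_monoD)
qed

text \<open>At the lowest index where the coefficients A, B do not both vanish, X^s divides A +
  f^\<alpha> B. Multiply by A - f^\<alpha> B: since 2\<alpha> = s + 1, X^s divides A^2 - f^s f B^2.
  By Frobenius f^s is congruent to the constant r^s with r = f(0), so X^s divides A^2 - r^s f B^2,
  which is too short not to vanish. If r is nonzero, the valuation at a prime factor of the
  square-free \<open>f\<close> is even on one side and odd on the other. If r = 0, then A = 0, and X
  divides \<open>f\<close> exactly once, so f^\<alpha> B has too small a valuation at X.\<close>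

lemma aux_nonzero:
  assumes a: "\<And>i. i < \<alpha> + 2 * m \<Longrightarrow> a i \<in> V \<alpha>" and b: "\<And>i. i < \<alpha> + m \<Longrightarrow> b i \<in> V (\<alpha> - m)"
    and nz: "(\<exists>i<\<alpha> + 2 * m. a i \<noteq> []) \<or> (\<exists>i<\<alpha> + m. b i \<noteq> [])"
  shows "aux a b \<noteq> []"
proof
  assume G0: "aux a b = []"
  \<comment> \<open>Extended by zero, both coefficient families share one index range, so that
    \<open>fs_lowest_term\<close> applies to their combination.\<close>
  define b' where "b' i = (if i < \<alpha> + m then b i else [])" for i
  have ac: "a i \<in> carrier S" if "i < \<alpha> + 2 * m" for i using V_carrier[OF a[OF that]] .
  have b'V: "b' i \<in> V (\<alpha> - m)" for i using b by (simp add: b'_def)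
  have b'c: "b' i \<in> carrier S" for i using V_carrier[OF b'V] .
  let ?y = "X \<up> s"
  have yc: "?y \<in> carrier S" "?y \<noteq> []" using pow_eq_nil_iff by auto
  have "fs (\<lambda>i. (a i \<boxplus> f \<up> \<alpha> \<boxtimes> b' i) \<boxtimes> ?y \<up> i) (\<alpha> + 2 * m) =
    fs (\<lambda>i. a i \<boxtimes> X \<up> (s * i) \<boxplus> f \<up> \<alpha> \<boxtimes> (b' i \<boxtimes> X \<up> (s * i))) (\<alpha> + 2 * m)"
    using ac b'c fc(1) by (intro fs_cong) (simp add: S.l_distr S.m_assoc S.nat_pow_pow)
  also have "\<dots> = fs (\<lambda>i. a i \<boxtimes> X \<up> (s * i)) (\<alpha> + 2 * m) \<boxplus> fs (\<lambda>i. f \<up> \<alpha> \<boxtimes> (b' i \<boxtimes> X \<up> (s * i))) (\<alpha> + 2 * m)"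
    using ac b'c fc(1) by (intro fs_add) auto
  also have "fs (\<lambda>i. f \<up> \<alpha> \<boxtimes> (b' i \<boxtimes> X \<up> (s * i))) (\<alpha> + 2 * m) = f \<up> \<alpha> \<boxtimes> fs (\<lambda>i. b' i \<boxtimes> X \<up> (s * i)) (\<alpha> + 2 * m)"
    using b'c fc(1) by (intro fs_mult) auto
  also have "fs (\<lambda>i. b' i \<boxtimes> X \<up> (s * i)) (\<alpha> + 2 * m) = fs (\<lambda>i. b' i \<boxtimes> X \<up> (s * i)) (\<alpha> + m)"
  proof (rule fs_extend)
    fix i assume "\<alpha> + m \<le> i"
    then have "b' i = []" by (simp add: b'_def)
    then show "b' i \<boxtimes> X \<up> (s * i) = []" by simp
  qed (use b'c in simp_all)
  also have "\<dots> = fs (\<lambda>i. b i \<boxtimes> X \<up> (s * i)) (\<alpha> + m)" by (intro fs_cong) (simp add: b'_def)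
  finally have fs0: "fs (\<lambda>i. (a i \<boxplus> f \<up> \<alpha> \<boxtimes> b' i) \<boxtimes> ?y \<up> i) (\<alpha> + 2 * m) = []"
    using G0 unfolding aux_def by simp
  define i0 where "i0 = (LEAST i. i < \<alpha> + 2 * m \<and> (a i \<noteq> [] \<or> b' i \<noteq> []))"
  have "\<exists>i. i < \<alpha> + 2 * m \<and> (a i \<noteq> [] \<or> b' i \<noteq> [])"
  proof -
    from nz consider i where "i < \<alpha> + 2 * m" "a i \<noteq> []" | i where "i < \<alpha> + m" "b i \<noteq> []" by blast
    then show ?thesis
    proof cases
      case (2 i) then show ?thesis by (intro exI[of _ i]) (simp add: b'_def)
    qed blast
  qed
  then have i0: "i0 < \<alpha> + 2 * m" "a i0 \<noteq> [] \<or> b' i0 \<noteq> []" unfolding i0_def by (metis (mono_tags, lifting) LeastI)+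
  have min: "a i = [] \<and> b' i = []" if "i < i0" for i
    using not_less_Least[of i "\<lambda>i. i < \<alpha> + 2 * m \<and> (a i \<noteq> [] \<or> b' i \<noteq> [])"] that i0(1) unfolding i0_def[symmetric] by auto
  have dv: "?y pdivides (a i0 \<boxplus> f \<up> \<alpha> \<boxtimes> b' i0)"
  proof (rule fs_lowest_term[OF yc _ i0(1) _ fs0])
    fix i assume "i < \<alpha> + 2 * m" then show "a i \<boxplus> f \<up> \<alpha> \<boxtimes> b' i \<in> carrier S" using ac b'c fc(1) by simp
  next
    fix i assume "i < i0" then show "a i \<boxplus> f \<up> \<alpha> \<boxtimes> b' i = []" using min fc(1) by simp
  qed
  define A where "A = a i0" define B where "B = b' i0"
  have Ac: "A \<in> carrier S" "A \<in> V \<alpha>" using ac a i0(1) by (auto simp: A_def)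
  have Bc: "B \<in> carrier S" "B \<in> V (\<alpha> - m)" using b'c b'V by (auto simp: B_def)
  have AB: "A \<noteq> [] \<or> B \<noteq> []" using i0(2) by (simp add: A_def B_def)
  let ?fB = "f \<up> \<alpha> \<boxtimes> B"
  have fBc: "?fB \<in> carrier S" using fc(1) Bc by simp
  obtain k where k: "k \<in> carrier S" "A \<boxplus> ?fB = ?y \<boxtimes> k" using dv unfolding A_def[symmetric] B_def[symmetric] by (rule pdividesE)
  define r where "r = f pmod X" define h where "h = f pdiv X"
  have rh: "r \<in> carrier S" "h \<in> carrier S" using long_division_closed[OF carrier_is_subfield fc(1) var_carrier] by (auto simp: r_def h_def)
  have rV: "r \<in> V 1" using pmod_V[OF var_prime fc(1)] degree_var by (simp add: r_def)
  have fdiv: "f = X \<boxtimes> h \<boxplus> r" unfolding r_def h_def by (rule pdiv_pmod[OF carrier_is_subfield fc(1) var_carrier])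
  have fs': "f \<up> s = ?y \<boxtimes> (h \<up> s) \<boxplus> r \<up> s"
  proof -
    have "f \<up> s = (X \<boxtimes> h \<boxplus> r) \<up> s" using fdiv by simp
    also have "\<dots> = (X \<boxtimes> h) \<up> s \<boxplus> r \<up> s" unfolding s_def using frobenius_q rh by simp
    finally show ?thesis using rh by (simp add: S.nat_pow_distrib)
  qed
  let ?u = "r \<up> s" and ?W = "f \<boxtimes> (B \<boxtimes> B)"
  have Wc: "?W \<in> carrier S" and uc: "?u \<in> carrier S" using fc(1) Bc rh by auto
  have fBsq: "?fB \<boxtimes> ?fB = ?u \<boxtimes> ?W \<boxplus> ?y \<boxtimes> ((h \<up> s) \<boxtimes> ?W)"
  proof -
    have "?fB \<boxtimes> ?fB = (f \<up> \<alpha> \<boxtimes> f \<up> \<alpha>) \<boxtimes> (B \<boxtimes> B)" using fc(1) Bc by (simp add: S.m_ac)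
    also have "f \<up> \<alpha> \<boxtimes> f \<up> \<alpha> = f \<up> s \<boxtimes> f"
    proof -
      have "\<alpha> + \<alpha> = Suc s" using s_\<alpha> by linarith
      then show ?thesis using fc(1) by (simp add: S.nat_pow_mult)
    qed
    also have "(f \<up> s \<boxtimes> f) \<boxtimes> (B \<boxtimes> B) = f \<up> s \<boxtimes> ?W" using fc(1) Bc by (simp add: S.m_assoc)
    also have "\<dots> = ?y \<boxtimes> ((h \<up> s) \<boxtimes> ?W) \<boxplus> ?u \<boxtimes> ?W"
      unfolding fs' using yc uc rh Wc by (simp only: S.l_distr S.m_assoc S.m_closed S.nat_pow_closed)
    finally show ?thesis using yc rh Wc uc by (simp add: S.a_comm)
  qed
  have "A \<boxtimes> A \<boxminus> ?u \<boxtimes> ?W = (A \<boxtimes> A \<boxminus> ?fB \<boxtimes> ?fB) \<boxplus> ?y \<boxtimes> ((h \<up> s) \<boxtimes> ?W)"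
    unfolding fBsq using sub_add_cancel[of "A \<boxtimes> A" "?u \<boxtimes> ?W" "?y \<boxtimes> ((h \<up> s) \<boxtimes> ?W)"] Ac uc Wc yc rh by simp
  also have "A \<boxtimes> A \<boxminus> ?fB \<boxtimes> ?fB = ?y \<boxtimes> (k \<boxtimes> (A \<boxminus> ?fB))"
    using diff_squares[OF Ac(1) fBc] k yc Ac fBc by (simp add: S.m_assoc)
  finally have "A \<boxtimes> A \<boxminus> ?u \<boxtimes> ?W = ?y \<boxtimes> (k \<boxtimes> (A \<boxminus> ?fB) \<boxplus> (h \<up> s) \<boxtimes> ?W)"
    using k yc Ac fBc rh Wc by (simp add: S.r_distr)
  then have dvD: "?y pdivides (A \<boxtimes> A \<boxminus> ?u \<boxtimes> ?W)"
    by (rule pdividesI[rotated]) (use k Ac fBc rh Wc in simp)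
  \<comment> \<open>Here the degree bounds on the coefficients are decided: length \<alpha> for
    \<open>A\<close> is the largest for which A^2 fits below X^s, and \<alpha> - m for
    \<open>B\<close> leaves room for the factor \<open>f\<close>.\<close>
  have DV: "A \<boxtimes> A \<boxminus> ?u \<boxtimes> ?W \<in> V s"
  proof (rule V_sub)
    show "A \<boxtimes> A \<in> V s" by (rule V_monoD[OF mult_V[OF Ac(2) Ac(2)]]) (use s_\<alpha> in linarith)
    have "?u \<in> V 1" using pow_V[OF rV, of s] by simp
    then show "?u \<boxtimes> ?W \<in> V s"
      by (rule V_monoD[OF mult_V[OF _ mult_V[OF fc(5) mult_V[OF Bc(2) Bc(2)]]]]) (use s_\<alpha> m in linarith)
  qed
  have D0: "A \<boxtimes> A \<boxminus> ?u \<boxtimes> ?W = []"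
  proof (rule ccontr)
    assume ne: "A \<boxtimes> A \<boxminus> ?u \<boxtimes> ?W \<noteq> []"
    have "degree ?y \<le> degree (A \<boxtimes> A \<boxminus> ?u \<boxtimes> ?W)"
      by (rule pdivides_degree_le[OF dvD yc(1) _ ne]) (use Ac uc Wc in simp)
    moreover have "degree ?y = s" using degree_pow[OF var_carrier, of s] degree_var by simp
    moreover have "length (A \<boxtimes> A \<boxminus> ?u \<boxtimes> ?W) \<le> s" using DV by (simp add: V_def)
    ultimately show False using s_ge by linarith
  qed
  then have eq: "A \<boxtimes> A = ?u \<boxtimes> ?W" using S.r_right_minus_eq[of "A \<boxtimes> A" "?u \<boxtimes> ?W"] Ac uc Wc by simp
  show False
  proof (cases "r = []")
    case True
    have "?u = []" using True S.nat_pow_zero[of s] s_ge by simp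
    then have A0: "A = []" using eq Ac Wc by simp
    then have Bne: "B \<noteq> []" using AB by simp
    have "X pdivides f" using True pmod_zero_iff_pdivides[OF carrier_is_subfield fc(1) var_carrier] by (simp add: r_def)
    then have "v X f = 1" using v_pos_iff[OF var_prime fc(1,2)] f var_prime by (force simp: hyper_iff)
    then have vfB: "v X ?fB = \<alpha> + v X B"
      using v_mult[OF var_prime, of "f \<up> \<alpha>" B] v_pow[OF var_prime fc(1,2), of \<alpha>] fc pow_eq_nil_iff Bc Bne by simp
    have "?y pdivides ?fB" using dv A0 fBc unfolding A_def[symmetric] B_def[symmetric] by simp
    then have "s \<le> v X ?fB" using pow_pdivides_iff[OF var_prime fBc, of s] Bne fc pow_eq_nil_iff Bc by simp
    moreover have "v X B * degree X \<le> degree B" by (rule v_le_degree[OF var_prime Bc(1) Bne])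
    then have "v X B \<le> degree B" unfolding degree_var by simp
    moreover have "length B \<le> \<alpha> - m" using Bc by (simp add: V_def)
    ultimately show False using s_\<alpha> m vfB by linarith
  next
    case False
    have une: "?u \<noteq> []" using pow_eq_nil_iff[OF rh(1) False] .
    have rd: "degree r = 0" using rV by (simp add: V_def)
    have ud: "degree ?u = 0" unfolding degree_pow[OF rh(1)] rd by simp
    have Bne: "B \<noteq> []"
    proof
      assume "B = []"
      then have "A = []" using eq Ac uc fc by simp
      then show False using AB \<open>B = []\<close> by simp
    qed
    have Ane: "A \<noteq> []"
    proof
      assume "A = []"
      then have "?u \<boxtimes> ?W = []" using eq by simp
      then show False using une uc Wc fc Bc Bne by simp
    qed
    obtain T where T: "T \<in> prime_polys R" "T pdivides f" using exists_prime_factor[OF fc(1)] fc(4) m by auto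
    have vf: "v T f = 1" using v_pos_iff[OF T(1) fc(1,2)] T f by (force simp: hyper_iff)
    have "v T (A \<boxtimes> A) = 2 * v T A" using v_mult[OF T(1) Ac(1) Ane Ac(1) Ane] by simp
    moreover have "v T (?u \<boxtimes> ?W) = 1 + 2 * v T B"
      using v_mult[OF T(1) uc une, of ?W] v_mult[OF T(1) fc(1,2), of "B \<boxtimes> B"] v_mult[OF T(1) Bc(1) Bne Bc(1) Bne]
        v_degree_0[OF T(1) uc une ud] vf fc Bc Bne by simp
    ultimately have "2 * v T A = 1 + 2 * v T B" using eq by simp
    then show False by presburger
  qed
qed

lemma cond_V:
  assumes a: "\<And>i. i < \<alpha> + 2 * m \<Longrightarrow> a i \<in> V \<alpha>" and b: "\<And>i. i < \<alpha> + m \<Longrightarrow> b i \<in> V (\<alpha> - m)"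
  shows "cond a b \<in> V ((\<alpha> - 1) * s + \<alpha> + 2 * m)"
proof -
  obtain k where k: "\<alpha> = m + 1 + k" using s_\<alpha>(2) le_Suc_ex by (metis add.assoc)
  have s: "s = 2 * m + 2 * k + 1" using s_\<alpha>(1) k by simp
  have 1: "fs (\<lambda>i. a i \<up> s \<boxtimes> X \<up> i) (\<alpha> + 2 * m) \<in> V ((\<alpha> - 1) * s + \<alpha> + 2 * m)"
  proof (rule fs_V)
    fix i assume i: "i < \<alpha> + 2 * m"
    have "a i \<up> s \<in> V (s * (\<alpha> - 1) + 1)" by (rule pow_V[OF a[OF i]]) (use k in linarith)
    from mult_V[OF this var_pow_V[of i]] show "a i \<up> s \<boxtimes> X \<up> i \<in> V ((\<alpha> - 1) * s + \<alpha> + 2 * m)"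
      by (rule V_monoD) (use i in \<open>simp add: mult.commute\<close>)
  qed
  have 2: "fs (\<lambda>i. b i \<up> s \<boxtimes> X \<up> i) (\<alpha> + m) \<in> V ((\<alpha> - m - 1) * s + \<alpha> + m)"
  proof (rule fs_V)
    fix i assume i: "i < \<alpha> + m"
    have "b i \<up> s \<in> V (s * (\<alpha> - m - 1) + 1)" by (rule pow_V[OF b[OF i]]) (use k in linarith)
    from mult_V[OF this var_pow_V[of i]] show "b i \<up> s \<boxtimes> X \<up> i \<in> V ((\<alpha> - m - 1) * s + \<alpha> + m)"
      by (rule V_monoD) (use i in \<open>simp add: mult.commute\<close>)
  qed
  have "f \<up> \<alpha> \<in> V (\<alpha> * m + 1)" using pow_V[OF fc(5), of \<alpha>] by simp
  note 3 = mult_V[OF this 2]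
  have "sgnS \<in> V 1" using sgnS_closed by (simp add: V_def) (simp add: sgnS_def)
  note 4 = mult_V[OF this 3]
  have "1 + (\<alpha> * m + 1 + ((\<alpha> - m - 1) * s + \<alpha> + m) - 1) - 1 \<le> (\<alpha> - 1) * s + \<alpha> + 2 * m"
  proof -
    have "(\<alpha> - 1) * s = (\<alpha> - m - 1) * s + m * s" unfolding k by (simp add: algebra_simps)
    moreover have "\<alpha> * m \<le> m * s" unfolding k s by (simp add: algebra_simps)
    ultimately show ?thesis by linarith
  qed
  from V_monoD[OF 4 this] show ?thesis unfolding cond_def by (intro V_add 1)
qed

text \<open>Additivity of the s-th power; a difference of two coefficient choices is all that the
  collision argument needs.\<close>

lemma cond_diff:
  assumes c: "\<And>i. i < \<alpha> + 2 * m \<Longrightarrow> a i \<in> carrier S" "\<And>i. i < \<alpha> + m \<Longrightarrow> b i \<in> carrier S"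
    "\<And>i. i < \<alpha> + 2 * m \<Longrightarrow> a' i \<in> carrier S" "\<And>i. i < \<alpha> + m \<Longrightarrow> b' i \<in> carrier S"
  shows "cond (\<lambda>i. a i \<boxminus> a' i) (\<lambda>i. b i \<boxminus> b' i) = cond a b \<boxminus> cond a' b'"
proof -
  have t: "(y \<boxminus> z) \<up> s \<boxtimes> w = y \<up> s \<boxtimes> w \<boxminus> z \<up> s \<boxtimes> w" if "y \<in> carrier S" "z \<in> carrier S" "w \<in> carrier S" for y z w
    unfolding s_def frobenius_q_diff[OF that(1,2)] using that by (simp add: a_minus_def S.l_distr S.l_minus)
  let ?A = "\<lambda>a. fs (\<lambda>i. a i \<up> s \<boxtimes> X \<up> i) (\<alpha> + 2 * m)" and ?B = "\<lambda>b. fs (\<lambda>i. b i \<up> s \<boxtimes> X \<up> i) (\<alpha> + m)"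
  have cl: "?A a \<in> carrier S" "?A a' \<in> carrier S" "?B b \<in> carrier S" "?B b' \<in> carrier S"
    using c by (auto intro!: fs_closed)
  have 1: "?A (\<lambda>i. a i \<boxminus> a' i) = ?A a \<boxminus> ?A a'"
  proof -
    have "?A (\<lambda>i. a i \<boxminus> a' i) = fs (\<lambda>i. a i \<up> s \<boxtimes> X \<up> i \<boxminus> a' i \<up> s \<boxtimes> X \<up> i) (\<alpha> + 2 * m)"
      using c by (intro fs_cong t) auto
    then show ?thesis using c by (simp add: fs_diff)
  qed
  have 2: "?B (\<lambda>i. b i \<boxminus> b' i) = ?B b \<boxminus> ?B b'"
  proof -
    have "?B (\<lambda>i. b i \<boxminus> b' i) = fs (\<lambda>i. b i \<up> s \<boxtimes> X \<up> i \<boxminus> b' i \<up> s \<boxtimes> X \<up> i) (\<alpha> + m)"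
      using c by (intro fs_cong t) auto
    then show ?thesis using c by (simp add: fs_diff)
  qed
  show ?thesis unfolding cond_def 1 2
    using cl sgnS_closed fc(1) by (simp add: a_minus_def S.r_distr S.r_minus S.minus_add S.a_ac)
qed

text \<open>Pigeonhole. The coefficients range over a space of dimension \<alpha>(\<alpha> + 2m) +
  (\<alpha> - m)(\<alpha> + m), the values of \<open>cond\<close> over one of dimension (\<alpha> -
  1) s + \<alpha> + 2m. With s = 2\<alpha> - 1 the surplus is (m + 1)(2\<alpha> - m - 1) > 0. The
  difference of two colliding choices is the solution.\<close>

lemma aux_exists:
  "\<exists>a b. (\<forall>i<\<alpha> + 2 * m. a i \<in> V \<alpha>) \<and> (\<forall>i<\<alpha> + m. b i \<in> V (\<alpha> - m)) \<and>
     ((\<exists>i<\<alpha> + 2 * m. a i \<noteq> []) \<or> (\<exists>i<\<alpha> + m. b i \<noteq> [])) \<and> cond a b = []"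
proof -
  let ?Z = "PiE {..<\<alpha> + 2 * m} (\<lambda>_. V \<alpha>) \<times> PiE {..<\<alpha> + m} (\<lambda>_. V (\<alpha> - m))"
  let ?E = "(\<alpha> - 1) * s + \<alpha> + 2 * m"
  let ?g = "\<lambda>(a, b). cond a b"
  have Zmem: "(\<forall>i<\<alpha> + 2 * m. a i \<in> V \<alpha>) \<and> (\<forall>i<\<alpha> + m. b i \<in> V (\<alpha> - m))" if "(a, b) \<in> ?Z" for a b
    using that by (auto simp: PiE_iff)
  have img: "?g ` ?Z \<subseteq> V ?E"
  proof
    fix y assume "y \<in> ?g ` ?Z"
    then obtain a b where ab: "(a, b) \<in> ?Z" "y = cond a b" by auto
    then show "y \<in> V ?E" using Zmem[OF ab(1)] cond_V[of a b] by simp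
  qed
  have finZ: "finite ?Z" by (intro finite_cartesian_product finite_PiE) auto
  have cardZ: "card ?Z = q ^ (\<alpha> * (\<alpha> + 2 * m) + (\<alpha> - m) * (\<alpha> + m))"
  proof -
    have "card ?Z = (q ^ \<alpha>) ^ (\<alpha> + 2 * m) * (q ^ (\<alpha> - m)) ^ (\<alpha> + m)"
      by (simp add: card_cartesian_product card_PiE card_V)
    also have "\<dots> = q ^ (\<alpha> * (\<alpha> + 2 * m) + (\<alpha> - m) * (\<alpha> + m))"
      by (simp only: power_mult[symmetric] power_add[symmetric])
    finally show ?thesis .
  qed
  have "?E < \<alpha> * (\<alpha> + 2 * m) + (\<alpha> - m) * (\<alpha> + m)"
  proof -
    obtain k where k: "\<alpha> = m + 1 + k" using s_\<alpha>(2) le_Suc_ex by (metis add.assoc)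
    have s: "s = 2 * m + 2 * k + 1" using s_\<alpha>(1) k by simp
    show ?thesis unfolding k s by (simp add: algebra_simps)
  qed
  then have "card (V ?E) < card ?Z" unfolding cardZ card_V using order_ge_3 by (intro power_strict_increasing) auto
  then have "\<not> inj_on ?g ?Z" using card_inj_on_le[OF _ img finite_V] by linarith
  then obtain z z' where zz: "z \<in> ?Z" "z' \<in> ?Z" "?g z = ?g z'" "z \<noteq> z'" unfolding inj_on_def by blast
  obtain a b where z: "z = (a, b)" by (cases z)
  obtain a' b' where z': "z' = (a', b')" by (cases z')
  have m1: "(\<forall>i<\<alpha> + 2 * m. a i \<in> V \<alpha>) \<and> (\<forall>i<\<alpha> + m. b i \<in> V (\<alpha> - m))" using Zmem zz(1) z by blast
  have m2: "(\<forall>i<\<alpha> + 2 * m. a' i \<in> V \<alpha>) \<and> (\<forall>i<\<alpha> + m. b' i \<in> V (\<alpha> - m))" using Zmem zz(2) z' by blast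
  have c: "\<forall>i<\<alpha> + 2 * m. a i \<in> carrier S \<and> a' i \<in> carrier S" "\<forall>i<\<alpha> + m. b i \<in> carrier S \<and> b' i \<in> carrier S"
    using m1 m2 V_carrier by blast+
  have "cond (\<lambda>i. a i \<boxminus> a' i) (\<lambda>i. b i \<boxminus> b' i) = cond a b \<boxminus> cond a' b'"
    using c by (intro cond_diff) auto
  also have "\<dots> = []"
  proof -
    have "cond a b \<in> carrier S" using m1 cond_V[of a b] V_carrier by blast
    then show ?thesis using zz(3) z z' by (simp add: a_minus_def S.r_neg)
  qed
  finally have "cond (\<lambda>i. a i \<boxminus> a' i) (\<lambda>i. b i \<boxminus> b' i) = []" .
  moreover have "(\<exists>i<\<alpha> + 2 * m. a i \<boxminus> a' i \<noteq> []) \<or> (\<exists>i<\<alpha> + m. b i \<boxminus> b' i \<noteq> [])"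
  proof (rule ccontr)
    assume "\<not> ?thesis"
    then have e: "\<forall>i<\<alpha> + 2 * m. a i = a' i" "\<forall>i<\<alpha> + m. b i = b' i"
      using c S.r_right_minus_eq by (auto simp: )
    have "a = a'" using zz(1,2) z z' e by (intro PiE_ext[of a "{..<\<alpha> + 2 * m}" "\<lambda>_. V \<alpha>"]) auto
    moreover have "b = b'" using zz(1,2) z z' e by (intro PiE_ext[of b "{..<\<alpha> + m}" "\<lambda>_. V (\<alpha> - m)"]) auto
    ultimately show False using zz(4) z z' by simp
  qed
  moreover have "\<forall>i<\<alpha> + 2 * m. a i \<boxminus> a' i \<in> V \<alpha>" "\<forall>i<\<alpha> + m. b i \<boxminus> b' i \<in> V (\<alpha> - m)"
    using m1 m2 V_sub by blast+
  ultimately show ?thesis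
    by (intro exI[of _ "\<lambda>i. a i \<boxminus> a' i"] exI[of _ "\<lambda>i. b i \<boxminus> b' i"] conjI)
qed

text \<open>All these primes divide the nonzero \<open>aux\<close>. Twice its degree is at most s^2
  + 4ms - 1, and s^2/2 is the expected weight of one sign of the symbol, so the leading term is
  right.\<close>

lemma stepanov_count:
  "2 * (2 * \<delta> * card {P \<in> prime_polys_deg R (2 * \<delta>). leg f P = \<sigma>}) \<le> s * s + 4 * m * s"
proof -
  let ?T = "{P \<in> prime_polys_deg R (2 * \<delta>). leg f P = \<sigma>}"
  obtain a b where ab: "\<forall>i<\<alpha> + 2 * m. a i \<in> V \<alpha>" "\<forall>i<\<alpha> + m. b i \<in> V (\<alpha> - m)"
     "(\<exists>i<\<alpha> + 2 * m. a i \<noteq> []) \<or> (\<exists>i<\<alpha> + m. b i \<noteq> [])" "cond a b = []" using aux_exists by blast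
  have ne: "aux a b \<noteq> []" using aux_nonzero[of a b] ab by blast
  have GV: "aux a b \<in> V (\<alpha> + (\<alpha> + 2 * m - 1) * s)" using aux_V[of a b] ab by blast
  have "(\<Sum>P\<in>?T. degree P) \<le> degree (aux a b)"
  proof (rule sum_degree_prime_divisors_le[OF V_carrier[OF GV] ne])
    fix P assume "P \<in> ?T"
    then have P: "P \<in> prime_polys R" "degree P = 2 * \<delta>" "leg f P = \<sigma>" by (auto simp: prime_deg_iff)
    show "P pdivides aux a b" by (rule aux_vanishing[OF P _ _ ab(4)]) (use ab V_carrier in blast)+
  next
    show "finite ?T" by simp
    show "?T \<subseteq> prime_polys R" by (auto simp: prime_deg_iff)
  qed
  also have "(\<Sum>P\<in>?T. degree P) = (\<Sum>P\<in>?T. 2 * \<delta>)" by (intro sum.cong refl) (simp add: prime_deg_iff)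
  also have "\<dots> = 2 * \<delta> * card ?T" by simp
  finally have le: "2 * \<delta> * card ?T \<le> degree (aux a b)" .
  have "length (aux a b) \<le> \<alpha> + (\<alpha> + 2 * m - 1) * s" using GV by (simp add: V_def)
  then have "2 * (2 * \<delta> * card ?T) \<le> 2 * (\<alpha> + (\<alpha> + 2 * m - 1) * s - 1)"
    using order_trans[OF le diff_le_mono] by (intro mult_le_mono2)
  also have "\<dots> \<le> s * s + 4 * m * s"
  proof -
    obtain k where k: "\<alpha> = m + 1 + k" using s_\<alpha>(2) le_Suc_ex by (metis add.assoc)
    have s: "s = 2 * m + 2 * k + 1" using s_\<alpha>(1) k by simp
    show ?thesis unfolding k s by (simp add: algebra_simps)
  qed
  finally show ?thesis .
qed

end

section \<open>Averages over primes of even degree\<close>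

text \<open>Both signs obey the upper bound of \<open>stepanov_count\<close>, primes dividing
  \<open>f\<close> have total degree at most m, and all together have weight at least s^2 - 2s. So
  an upper bound for one sign is a lower bound for the other.\<close>

lemma weil_squarefree:
  assumes f: "f \<in> hyperelliptic R m" and m: "m \<ge> 1" and \<delta>: "\<delta> \<ge> 1"
  shows "\<bar>\<Sum>P\<in>prime_polys_deg R (2 * \<delta>). int (2 * \<delta>) * leg f P\<bar> \<le> 7 * int m * int q ^ \<delta>"
proof -
  let ?T = "prime_polys_deg R (2 * \<delta>)"
  define s where "s = q ^ \<delta>"
  have s1: "s \<ge> 1" using order_ge_3 by (simp add: s_def)
  have fc: "f \<in> carrier S" "f \<noteq> []" "degree f = m" using f by (auto simp: hyper_iff monic_iff)
  let ?p = "2 * \<delta> * card {P \<in> ?T. leg f P = 1}" and ?n = "2 * \<delta> * card {P \<in> ?T. leg f P = -1}"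
    and ?z = "2 * \<delta> * card {P \<in> ?T. leg f P = 0}" and ?N = "2 * \<delta> * card ?T"
  have lc: "leg f P = 1 \<or> leg f P = -1 \<or> leg f P = 0" if "P \<in> ?T" for P
    using leg_cases[of P f] that fc(1) by (simp add: prime_deg_iff) blast
  have part: "?T = {P \<in> ?T. leg f P = 1} \<union> ({P \<in> ?T. leg f P = -1} \<union> {P \<in> ?T. leg f P = 0})"
    using lc by blast
  have card: "card ?T = card {P \<in> ?T. leg f P = 1} + (card {P \<in> ?T. leg f P = -1} + card {P \<in> ?T. leg f P = 0})"
    by (subst part, subst card_Un_disjoint, simp, simp, fastforce, subst card_Un_disjoint) auto
  have N: "?N = ?p + (?n + ?z)" unfolding card by (simp add: distrib_left)
  have "(\<Sum>P\<in>?T. leg f P) = (\<Sum>P\<in>?T. of_bool (leg f P = 1) - of_bool (leg f P = -1))"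
    using lc by (intro sum.cong refl) force
  also have "\<dots> = int (card {P \<in> ?T. leg f P = 1}) - int (card {P \<in> ?T. leg f P = -1})"
    by (simp add: sum_subtractf of_bool_def sum.If_cases Int_def)
  finally have S: "(\<Sum>P\<in>?T. leg f P) = int (card {P \<in> ?T. leg f P = 1}) - int (card {P \<in> ?T. leg f P = -1})" .
  have "(\<Sum>P\<in>?T. int (2 * \<delta>) * leg f P) = int ?p - int ?n"
    unfolding sum_distrib_left[symmetric] S of_nat_mult[of "2 * \<delta>"] right_diff_distrib ..
  moreover have Nle: "?N \<le> s * s"
    using card_prime_le[of "2 * \<delta>"] by (simp add: s_def mult_2 power_add[symmetric])
  moreover have "\<bar>int ?p - int ?n\<bar> \<le> 7 * int m * int s"
  proof (cases "s \<ge> 2 * m + 1")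
    \<comment> \<open>Here s is too small for the auxiliary polynomial, but s \<le> 2m makes the
      trivial bound s^2 sufficient.\<close>
    case False
    then have "s * s \<le> 2 * m * s" by (intro mult_le_mono1) simp
    moreover have "\<bar>int ?p - int ?n\<bar> \<le> int ?N" unfolding N by linarith
    ultimately have "\<bar>int ?p - int ?n\<bar> \<le> int (2 * m * s)" using Nle by linarith
    also have "\<dots> \<le> 7 * int m * int s" by simp
    finally show ?thesis .
  next
    case True
    have p: "2 * ?p \<le> s * s + 4 * m * s"
      by (rule stepanov_count[OF f m s_def True refl]) simp
    have n: "2 * ?n \<le> s * s + 4 * m * s"
      by (rule stepanov_count[OF f m s_def True refl]) simp
    have z: "?z \<le> m"
    proof -
      have "(\<Sum>P\<in>{P \<in> ?T. leg f P = 0}. degree P) \<le> degree f"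
      proof (rule sum_degree_prime_divisors_le[OF fc(1,2)])
        show "finite {P \<in> ?T. leg f P = 0}" by simp
        show "{P \<in> ?T. leg f P = 0} \<subseteq> prime_polys R" by (auto simp: prime_deg_iff)
        fix P assume "P \<in> {P \<in> ?T. leg f P = 0}"
        then show "P pdivides f" using leg_zero_iff[of P f] fc(1) by (simp add: prime_deg_iff)
      qed
      moreover have "(\<Sum>P\<in>{P \<in> ?T. leg f P = 0}. degree P) = (\<Sum>P\<in>{P \<in> ?T. leg f P = 0}. 2 * \<delta>)"
        by (intro sum.cong refl) (simp add: prime_deg_iff)
      ultimately show ?thesis using fc(3) by (simp add: mult.commute)
    qed
    have ss: "s * s = q ^ (2 * \<delta>)" by (simp only: s_def mult_2 power_add)
    have ge: "s * s \<le> ?N + 2 * s" unfolding ss using card_prime_ge[OF \<delta>] by (simp only: s_def)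
    have ms: "s \<le> m * s" "m \<le> m * s" using m s1 by simp_all
    have arith: "2 * a \<le> S' + 4 * t \<Longrightarrow> 2 * b \<le> S' + 4 * t \<Longrightarrow> c \<le> m' \<Longrightarrow> S' \<le> d + 2 * s' \<Longrightarrow> s' \<le> t \<Longrightarrow>
        m' \<le> t \<Longrightarrow> d = a + (b + c) \<Longrightarrow> \<bar>int a - int b\<bar> \<le> int (7 * t)" for a b c d t S' m' s' :: nat
      by linarith
    \<comment> \<open>The 7 is 4 + 2 + 1: twice the excess 2ms of one sign, the 2s lost to elements
      of lower degree, and the m for primes dividing \<open>f\<close>.\<close>
    have "\<bar>int ?p - int ?n\<bar> \<le> int (7 * (m * s))"
      by (rule arith[OF p[unfolded mult.assoc[of 4 m s]] n[unfolded mult.assoc[of 4 m s]] z ge ms N])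
    then show ?thesis by simp
  qed
  ultimately show ?thesis unfolding s_def by simp
qed

text \<open>Pass to the square-free part D of \<open>f\<close>, nontrivial because \<open>f\<close>
  is not a square. The symbols of \<open>f\<close> and D differ only at primes dividing the cofactor
  h, whose total degree is at most degree h.\<close>

lemma weil_bound:
  assumes f: "f \<in> monic_polys_deg R i" and ns: "\<not> (\<exists>h\<in>monic_polys R. f = h \<boxtimes> h)" and \<delta>: "\<delta> \<ge> 1"
  shows "\<bar>\<Sum>P\<in>prime_polys_deg R (2 * \<delta>). int (2 * \<delta>) * leg f P\<bar> \<le> 7 * int i * int q ^ \<delta>"
proof -
  let ?T = "prime_polys_deg R (2 * \<delta>)"
  have fm: "f \<in> monic_polys R" "degree f = i" using f by (auto simp: monic_deg_iff)
  obtain D h where Dh: "h \<in> monic_polys R" "D \<in> hyperelliptic R (degree D)" "f = D \<boxtimes> (h \<boxtimes> h)"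
    using square_decomposition[OF fm(1)] by blast
  have c: "h \<in> carrier S" "h \<noteq> []" "D \<in> carrier S" "D \<noteq> []" "D \<in> monic_polys R"
    using Dh by (auto simp: hyper_iff monic_iff)
  have D1: "degree D \<ge> 1"
  proof (rule ccontr)
    assume "\<not> degree D \<ge> 1"
    then have "D = \<one>\<^bsub>S\<^esub>" using monic_degree_0[OF c(5)] by linarith
    then show False using ns Dh(1,3) c by auto
  qed
  have "degree (h \<boxtimes> h) = degree h + degree h" using degree_mult c by blast
  then have deg: "i = degree D + 2 * degree h" using fm(2) Dh(3) degree_mult[of D "h \<boxtimes> h"] c by simp
  have l: "leg f P = leg D P - of_bool (P pdivides h) * leg D P" if "P \<in> ?T" for P
  proof -
    have P: "P \<in> prime_polys R" using that by (simp add: prime_deg_iff)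
    have "leg f P = leg D P * leg h P ^ 2" using Dh(3) c leg_mult[OF P] by (simp add: power2_eq_square)
    then show ?thesis using leg_square[OF P c(1)] by simp
  qed
  have "(\<Sum>P\<in>?T. int (2 * \<delta>) * leg f P) =
     (\<Sum>P\<in>?T. int (2 * \<delta>) * leg D P) - (\<Sum>P\<in>?T. of_bool (P pdivides h) * (int (2 * \<delta>) * leg D P))"
    unfolding sum_subtractf[symmetric] by (intro sum.cong refl) (simp add: l algebra_simps)
  moreover have "\<bar>\<Sum>P\<in>?T. of_bool (P pdivides h) * (int (2 * \<delta>) * leg D P)\<bar> \<le> int (degree h)"
  proof -
    have "\<bar>\<Sum>P\<in>?T. of_bool (P pdivides h) * (int (2 * \<delta>) * leg D P)\<bar> \<le> (\<Sum>P\<in>?T. if P pdivides h then int (degree P) else 0)"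
    proof (rule order_trans[OF sum_abs], rule sum_mono)
      fix P assume "P \<in> ?T"
      then have P: "P \<in> prime_polys R" "degree P = 2 * \<delta>" by (auto simp: prime_deg_iff)
      have "\<bar>leg D P\<bar> \<le> 1" using leg_cases[OF P(1) c(3)] by auto
      then have "\<bar>int (2 * \<delta>) * leg D P\<bar> \<le> int (2 * \<delta>) * 1" unfolding abs_mult by (intro mult_mono) auto
      then show "\<bar>of_bool (P pdivides h) * (int (2 * \<delta>) * leg D P)\<bar> \<le> (if P pdivides h then int (degree P) else 0)"
        unfolding P(2) by (cases "P pdivides h") (simp_all add: abs_mult)
    qed
    also have "\<dots> = int (\<Sum>P\<in>{P \<in> ?T. P pdivides h}. degree P)"
      by (simp add: sum.inter_filter[symmetric])
    also have "(\<Sum>P\<in>{P \<in> ?T. P pdivides h}. degree P) \<le> degree h"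
      by (rule sum_degree_prime_divisors_le[OF c(1,2)]) (auto simp: prime_deg_iff intro: finite_subset[OF _ finite_prime_deg[of "2 * \<delta>"]])
    finally show ?thesis by simp
  qed
  moreover have "\<bar>\<Sum>P\<in>?T. int (2 * \<delta>) * leg D P\<bar> \<le> 7 * int (degree D) * int q ^ \<delta>"
    by (rule weil_squarefree[OF Dh(2) D1 \<delta>])
  ultimately have "\<bar>\<Sum>P\<in>?T. int (2 * \<delta>) * leg f P\<bar> \<le> 7 * int (degree D) * int q ^ \<delta> + int (degree h)" by linarith
  also have "\<dots> \<le> 7 * int (degree D) * int q ^ \<delta> + 14 * int (degree h) * int q ^ \<delta>"
  proof -
    have "int q ^ \<delta> \<ge> 1" using order_ge_3 by simp
    then have "int (degree h) * 1 \<le> 14 * int (degree h) * int q ^ \<delta>" by (intro mult_mono) auto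
    then show ?thesis by linarith
  qed
  also have "\<dots> = 7 * int i * int q ^ \<delta>" unfolding deg of_nat_add of_nat_mult by (simp add: algebra_simps)
  finally show ?thesis .
qed

text \<open>The number of elements of exact degree 2\<delta> in the field of order q^(2\<delta>),
  which is the total weight of the primes of that degree.\<close>

definition psize :: "nat \<Rightarrow> int" where "psize \<delta> = int (2 * \<delta>) * int (card (prime_polys_deg R (2 * \<delta>)))"

text \<open>A square f = h^2 of degree below 4\<delta> has h of degree below 2\<delta>, so its
  symbol is 1 at every prime of degree 2\<delta>; there are q^(j/2) such f, and
  \<open>weil_bound\<close> covers the rest.\<close>

lemma sum_msum_leg:
  assumes \<delta>: "\<delta> \<ge> 1" and j: "j < 4 * \<delta>"
  shows "\<bar>(\<Sum>P\<in>prime_polys_deg R (2 * \<delta>). int (2 * \<delta>) * msum (\<lambda>f. leg f P) j) -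
     (if even j then int q ^ (j div 2) else 0) * psize \<delta>\<bar> \<le> 7 * int j * int q ^ \<delta> * int q ^ j"
proof -
  let ?T = "prime_polys_deg R (2 * \<delta>)" and ?M = "monic_polys_deg R j"
  define sq where "sq f \<longleftrightarrow> (\<exists>h\<in>monic_polys R. f = h \<boxtimes> h)" for f
  let ?L = "\<lambda>f. \<Sum>P\<in>?T. int (2 * \<delta>) * leg f P"
  have "(\<Sum>P\<in>?T. int (2 * \<delta>) * msum (\<lambda>f. leg f P) j) = (\<Sum>f\<in>?M. ?L f)"
    unfolding msum_def sum_distrib_left by (rule sum.swap)
  also have "\<dots> = (\<Sum>f\<in>{f \<in> ?M. sq f}. ?L f) + (\<Sum>f\<in>{f \<in> ?M. \<not> sq f}. ?L f)"
  proof -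
    have u: "?M = {f \<in> ?M. sq f} \<union> {f \<in> ?M. \<not> sq f}" by blast
    show ?thesis by (subst u, rule sum.union_disjoint) auto
  qed
  also have "(\<Sum>f\<in>{f \<in> ?M. sq f}. ?L f) = (\<Sum>f\<in>{f \<in> ?M. sq f}. psize \<delta>)"
  proof (intro sum.cong refl)
    fix f assume "f \<in> {f \<in> ?M. sq f}"
    then obtain h where h: "h \<in> monic_polys R" "f = h \<boxtimes> h" "degree f = j" by (auto simp: sq_def monic_deg_iff)
    have hc: "h \<in> carrier S" "h \<noteq> []" using h by (auto simp: monic_iff)
    have dh: "j = degree h + degree h" using h degree_mult[OF hc(1) hc(1) hc(2) hc(2)] by simp
    have "leg f P = 1" if "P \<in> ?T" for P
    proof -
      have P: "P \<in> prime_polys R" "degree P = 2 * \<delta>" using that by (auto simp: prime_deg_iff)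
      have "\<not> P pdivides h" using pdivides_degree_le[OF _ prime_carrier[OF P(1)] hc] P(2) dh j by linarith
      then show ?thesis using leg_mult[OF P(1) hc(1) hc(1)] leg_square[OF P(1) hc(1)] h by (simp add: power2_eq_square)
    qed
    then show "?L f = psize \<delta>" by (simp add: psize_def)
  qed
  also have "\<dots> = (if even j then int q ^ (j div 2) else 0) * psize \<delta>"
  proof -
    have "card {f \<in> ?M. sq f} = (if even j then q ^ (j div 2) else 0)"
    proof (cases "even j")
      case True
      have "{f \<in> ?M. sq f} = (\<lambda>h. h \<boxtimes> h) ` monic_polys_deg R (j div 2)"
      proof (intro equalityI subsetI)
        fix f assume "f \<in> {f \<in> ?M. sq f}"
        then obtain h where h: "h \<in> monic_polys R" "f = h \<boxtimes> h" "degree f = j" by (auto simp: sq_def monic_deg_iff)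
        have hc: "h \<in> carrier S" "h \<noteq> []" using h by (auto simp: monic_iff)
        have "j = degree h + degree h" using h degree_mult[OF hc(1) hc(1) hc(2) hc(2)] by simp
        then have "degree h = j div 2" by linarith
        then show "f \<in> (\<lambda>h. h \<boxtimes> h) ` monic_polys_deg R (j div 2)" using h by (auto simp: monic_deg_iff)
      next
        fix f assume "f \<in> (\<lambda>h. h \<boxtimes> h) ` monic_polys_deg R (j div 2)"
        then obtain h where h: "h \<in> monic_polys R" "f = h \<boxtimes> h" "degree h = j div 2" by (auto simp: monic_deg_iff)
        have hc: "h \<in> carrier S" "h \<noteq> []" using h by (auto simp: monic_iff)
        have "degree f = degree h + degree h" using h degree_mult[OF hc(1) hc(1) hc(2) hc(2)] by simp
        then have "degree f = j" using h(3) True by (metis even_two_times_div_two mult_2)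
        then show "f \<in> {f \<in> ?M. sq f}" using h monic_mult[OF h(1) h(1)] by (auto simp: monic_deg_iff sq_def)
      qed
      moreover have "inj_on (\<lambda>h. h \<boxtimes> h) (monic_polys_deg R (j div 2))"
      proof (rule inj_onI)
        fix a b assume ab: "a \<in> monic_polys_deg R (j div 2)" "b \<in> monic_polys_deg R (j div 2)" "a \<boxtimes> a = b \<boxtimes> b"
        have am: "a \<in> monic_polys R" "b \<in> monic_polys R" using ab by (auto simp: monic_deg_iff)
        have c: "a \<in> carrier S" "a \<noteq> []" "b \<in> carrier S" "b \<noteq> []" using am by (auto simp: monic_iff)
        show "a = b"
        proof (rule monic_eqI_v[OF am])
          fix P assume P: "P \<in> prime_polys R"
          show "v P a = v P b" using v_mult[OF P c(1,2) c(1,2)] v_mult[OF P c(3,4) c(3,4)] ab(3) by simp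
        qed
      qed
      ultimately show ?thesis using True by (simp add: card_image card_monic_deg)
    next
      case False
      have "{f \<in> ?M. sq f} = {}"
      proof (rule ccontr)
        assume "{f \<in> ?M. sq f} \<noteq> {}"
        then obtain f h where h: "h \<in> monic_polys R" "f = h \<boxtimes> h" "degree f = j" by (auto simp: sq_def monic_deg_iff)
        have hc: "h \<in> carrier S" "h \<noteq> []" using h by (auto simp: monic_iff)
        have "j = degree h + degree h" using h degree_mult[OF hc(1) hc(1) hc(2) hc(2)] by simp
        then show False using False by presburger
      qed
      then show ?thesis using False by (simp only: card.empty if_False)
    qed
    then show ?thesis by simp
  qed
  finally have eq: "(\<Sum>P\<in>?T. int (2 * \<delta>) * msum (\<lambda>f. leg f P) j) - (if even j then int q ^ (j div 2) else 0) * psize \<delta> =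
     (\<Sum>f\<in>{f \<in> ?M. \<not> sq f}. ?L f)" by simp
  have "\<bar>\<Sum>f\<in>{f \<in> ?M. \<not> sq f}. ?L f\<bar> \<le> (\<Sum>f\<in>{f \<in> ?M. \<not> sq f}. 7 * int j * int q ^ \<delta>)"
    by (rule order_trans[OF sum_abs], rule sum_mono) (use weil_bound[OF _ _ \<delta>] in \<open>simp add: sq_def\<close>)
  also have "\<dots> \<le> (\<Sum>f\<in>?M. 7 * int j * int q ^ \<delta>)" by (rule sum_mono2) auto
  also have "\<dots> = 7 * int j * int q ^ \<delta> * int q ^ j" by (simp add: card_monic_deg)
  finally show ?thesis unfolding eq .
qed

text \<open>Summation of \<open>sum_msum_leg\<close> along \<open>C_Suc\<close>. The main terms
  telescope, and an error e carried along with (q - 1) e gives q e, so the constant does not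
  grow.\<close>

lemma sum_C:
  assumes \<delta>: "\<delta> \<ge> 1" and n: "n \<le> 4 * \<delta>"
  shows "\<bar>(\<Sum>P\<in>prime_polys_deg R (2 * \<delta>). int (2 * \<delta>) * C P n) - (int q ^ ((n + 1) div 2) - 1) * psize \<delta>\<bar>
     \<le> 7 * int n * int q ^ \<delta> * int q ^ n"
  using n
proof (induction n)
  case 0
  then show ?case using C_0 by (simp add: prime_deg_iff)
next
  case (Suc n)
  let ?T = "prime_polys_deg R (2 * \<delta>)"
  let ?c = "\<lambda>n. \<Sum>P\<in>?T. int (2 * \<delta>) * C P n" and ?a = "\<Sum>P\<in>?T. int (2 * \<delta>) * msum (\<lambda>f. leg f P) n"
  let ?x = "(if even n then int q ^ (n div 2) else 0)"
  let ?e = "7 * int n * int q ^ \<delta> * int q ^ n"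
  have IH: "\<bar>?c n - (int q ^ ((n + 1) div 2) - 1) * psize \<delta>\<bar> \<le> ?e" using Suc by simp
  have A: "\<bar>?a - ?x * psize \<delta>\<bar> \<le> ?e" by (rule sum_msum_leg[OF \<delta>]) (use Suc.prems in simp)
  have "?c (Suc n) = ?c n + (int q - 1) * ?a"
    unfolding sum_distrib_left sum.distrib[symmetric]
    by (intro sum.cong refl) (simp add: prime_deg_iff C_Suc algebra_simps)
  moreover have "int q ^ ((Suc n + 1) div 2) - 1 = (int q ^ ((n + 1) div 2) - 1) + (int q - 1) * ?x"
  proof (cases "even n")
    case True
    then have "(Suc n + 1) div 2 = Suc (n div 2)" "(n + 1) div 2 = n div 2" by auto
    then show ?thesis using True by (simp add: algebra_simps)
  next
    case False
    then have "(Suc n + 1) div 2 = (n + 1) div 2" by (auto elim: oddE)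
    then show ?thesis using False by simp
  qed
  ultimately have "?c (Suc n) - (int q ^ ((Suc n + 1) div 2) - 1) * psize \<delta> =
     (?c n - (int q ^ ((n + 1) div 2) - 1) * psize \<delta>) + (int q - 1) * (?a - ?x * psize \<delta>)"
    by (simp only:) (simp add: algebra_simps)
  also have "\<bar>\<dots>\<bar> \<le> ?e + (int q - 1) * ?e"
  proof -
    have "\<bar>(int q - 1) * (?a - ?x * psize \<delta>)\<bar> \<le> (int q - 1) * ?e"
      unfolding abs_mult using A order_ge_3 by (intro mult_mono) auto
    then show ?thesis using IH by linarith
  qed
  also have "\<dots> = 7 * int n * int q ^ \<delta> * int q ^ Suc n" by (simp add: algebra_simps)
  also have "\<dots> \<le> 7 * int (Suc n) * int q ^ \<delta> * int q ^ Suc n"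
    by (intro mult_right_mono) auto
  finally show ?case .
qed

definition U :: "nat \<Rightarrow> nat \<Rightarrow> int" where
  "U g d = (\<Sum>P\<in>prime_polys_deg R d. int d * hsum (\<lambda>f. leg f P) (2 * g + 1))"

text \<open>The contribution of squares to \<open>U g (2 * \<delta>)\<close>, with
  \<open>psize \<delta>\<close> replaced by q^(2\<delta>); the three cases are those of
  \<open>hsum_leg_cases\<close>.\<close>

definition U_main :: "nat \<Rightarrow> nat \<Rightarrow> int" where
  "U_main g \<delta> = (if g mod (2 * \<delta>) = \<delta> then int q ^ (3 * \<delta>)
     else if g mod (2 * \<delta>) < \<delta> then - ((int q - 1) * int q ^ (2 * (g mod (2 * \<delta>)) + \<delta>)) else 0)"

lemma psize_bounds:
  assumes "\<delta> \<ge> 1" shows "psize \<delta> \<le> int q ^ (2 * \<delta>)" "int q ^ (2 * \<delta>) \<le> psize \<delta> + 2 * int q ^ \<delta>"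
proof -
  have "psize \<delta> = int (2 * \<delta> * card (prime_polys_deg R (2 * \<delta>)))" by (simp add: psize_def)
  moreover have "int (2 * \<delta> * card (prime_polys_deg R (2 * \<delta>))) \<le> int (q ^ (2 * \<delta>))"
    using card_prime_le[of "2 * \<delta>"] by linarith
  moreover have "int (q ^ (2 * \<delta>)) \<le> int (2 * \<delta> * card (prime_polys_deg R (2 * \<delta>)) + 2 * q ^ \<delta>)"
    using card_prime_ge[OF assms] by linarith
  ultimately show "psize \<delta> \<le> int q ^ (2 * \<delta>)" "int q ^ (2 * \<delta>) \<le> psize \<delta> + 2 * int q ^ \<delta>" by simp_all
qed

lemma U_bound:
  assumes \<delta>: "\<delta> \<ge> 1"
  shows "\<bar>U g (2 * \<delta>) - U_main g \<delta>\<bar> \<le> 128 * int \<delta> * int q ^ (2 * \<delta>)"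
proof -
  let ?T = "prime_polys_deg R (2 * \<delta>)"
  define \<rho> where "\<rho> = g mod (2 * \<delta>)"
  have T: "P \<in> prime_polys R" "degree P = 2 * \<delta>" if "P \<in> ?T" for P using that by (auto simp: prime_deg_iff)
  note cas = hsum_leg_cases[OF T(1) T(2) \<rho>_def]
  have q3: "int q \<ge> 3" using order_ge_3 by simp
  consider "\<rho> > \<delta>" | "\<rho> = \<delta>" | "\<rho> < \<delta>" by linarith
  then show ?thesis
  proof cases
    case 1
    then have "U g (2 * \<delta>) = 0" unfolding U_def using cas(1) by (intro sum.neutral) simp
    then show ?thesis using 1 by (simp add: U_main_def \<rho>_def[symmetric])
  next
    case 2
    have "U g (2 * \<delta>) = psize \<delta> * int q ^ \<delta>"
      unfolding U_def psize_def using cas(2)[OF _ _ 2] by simp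
    moreover have "int q ^ (3 * \<delta>) = int q ^ (2 * \<delta>) * int q ^ \<delta>" by (simp add: power_add[symmetric])
    moreover have "\<bar>psize \<delta> - int q ^ (2 * \<delta>)\<bar> * int q ^ \<delta> \<le> 2 * int q ^ \<delta> * int q ^ \<delta>"
      using psize_bounds[OF \<delta>] by (intro mult_right_mono) auto
    ultimately have "\<bar>U g (2 * \<delta>) - int q ^ (3 * \<delta>)\<bar> \<le> 2 * int q ^ \<delta> * int q ^ \<delta>"
      by (simp add: left_diff_distrib[symmetric] abs_mult)
    also have "\<dots> = 2 * int q ^ (2 * \<delta>)" by (simp only: mult_2[of \<delta>] power_add mult.assoc)
    also have "\<dots> \<le> 128 * int \<delta> * int q ^ (2 * \<delta>)" using \<delta> by (intro mult_right_mono) auto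
    finally show ?thesis using 2 by (simp add: U_main_def \<rho>_def[symmetric])
  next
    case 3
    define t where "t = \<delta> - \<rho>"
    have t: "t \<ge> 1" "\<delta> = \<rho> + t" using 3 by (auto simp: t_def)
    let ?c = "\<lambda>n. \<Sum>P\<in>?T. int (2 * \<delta>) * C P n"
    have "(int q - 1) * int q ^ \<delta> * U g (2 * \<delta>) = (\<Sum>P\<in>?T. int (2 * \<delta>) * ((int q - 1) * int q ^ \<delta> * hsum (\<lambda>f. leg f P) (2 * g + 1)))"
      unfolding U_def sum_distrib_left by (intro sum.cong refl) (simp add: mult.left_commute)
    also have "\<dots> = (\<Sum>P\<in>?T. int (2 * \<delta>) * (int q ^ (2 * \<rho>) *
        (int q ^ 2 * C P (2 * t - 2) - int q * C P (2 * t - 1) - int q * C P (2 * t) + C P (2 * t + 1))))"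
      using cas(3)[OF _ _ 3, of _ "2 * t"] by (intro sum.cong refl) (simp add: t_def)
    also have "\<dots> = int q ^ (2 * \<rho>) * (int q ^ 2 * ?c (2 * t - 2) - int q * ?c (2 * t - 1) - int q * ?c (2 * t) + ?c (2 * t + 1))"
      unfolding sum_distrib_left sum_subtractf[symmetric] sum.distrib[symmetric]
      by (intro sum.cong refl) (simp add: algebra_simps)
    finally have eq: "(int q - 1) * int q ^ \<delta> * U g (2 * \<delta>) =
      int q ^ (2 * \<rho>) * (int q ^ 2 * ?c (2 * t - 2) - int q * ?c (2 * t - 1) - int q * ?c (2 * t) + ?c (2 * t + 1))" .
    obtain u where u: "t = Suc u" using t by (cases t) auto
    \<comment> \<open>A common bound for the four errors from \<open>sum_C\<close>: the weights q^2,
      q, q, 1 make up for the shorter lengths, so that i + n \<le> 2t + 1 in each of them.\<close>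
    define E where "E = 7 * int (2 * \<delta> + 1) * int q ^ \<delta> * int q ^ (2 * t + 1)"
    define z where "z n = ?c n - (int q ^ ((n + 1) div 2) - 1) * psize \<delta>" for n
    have zb: "\<bar>z n\<bar> \<le> 7 * int n * int q ^ \<delta> * int q ^ n" if "n \<le> 4 * \<delta>" for n
      unfolding z_def by (rule sum_C[OF \<delta> that])
    have zE: "int q ^ i * \<bar>z n\<bar> \<le> E" if "n \<le> 2 * t + 1" "i + n \<le> 2 * t + 1" for n i
    proof -
      have "int q ^ i * \<bar>z n\<bar> \<le> int q ^ i * (7 * int n * int q ^ \<delta> * int q ^ n)"
        using zb[of n] that t \<delta> by (intro mult_left_mono) auto
      also have "\<dots> = 7 * int n * int q ^ \<delta> * int q ^ (i + n)" by (simp add: power_add)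
      also have "\<dots> \<le> E" unfolding E_def using that t q3 by (intro mult_mono power_increasing) auto
      finally show ?thesis .
    qed
    \<comment> \<open>The square contributions, each of size about q^(t + 1) after weighting, cancel
      down to a quantity of order q^2.\<close>
    have main: "int q ^ 2 * (int q ^ u - 1) - int q * (int q ^ t - 1) - int q * (int q ^ t - 1) + (int q ^ (t + 1) - 1) = - ((int q - 1) ^ 2)"
      unfolding u by (simp add: power2_eq_square algebra_simps)
    have d1: "(2 * t - 2 + 1) div 2 = u" "(2 * t - 1 + 1) div 2 = t" "(2 * t + 1) div 2 = t" "(2 * t + 1 + 1) div 2 = t + 1"
      using u by auto
    have "int q ^ 2 * ?c (2 * t - 2) - int q * ?c (2 * t - 1) - int q * ?c (2 * t) + ?c (2 * t + 1) =
      (int q ^ 2 * (int q ^ u - 1) - int q * (int q ^ t - 1) - int q * (int q ^ t - 1) + (int q ^ (t + 1) - 1)) * psize \<delta>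
       + (int q ^ 2 * z (2 * t - 2) - int q * z (2 * t - 1) - int q * z (2 * t) + z (2 * t + 1))"
      unfolding z_def d1 by (simp add: algebra_simps)
    then have eq2: "(int q - 1) * int q ^ \<delta> * U g (2 * \<delta>) = int q ^ (2 * \<rho>) * (- ((int q - 1) ^ 2 * psize \<delta>)
       + (int q ^ 2 * z (2 * t - 2) - int q * z (2 * t - 1) - int q * z (2 * t) + z (2 * t + 1)))"
      unfolding eq main by simp
    have zz: "\<bar>int q ^ 2 * z (2 * t - 2) - int q * z (2 * t - 1) - int q * z (2 * t) + z (2 * t + 1)\<bar> \<le> 4 * E"
    proof -
      have "\<bar>int q ^ 2 * z (2 * t - 2)\<bar> \<le> E" using zE[of "2 * t - 2" 2] t by (simp add: abs_mult)
      moreover have "\<bar>int q * z (2 * t - 1)\<bar> \<le> E" using zE[of "2 * t - 1" 1] t by (simp add: abs_mult)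
      moreover have "\<bar>int q * z (2 * t)\<bar> \<le> E" using zE[of "2 * t" 1] by (simp add: abs_mult)
      moreover have "\<bar>z (2 * t + 1)\<bar> \<le> E" using zE[of "2 * t + 1" 0] by simp
      ultimately show ?thesis by linarith
    qed
    let ?w = "int q ^ 2 * z (2 * t - 2) - int q * z (2 * t - 1) - int q * z (2 * t) + z (2 * t + 1)"
    have "(int q - 1) * int q ^ \<delta> * (U g (2 * \<delta>) + (int q - 1) * int q ^ (2 * \<rho> + \<delta>)) =
      int q ^ (2 * \<rho>) * ?w + (int q - 1) ^ 2 * int q ^ (2 * \<rho>) * (int q ^ (2 * \<delta>) - psize \<delta>)"
      unfolding distrib_left eq2 by (simp only: power_add mult_2[of \<delta>] mult_2[of \<rho>]) (simp add: power2_eq_square algebra_simps)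
    then have eq3: "\<bar>(int q - 1) * int q ^ \<delta> * (U g (2 * \<delta>) + (int q - 1) * int q ^ (2 * \<rho> + \<delta>))\<bar> =
      \<bar>int q ^ (2 * \<rho>) * ?w + (int q - 1) ^ 2 * int q ^ (2 * \<rho>) * (int q ^ (2 * \<delta>) - psize \<delta>)\<bar>"
      by (simp only:)
    have cn: "(int q - 1) * int q ^ \<delta> \<ge> 0" using q3 by simp
    have "(int q - 1) * int q ^ \<delta> * \<bar>U g (2 * \<delta>) + (int q - 1) * int q ^ (2 * \<rho> + \<delta>)\<bar> =
      \<bar>int q ^ (2 * \<rho>) * ?w + (int q - 1) ^ 2 * int q ^ (2 * \<rho>) * (int q ^ (2 * \<delta>) - psize \<delta>)\<bar>"
      using eq3 unfolding abs_mult[of "(int q - 1) * int q ^ \<delta>"] abs_of_nonneg[OF cn] .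
    also have "\<dots> \<le> int q ^ (2 * \<rho>) * (4 * E) + (int q - 1) ^ 2 * int q ^ (2 * \<rho>) * (2 * int q ^ \<delta>)"
    proof (rule order_trans[OF abs_triangle_ineq], rule add_mono)
      show "\<bar>int q ^ (2 * \<rho>) * ?w\<bar> \<le> int q ^ (2 * \<rho>) * (4 * E)" unfolding abs_mult using zz by (intro mult_mono) auto
      show "\<bar>(int q - 1) ^ 2 * int q ^ (2 * \<rho>) * (int q ^ (2 * \<delta>) - psize \<delta>)\<bar> \<le> (int q - 1) ^ 2 * int q ^ (2 * \<rho>) * (2 * int q ^ \<delta>)"
        unfolding abs_mult using psize_bounds[OF \<delta>] by (intro mult_mono) auto
    qed
    \<comment> \<open>126 is 14 times 9, from 4E together with 2\<delta> + 1 \<le> 3\<delta> and 2q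
      \<le> 3(q - 1). The other 2 pays for replacing \<open>psize \<delta>\<close> by
      q^(2\<delta>).\<close>
    also have "\<dots> \<le> (int q - 1) * int q ^ \<delta> * (128 * int \<delta> * int q ^ (2 * \<delta>))"
    proof -
      have r1: "int q ^ (2 * \<rho>) * (4 * E) = 28 * int (2 * \<delta> + 1) * int q ^ \<delta> * (int q ^ (2 * \<delta>) * int q)"
      proof -
        have "int q ^ (2 * \<rho>) * int q ^ (2 * t + 1) = int q ^ (2 * \<delta>) * int q"
          unfolding t(2) distrib_left power_add by simp
        moreover have "a * (4 * (7 * c * d * b)) = 28 * c * d * (a * b)" for a b c d :: int by simp
        ultimately show ?thesis unfolding E_def by (simp only:)
      qed
      have f1: "int (2 * \<delta> + 1) \<le> 3 * int \<delta>" using \<delta> by simp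
      have f2: "2 * int q \<le> 3 * (int q - 1)" using q3 by simp
      have f3: "int (2 * \<delta> + 1) * (2 * int q) \<le> (3 * int \<delta>) * (3 * (int q - 1))"
        by (rule mult_mono[OF f1 f2]) simp_all
      have "28 * x * y = 14 * (x * (2 * y))" "126 * x * y = 14 * ((3 * x) * (3 * y))" for x y :: int by simp_all
      then have "28 * int (2 * \<delta> + 1) * int q \<le> 126 * int \<delta> * (int q - 1)"
        using mult_left_mono[OF f3, of 14] by (simp only:)
      then have b1: "int q ^ (2 * \<rho>) * (4 * E) \<le> 126 * int \<delta> * (int q - 1) * (int q ^ \<delta> * int q ^ (2 * \<delta>))"
        unfolding r1 using mult_right_mono[of "28 * int (2 * \<delta> + 1) * int q" "126 * int \<delta> * (int q - 1)" "int q ^ \<delta> * int q ^ (2 * \<delta>)"]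
        by (simp add: mult_ac)
      have "(int q - 1) * int q ^ (2 * \<rho>) \<le> int q * int q ^ (2 * \<rho>)" by (intro mult_right_mono) auto
      also have "\<dots> = int q ^ (2 * \<rho> + 1)" by simp
      also have "\<dots> \<le> int q ^ (2 * \<delta>)" using t q3 by (intro power_increasing) auto
      also have "\<dots> \<le> int \<delta> * int q ^ (2 * \<delta>)" using \<delta> mult_right_mono[of 1 "int \<delta>" "int q ^ (2 * \<delta>)"] by simp
      finally have "((int q - 1) * int q ^ (2 * \<rho>)) * ((int q - 1) * (2 * int q ^ \<delta>)) \<le> (int \<delta> * int q ^ (2 * \<delta>)) * ((int q - 1) * (2 * int q ^ \<delta>))"
        by (rule mult_right_mono) (use q3 in simp)
      moreover have "(w * r) * (w * (2 * y)) = w ^ 2 * r * (2 * y)" "(x * z) * (w * (2 * y)) = 2 * x * w * (y * z)"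
        "126 * x * w * (y * z) + 2 * x * w * (y * z) = w * y * (128 * x * z)" for w r x y z :: int
        by (simp_all add: power2_eq_square)
      ultimately show ?thesis using b1 by (metis add_mono)
    qed
    finally have "\<bar>U g (2 * \<delta>) + (int q - 1) * int q ^ (2 * \<rho> + \<delta>)\<bar> \<le> 128 * int \<delta> * int q ^ (2 * \<delta>)"
      by (rule mult_left_le_imp_le) (use q3 in simp)
    then show ?thesis using 3 by (simp add: U_main_def \<rho>_def[symmetric])
  qed
qed

section \<open>Primes of odd degree\<close>

text \<open>The substitution \<open>f(x) \<mapsto> f(c x)\<close>. For a nonresidue \<open>c\<close> it flips the sign of the Legendre symbol when both degrees are odd, so primes of odd degree cancel on average.\<close>

definition scale_var :: "'a \<Rightarrow> 'a list \<Rightarrow> 'a list" where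
  "scale_var c f = map (\<lambda>i. c [^] i \<otimes> coeff f i) (rev [0..<length f])"

lemma length_scale_var [simp]: "length (scale_var c f) = length f" by (simp add: scale_var_def)

lemma scale_var_nil_iff [simp]: "scale_var c f = [] \<longleftrightarrow> f = []"
  using length_scale_var[of c f] by (metis length_0_conv)

lemma coeff_map_rev: "coeff (map g (rev [0..<n])) i = (if i < n then g i else \<zero>)"
  by (induction n) auto

lemma coeff_scale_var:
  assumes "c \<in> carrier R" "f \<in> carrier S" shows "coeff (scale_var c f) i = c [^] i \<otimes> coeff f i"
  using assms coeff_length[of f i] by (simp add: scale_var_def coeff_map_rev)

lemma nonzero_pow: "c \<in> carrier R \<Longrightarrow> c \<noteq> \<zero> \<Longrightarrow> c [^] (n::nat) \<in> carrier R \<and> c [^] n \<noteq> \<zero>"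
  using Units_pow_closed[of c n] by (auto simp: field_Units)

lemma hd_scale_var:
  assumes "c \<in> carrier R" "f \<in> carrier S" "f \<noteq> []" shows "hd (scale_var c f) = c [^] degree f \<otimes> hd f"
proof -
  have ne: "scale_var c f \<noteq> []" using assms by simp
  have "hd (scale_var c f) = coeff (scale_var c f) (degree f)" using lead_coeff_simp[OF ne] by simp
  then show ?thesis using coeff_scale_var[OF assms(1,2)] lead_coeff_simp[OF assms(3)] by simp
qed

lemma scale_var_closed:
  assumes "c \<in> carrier R" "c \<noteq> \<zero>" "f \<in> carrier S" shows "scale_var c f \<in> carrier S"
proof (cases "f = []")
  case False
  have "set (scale_var c f) \<subseteq> carrier R" using assms by (auto simp: scale_var_def)
  moreover have "hd (scale_var c f) \<noteq> \<zero>"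
    using hd_scale_var[OF assms(1,3) False] hd_closed[OF assms(3) False] nonzero_pow[OF assms(1,2)] by (simp add: integral_iff)
  ultimately show ?thesis by (simp add: univ_poly_carrier[symmetric] polynomial_def)
qed (simp add: scale_var_def)

lemma scale_var_hom:
  assumes c: "c \<in> carrier R" "c \<noteq> \<zero>" shows "ring_hom_ring S S (scale_var c)"
proof (rule ring_hom_ringI2[OF S.ring_axioms S.ring_axioms], rule ring_hom_memI)
  fix f assume "f \<in> carrier S" then show "scale_var c f \<in> carrier S" by (rule scale_var_closed[OF c])
next
  fix f h assume fh: "f \<in> carrier S" "h \<in> carrier S"
  show "scale_var c (f \<boxplus> h) = scale_var c f \<boxplus> scale_var c h"
    using fh c scale_var_closed[OF c] by (intro coeff_eqI) (simp_all add: coeff_scale_var coeff_add r_distr)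
  show "scale_var c (f \<boxtimes> h) = scale_var c f \<boxtimes> scale_var c h"
  proof (rule coeff_eqI)
    fix i
    have "coeff (scale_var c f \<boxtimes> scale_var c h) i = (\<Oplus>k\<in>{..i}. coeff (scale_var c f) k \<otimes> coeff (scale_var c h) (i - k))"
      using fh scale_var_closed[OF c] by (simp add: coeff_mult)
    also have "\<dots> = (\<Oplus>k\<in>{..i}. c [^] i \<otimes> (coeff f k \<otimes> coeff h (i - k)))"
    proof (rule finsum_cong')
      fix k assume k: "k \<in> {..i}"
      have ci: "c [^] i = c [^] k \<otimes> c [^] (i - k)" using k c by (simp add: nat_pow_mult)
      show "coeff (scale_var c f) k \<otimes> coeff (scale_var c h) (i - k) = c [^] i \<otimes> (coeff f k \<otimes> coeff h (i - k))"
        unfolding ci coeff_scale_var[OF c(1) fh(1)] coeff_scale_var[OF c(1) fh(2)] using fh c by (simp add: m_ac)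
    qed (use fh c in auto)
    also have "\<dots> = c [^] i \<otimes> (\<Oplus>k\<in>{..i}. coeff f k \<otimes> coeff h (i - k))"
      using fh c by (intro finsum_rdistr[symmetric]) auto
    also have "\<dots> = coeff (scale_var c (f \<boxtimes> h)) i" using fh c by (simp add: coeff_scale_var coeff_mult)
    finally show "coeff (scale_var c (f \<boxtimes> h)) i = coeff (scale_var c f \<boxtimes> scale_var c h) i" ..
  qed (use fh scale_var_closed[OF c] in auto)
next
  show "scale_var c \<one>\<^bsub>S\<^esub> = \<one>\<^bsub>S\<^esub>" by (simp add: one_S scale_var_def)
qed

lemma scale_var_inv:
  assumes c: "c \<in> carrier R" "c \<noteq> \<zero>" and f: "f \<in> carrier S" shows "scale_var (inv c) (scale_var c f) = f"
proof (rule coeff_eqI)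
  have u: "c \<in> Units R" using c by (simp add: field_Units)
  have i: "inv c \<in> carrier R" "inv c \<noteq> \<zero>" using Units_inv_Units[OF u] by (auto simp: field_Units)
  show "scale_var (inv c) (scale_var c f) \<in> carrier S" by (rule scale_var_closed[OF i scale_var_closed[OF c f]])
  fix n :: nat
  have "inv c [^] n \<otimes> c [^] n = \<one>" using nat_pow_distrib[OF i(1) c(1), of n] u by simp
  then show "coeff (scale_var (inv c) (scale_var c f)) n = coeff f n"
    using coeff_scale_var[OF i(1) scale_var_closed[OF c f]] coeff_scale_var[OF c(1) f] i c f by (simp add: m_assoc[symmetric])
qed (rule f)

text \<open>The substitution multiplies the leading coefficient by c^(degree f). The constant that
  undoes this is the source of the sign in \<open>sum_msum_leg_odd\<close>.\<close>

definition scale_monic :: "'a \<Rightarrow> 'a list \<Rightarrow> 'a list" where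
  "scale_monic c f = [inv (c [^] degree f)] \<boxtimes> scale_var c f"

context
  fixes c assumes c: "c \<in> carrier R" "c \<noteq> \<zero>"
begin

interpretation scale_var: ring_hom_ring S S "scale_var c" by (rule scale_var_hom[OF c])

lemma inv_pow: "inv (c [^] (n::nat)) \<in> carrier R" "inv (c [^] n) \<noteq> \<zero>" "inv (c [^] n) \<otimes> c [^] n = \<one>"
proof -
  have u: "c [^] n \<in> Units R" using Units_pow_closed[of c n] c by (simp add: field_Units)
  have "inv (c [^] n) \<in> Units R" by (rule Units_inv_Units[OF u])
  then show "inv (c [^] n) \<in> carrier R" "inv (c [^] n) \<noteq> \<zero>" by (auto simp: field_Units)
  show "inv (c [^] n) \<otimes> c [^] n = \<one>" by (rule Units_l_inv[OF u])
qed

lemma scale_monic_monic: "f \<in> monic_polys R \<Longrightarrow> scale_monic c f \<in> monic_polys R \<and> length (scale_monic c f) = length f"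
proof -
  assume f: "f \<in> monic_polys R"
  have fc: "f \<in> carrier S" "f \<noteq> []" "hd f = \<one>" using f by (auto simp: monic_iff)
  have tc: "scale_var c f \<in> carrier S" by (rule scale_var_closed[OF c fc(1)])
  have cc: "[inv (c [^] degree f)] \<in> carrier S" by (rule const_closed[OF inv_pow(1,2)])
  have "hd (scale_monic c f) = inv (c [^] degree f) \<otimes> (c [^] degree f \<otimes> \<one>)"
    unfolding scale_monic_def using lead_coeff_mult[OF cc tc] fc hd_scale_var[OF c(1) fc(1,2)] by simp
  then have "hd (scale_monic c f) = \<one>" using inv_pow(3) nonzero_pow[OF c] by simp
  moreover have "length (scale_monic c f) = length f" unfolding scale_monic_def using length_const_mult[OF inv_pow(1,2) tc] by simp
  moreover have "scale_monic c f \<in> carrier S" unfolding scale_monic_def using cc tc by simp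
  ultimately show ?thesis using fc(2) by (auto simp: monic_iff)
qed

lemma scale_monic_pdivides:
  assumes "P \<in> carrier S" "y \<in> carrier S" shows "scale_monic c P pdivides scale_var c y \<longleftrightarrow> P pdivides y"
proof
  let ?u = "inv (c [^] degree P)"
  have cc: "[?u] \<in> carrier S" by (rule const_closed[OF inv_pow(1,2)])
  have nz: "c [^] degree P \<in> carrier R" "c [^] degree P \<noteq> \<zero>" using nonzero_pow[OF c] by auto
  have cc': "[c [^] degree P] \<in> carrier S" by (rule const_closed[OF nz])
  have one: "[?u] \<boxtimes> [c [^] degree P] = \<one>\<^bsub>S\<^esub>" using const_mult[OF inv_pow(1,2) cc'] inv_pow(3) by (simp add: one_S)
  have tc: "scale_var c P \<in> carrier S" "scale_var c y \<in> carrier S" using scale_var_closed[OF c] assms by auto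
  have i: "inv c \<in> carrier R" "inv c \<noteq> \<zero>" using inv_pow(1,2)[of 1] c by auto
  interpret ti: ring_hom_ring S S "scale_var (inv c)" by (rule scale_var_hom[OF i])
  {
    assume "P pdivides y"
    then obtain k where k: "k \<in> carrier S" "y = P \<boxtimes> k" by (rule pdividesE)
    have kc: "scale_var c k \<in> carrier S" by (rule scale_var_closed[OF c k(1)])
    have "scale_var c y = \<one>\<^bsub>S\<^esub> \<boxtimes> (scale_var c P \<boxtimes> scale_var c k)" using k assms tc kc by simp
    also have "\<dots> = scale_monic c P \<boxtimes> ([c [^] degree P] \<boxtimes> scale_var c k)"
      unfolding one[symmetric] scale_monic_def using cc cc' tc kc by (simp add: S.m_ac)
    finally show "scale_monic c P pdivides scale_var c y" using cc' kc by (intro pdividesI) auto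
  }
  assume "scale_monic c P pdivides scale_var c y"
  then obtain k where k: "k \<in> carrier S" "scale_var c y = scale_monic c P \<boxtimes> k" by (rule pdividesE)
  have kc: "scale_var (inv c) ([?u] \<boxtimes> k) \<in> carrier S" using scale_var_closed[OF i] cc k by simp
  have "scale_var c y = scale_var c P \<boxtimes> ([?u] \<boxtimes> k)" using k cc tc unfolding scale_monic_def by (simp add: S.m_ac)
  then have "scale_var (inv c) (scale_var c y) = scale_var (inv c) (scale_var c P) \<boxtimes> scale_var (inv c) ([?u] \<boxtimes> k)" using tc cc k by simp
  then have "y = P \<boxtimes> scale_var (inv c) ([?u] \<boxtimes> k)" using scale_var_inv[OF c] assms by simp
  then show "P pdivides y" using kc by (rule pdividesI[rotated])
qed

text \<open>Let T be a prime factor of the image, with cofactor k. Pulled back by the inverse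
  substitution, \<open>P\<close> divides the preimage of T or of k; the degree of k is too small, so
  the image divides T and equals it.\<close>

lemma scale_monic_prime: "P \<in> prime_polys R \<Longrightarrow> scale_monic c P \<in> prime_polys R"
proof -
  assume P: "P \<in> prime_polys R"
  have Pc: "P \<in> carrier S" by (rule prime_carrier[OF P])
  have m: "scale_monic c P \<in> monic_polys R" "length (scale_monic c P) = length P" using scale_monic_monic[OF prime_monic[OF P]] by auto
  have mc: "scale_monic c P \<in> carrier S" "degree (scale_monic c P) \<ge> 1" using m prime_degree[OF P] by (auto simp: monic_iff)
  obtain T where T: "T \<in> prime_polys R" "T pdivides scale_monic c P" using exists_prime_factor[OF mc] by blast
  have Tc: "T \<in> carrier S" by (rule prime_carrier[OF T(1)])
  have i: "inv c \<in> carrier R" "inv c \<noteq> \<zero>" using inv_pow(1,2)[of 1] c by auto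
  have ic: "inv (inv c) = c" using c by (simp add: field_Units)
  have tT: "scale_var (inv c) T \<in> carrier S" by (rule scale_var_closed[OF i Tc])
  have twT: "scale_var c (scale_var (inv c) T) = T" using scale_var_inv[OF i Tc] ic by simp
  have "scale_monic c P pdivides T"
  proof -
    obtain k where k: "k \<in> carrier S" "scale_monic c P = T \<boxtimes> k" using T(2) by (rule pdividesE)
    have ki: "scale_var (inv c) k \<in> carrier S" by (rule scale_var_closed[OF i k(1)])
    have "T \<boxtimes> k = scale_var c (scale_var (inv c) T \<boxtimes> scale_var (inv c) k)" using tT ki twT scale_var_inv[OF i k(1)] ic by simp
    moreover have "scale_monic c P pdivides T \<boxtimes> k" using k mc by (intro pdividesI[of "\<one>\<^bsub>S\<^esub>"]) auto
    ultimately have "P pdivides scale_var (inv c) T \<boxtimes> scale_var (inv c) k"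
      using scale_monic_pdivides[OF Pc, of "scale_var (inv c) T \<boxtimes> scale_var (inv c) k"] tT ki by simp
    then have "P pdivides scale_var (inv c) T \<or> P pdivides scale_var (inv c) k" using prime_pdivides_mult[OF P tT ki] by simp
    moreover have "\<not> P pdivides scale_var (inv c) k"
    proof
      assume "P pdivides scale_var (inv c) k"
      moreover have kn: "k \<noteq> []" using k m Tc monic_nonnil[OF m(1)] by auto
      ultimately have "degree P \<le> degree k"
        using pdivides_degree_le[OF _ Pc ki] by simp
      moreover have "degree (scale_monic c P) = degree T + degree k" using degree_mult[OF Tc k(1) prime_nonnil[OF T(1)] kn] k by simp
      ultimately show False using m(2) prime_degree[OF T(1)] by linarith
    qed
    ultimately show ?thesis using scale_monic_pdivides[OF Pc tT] twT by simp
  qed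
  then have "scale_monic c P \<sim>\<^bsub>S\<^esub> T" using T(2) by (simp add: associated_def pdivides_def)
  then have "scale_monic c P = T" using monic_associated[OF m(1) prime_monic[OF T(1)]] by simp
  then show ?thesis using T by simp
qed

lemma scale_monic_inj: "inj_on (scale_monic c) (monic_polys R)"
proof (rule inj_onI)
  fix a b assume ab: "a \<in> monic_polys R" "b \<in> monic_polys R" "scale_monic c a = scale_monic c b"
  have l: "length a = length b" using scale_monic_monic[OF ab(1)] scale_monic_monic[OF ab(2)] ab(3) by simp
  have ac: "a \<in> carrier S" "b \<in> carrier S" using ab by (auto simp: monic_iff)
  have "[inv (c [^] degree a)] \<boxtimes> scale_var c a = [inv (c [^] degree a)] \<boxtimes> scale_var c b"
    using ab(3) l by (simp add: scale_monic_def)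
  then have "scale_var c a = scale_var c b"
    using S.m_lcancel[of "[inv (c [^] degree a)]" "scale_var c a" "scale_var c b"] const_closed[OF inv_pow(1,2)] scale_var_closed[OF c] ac by simp
  then have "scale_var (inv c) (scale_var c a) = scale_var (inv c) (scale_var c b)" by (rule arg_cong)
  then show "a = b" unfolding scale_var_inv[OF c ac(1)] scale_var_inv[OF c ac(2)] .
qed

lemma scale_monic_bij_monic: "bij_betw (scale_monic c) (monic_polys_deg R n) (monic_polys_deg R n)"
proof -
  have inj: "inj_on (scale_monic c) (monic_polys_deg R n)"
    by (rule inj_on_subset[OF scale_monic_inj]) (auto simp: monic_deg_iff)
  have "scale_monic c ` monic_polys_deg R n \<subseteq> monic_polys_deg R n" using scale_monic_monic by (auto simp: monic_deg_iff)
  then show ?thesis using endo_inj_surj[OF finite_monic_deg _ inj] inj by (simp add: bij_betw_def)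
qed

lemma scale_monic_bij_prime: "bij_betw (scale_monic c) (prime_polys_deg R d) (prime_polys_deg R d)"
proof -
  have inj: "inj_on (scale_monic c) (prime_polys_deg R d)"
    by (rule inj_on_subset[OF scale_monic_inj]) (auto simp: prime_deg_iff prime_iff)
  have "scale_monic c ` prime_polys_deg R d \<subseteq> prime_polys_deg R d"
    using scale_monic_monic[OF prime_monic] scale_monic_prime by (auto simp: prime_deg_iff)
  then show ?thesis using endo_inj_surj[OF finite_prime_deg _ inj] inj by (simp add: bij_betw_def)
qed

text \<open>The automorphism carries the defining congruence modulo \<open>P\<close> to the one
  modulo \<open>scale_monic c P\<close>; it fixes the constants -1, 0, 1 and the exponent depends on
  the degree only.\<close>

lemma leg_scale_var:
  assumes P: "P \<in> prime_polys R" and f: "f \<in> carrier S"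
  shows "leg (scale_var c f) (scale_monic c P) = leg f P"
proof -
  have l: "length (scale_monic c P) = length P" using scale_monic_monic[OF prime_monic[OF P]] by simp
  let ?e = "(poly_norm R P - 1) div 2"
  have "(s \<in> {-1, 0, 1} \<and> scale_monic c P pdivides ((scale_var c f) \<up> ?e \<boxminus> add_pow S s \<one>\<^bsub>S\<^esub>)) \<longleftrightarrow>
      (s \<in> {-1, 0, 1} \<and> P pdivides (f \<up> ?e \<boxminus> add_pow S s \<one>\<^bsub>S\<^esub>))" for s :: int
  proof (cases "s \<in> {-1, 0, 1}")
    case True
    have a: "add_pow S s \<one>\<^bsub>S\<^esub> = (if s = 0 then \<zero>\<^bsub>S\<^esub> else if s = 1 then \<one>\<^bsub>S\<^esub> else \<ominus>\<^bsub>S\<^esub> \<one>\<^bsub>S\<^esub>)"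
      using True by (auto simp: add_pow_int_ge add_pow_int_lt)
    have ac: "add_pow S s \<one>\<^bsub>S\<^esub> \<in> carrier S" unfolding a by simp
    have "scale_var c (add_pow S s \<one>\<^bsub>S\<^esub>) = add_pow S s \<one>\<^bsub>S\<^esub>"
      unfolding a using scale_var.hom_zero scale_var.hom_one scale_var.hom_a_inv[OF S.one_closed] by auto
    then have "scale_var c (f \<up> ?e \<boxminus> add_pow S s \<one>\<^bsub>S\<^esub>) = (scale_var c f) \<up> ?e \<boxminus> add_pow S s \<one>\<^bsub>S\<^esub>"
      using f ac scale_var.hom_nat_pow[OF f, of ?e] scale_var.hom_a_inv[OF ac] by (simp add: a_minus_def)
    then show ?thesis using scale_monic_pdivides[OF prime_carrier[OF P], of "f \<up> ?e \<boxminus> add_pow S s \<one>\<^bsub>S\<^esub>"] f ac by simp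
  qed simp
  then show ?thesis unfolding legendre_poly_def poly_norm_def l by (simp only:)
qed

end

text \<open>Substituting in both f and P permutes the summands and multiplies each symbol by that of
  the constant c^(-j), which is (-1)^(jd) = -1 for a nonresidue c.\<close>

lemma sum_msum_leg_odd:
  assumes d: "odd d" and j: "odd j"
  shows "(\<Sum>P\<in>prime_polys_deg R d. msum (\<lambda>f. leg f P) j) = 0"
proof -
  obtain c where c0: "c \<in> carrier R" "qc c = -1" using exists_nonresidue by blast
  have c: "c \<in> carrier R" "c \<noteq> \<zero>" using c0 by auto
  let ?T = "prime_polys_deg R d" and ?M = "monic_polys_deg R j"
  have "(\<Sum>P\<in>?T. msum (\<lambda>f. leg f P) j) = (\<Sum>P\<in>?T. msum (\<lambda>f. leg f (scale_monic c P)) j)"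
    by (rule sum.reindex_bij_betw[OF scale_monic_bij_prime[OF c], symmetric])
  also have "\<dots> = (\<Sum>P\<in>?T. \<Sum>f\<in>?M. leg (scale_monic c f) (scale_monic c P))"
    unfolding msum_def by (intro sum.cong refl sum.reindex_bij_betw[OF scale_monic_bij_monic[OF c], symmetric])
  also have "\<dots> = (\<Sum>P\<in>?T. \<Sum>f\<in>?M. - leg f P)"
  proof (intro sum.cong refl)
    fix P f assume P: "P \<in> ?T" and f: "f \<in> ?M"
    have Pp: "P \<in> prime_polys R" "degree P = d" using P by (auto simp: prime_deg_iff)
    have fc: "f \<in> carrier S" "degree f = j" using f by (auto simp: monic_deg_iff monic_iff)
    have tp: "scale_monic c P \<in> prime_polys R" "degree (scale_monic c P) = d"
      using scale_monic_prime[OF c Pp(1)] scale_monic_monic[OF c prime_monic[OF Pp(1)]] Pp by auto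
    let ?u = "inv (c [^] j)"
    have qp: "qc (c [^] k) = (-1) ^ k" for k :: nat
      by (induction k) (simp_all add: qc_one qc_mult c c0)
    have "qc ?u * qc (c [^] j) = 1" using qc_mult[of ?u "c [^] j"] inv_pow[OF c, of j] c qc_one by simp
    then have "qc ?u = -1" using qp[of j] j by simp
    then have "leg [?u] (scale_monic c P) = -1" using leg_const[OF tp(1) inv_pow(1,2)[OF c]] tp(2) d by simp
    then show "leg (scale_monic c f) (scale_monic c P) = - leg f P"
      unfolding scale_monic_def[of c f] fc(2)
      using leg_mult[OF tp(1) const_closed[OF inv_pow(1,2)[OF c]] scale_var_closed[OF c fc(1)]] leg_scale_var[OF c Pp(1) fc(1)] by simp
  qed
  also have "\<dots> = - (\<Sum>P\<in>?T. msum (\<lambda>f. leg f P) j)" by (simp add: msum_def sum_negf)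
  finally show ?thesis by simp
qed

text \<open>The recursion for square-free sums lowers m by 2 or by 2d, so it never leaves the odd
  degrees, where \<open>sum_msum_leg_odd\<close> applies.\<close>

lemma U_odd: assumes d: "odd d" shows "U g d = 0"
proof -
  let ?T = "prime_polys_deg R d"
  have "(\<Sum>P\<in>?T. hsum (\<lambda>f. leg f P) m) = 0" if "odd m" for m
    using that
  proof (induction m rule: less_induct)
    case (less m)
    show ?case
    proof (cases "m < 2")
      case True
      have "hsum (\<lambda>f. leg f P) m = msum (\<lambda>f. leg f P) m" if "P \<in> ?T" for P
        using hsum_small[OF cmult_leg True] that by (simp add: prime_deg_iff)
      then show ?thesis using sum_msum_leg_odd[OF d less.prems] by simp
    next
      case False
      have "(\<Sum>P\<in>?T. hsum (\<lambda>f. leg f P) m) = (\<Sum>P\<in>?T. msum (\<lambda>f. leg f P) m - int q * msum (\<lambda>f. leg f P) (m - 2) +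
         (if 2 * d \<le> m then hsum (\<lambda>f. leg f P) (m - 2 * d) else 0))"
      proof (intro sum.cong refl)
        fix P assume "P \<in> ?T"
        then have P: "P \<in> prime_polys R" "degree P = d" by (auto simp: prime_deg_iff)
        have "hsum (\<lambda>f. leg f P) m = msum (\<lambda>f. leg f P) m - int q * msum (\<lambda>f. leg f P) (m - 2) +
         (if 2 * degree P \<le> m then hsum (\<lambda>f. leg f P) (m - 2 * degree P) else 0)"
          by (rule hsum_prime_recursion[OF P(1) _ cmult_leg[OF P(1)]])
             (use False leg_square[OF P(1)] in \<open>auto simp: monic_iff\<close>)
        then show "hsum (\<lambda>f. leg f P) m = msum (\<lambda>f. leg f P) m - int q * msum (\<lambda>f. leg f P) (m - 2) +
         (if 2 * d \<le> m then hsum (\<lambda>f. leg f P) (m - 2 * d) else 0)" unfolding P(2) .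
      qed
      also have "\<dots> = (\<Sum>P\<in>?T. msum (\<lambda>f. leg f P) m) - int q * (\<Sum>P\<in>?T. msum (\<lambda>f. leg f P) (m - 2)) +
         (if 2 * d \<le> m then (\<Sum>P\<in>?T. hsum (\<lambda>f. leg f P) (m - 2 * d)) else 0)"
        by (simp add: sum.distrib sum_subtractf sum_distrib_left)
      also have "(\<Sum>P\<in>?T. msum (\<lambda>f. leg f P) m) = 0" by (rule sum_msum_leg_odd[OF d less.prems])
      also have "(\<Sum>P\<in>?T. msum (\<lambda>f. leg f P) (m - 2)) = 0"
        by (rule sum_msum_leg_odd[OF d]) (use False less.prems in simp)
      also have "(if 2 * d \<le> m then (\<Sum>P\<in>?T. hsum (\<lambda>f. leg f P) (m - 2 * d)) else 0) = 0"
      proof (cases "2 * d \<le> m")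
        case True
        have "d \<noteq> 0" using d by (intro notI) simp
        then show ?thesis using less.IH[of "m - 2 * d"] True less.prems False by simp
      qed simp
      finally show ?thesis by simp
    qed
  qed
  from this[of "2 * g + 1"] show ?thesis by (simp add: U_def sum_distrib_left[symmetric])
qed

section \<open>Square-free polynomials prime to a given prime\<close>

definition hcop :: "'a list \<Rightarrow> nat \<Rightarrow> int" where
  "hcop P m = hsum (\<lambda>f. of_bool (\<not> P pdivides f)) m"

text \<open>A square-free multiple of \<open>P\<close> is \<open>P\<close> times a square-free
  polynomial prime to \<open>P\<close>.\<close>

lemma hcop_recursion:
  assumes P: "P \<in> prime_polys R" and m: "degree P \<le> m"
  shows "hcop P m + hcop P (m - degree P) = int (card (hyperelliptic R m))"
proof -
  have Pc: "P \<in> carrier S" "P \<noteq> []" using prime_carrier[OF P] prime_nonnil[OF P] by auto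
  have hc: "hcop P n = int (card {D \<in> hyperelliptic R n. \<not> P pdivides D})" for n
    by (simp add: hcop_def hsum_def of_bool_def sum.If_cases Int_def)
  have "{D \<in> hyperelliptic R m. P pdivides D} = (\<lambda>D. P \<boxtimes> D) ` {D \<in> hyperelliptic R (m - degree P). \<not> P pdivides D}"
  proof (intro equalityI subsetI)
    fix D assume "D \<in> {D \<in> hyperelliptic R m. P pdivides D}"
    then have D: "D \<in> monic_polys R" "degree D = m" "\<forall>T\<in>prime_polys R. v T D \<le> 1" "P pdivides D" by (auto simp: hyper_iff)
    obtain h where h: "h \<in> monic_polys R" "D = P \<boxtimes> h" "degree D = degree P + degree h"
      using monic_factor[OF prime_monic[OF P] D(1,4)] .
    have hcc: "h \<in> carrier S" "h \<noteq> []" using h by (auto simp: monic_iff)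
    have vv: "v T D = v T P + v T h" if "T \<in> prime_polys R" for T using v_mult[OF that Pc hcc] h(2) by simp
    have "v P h = 0" using vv[OF P] v_self[OF P P] D(3) P by force
    then have "\<not> P pdivides h" using v_pos_iff[OF P hcc] by simp
    moreover have "v T h \<le> 1" if "T \<in> prime_polys R" for T using vv[OF that] D(3) that by force
    moreover have "degree h = m - degree P" using h(3) D(2) by linarith
    ultimately show "D \<in> (\<lambda>D. P \<boxtimes> D) ` {D \<in> hyperelliptic R (m - degree P). \<not> P pdivides D}"
      using h by (auto simp: hyper_iff)
  next
    fix D assume "D \<in> (\<lambda>D. P \<boxtimes> D) ` {D \<in> hyperelliptic R (m - degree P). \<not> P pdivides D}"
    then obtain h where h: "h \<in> monic_polys R" "degree h = m - degree P" "\<forall>T\<in>prime_polys R. v T h \<le> 1" "\<not> P pdivides h" "D = P \<boxtimes> h"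
      by (auto simp: hyper_iff)
    have hcc: "h \<in> carrier S" "h \<noteq> []" using h by (auto simp: monic_iff)
    have "v T D \<le> 1" if T: "T \<in> prime_polys R" for T
    proof (cases "T = P")
      case True
      have "v P h = 0" using v_pos_iff[OF P hcc] h(4) by simp
      then show ?thesis using v_mult[OF P Pc hcc] v_self[OF P P] h(5) True by simp
    next
      case False
      then show ?thesis using v_mult[OF T Pc hcc] v_self[OF T P] h(3,5) T by simp
    qed
    moreover have "degree D = m" using degree_mult[OF Pc(1) hcc(1) Pc(2) hcc(2)] h m by simp
    ultimately show "D \<in> {D \<in> hyperelliptic R m. P pdivides D}"
      using monic_mult[OF prime_monic[OF P] h(1)] h(5) hcc by (auto simp: hyper_iff intro: pdividesI)
  qed
  moreover have "inj_on (\<lambda>D. P \<boxtimes> D) {D \<in> hyperelliptic R (m - degree P). \<not> P pdivides D}"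
    using S.m_lcancel[of P] Pc by (auto simp: inj_on_def hyper_iff monic_iff)
  ultimately have "card {D \<in> hyperelliptic R m. P pdivides D} = card {D \<in> hyperelliptic R (m - degree P). \<not> P pdivides D}"
    by (simp add: card_image)
  moreover have "card (hyperelliptic R m) = card {D \<in> hyperelliptic R m. \<not> P pdivides D} + card {D \<in> hyperelliptic R m. P pdivides D}"
  proof -
    have u: "hyperelliptic R m = {D \<in> hyperelliptic R m. \<not> P pdivides D} \<union> {D \<in> hyperelliptic R m. P pdivides D}" by blast
    show ?thesis by (subst u, rule card_Un_disjoint) auto
  qed
  ultimately show ?thesis unfolding hc by simp
qed

lemma card_hyper_small: "card (hyperelliptic R 0) = 1" "card (hyperelliptic R 1) = q"
proof -
  have "hsum (\<lambda>_. 1::int) n = int q ^ n" if "n < 2" for n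
    by (simp add: hsum_small[OF cmult_1 that] msum_1)
  from this[of 0] this[of 1] show "card (hyperelliptic R 0) = 1" "card (hyperelliptic R 1) = q"
    by (simp_all add: hsum_def)
qed

text \<open>If the number of square-free polynomials were exactly \<open>h\<close>, the density Q/(Q
  + 1) would solve the recursion. The error thus satisfies D(m) = b(m) - D(m - degree P), and b
  vanishes for m \<ge> 2, so its size does not grow.\<close>

lemma hcop_bound:
  assumes P: "P \<in> prime_polys R"
  defines "Q \<equiv> real q ^ degree P"
  shows "\<bar>real_of_int (hcop P m) - Q / (Q + 1) * (real q ^ m * (1 - 1 / real q))\<bar> \<le> 2"
proof -
  have q3: "real q \<ge> 3" using order_ge_3 by simp
  have Q1: "Q \<ge> 1" unfolding Q_def using q3 by simp
  define h where "h m = real q ^ m * (1 - 1 / real q)" for m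
  define b where "b m = real (card (hyperelliptic R m)) - h m" for m
  have b0: "b 0 = 1 / real q" "b 1 = 1"
    using q3 by (auto simp: b_def h_def card_hyper_small card_hyper_small[unfolded One_nat_def] field_simps)
  have b2: "b m = 0" if "m \<ge> 2" for m
  proof -
    have "real (card (hyperelliptic R m)) = real_of_int (int q ^ m - int q ^ (m - 1))"
      using card_hyper[OF that] by (metis of_int_of_nat_eq)
    also have "\<dots> = real q ^ m - real q ^ (m - 1)" by simp
    also have "\<dots> = h m" using that q3 by (cases m) (auto simp: h_def field_simps)
    finally show ?thesis by (simp add: b_def)
  qed
  define D where "D m = real_of_int (hcop P m) - Q / (Q + 1) * h m" for m
  have hnn: "0 \<le> h m" for m using q3 by (simp add: h_def)
  have small: "D m = b m + h m / (Q + 1)" if "m < degree P" for m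
  proof -
    have "hcop P m = int (card (hyperelliptic R m))"
    proof -
      have "\<not> P pdivides D" if "D \<in> hyperelliptic R m" for D
        using pdivides_degree_le[OF _ prime_carrier[OF P], of D] that \<open>m < degree P\<close> by (auto simp: hyper_iff monic_iff)
      then have "hcop P m = (\<Sum>D\<in>hyperelliptic R m. 1)" unfolding hcop_def hsum_def by (intro sum.cong refl) simp
      then show ?thesis by simp
    qed
    then show ?thesis using Q1 by (simp add: D_def b_def field_simps)
  qed
  have rec: "D m = b m - D (m - degree P)" if "degree P \<le> m" for m
  proof -
    have "real_of_int (hcop P m) + real_of_int (hcop P (m - degree P)) = real (card (hyperelliptic R m))"
      using hcop_recursion[OF P that] by (metis of_int_add of_int_of_nat_eq)
    moreover have hm: "h m = Q * h (m - degree P)"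
      using that by (simp add: h_def Q_def power_add[symmetric])
    have "Q / (Q + 1) * h m + Q / (Q + 1) * h (m - degree P) = h m"
    proof -
      have r: "Q / (Q + 1) * (Q + 1) = Q" using Q1 by simp
      have "x * (Q * k) + x * k = (x * (Q + 1)) * k" for x k :: real by (simp add: algebra_simps)
      then show ?thesis unfolding hm by (simp only: r)
    qed
    ultimately show ?thesis unfolding D_def b_def by linarith
  qed
  have sm: "h m / (Q + 1) \<le> 1" if "m < degree P" for m
  proof -
    have "h m \<le> real q ^ m * 1" unfolding h_def using q3 by (intro mult_left_mono) auto
    also have "\<dots> \<le> Q" unfolding Q_def using that q3 by (auto intro: power_increasing)
    finally show ?thesis using Q1 by simp
  qed
  have "\<bar>D m\<bar> \<le> 2"
  proof (induction m rule: less_induct)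
    case (less m)
    show ?case
    proof (cases "m < degree P")
      case True
      consider "m = 0" | "m = 1" | "m \<ge> 2" by linarith
      then have "0 \<le> b m \<and> b m \<le> 1" by cases (use b0 b2[of m] q3 in simp_all)
      moreover have "0 \<le> h m / (Q + 1)" using hnn Q1 by simp
      ultimately show ?thesis using small[OF True] sm[OF True] by linarith
    next
      case False
      then have le: "degree P \<le> m" by simp
      have lt: "m - degree P < m" using prime_degree[OF P] le by linarith
      show ?thesis
      proof (cases "m \<ge> 2")
        case True
        then show ?thesis using rec[OF le] b2[OF True] less.IH[OF lt] by simp
      next
        case False
        \<comment> \<open>The only step of the recursion with b(m) nonzero. Since D(0) lies between
          0 and 1, so does D(1) = 1 - D(0).\<close>
        then have m1: "m = 1" "degree P = 1" using le prime_degree[OF P] by linarith+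
        have "D 0 = b 0 + h 0 / (Q + 1)" by (rule small) (use m1 in simp)
        moreover have "h 0 / (Q + 1) \<le> 1 / 2" 
          by (rule frac_le) (use q3 Q1 in \<open>simp_all add: h_def\<close>)
        moreover have "0 \<le> h 0 / (Q + 1)" using hnn Q1 by simp
        moreover have "1 / real q \<le> 1 / 2" using q3 by (simp add: field_simps)
        moreover have "0 \<le> 1 / real q" by simp
        ultimately have "0 \<le> D 0" "D 0 \<le> 1" unfolding b0(1) by linarith+
        moreover have "D 1 = b 1 - D 0" using rec[OF le] m1 by simp
        ultimately show ?thesis using b0(2) m1(1) by simp
      qed
    qed
  qed
  then show ?thesis by (simp add: D_def h_def)
qed

end

section \<open>The explicit formula\<close>

text \<open>Divide the difference by u^n, its lower coefficients being zero, and let u tend to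
  0.\<close>

lemma powser_coeffs_unique:
  fixes a b :: "nat \<Rightarrow> complex"
  assumes r: "r > 0" and a: "\<And>u. norm u < r \<Longrightarrow> (\<lambda>n. a n * u ^ n) sums f u"
    and b: "\<And>u. norm u < r \<Longrightarrow> (\<lambda>n. b n * u ^ n) sums f u"
  shows "a n = b n"
proof (induction n rule: less_induct)
  case (less n)
  define c where "c k = a k - b k" for k
  have c0: "c k = 0" if "k < n" for k using less that by (simp add: c_def)
  have cs: "(\<lambda>k. c k * u ^ k) sums 0" if "norm u < r" for u
    using sums_diff[OF a[OF that] b[OF that]] by (simp add: c_def left_diff_distrib)
  have "(\<lambda>k. c (k + n) * u ^ k) sums 0" if u: "u \<noteq> 0" "norm u < r" for u
  proof -
    have "(\<lambda>k. c (k + n) * u ^ (k + n)) sums (0 - (\<Sum>k<n. c k * u ^ k))"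
      using sums_split_initial_segment[OF cs[OF u(2)], of n] by simp
    also have "(\<Sum>k<n. c k * u ^ k) = 0" using c0 by (intro sum.neutral) simp
    finally have "(\<lambda>k. c (k + n) * u ^ (k + n) / u ^ n) sums (0 / u ^ n)" by (intro sums_divide) simp
    then show ?thesis using u by (simp add: power_add)
  qed
  from powser_limit_0_strong[OF r this] have "((\<lambda>u. 0) \<longlongrightarrow> c (0 + n)) (at (0::complex))" by simp
  moreover have "((\<lambda>u. 0) \<longlongrightarrow> 0) (at (0::complex))" by simp
  ultimately have "c (0 + n) = 0" by (rule tendsto_unique[OF at_neq_bot])
  then show ?case by (simp add: c_def)
qed

text \<open>Newton's identities as u F'/F = minus the series of power sums, proved one factor at a
  time: each adds its own geometric series. The second part links the formal product to the analytic
  one.\<close>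

lemma newton_power_sums:
  fixes \<alpha> :: "nat \<Rightarrow> complex" and A :: "nat set"
  assumes "finite A"
  defines "F \<equiv> (\<Prod>j\<in>A. 1 - fps_const (\<alpha> j) * fps_X)"
  shows "fps_X * fps_deriv F = - (F * Abs_fps (\<lambda>i. if i = 0 then 0 else \<Sum>j\<in>A. \<alpha> j ^ i))"
    and "(\<lambda>n. fps_nth F n * u ^ n) sums (\<Prod>j\<in>A. 1 - u * \<alpha> j)"
  using assms(1) unfolding F_def
proof (induction A rule: finite_induct)
  case empty
  {
    case 1
    have "Abs_fps (\<lambda>i. if i = 0 then 0 else \<Sum>j\<in>{}. \<alpha> j ^ i) = (0 :: complex fps)" by (simp add: fps_eq_iff)
    then show ?case by simp
  next
    case 2
    have "(\<lambda>n. fps_nth 1 n * u ^ n) sums (\<Sum>n\<in>{0}. fps_nth 1 n * u ^ n)"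
      by (rule sums_finite) auto
    then show ?case by simp
  }
next
  case (insert a A)
  let ?F = "\<Prod>j\<in>A. 1 - fps_const (\<alpha> j) * fps_X"
  let ?G = "1 - fps_const (\<alpha> a) * fps_X"
  let ?T = "\<lambda>A. Abs_fps (\<lambda>i. if i = 0 then 0 else \<Sum>j\<in>A. \<alpha> j ^ i)"
  let ?t = "Abs_fps (\<lambda>i. if i = 0 then 0 else \<alpha> a ^ i)"
  {
    case 1
    have T: "?T (insert a A) = ?t + ?T A" using insert by (simp add: fps_eq_iff)
    have G: "?G * ?t = fps_const (\<alpha> a) * fps_X"
    proof (rule fps_ext)
      fix n
      have eqn: "fps_nth (?G * ?t) n = fps_nth ?t n - \<alpha> a * fps_nth (fps_X * ?t) n"
        by (simp add: left_diff_distrib mult.assoc)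
      consider "n = 0" | "n = 1" | k where "n = Suc (Suc k)"
        by (cases n; cases "n - 1") auto
      then show "fps_nth (?G * ?t) n = fps_nth (fps_const (\<alpha> a) * fps_X) n"
        unfolding eqn by cases simp_all
    qed
    have dG: "fps_X * fps_deriv ?G = - (?G * ?t)" unfolding G by (simp add: mult.commute flip: fps_const_neg)
    have "fps_X * fps_deriv (x * y) = (fps_X * fps_deriv x) * y + x * (fps_X * fps_deriv y)" for x y :: "complex fps"
      by (simp add: fps_deriv_mult algebra_simps)
    then have "fps_X * fps_deriv (?G * ?F) = (fps_X * fps_deriv ?G) * ?F + ?G * (fps_X * fps_deriv ?F)" .
    also have "\<dots> = - ((?G * ?F) * (?t + ?T A))" unfolding dG insert.IH(1) by (simp add: algebra_simps)
    finally show ?case using insert T by simp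
  next
    case 2
    have s: "(\<lambda>n. fps_nth ?F n * u ^ n) sums (\<Prod>j\<in>A. 1 - u * \<alpha> j)" by (rule insert.IH(2))
    let ?x = "\<Prod>j\<in>A. 1 - u * \<alpha> j"
    have "(\<lambda>n. u * (fps_nth ?F n * u ^ n)) sums (u * ?x)" by (rule sums_mult[OF s])
    then have "(\<lambda>n. fps_nth (fps_X * ?F) (Suc n) * u ^ Suc n) sums (u * ?x)" by (simp add: mult_ac)
    then have "(\<lambda>n. fps_nth (fps_X * ?F) n * u ^ n) sums (u * ?x + fps_nth (fps_X * ?F) 0 * u ^ 0)" by (rule sums_Suc)
    then have "(\<lambda>n. fps_nth (fps_X * ?F) n * u ^ n) sums (u * ?x)" by simp
    from sums_diff[OF s sums_mult[OF this, of "\<alpha> a"]]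
    have d: "(\<lambda>n. fps_nth ?F n * u ^ n - \<alpha> a * (fps_nth (fps_X * ?F) n * u ^ n)) sums (?x - \<alpha> a * (u * ?x))" .
    have "fps_nth (?G * ?F) n = fps_nth ?F n - \<alpha> a * fps_nth (fps_X * ?F) n" for n
      by (simp add: left_diff_distrib mult.assoc)
    then have "(\<lambda>n. fps_nth (?G * ?F) n * u ^ n) = (\<lambda>n. fps_nth ?F n * u ^ n - \<alpha> a * (fps_nth (fps_X * ?F) n * u ^ n))"
      by (simp only: left_diff_distrib mult.assoc)
    moreover have "?x - \<alpha> a * (u * ?x) = (1 - u * \<alpha> a) * ?x" by (simp add: algebra_simps)
    ultimately have "(\<lambda>n. fps_nth (?G * ?F) n * u ^ n) sums ((1 - u * \<alpha> a) * ?x)" using d by (simp only:)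
    then show ?case using insert by simp
  }
qed

context poly_over_odd_field
begin

lemma quad_char_cases: assumes "D \<in> carrier S" "f \<in> monic_polys R" shows "\<bar>quad_char R D f\<bar> \<le> 1"
proof -
  have "\<bar>quad_char R D f\<bar> = (\<Prod>P \<in> {P \<in> prime_polys R. P pdivides f}. \<bar>leg D P ^ v P f\<bar>)"
    by (simp add: quad_char_def jacobi_poly_def abs_prod)
  also have "\<dots> \<le> (\<Prod>P \<in> {P \<in> prime_polys R. P pdivides f}. 1)"
  proof (rule prod_mono)
    fix P assume "P \<in> {P \<in> prime_polys R. P pdivides f}"
    then have "leg D P \<in> {-1, 0, 1}" using leg_cases[OF _ assms(1)] by blast
    then have "\<bar>leg D P\<bar> \<le> 1" by auto
    then show "0 \<le> \<bar>leg D P ^ v P f\<bar> \<and> \<bar>leg D P ^ v P f\<bar> \<le> 1" by (simp add: power_abs power_le_one)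
  qed
  finally show ?thesis by simp
qed

text \<open>By \<open>log_derivative\<close> and by Newton's identities, the prime power sums and
  the negated power sums of the inverse zeros satisfy the same recursion, with the same coefficients
  of the L-function; the constant coefficient 1 allows solving for the n-th term.\<close>

lemma explicit_formula:
  assumes z: "zero_angles R g \<theta>" and D: "D \<in> hyperelliptic R (2 * g + 1)" and n: "n \<ge> 1"
  shows "complex_of_int (psum (\<lambda>f. quad_char R D f) n) =
    - (\<Sum>j = 1..2 * g. (complex_of_real (sqrt (real q)) * e (- \<theta> D j)) ^ n)"
proof -
  have Dc: "D \<in> carrier S" using D by (auto simp: hyper_iff monic_iff)
  have q3: "real q \<ge> 3" using order_ge_3 by simp
  define \<alpha> where "\<alpha> j = complex_of_real (sqrt (real q)) * e (- \<theta> D j)" for j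
  define \<psi> where "\<psi> f = complex_of_int (quad_char R D f)" for f
  have \<psi>: "cmult \<psi>" using cmult_quad_char[of D] by (simp add: cmult_def \<psi>_def)
  define F where "F = (\<Prod>j\<in>{1..2 * g}. 1 - fps_const (\<alpha> j) * fps_X)"
  note nt = newton_power_sums[of "{1..2 * g}" \<alpha>, folded F_def, simplified]
  have eqL: "quad_L R D u = (\<Prod>j = 1..2 * g. 1 - u * \<alpha> j)" for u
    using z D by (simp add: zero_angles_def \<alpha>_def mult.assoc)
  have bd: "norm (msum \<psi> n) \<le> real q ^ n" for n
  proof -
    have "norm (msum \<psi> n) \<le> (\<Sum>f\<in>monic_polys_deg R n. 1)"
      unfolding msum_def
    proof (rule order_trans[OF norm_sum], rule sum_mono)
      fix f assume "f \<in> monic_polys_deg R n"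
      then have "\<bar>quad_char R D f\<bar> \<le> 1" using quad_char_cases[OF Dc] by (simp add: monic_deg_iff)
      then show "norm (\<psi> f) \<le> 1" by (simp add: \<psi>_def)
    qed
    then show ?thesis by (simp add: card_monic_deg)
  qed
  \<comment> \<open>\<open>quad_L\<close> is defined as an infinite sum, so convergence must be
    shown before its value can be used; the trivial bound q^n on the coefficients gives the disc of
    radius 1/q.\<close>
  have sums1: "(\<lambda>n. msum \<psi> n * u ^ n) sums (\<Prod>j = 1..2 * g. 1 - u * \<alpha> j)" if u: "norm u < 1 / real q" for u
  proof -
    have lt: "real q * norm u < 1" using u q3 by (simp add: field_simps)
    have "summable (\<lambda>n. (real q * norm u) ^ n)" using lt by (intro summable_geometric) (simp add: abs_mult)
    then have "summable (\<lambda>n. msum \<psi> n * u ^ n)"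
    proof (rule summable_comparison_test'[where N=0])
      fix n
      show "norm (msum \<psi> n * u ^ n) \<le> (real q * norm u) ^ n"
        using bd[of n] by (simp add: norm_mult norm_power power_mult_distrib mult_right_mono)
    qed
    then have "(\<lambda>n. msum \<psi> n * u ^ n) sums (\<Sum>n. msum \<psi> n * u ^ n)" by (rule summable_sums)
    moreover have "(\<Sum>n. msum \<psi> n * u ^ n) = quad_L R D u" by (simp add: quad_L_def msum_def \<psi>_def)
    ultimately show ?thesis using eqL by simp
  qed
  have coef: "msum \<psi> n = fps_nth F n" for n
    by (rule powser_coeffs_unique[of "1 / real q" _ "\<lambda>u. \<Prod>j = 1..2 * g. 1 - u * \<alpha> j"]) (use q3 sums1 nt(2) in auto)
  have m0: "msum \<psi> 0 = 1" using \<psi> by (simp add: msum_def monic_deg_0 cmult_def)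
  have newton: "of_nat n * msum \<psi> n = - (\<Sum>i=1..n. (\<Sum>j = 1..2 * g. \<alpha> j ^ i) * msum \<psi> (n - i))" for n
  proof -
    have "fps_nth (fps_X * fps_deriv F) n = of_nat n * fps_nth F n" by (cases n) auto
    moreover have "fps_nth (F * Abs_fps (\<lambda>i. if i = 0 then 0 else \<Sum>j = 1..2 * g. \<alpha> j ^ i)) n =
        (\<Sum>i=0..n. (if i = 0 then 0 else \<Sum>j = 1..2 * g. \<alpha> j ^ i) * fps_nth F (n - i))"
      by (subst mult.commute) (simp add: fps_mult_nth)
    moreover have "\<dots> = (\<Sum>i=1..n. (\<Sum>j = 1..2 * g. \<alpha> j ^ i) * fps_nth F (n - i))"
      by (rule sum.mono_neutral_cong_right) auto
    ultimately show ?thesis using nt(1) coef by (simp add: fps_eq_iff)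
  qed
  have "psum \<psi> n = - (\<Sum>j = 1..2 * g. \<alpha> j ^ n)"
    using n
  proof (induction n rule: less_induct)
    case (less n)
    have split: "(\<Sum>i=1..n. G i * msum \<psi> (n - i)) = (\<Sum>i=1..<n. G i * msum \<psi> (n - i)) + G n" for G :: "nat \<Rightarrow> complex"
      using less.prems m0 by (subst atLeastLessThanSuc_atLeastAtMost[symmetric], subst sum.atLeastLessThan_Suc) auto
    have "(\<Sum>i=1..n. psum \<psi> i * msum \<psi> (n - i)) = (\<Sum>i=1..n. - (\<Sum>j = 1..2 * g. \<alpha> j ^ i) * msum \<psi> (n - i))"
      using log_derivative[OF \<psi>, of n] newton[of n] by (simp add: sum_negf)
    moreover have "(\<Sum>i=1..<n. psum \<psi> i * msum \<psi> (n - i)) = (\<Sum>i=1..<n. - (\<Sum>j = 1..2 * g. \<alpha> j ^ i) * msum \<psi> (n - i))"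
      using less.IH by (intro sum.cong refl) simp
    ultimately show ?case unfolding split by simp
  qed
  moreover have "psum \<psi> n = complex_of_int (psum (\<lambda>f. quad_char R D f) n)"
    by (simp add: psum_def \<psi>_def)
  ultimately show ?thesis by (simp add: \<alpha>_def)
qed

section \<open>Even and odd prime powers in the power sums\<close>

definition trace_sum :: "nat \<Rightarrow> nat \<Rightarrow> int" where
  "trace_sum g n = (\<Sum>D\<in>hyperelliptic R (2 * g + 1). psum (\<lambda>f. quad_char R D f) n)"

text \<open>The contribution of even prime powers of degree 2\<nu>, for which d runs over the
  divisors of \<nu>.\<close>

definition coprime_sum :: "nat \<Rightarrow> nat \<Rightarrow> int" where
  "coprime_sum g \<nu> = (\<Sum>d | d dvd \<nu>. \<Sum>P\<in>prime_polys_deg R d. int d * hcop P (2 * g + 1))"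

text \<open>An even positive power of a symbol only records whether P divides D, an odd one is the
  symbol itself.\<close>

lemma trace_sum_eq:
  assumes "n \<ge> 1"
  shows "trace_sum g n = (\<Sum>d | d dvd n. if even (n div d) then (\<Sum>P\<in>prime_polys_deg R d. int d * hcop P (2 * g + 1)) else U g d)"
proof -
  have "trace_sum g n = (\<Sum>d | d dvd n. \<Sum>P\<in>prime_polys_deg R d. \<Sum>D\<in>hyperelliptic R (2 * g + 1). int d * quad_char R D P ^ (n div d))"
  proof -
    have "trace_sum g n = (\<Sum>d | d dvd n. \<Sum>D\<in>hyperelliptic R (2 * g + 1). \<Sum>P\<in>prime_polys_deg R d. int d * quad_char R D P ^ (n div d))"
      unfolding trace_sum_def psum_def by (rule sum.swap)
    also have "\<dots> = (\<Sum>d | d dvd n. \<Sum>P\<in>prime_polys_deg R d. \<Sum>D\<in>hyperelliptic R (2 * g + 1). int d * quad_char R D P ^ (n div d))"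
      by (rule sum.cong[OF refl]) (rule sum.swap)
    finally show ?thesis .
  qed
  also have "\<dots> = (\<Sum>d | d dvd n. if even (n div d) then (\<Sum>P\<in>prime_polys_deg R d. int d * hcop P (2 * g + 1)) else U g d)"
  proof (intro sum.cong refl)
    fix d assume "d \<in> {d. d dvd n}"
    then obtain k where "n = d * k" unfolding dvd_def by blast
    then have nd: "n div d \<noteq> 0" using assms by (cases "d = 0") auto
    have qp: "quad_char R D P ^ (n div d) = (if even (n div d) then of_bool (\<not> P pdivides D) else leg D P)"
      if "P \<in> prime_polys_deg R d" "D \<in> hyperelliptic R (2 * g + 1)" for P D
    proof -
      have P: "P \<in> prime_polys R" using that by (simp add: prime_deg_iff)
      have Dc: "D \<in> carrier S" using that by (auto simp: hyper_iff monic_iff)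
      have l: "leg D P \<in> {-1, 0, 1}" by (rule leg_cases[OF P Dc])
      show ?thesis using l leg_zero_iff[OF P Dc] nd by (auto simp: quad_char_prime[OF P] zero_power)
    qed
    show "(\<Sum>P\<in>prime_polys_deg R d. \<Sum>D\<in>hyperelliptic R (2 * g + 1). int d * quad_char R D P ^ (n div d)) =
      (if even (n div d) then (\<Sum>P\<in>prime_polys_deg R d. int d * hcop P (2 * g + 1)) else U g d)"
      unfolding hcop_def U_def hsum_def sum_distrib_left using qp by (simp cong: sum.cong)
  qed
  finally show ?thesis .
qed

text \<open>For odd \<open>n\<close> every divisor and its quotient are odd, so only primes of odd
  degree to odd powers occur, and these cancel by \<open>U_odd\<close>.\<close>

lemma trace_sum_odd: assumes "odd n" shows "trace_sum g n = 0"
proof -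
  have n: "n \<ge> 1" using assms by (cases n) auto
  have "(if even (n div d) then (\<Sum>P\<in>prime_polys_deg R d. int d * hcop P (2 * g + 1)) else U g d) = 0"
    if dn: "d \<in> {d. d dvd n}" for d
  proof -
    obtain k where k: "n = d * k" using dn unfolding dvd_def by blast
    have d0: "d \<noteq> 0" using n k by (intro notI) simp
    have "odd d" "odd k" using assms k by auto
    moreover have "n div d = k" using k d0 by simp
    ultimately show ?thesis using U_odd by simp
  qed
  then show ?thesis unfolding trace_sum_eq[OF n] by (intro sum.neutral) blast
qed

lemma trace_sum_even:
  assumes \<nu>: "\<nu> \<ge> 1"
  shows "trace_sum g (2 * \<nu>) = coprime_sum g \<nu> + (\<Sum>\<delta> | \<delta> dvd \<nu> \<and> odd (\<nu> div \<delta>). U g (2 * \<delta>))"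
proof -
  let ?n = "2 * \<nu>"
  let ?f = "\<lambda>d. \<Sum>P\<in>prime_polys_deg R d. int d * hcop P (2 * g + 1)"
  have fin: "finite {d. d dvd ?n}" using \<nu> by simp
  have "trace_sum g ?n = (\<Sum>d | d dvd ?n. if even (?n div d) then ?f d else U g d)" by (rule trace_sum_eq) (use \<nu> in simp)
  also have "\<dots> = (\<Sum>d\<in>{d. d dvd ?n} \<inter> {d. even (?n div d)}. ?f d) + (\<Sum>d\<in>{d. d dvd ?n} \<inter> - {d. even (?n div d)}. U g d)"
    by (rule sum.If_cases[OF fin])
  also have "{d. d dvd ?n} \<inter> {d. even (?n div d)} = {d. d dvd \<nu>}"
  proof (intro equalityI subsetI)
    fix d assume "d \<in> {d. d dvd ?n} \<inter> {d. even (?n div d)}"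
    then obtain k where k: "?n = d * k" "even (?n div d)" unfolding dvd_def[of d] by blast
    have d0: "d \<noteq> 0" using \<nu> k(1) by (intro notI) simp
    then have "even k" using k by simp
    then obtain j where "k = 2 * j" by auto
    then have "\<nu> = d * j" using k(1) by simp
    then show "d \<in> {d. d dvd \<nu>}" by simp
  next
    fix d assume "d \<in> {d. d dvd \<nu>}"
    then obtain k where k: "\<nu> = d * k" by auto
    have d0: "d \<noteq> 0" using \<nu> k by (intro notI) simp
    have n: "?n = d * (2 * k)" using k by simp
    have "?n div d = 2 * k" unfolding n using d0 by simp
    then show "d \<in> {d. d dvd ?n} \<inter> {d. even (?n div d)}" using k by simp
  qed
  also have "{d. d dvd ?n} \<inter> - {d. even (?n div d)} = (\<lambda>\<delta>. 2 * \<delta>) ` {\<delta>. \<delta> dvd \<nu> \<and> odd (\<nu> div \<delta>)}"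
  proof (intro equalityI subsetI)
    fix d assume "d \<in> {d. d dvd ?n} \<inter> - {d. even (?n div d)}"
    then obtain k where k: "?n = d * k" "odd (?n div d)" unfolding dvd_def[of d] by blast
    have d0: "d \<noteq> 0" using \<nu> k(1) by (intro notI) simp
    then have ok: "odd k" using k by simp
    have "even (d * k)" using k(1) by (metis dvd_triv_left)
    then obtain j where j: "d = 2 * j" using ok by (auto elim: evenE)
    then have vj: "\<nu> = j * k" using k(1) by simp
    moreover have "\<nu> div j = k" using vj d0 j by simp
    ultimately show "d \<in> (\<lambda>\<delta>. 2 * \<delta>) ` {\<delta>. \<delta> dvd \<nu> \<and> odd (\<nu> div \<delta>)}" using j ok by auto
  next
    fix d assume "d \<in> (\<lambda>\<delta>. 2 * \<delta>) ` {\<delta>. \<delta> dvd \<nu> \<and> odd (\<nu> div \<delta>)}"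
    then obtain j where j: "d = 2 * j" "j dvd \<nu>" "odd (\<nu> div j)" by auto
    then show "d \<in> {d. d dvd ?n} \<inter> - {d. even (?n div d)}" by simp
  qed
  also have "(\<Sum>d\<in>(\<lambda>\<delta>. 2 * \<delta>) ` {\<delta>. \<delta> dvd \<nu> \<and> odd (\<nu> div \<delta>)}. U g d) = (\<Sum>\<delta> | \<delta> dvd \<nu> \<and> odd (\<nu> div \<delta>). U g (2 * \<delta>))"
    by (subst sum.reindex) (auto simp: inj_on_def)
  finally show ?thesis unfolding coprime_sum_def .
qed

section \<open>Mean values of the power sums\<close>

text \<open>Exact vanishing, where \<open>U_bound\<close> would leave an error. It removes all such
  \<delta> from the error terms and thereby confines the remaining ones to small \<delta>.\<close>

lemma U_zero: assumes "\<delta> \<ge> 1" "g mod (2 * \<delta>) > \<delta>" shows "U g (2 * \<delta>) = 0"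
  unfolding U_def
proof (rule sum.neutral, rule ballI)
  fix P assume "P \<in> prime_polys_deg R (2 * \<delta>)"
  then have P: "P \<in> prime_polys R" "degree P = 2 * \<delta>" by (auto simp: prime_deg_iff)
  show "int (2 * \<delta>) * hsum (\<lambda>f. leg f P) (2 * g + 1) = 0"
    unfolding hsum_leg_cases(1)[OF P refl assms(2)] by simp
qed

lemma U_main_bound: assumes "\<delta> \<ge> 1" shows "\<bar>U_main g \<delta>\<bar> \<le> int q ^ (3 * \<delta>)"
proof (cases "g mod (2 * \<delta>) < \<delta>")
  case True
  have "(int q - 1) * int q ^ (2 * (g mod (2 * \<delta>)) + \<delta>) \<le> int q * int q ^ (2 * (g mod (2 * \<delta>)) + \<delta>)"
    by (intro mult_right_mono) auto
  also have "\<dots> = int q ^ (2 * (g mod (2 * \<delta>)) + \<delta> + 1)" by simp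
  also have "\<dots> \<le> int q ^ (3 * \<delta>)" using True order_ge_3 by (intro power_increasing) auto
  finally show ?thesis using True order_ge_3 by (simp add: U_main_def abs_mult)
qed (auto simp: U_main_def)

lemma le_q_pow: "int \<delta> \<le> int q ^ \<delta>"
proof -
  have "\<delta> < 2 ^ \<delta>" by simp
  also have "\<dots> \<le> q ^ \<delta>" using order_ge_3 by (intro power_mono) auto
  finally show ?thesis by (metis less_imp_le of_nat_le_iff of_nat_power)
qed

lemma U_abs_bound: assumes "\<delta> \<ge> 1" shows "\<bar>U g (2 * \<delta>)\<bar> \<le> 129 * int q ^ (3 * \<delta>)"
proof -
  have "int \<delta> * int q ^ (2 * \<delta>) \<le> int q ^ \<delta> * int q ^ (2 * \<delta>)" by (intro mult_right_mono le_q_pow) simp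
  also have "\<dots> = int q ^ (3 * \<delta>)" by (simp add: power_add[symmetric])
  finally have "128 * int \<delta> * int q ^ (2 * \<delta>) \<le> 128 * int q ^ (3 * \<delta>)" by simp
  then show ?thesis using U_bound[OF assms, of g] U_main_bound[OF assms, of g] by linarith
qed

lemma sum_pow_le: "finite A \<Longrightarrow> (\<And>i. i \<in> A \<Longrightarrow> i \<le> n) \<Longrightarrow> (\<Sum>i\<in>A. real q ^ i) \<le> 2 * real q ^ n"
proof -
  assume A: "finite A" "\<And>i. i \<in> A \<Longrightarrow> i \<le> n"
  have q3: "real q \<ge> 3" using order_ge_3 by simp
  have "(\<Sum>i\<in>A. real q ^ i) \<le> (\<Sum>i\<le>n. real q ^ i)" using A by (intro sum_mono2) auto
  also have "\<dots> \<le> 2 * real q ^ n"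
  proof (induction n)
    case (Suc n)
    have "2 * real q ^ n \<le> real q * real q ^ n" using q3 by (intro mult_right_mono) auto
    with Suc show ?case unfolding sum.atMost_Suc power_Suc by linarith
  qed simp
  finally show ?thesis .
qed

definition hyper_size :: "nat \<Rightarrow> real" where "hyper_size g = real q ^ (2 * g) * (real q - 1)"

lemma hyper_size_eq: "g \<ge> 1 \<Longrightarrow> real (card (hyperelliptic R (2 * g + 1))) = hyper_size g"
proof -
  assume g: "g \<ge> 1"
  have "real (card (hyperelliptic R (2 * g + 1))) = real_of_int (int q ^ (2 * g + 1) - int q ^ (2 * g + 1 - 1))"
    using arg_cong[OF card_hyper[of "2 * g + 1"], of real_of_int] g by simp
  then show ?thesis by (simp add: hyper_size_def algebra_simps)
qed

lemma hyper_size_pos: "hyper_size g > 0" using order_ge_3 by (simp add: hyper_size_def)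

text \<open>The double sum over r and P in \<open>c_term\<close>, as a real number.\<close>

definition \<kappa> :: "nat \<Rightarrow> real" where
  "\<kappa> n = (\<Sum>r | 1 \<le> r \<and> r dvd n. \<Sum>P \<in> prime_polys_deg R (n div r).
           real (degree P) / (real (poly_norm R P) ^ r * (real (poly_norm R P) + 1)))"

lemma \<kappa>_eq:
  assumes \<nu>: "\<nu> \<ge> 1"
  shows "\<kappa> \<nu> = (\<Sum>d | d dvd \<nu>. \<Sum>P\<in>prime_polys_deg R d. real d / (real q ^ \<nu> * (real q ^ d + 1)))"
  unfolding \<kappa>_def
proof (rule sum.reindex_bij_witness[of _ "\<lambda>d. \<nu> div d" "\<lambda>r. \<nu> div r"])
  fix r assume "r \<in> {r. 1 \<le> r \<and> r dvd \<nu>}"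
  then obtain k where k: "\<nu> = r * k" "r \<ge> 1" unfolding dvd_def by blast
  have k0: "k \<ge> 1" using k \<nu> by (cases k) auto
  have kd: "\<nu> div r = k" using k by simp
  show "\<nu> div (\<nu> div r) = r" unfolding kd using k k0 by simp
  show "\<nu> div r \<in> {d. d dvd \<nu>}" unfolding kd using k by simp
  show "(\<Sum>P\<in>prime_polys_deg R (\<nu> div r). real (\<nu> div r) / (real q ^ \<nu> * (real q ^ (\<nu> div r) + 1))) =
    (\<Sum>P\<in>prime_polys_deg R (\<nu> div r). real (degree P) / (real (poly_norm R P) ^ r * (real (poly_norm R P) + 1)))"
    unfolding kd
  proof (intro sum.cong refl)
    fix P assume "P \<in> prime_polys_deg R k"
    then have "degree P = k" by (simp add: prime_deg_iff)
    then have pn: "real (poly_norm R P) = real q ^ k" by (simp add: poly_norm_def)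
    have "(real q ^ k) ^ r = real q ^ \<nu>" unfolding k(1) power_mult[symmetric] by (simp add: mult.commute)
    then show "real k / (real q ^ \<nu> * (real q ^ k + 1)) = real (degree P) / (real (poly_norm R P) ^ r * (real (poly_norm R P) + 1))"
      unfolding pn \<open>degree P = k\<close> by simp
  qed
next
  fix d assume "d \<in> {d. d dvd \<nu>}"
  then obtain k where k: "\<nu> = d * k" unfolding dvd_def by blast
  have d0: "d \<ge> 1" "k \<ge> 1" using k \<nu> by (cases d; cases k; simp)+
  have kd: "\<nu> div d = k" using k d0 by simp
  show "\<nu> div (\<nu> div d) = d" unfolding kd using k d0 by simp
  show "\<nu> div d \<in> {r. 1 \<le> r \<and> r dvd \<nu>}" unfolding kd using k d0 by simp
qed

text \<open>Replace \<open>hcop\<close> by its density |P|/(|P| + 1) = 1 - 1/(|P| + 1): the 1 sums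
  to q^\<nu> by \<open>prime_poly_count\<close>, the rest is q^\<nu> \<kappa>(\<nu>). The error 2
  for each prime is summed with the same total weight q^\<nu>.\<close>

lemma coprime_sum_bound:
  assumes \<nu>: "\<nu> \<ge> 1"
  shows "\<bar>real_of_int (coprime_sum g \<nu>) - real q ^ \<nu> * hyper_size g * (1 - \<kappa> \<nu>)\<bar> \<le> 2 * real q ^ \<nu>"
proof -
  have q3: "real q \<ge> 3" using order_ge_3 by simp
  have fin: "finite {d. d dvd \<nu>}" using \<nu> by simp
  have hyper_size: "real q ^ (2 * g + 1) * (1 - 1 / real q) = hyper_size g" using q3 by (simp add: hyper_size_def field_simps)
  have cnt: "(\<Sum>d | d dvd \<nu>. \<Sum>P\<in>prime_polys_deg R d. real d) = real q ^ \<nu>"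
  proof -
    have "(\<Sum>d | d dvd \<nu>. \<Sum>P\<in>prime_polys_deg R d. real d) = real (\<Sum>d | d dvd \<nu>. d * card (prime_polys_deg R d))"
      by (simp add: mult.commute)
    then show ?thesis using prime_poly_count[OF \<nu>] by simp
  qed
  have "real q ^ \<nu> * hyper_size g * (1 - \<kappa> \<nu>) = hyper_size g * (real q ^ \<nu> - real q ^ \<nu> * \<kappa> \<nu>)" by (simp add: algebra_simps)
  also have "real q ^ \<nu> - real q ^ \<nu> * \<kappa> \<nu> = (\<Sum>d | d dvd \<nu>. \<Sum>P\<in>prime_polys_deg R d. real d * (real q ^ d / (real q ^ d + 1)))"
  proof -
    have "real q ^ \<nu> * \<kappa> \<nu> = (\<Sum>d | d dvd \<nu>. \<Sum>P\<in>prime_polys_deg R d. real d / (real q ^ d + 1))"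
      unfolding \<kappa>_eq[OF \<nu>] sum_distrib_left using q3 by (intro sum.cong refl) simp
    then have "real q ^ \<nu> - real q ^ \<nu> * \<kappa> \<nu> = (\<Sum>d | d dvd \<nu>. \<Sum>P\<in>prime_polys_deg R d. real d - real d / (real q ^ d + 1))"
      using cnt by (simp only: sum_subtractf)
    also have "\<dots> = (\<Sum>d | d dvd \<nu>. \<Sum>P\<in>prime_polys_deg R d. real d * (real q ^ d / (real q ^ d + 1)))"
    proof (intro sum.cong refl)
      fix d
      have "real q ^ d + 1 > 0" using q3 by (intro add_pos_pos) auto
      then show "real d - real d / (real q ^ d + 1) = real d * (real q ^ d / (real q ^ d + 1))"
        by (simp add: field_simps)
    qed
    finally show ?thesis .
  qed
  finally have "real_of_int (coprime_sum g \<nu>) - real q ^ \<nu> * hyper_size g * (1 - \<kappa> \<nu>) = (\<Sum>d | d dvd \<nu>. \<Sum>P\<in>prime_polys_deg R d.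
      real d * (real_of_int (hcop P (2 * g + 1)) - real q ^ d / (real q ^ d + 1) * hyper_size g))"
    unfolding coprime_sum_def by (simp add: sum_distrib_left sum_subtractf algebra_simps)
  also have "\<bar>\<dots>\<bar> \<le> (\<Sum>d | d dvd \<nu>. \<Sum>P\<in>prime_polys_deg R d. real d * 2)"
  proof (rule order_trans[OF sum_abs], rule sum_mono, rule order_trans[OF sum_abs], rule sum_mono)
    fix d P assume "P \<in> prime_polys_deg R d"
    then have P: "P \<in> prime_polys R" "degree P = d" by (auto simp: prime_deg_iff)
    have "\<bar>real_of_int (hcop P (2 * g + 1)) - real q ^ d / (real q ^ d + 1) * hyper_size g\<bar> \<le> 2"
      using hcop_bound[OF P(1), of "2 * g + 1"] unfolding P(2) hyper_size .
    then show "\<bar>real d * (real_of_int (hcop P (2 * g + 1)) - real q ^ d / (real q ^ d + 1) * hyper_size g)\<bar> \<le> real d * 2"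
      unfolding abs_mult by (intro mult_mono) auto
  qed
  also have "\<dots> = 2 * real q ^ \<nu>" unfolding cnt[symmetric] sum_distrib_left by (intro sum.cong refl) simp
  finally show ?thesis .
qed

text \<open>The square contribution obtained through the functional equation, on the scale q^\<nu>
  times the size of the ensemble, on which the even prime powers contribute 1 -
  \<kappa>(\<nu>).\<close>

definition dual_ratio :: "nat \<Rightarrow> nat \<Rightarrow> real" where "dual_ratio g \<nu> = real_of_int (U_main g \<nu>) / (real q ^ \<nu> * hyper_size g)"

lemma trace_sum_bound:
  assumes \<nu>: "\<nu> \<ge> 1"
  shows "\<bar>real_of_int (trace_sum g (2 * \<nu>)) / (real q ^ \<nu> * hyper_size g) - (1 - \<kappa> \<nu> + dual_ratio g \<nu>)\<bar>
    \<le> (260 + (if g mod (2 * \<nu>) \<le> \<nu> then 128 * real \<nu> * real q ^ \<nu> else 0)) / hyper_size g"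
proof -
  have q3: "real q \<ge> 3" using order_ge_3 by simp
  let ?S = "{\<delta>. \<delta> dvd \<nu> \<and> odd (\<nu> div \<delta>)}"
  have fin: "finite ?S" using \<nu> by (auto intro: finite_subset[of _ "{\<delta>. \<delta> dvd \<nu>}"])
  have S: "?S = insert \<nu> (?S - {\<nu>})" using \<nu> by auto
  have sumU: "(\<Sum>\<delta>\<in>?S. U g (2 * \<delta>)) = U g (2 * \<nu>) + (\<Sum>\<delta>\<in>?S - {\<nu>}. U g (2 * \<delta>))"
    by (subst S, subst sum.insert) (use fin in auto)
  \<comment> \<open>The quotient is odd and not 1, hence at least 3, so the terms q^(3\<delta>)
    belong to a geometric sum ending at q^\<nu>. With 129 from \<open>U_abs_bound\<close> this costs
    258 q^\<nu>; another 2 q^\<nu> from \<open>coprime_sum_bound\<close> makes 260.\<close>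
  have small: "\<delta> \<ge> 1 \<and> 3 * \<delta> \<le> \<nu>" if "\<delta> \<in> ?S - {\<nu>}" for \<delta>
  proof -
    have "\<delta> dvd \<nu>" "odd (\<nu> div \<delta>)" "\<delta> \<noteq> \<nu>" using that by auto
    then obtain k where k: "\<nu> = \<delta> * k" "odd (\<nu> div \<delta>)" "\<delta> \<noteq> \<nu>" unfolding dvd_def by blast
    have d0: "\<delta> \<noteq> 0" using \<nu> k by (intro notI) simp
    have "odd k" using k d0 by simp
    moreover have "k \<noteq> 1" using k by (intro notI) simp
    ultimately have "k \<ge> 3" by (metis One_nat_def Suc_leI even_zero even_numeral le_neq_implies_less less_one not_less numeral_2_eq_2 numeral_3_eq_3 odd_pos)
    then have "\<delta> * 3 \<le> \<nu>" unfolding k(1) by (rule mult_le_mono2)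
    then show ?thesis using d0 by simp
  qed
  have rest: "\<bar>real_of_int (\<Sum>\<delta>\<in>?S - {\<nu>}. U g (2 * \<delta>))\<bar> \<le> 258 * real q ^ \<nu>"
  proof -
    have "\<bar>real_of_int (\<Sum>\<delta>\<in>?S - {\<nu>}. U g (2 * \<delta>))\<bar> \<le> (\<Sum>\<delta>\<in>?S - {\<nu>}. 129 * real q ^ (3 * \<delta>))"
      unfolding of_int_sum
    proof (rule order_trans[OF sum_abs], rule sum_mono)
      fix \<delta> assume "\<delta> \<in> ?S - {\<nu>}"
      then have "\<delta> \<ge> 1" using small by blast
      then have "real_of_int \<bar>U g (2 * \<delta>)\<bar> \<le> real_of_int (129 * int q ^ (3 * \<delta>))" using U_abs_bound by (intro of_int_le_iff[THEN iffD2])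
      then show "\<bar>real_of_int (U g (2 * \<delta>))\<bar> \<le> 129 * real q ^ (3 * \<delta>)" by simp
    qed
    also have "\<dots> = 129 * (\<Sum>\<delta>\<in>?S - {\<nu>}. real q ^ (3 * \<delta>))" by (simp add: sum_distrib_left)
    also have "(\<Sum>\<delta>\<in>?S - {\<nu>}. real q ^ (3 * \<delta>)) = (\<Sum>i\<in>(\<lambda>\<delta>. 3 * \<delta>) ` (?S - {\<nu>}). real q ^ i)"
      by (subst sum.reindex) (auto simp: inj_on_def)
    also have "129 * \<dots> \<le> 129 * (2 * real q ^ \<nu>)"
      using fin small by (intro mult_left_mono sum_pow_le) auto
    finally show ?thesis by simp
  qed
  have main: "\<bar>real_of_int (U g (2 * \<nu>) - U_main g \<nu>)\<bar> \<le> (if g mod (2 * \<nu>) \<le> \<nu> then 128 * real \<nu> * real q ^ (2 * \<nu>) else 0)"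
  proof (cases "g mod (2 * \<nu>) \<le> \<nu>")
    case True
    have "real_of_int \<bar>U g (2 * \<nu>) - U_main g \<nu>\<bar> \<le> real_of_int (128 * int \<nu> * int q ^ (2 * \<nu>))"
      using U_bound[OF \<nu>] by (intro of_int_le_iff[THEN iffD2])
    then show ?thesis using True by simp
  next
    case False
    then show ?thesis using U_zero[OF \<nu>, of g] by (simp add: U_main_def)
  qed
  let ?c = "real q ^ \<nu> * hyper_size g"
  have cpos: "?c > 0" using hyper_size_pos q3 by simp
  then have c0: "?c \<noteq> 0" by linarith
  have "real_of_int (trace_sum g (2 * \<nu>)) - ?c * (1 - \<kappa> \<nu> + dual_ratio g \<nu>) =
     (real_of_int (coprime_sum g \<nu>) - ?c * (1 - \<kappa> \<nu>)) + real_of_int (U g (2 * \<nu>) - U_main g \<nu>) + real_of_int (\<Sum>\<delta>\<in>?S - {\<nu>}. U g (2 * \<delta>))"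
  proof -
    have "?c * dual_ratio g \<nu> = real_of_int (U_main g \<nu>)" unfolding dual_ratio_def times_divide_eq_right by (rule nonzero_mult_div_cancel_left[OF c0])
    moreover have "?c * (1 - \<kappa> \<nu> + dual_ratio g \<nu>) = ?c * (1 - \<kappa> \<nu>) + ?c * dual_ratio g \<nu>" by (rule distrib_left)
    moreover have "real_of_int (trace_sum g (2 * \<nu>)) = real_of_int (coprime_sum g \<nu>) + (real_of_int (U g (2 * \<nu>)) + real_of_int (\<Sum>\<delta>\<in>?S - {\<nu>}. U g (2 * \<delta>)))"
      unfolding trace_sum_even[OF \<nu>] sumU by simp
    ultimately show ?thesis by simp
  qed
  then have "\<bar>real_of_int (trace_sum g (2 * \<nu>)) - ?c * (1 - \<kappa> \<nu> + dual_ratio g \<nu>)\<bar> \<le>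
     2 * real q ^ \<nu> + (if g mod (2 * \<nu>) \<le> \<nu> then 128 * real \<nu> * real q ^ (2 * \<nu>) else 0) + 258 * real q ^ \<nu>"
    using coprime_sum_bound[OF \<nu>, of g] main rest by linarith
  also have "\<dots> = (260 + (if g mod (2 * \<nu>) \<le> \<nu> then 128 * real \<nu> * real q ^ \<nu> else 0)) * real q ^ \<nu>"
  proof -
    have "real q ^ (2 * \<nu>) = real q ^ \<nu> * real q ^ \<nu>" by (simp only: mult_2 power_add)
    then have "2 * real q ^ \<nu> + (if b then 128 * real \<nu> * real q ^ (2 * \<nu>) else 0) + 258 * real q ^ \<nu>
      = (260 + (if b then 128 * real \<nu> * real q ^ \<nu> else 0)) * real q ^ \<nu>" for b
      by (cases b) (simp_all add: distrib_right)
    then show ?thesis .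
  qed
  finally have le: "\<bar>real_of_int (trace_sum g (2 * \<nu>)) - ?c * (1 - \<kappa> \<nu> + dual_ratio g \<nu>)\<bar> \<le>
     (260 + (if g mod (2 * \<nu>) \<le> \<nu> then 128 * real \<nu> * real q ^ \<nu> else 0)) * real q ^ \<nu>" .
  have "\<bar>real_of_int (trace_sum g (2 * \<nu>)) / ?c - (1 - \<kappa> \<nu> + dual_ratio g \<nu>)\<bar> = \<bar>real_of_int (trace_sum g (2 * \<nu>)) - ?c * (1 - \<kappa> \<nu> + dual_ratio g \<nu>)\<bar> / ?c"
  proof -
    have "real_of_int (trace_sum g (2 * \<nu>)) / ?c - (1 - \<kappa> \<nu> + dual_ratio g \<nu>) = (real_of_int (trace_sum g (2 * \<nu>)) - ?c * (1 - \<kappa> \<nu> + dual_ratio g \<nu>)) / ?c"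
      by (simp only: diff_divide_distrib nonzero_mult_div_cancel_left[OF c0])
    then show ?thesis using cpos by (simp add: abs_divide)
  qed
  also have "\<dots> \<le> ((260 + (if g mod (2 * \<nu>) \<le> \<nu> then 128 * real \<nu> * real q ^ \<nu> else 0)) * real q ^ \<nu>) / ?c"
    using le cpos by (intro divide_right_mono) auto
  also have "\<dots> = (260 + (if g mod (2 * \<nu>) \<le> \<nu> then 128 * real \<nu> * real q ^ \<nu> else 0)) / hyper_size g"
    using q3 by simp
  finally show ?thesis .
qed

lemma dual_ratio_cases:
  assumes "\<nu> \<ge> 1"
  shows "g mod (2 * \<nu>) = \<nu> \<Longrightarrow> dual_ratio g \<nu> = real q powr (2 * real \<nu> - 2 * real g) / (real q - 1)"
    and "g mod (2 * \<nu>) < \<nu> \<Longrightarrow> dual_ratio g \<nu> = - (real q powr (2 * real (g mod (2 * \<nu>)) - 2 * real g))"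
    and "g mod (2 * \<nu>) > \<nu> \<Longrightarrow> dual_ratio g \<nu> = 0"
proof -
  have q3: "real q \<ge> 3" using order_ge_3 by simp
  have pw: "real q powr (2 * real a - 2 * real g) = real q ^ (2 * a) / real q ^ (2 * g)" for a
    using q3 by (simp add: powr_diff powr_realpow[symmetric])
  show "dual_ratio g \<nu> = real q powr (2 * real \<nu> - 2 * real g) / (real q - 1)" if "g mod (2 * \<nu>) = \<nu>"
  proof -
    have "real q ^ (3 * \<nu>) = real q ^ \<nu> * real q ^ (2 * \<nu>)" by (simp add: power_add[symmetric])
    then show ?thesis using that q3 unfolding dual_ratio_def U_main_def hyper_size_def pw by simp
  qed
  show "dual_ratio g \<nu> = - (real q powr (2 * real (g mod (2 * \<nu>)) - 2 * real g))" if "g mod (2 * \<nu>) < \<nu>"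
    using that q3 unfolding dual_ratio_def U_main_def hyper_size_def pw by (simp add: power_add)
  show "dual_ratio g \<nu> = 0" if "g mod (2 * \<nu>) > \<nu>" using that by (simp add: dual_ratio_def U_main_def)
qed

end

section \<open>Trigonometric polynomials\<close>

lemma e_eq_cis: "e x = cis (2 * pi * x)"
  by (simp add: e_def cis_conv_exp mult_ac)

lemma e_power: "e x ^ n = e (real n * x)"
  by (simp add: e_eq_cis Complex.DeMoivre mult_ac)

lemma e_add: "e (x + y) = e x * e y"
  by (simp add: e_eq_cis cis_mult distrib_left)

lemma e_zero: "e 0 = 1"
  by (simp add: e_def)

lemma cnj_e: "cnj (e x) = e (- x)"
  by (simp add: e_eq_cis cis_cnj)

lemma infinite_range_e: "infinite (range e)"
proof
  assume "finite (range e)"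
  then have "finite (e ` {0..1/2})" by (rule finite_subset[rotated]) auto
  moreover have "inj_on e {0..1/2}"
  proof (rule inj_onI)
    fix x y :: real assume xy: "x \<in> {0..1/2}" "y \<in> {0..1/2}" "e x = e y"
    have "Re (e x) = Re (e y)" using xy(3) by simp
    then have "cos (2 * pi * x) = cos (2 * pi * y)" by (simp add: e_eq_cis)
    moreover have "0 \<le> 2 * pi * z \<and> 2 * pi * z \<le> pi" if "z \<in> {0..1/2}" for z :: real
    proof -
      have "pi * (2 * z) \<le> pi * 1" using that by (intro mult_left_mono) auto
      then show ?thesis using that by (simp add: mult_ac)
    qed
    ultimately have "2 * pi * x = 2 * pi * y" using xy(1,2) cos_inj_pi by presburger
    then show "x = y" by simp
  qed
  ultimately have "finite {0..1/2::real}" by (rule finite_imageD)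
  then show False using infinite_Icc[of "0::real" "1/2"] by simp
qed

text \<open>Multiplied by e(N \<theta>) the sum becomes a polynomial of degree at most 2N in z =
  e(\<theta>), with infinitely many zeros.\<close>

lemma trig_poly_coeffs_zero:
  assumes "\<And>\<theta>. (\<Sum>n = - int N..int N. c n * e (real_of_int n * \<theta>)) = 0" and "\<bar>n\<bar> \<le> int N"
  shows "c n = 0"
proof -
  have root: "(\<Sum>i\<le>2 * N. c (int i - int N) * e \<theta> ^ i) = 0" for \<theta>
  proof -
    have "(\<Sum>i\<le>2 * N. c (int i - int N) * e \<theta> ^ i) = (\<Sum>n = - int N..int N. c n * e (real_of_int n * \<theta>) * e (real N * \<theta>))"
    proof (rule sum.reindex_bij_witness[of _ "\<lambda>n. nat (n + int N)" "\<lambda>i. int i - int N"])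
      fix i :: nat
      have "e \<theta> ^ i = e (real_of_int (int i - int N) * \<theta>) * e (real N * \<theta>)"
        unfolding e_power e_add[symmetric] by (simp add: algebra_simps)
      then show "c (int i - int N) * e (real_of_int (int i - int N) * \<theta>) * e (real N * \<theta>) = c (int i - int N) * e \<theta> ^ i" by simp
    qed auto
    also have "\<dots> = 0" unfolding sum_distrib_right[symmetric] assms(1) by simp
    finally show ?thesis .
  qed
  then have "range e \<subseteq> {z. (\<Sum>i\<le>2 * N. c (int i - int N) * z ^ i) = 0}" by auto
  then have "infinite {z. (\<Sum>i\<le>2 * N. c (int i - int N) * z ^ i) = 0}" using infinite_range_e infinite_super by blast
  then have "\<forall>i\<le>2 * N. c (int i - int N) = 0" using polyfun_finite_roots[of "\<lambda>i. c (int i - int N)" "2 * N"] by blast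
  then have "c (int (nat (n + int N)) - int N) = 0" using assms(2) by (elim allE[of _ "nat (n + int N)"]) auto
  moreover have "int (nat (n + int N)) - int N = n" using assms(2) by linarith
  ultimately show ?thesis by simp
qed

text \<open>The trigonometric polynomial \<phi>(\<theta>) - \<phi>(-\<theta>) has the coefficients
  a(n) - a(-n) and vanishes identically.\<close>

lemma even_trig_poly_coeffs:
  assumes "even_trig_poly N a \<phi>" shows "a (- n) = a n"
proof (cases "\<bar>n\<bar> \<le> int N")
  case True
  have "(\<Sum>n = - int N..int N. (a n - a (- n)) * e (real_of_int n * \<theta>)) = 0" for \<theta>
  proof -
    have "(\<Sum>n = - int N..int N. a n * e (real_of_int n * \<theta>)) = (\<Sum>n = - int N..int N. a n * e (real_of_int n * (- \<theta>)))"
      using assms unfolding even_trig_poly_def by metis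
    also have "\<dots> = (\<Sum>n = - int N..int N. a (- n) * e (real_of_int n * \<theta>))"
      by (rule sum.reindex_bij_witness[of _ uminus uminus]) auto
    finally show ?thesis by (simp add: left_diff_distrib sum_subtractf)
  qed
  from trig_poly_coeffs_zero[where c = "\<lambda>n. a n - a (- n)", OF this True] show ?thesis by simp
next
  case False
  then show ?thesis using assms unfolding even_trig_poly_def by simp
qed

lemma even_trig_poly_eq:
  assumes "even_trig_poly N a \<phi>"
  shows "complex_of_real (\<phi> \<theta>) = a 0 + (\<Sum>n = 1..N. a (int n) * (e (real n * \<theta>) + e (- (real n * \<theta>))))"
proof -
  have split: "{- int N..int N} = insert 0 (int ` {1..N} \<union> (\<lambda>n. - int n) ` {1..N})"
  proof (intro equalityI subsetI)
    fix x assume x: "x \<in> {- int N..int N}"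
    consider "x = 0" | "x > 0" | "x < 0" by linarith
    then show "x \<in> insert 0 (int ` {1..N} \<union> (\<lambda>n. - int n) ` {1..N})"
    proof cases
      case 2
      then have "x = int (nat x)" "nat x \<in> {1..N}" using x by auto
      then show ?thesis by blast
    next
      case 3
      then have "x = - int (nat (- x))" "nat (- x) \<in> {1..N}" using x by auto
      then show ?thesis by blast
    qed simp
  qed auto
  let ?F = "\<lambda>n::int. a n * e (real_of_int n * \<theta>)"
  have "complex_of_real (\<phi> \<theta>) = sum ?F {- int N..int N}" using assms unfolding even_trig_poly_def by blast
  also have "\<dots> = ?F 0 + (sum ?F (int ` {1..N}) + sum ?F ((\<lambda>n. - int n) ` {1..N}))"
    unfolding split by (subst sum.insert) (auto intro!: arg_cong2[of _ _ _ _ "(+)"] sum.union_disjoint)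
  also have "sum ?F (int ` {1..N}) = (\<Sum>n = 1..N. a (int n) * e (real n * \<theta>))"
    by (subst sum.reindex) (auto simp: inj_on_def)
  also have "sum ?F ((\<lambda>n. - int n) ` {1..N}) = (\<Sum>n = 1..N. a (int n) * e (- (real n * \<theta>)))"
    by (subst sum.reindex) (auto simp: inj_on_def even_trig_poly_coeffs[OF assms])
  finally show ?thesis by (simp add: e_zero sum.distrib distrib_left)
qed

lemma sum_even_terms:
  fixes f :: "nat \<Rightarrow> 'b::comm_monoid_add"
  assumes "\<And>n. odd n \<Longrightarrow> f n = 0"
  shows "(\<Sum>n = 1..N. f n) = (\<Sum>n = 1..N div 2. f (2 * n))"
proof -
  have "(\<Sum>n = 1..N. f n) = (\<Sum>n\<in>(\<lambda>n. 2 * n) ` {1..N div 2}. f n)"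
  proof (rule sum.mono_neutral_right)
    show "\<forall>i\<in>{1..N} - (\<lambda>n. 2 * n) ` {1..N div 2}. f i = 0"
    proof
      fix i assume i: "i \<in> {1..N} - (\<lambda>n. 2 * n) ` {1..N div 2}"
      have "odd i"
      proof
        assume "even i"
        then have "i = 2 * (i div 2)" "i div 2 \<in> {1..N div 2}" using i by (auto simp: div_le_mono)
        then show False using i by blast
      qed
      then show "f i = 0" by (rule assms)
    qed
  qed auto
  also have "\<dots> = (\<Sum>n = 1..N div 2. f (2 * n))" by (subst sum.reindex) (auto simp: inj_on_def)
  finally show ?thesis .
qed

lemma half_range: "{n::nat. 1 \<le> n \<and> real n \<le> real N / 2} = {1..N div 2}"
proof -
  have h: "real n \<le> real N / 2 \<longleftrightarrow> n \<le> N div 2" for n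
  proof -
    have "real n \<le> real N / 2 \<longleftrightarrow> real (2 * n) \<le> real N" by (simp add: field_simps)
    also have "\<dots> \<longleftrightarrow> n \<le> N div 2" unfolding of_nat_le_iff by presburger
    finally show ?thesis .
  qed
  show ?thesis by (rule Set.set_eqI) (simp only: mem_Collect_eq h atLeastAtMost_iff)
qed

lemma Phi_hat_nat: "g \<ge> 1 \<Longrightarrow> Phi_hat g a (real \<nu> / real g) = 2 * of_nat g * a (int (2 * \<nu>))"
proof -
  assume "g \<ge> 1"
  then have "2 * real g * (real \<nu> / real g) = real_of_int (int (2 * \<nu>))" by simp
  then show ?thesis unfolding Phi_hat_def by (simp only: floor_of_int)
qed

section \<open>The ensemble average in terms of power sums\<close>

context poly_over_odd_field
begin

text \<open>The explicit formula evaluates the sum of e(-n \<theta>) as a real number; the sum of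
  e(n \<theta>) is its conjugate and hence equal.\<close>

lemma power_sum_angles:
  assumes z: "zero_angles R g \<theta>" and D: "D \<in> hyperelliptic R (2 * g + 1)" and n: "n \<ge> 1"
  shows "(\<Sum>j = 1..2 * g. e (real n * \<theta> D j) + e (- (real n * \<theta> D j))) =
    - 2 * complex_of_real (real_of_int (psum (\<lambda>f. quad_char R D f) n) / sqrt (real q) ^ n)"
proof -
  let ?s = "complex_of_real (sqrt (real q))"
  let ?p = "real_of_int (psum (\<lambda>f. quad_char R D f) n)"
  have s0: "?s ^ n \<noteq> 0" using order_ge_3 by simp
  have "complex_of_real ?p = - (\<Sum>j = 1..2 * g. ?s ^ n * e (- (real n * \<theta> D j)))"
    using explicit_formula[OF z D n] by (simp add: power_mult_distrib e_power)
  then have "complex_of_real ?p = - (?s ^ n * (\<Sum>j = 1..2 * g. e (- (real n * \<theta> D j))))"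
    by (simp only: sum_distrib_left)
  then have m: "(\<Sum>j = 1..2 * g. e (- (real n * \<theta> D j))) = complex_of_real (- (?p / sqrt (real q) ^ n))"
    using s0 by (simp add: field_simps)
  have "(\<Sum>j = 1..2 * g. e (real n * \<theta> D j)) = cnj (\<Sum>j = 1..2 * g. e (- (real n * \<theta> D j)))"
    by (simp add: cnj_e)
  also have "\<dots> = complex_of_real (- (?p / sqrt (real q) ^ n))" unfolding m by (rule complex_cnj_complex_of_real)
  finally show ?thesis unfolding sum.distrib m by simp
qed

lemma ensemble_avg_eq:
  assumes z: "zero_angles R g \<theta>" and \<phi>: "even_trig_poly N a \<phi>" and g: "g \<ge> 1"
  shows "complex_of_real (ensemble_avg R (2 * g + 1) (Sigma1 \<phi> g \<theta>)) = Phi_hat g a 0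
    - 1 / of_nat g * (\<Sum>\<nu> = 1..N div 2. Phi_hat g a (real \<nu> / real g) *
        complex_of_real (real_of_int (trace_sum g (2 * \<nu>)) / (real q ^ \<nu> * hyper_size g)))"
proof -
  let ?H = "hyperelliptic R (2 * g + 1)"
  let ?p = "\<lambda>D n. real_of_int (psum (\<lambda>f. quad_char R D f) n)"
  let ?s = "sqrt (real q)"
  have q3: "real q \<ge> 3" using order_ge_3 by simp
  have one: "complex_of_real (Sigma1 \<phi> g \<theta> D) = 2 * of_nat g * a 0 - 2 * (\<Sum>n = 1..N. a (int n) * complex_of_real (?p D n / ?s ^ n))"
    if D: "D \<in> ?H" for D
  proof -
    have "complex_of_real (Sigma1 \<phi> g \<theta> D) = (\<Sum>j = 1..2 * g. complex_of_real (\<phi> (\<theta> D j)))"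
      unfolding Sigma1_def Phi_def using g by simp
    also have "\<dots> = 2 * of_nat g * a 0 + (\<Sum>j = 1..2 * g. \<Sum>n = 1..N. a (int n) * (e (real n * \<theta> D j) + e (- (real n * \<theta> D j))))"
      unfolding even_trig_poly_eq[OF \<phi>] by (simp add: sum.distrib)
    also have "(\<Sum>j = 1..2 * g. \<Sum>n = 1..N. a (int n) * (e (real n * \<theta> D j) + e (- (real n * \<theta> D j))))
      = (\<Sum>n = 1..N. a (int n) * (\<Sum>j = 1..2 * g. e (real n * \<theta> D j) + e (- (real n * \<theta> D j))))"
      unfolding sum_distrib_left by (rule sum.swap)
    also have "\<dots> = (\<Sum>n = 1..N. a (int n) * (- 2 * complex_of_real (?p D n / ?s ^ n)))"
      by (intro sum.cong refl arg_cong2[of _ _ _ _ times] power_sum_angles[OF z D]) simp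
    finally show ?thesis by (simp add: sum_distrib_left sum_negf mult_ac)
  qed
  have Ms: "(\<Sum>D\<in>?H. ?p D n) = real_of_int (trace_sum g n)" for n by (simp add: trace_sum_def)
  have cH: "complex_of_real (hyper_size g) = of_nat (card ?H)" using hyper_size_eq[OF g] by (metis of_real_of_nat_eq)
  have h0: "complex_of_real (hyper_size g) \<noteq> 0" using hyper_size_pos[of g] by simp
  have "(\<Sum>D\<in>?H. complex_of_real (Sigma1 \<phi> g \<theta> D)) =
     complex_of_real (hyper_size g) * (2 * of_nat g * a 0) - 2 * (\<Sum>D\<in>?H. \<Sum>n = 1..N. a (int n) * complex_of_real (?p D n / ?s ^ n))"
    unfolding cH by (simp add: one sum_subtractf sum_distrib_left)
  also have "(\<Sum>D\<in>?H. \<Sum>n = 1..N. a (int n) * complex_of_real (?p D n / ?s ^ n)) = (\<Sum>n = 1..N. a (int n) * complex_of_real ((\<Sum>D\<in>?H. ?p D n) / ?s ^ n))"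
    unfolding sum_divide_distrib of_real_sum sum_distrib_left by (rule sum.swap)
  also have "\<dots> = (\<Sum>n = 1..N. a (int n) * complex_of_real (real_of_int (trace_sum g n) / ?s ^ n))" unfolding Ms ..
  also have "\<dots> = (\<Sum>\<nu> = 1..N div 2. a (int (2 * \<nu>)) * complex_of_real (real_of_int (trace_sum g (2 * \<nu>)) / ?s ^ (2 * \<nu>)))"
    by (rule sum_even_terms) (simp add: trace_sum_odd)
  also have "\<dots> = (\<Sum>\<nu> = 1..N div 2. a (int (2 * \<nu>)) * complex_of_real (real_of_int (trace_sum g (2 * \<nu>)) / real q ^ \<nu>))"
    using q3 by (simp add: power_mult)
  finally have S: "(\<Sum>D\<in>?H. complex_of_real (Sigma1 \<phi> g \<theta> D)) =
     complex_of_real (hyper_size g) * (2 * of_nat g * a 0) - 2 * (\<Sum>\<nu> = 1..N div 2. a (int (2 * \<nu>)) * complex_of_real (real_of_int (trace_sum g (2 * \<nu>)) / real q ^ \<nu>))" .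
  have "complex_of_real (ensemble_avg R (2 * g + 1) (Sigma1 \<phi> g \<theta>)) = (\<Sum>D\<in>?H. complex_of_real (Sigma1 \<phi> g \<theta> D)) / complex_of_real (hyper_size g)"
    unfolding ensemble_avg_def hyper_size_eq[OF g] by simp
  also have "\<dots> = 2 * of_nat g * a 0 - 2 * (\<Sum>\<nu> = 1..N div 2. a (int (2 * \<nu>)) * complex_of_real (real_of_int (trace_sum g (2 * \<nu>)) / real q ^ \<nu>)) / complex_of_real (hyper_size g)"
    unfolding S diff_divide_distrib nonzero_mult_div_cancel_left[OF h0] ..
  also have "2 * (\<Sum>\<nu> = 1..N div 2. a (int (2 * \<nu>)) * complex_of_real (real_of_int (trace_sum g (2 * \<nu>)) / real q ^ \<nu>)) / complex_of_real (hyper_size g)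
     = 1 / of_nat g * (\<Sum>\<nu> = 1..N div 2. Phi_hat g a (real \<nu> / real g) *
        complex_of_real (real_of_int (trace_sum g (2 * \<nu>)) / (real q ^ \<nu> * hyper_size g)))"
    unfolding sum_distrib_left sum_divide_distrib Phi_hat_nat[OF g] using g by (intro sum.cong refl) simp
  finally show ?thesis by (simp add: Phi_hat_def)
qed

lemma c_term_eq: "c_term R g N a = 1 / of_nat g * (\<Sum>\<nu> = 1..N div 2. Phi_hat g a (real \<nu> / real g) * complex_of_real (\<kappa> \<nu>))"
  unfolding c_term_def \<kappa>_def half_range by (simp add: of_real_sum)

definition trace_err :: "nat \<Rightarrow> nat \<Rightarrow> real" where
  "trace_err g \<nu> = real_of_int (trace_sum g (2 * \<nu>)) / (real q ^ \<nu> * hyper_size g) - (1 - \<kappa> \<nu> + dual_ratio g \<nu>)"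

lemma ensemble_avg_expansion:
  assumes z: "zero_angles R g \<theta>" and \<phi>: "even_trig_poly N a \<phi>" and g: "g \<ge> 1"
  shows "complex_of_real (ensemble_avg R (2 * g + 1) (Sigma1 \<phi> g \<theta>)) = Phi_hat g a 0
    - 1 / of_nat g * (\<Sum>\<nu> = 1..N div 2. Phi_hat g a (real \<nu> / real g)) + c_term R g N a
    - 1 / of_nat g * (\<Sum>\<nu> = 1..N div 2. Phi_hat g a (real \<nu> / real g) * complex_of_real (dual_ratio g \<nu>))
    - 1 / of_nat g * (\<Sum>\<nu> = 1..N div 2. Phi_hat g a (real \<nu> / real g) * complex_of_real (trace_err g \<nu>))"
proof -
  have "complex_of_real (real_of_int (trace_sum g (2 * \<nu>)) / (real q ^ \<nu> * hyper_size g)) =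
      1 - complex_of_real (\<kappa> \<nu>) + complex_of_real (dual_ratio g \<nu>) + complex_of_real (trace_err g \<nu>)" for \<nu>
    by (simp add: trace_err_def)
  then show ?thesis unfolding ensemble_avg_eq[OF assms] c_term_eq
    by (simp add: distrib_left right_diff_distrib sum.distrib sum_subtractf)
qed

lemma trace_err_bound:
  assumes "\<nu> \<ge> 1"
  shows "\<bar>trace_err g \<nu>\<bar> \<le> (260 + (if g mod (2 * \<nu>) \<le> \<nu> then 128 * real \<nu> * real q ^ \<nu> else 0)) / hyper_size g"
  unfolding trace_err_def by (rule trace_sum_bound[OF assms])

lemma sum_powr_le:
  assumes "finite A" "\<And>i. i \<in> A \<Longrightarrow> real i \<le> x"
  shows "(\<Sum>i\<in>A. real q ^ i) \<le> 2 * real q powr x"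
proof (cases "A = {}")
  case False
  then obtain i where i: "i \<in> A" by blast
  have x0: "x \<ge> 0" using assms(2)[OF i] by linarith
  have "(\<Sum>i\<in>A. real q ^ i) \<le> 2 * real q ^ nat \<lfloor>x\<rfloor>"
    using assms by (intro sum_pow_le) (auto simp: le_nat_floor)
  also have "real q ^ nat \<lfloor>x\<rfloor> = real q powr real (nat \<lfloor>x\<rfloor>)" using order_ge_3 by (simp add: powr_realpow)
  also have "\<dots> \<le> real q powr x" using order_ge_3 x0 by (intro powr_mono) auto
  finally show ?thesis by simp
qed simp

lemma inverse_hyper_size_le: "1 / hyper_size g \<le> 2 * real q powr (- 2 * real g - 1)"
proof -
  have q3: "real q \<ge> 3" using order_ge_3 by simp
  have "real q powr (2 * real g + 1) = real q ^ (2 * g) * real q"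
    using q3 by (simp add: powr_add powr_realpow[symmetric])
  also have "\<dots> \<le> real q ^ (2 * g) * (2 * (real q - 1))" using q3 by (intro mult_left_mono) auto
  also have "\<dots> = 2 * hyper_size g" by (simp add: hyper_size_def)
  finally have le: "real q powr (2 * real g + 1) \<le> 2 * hyper_size g" .
  have "1 / hyper_size g = 2 * (1 / (2 * hyper_size g))" by simp
  also have "\<dots> \<le> 2 * (1 / real q powr (2 * real g + 1))"
    using le q3 hyper_size_pos[of g] by (intro mult_left_mono divide_left_mono) auto
  also have "1 / real q powr (2 * real g + 1) = real q powr (- 2 * real g - 1)"
    by (simp add: powr_minus_divide[symmetric])
  finally show ?thesis .
qed

text \<open>Only \<nu> with g mod 2\<nu> \<le> \<nu> carry a term \<nu> q^\<nu>. They satisfy \<nu>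
  \<le> x, so the powers form part of a geometric sum, while \<nu> \<le> M \<le> g t is absorbed by
  1/g. The constant 1032 is 2(260 + 256), the outer 2 coming from q - 1 \<ge> q/2.\<close>

lemma trace_err_sum_bound:
  assumes g: "g \<ge> 1" and t: "t \<ge> 0" "real M \<le> real g * t" and x: "x \<ge> 0"
    and A: "\<And>\<nu>. \<lbrakk>1 \<le> \<nu>; \<nu> \<le> M; g mod (2 * \<nu>) \<le> \<nu>\<rbrakk> \<Longrightarrow> real \<nu> \<le> x"
  shows "1 / real g * (\<Sum>\<nu> = 1..M. \<bar>trace_err g \<nu>\<bar>) \<le> 1032 * t * real q powr (x - 2 * real g - 1)"
proof -
  let ?A = "{\<nu> \<in> {1..M}. g mod (2 * \<nu>) \<le> \<nu>}"
  have q3: "real q \<ge> 3" using order_ge_3 by simp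
  have "(\<Sum>\<nu> = 1..M. \<bar>trace_err g \<nu>\<bar>) \<le> (\<Sum>\<nu> = 1..M. (260 + (if g mod (2 * \<nu>) \<le> \<nu> then 128 * real \<nu> * real q ^ \<nu> else 0)) / hyper_size g)"
    by (intro sum_mono trace_err_bound) simp
  also have "\<dots> = (260 * real M + (\<Sum>\<nu> = 1..M. if g mod (2 * \<nu>) \<le> \<nu> then 128 * real \<nu> * real q ^ \<nu> else 0)) / hyper_size g"
    unfolding sum_divide_distrib[symmetric] sum.distrib by simp
  also have "(\<Sum>\<nu> = 1..M. if g mod (2 * \<nu>) \<le> \<nu> then 128 * real \<nu> * real q ^ \<nu> else 0) = (\<Sum>\<nu>\<in>?A. 128 * real \<nu> * real q ^ \<nu>)"
    by (subst sum.inter_filter) auto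
  also have "\<dots> \<le> (\<Sum>\<nu>\<in>?A. 128 * real M * real q ^ \<nu>)" by (intro sum_mono mult_right_mono) auto
  also have "\<dots> = 128 * real M * (\<Sum>\<nu>\<in>?A. real q ^ \<nu>)" by (simp add: sum_distrib_left)
  also have "\<dots> \<le> 128 * real M * (2 * real q powr x)" using A by (intro mult_left_mono sum_powr_le) auto
  also have "(260 * real M + 128 * real M * (2 * real q powr x)) / hyper_size g \<le> (516 * real M * real q powr x) / hyper_size g"
  proof (intro divide_right_mono)
    have "1 \<le> real q powr x" using q3 x by (simp add: ge_one_powr_ge_zero)
    then have "260 * real M * 1 \<le> 260 * real M * real q powr x" by (intro mult_left_mono) auto
    then show "260 * real M + 128 * real M * (2 * real q powr x) \<le> 516 * real M * real q powr x" by simp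
  qed (use hyper_size_pos[of g] in simp)
  finally have "(\<Sum>\<nu> = 1..M. \<bar>trace_err g \<nu>\<bar>) \<le> 516 * real M * real q powr x / hyper_size g"
    using hyper_size_pos[of g] by (simp add: divide_right_mono)
  also have "\<dots> = 516 * real M * real q powr x * (1 / hyper_size g)" by simp
  also have "\<dots> \<le> 516 * (real g * t) * real q powr x * (2 * real q powr (- 2 * real g - 1))"
    using t g hyper_size_pos[of g] by (intro mult_mono inverse_hyper_size_le) auto
  also have "\<dots> = real g * (1032 * t * real q powr (x - 2 * real g - 1))"
    by (simp add: powr_add[symmetric] algebra_simps)
  finally show ?thesis using g by (simp add: field_simps)
qed

end

section \<open>The secondary main terms\<close>

lemma double_div_mod_unique:
  assumes "(g::nat) = 2 * \<nu> * k + \<rho>" "\<rho> < 2 * \<nu>"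
  shows "g div (2 * \<nu>) = k" "g mod (2 * \<nu>) = \<rho>"
  using assms by (simp_all add: div_mult_self3)

text \<open>With quotient k and residue at most \<nu> one has 2g \<le> (2k + 1) 2\<nu> \<le> (2k +
  1) N. For k < K this contradicts the upper bound on N, the -1 in 2g - 1 providing
  strictness.\<close>

lemma window_le_div:
  assumes K: "K \<ge> 1" and N: "real N \<le> (2 * real g - 1) / (2 * real K - 1)"
    and \<nu>: "1 \<le> \<nu>" "\<nu> \<le> N div 2" and \<rho>: "g mod (2 * \<nu>) \<le> \<nu>"
  shows "K \<le> g div (2 * \<nu>)"
proof (rule ccontr)
  let ?k = "g div (2 * \<nu>)"
  assume "\<not> K \<le> ?k"
  then have k: "2 * real ?k + 1 \<le> 2 * real K - 1" by linarith
  have "2 * real K - 1 > 0" using K by linarith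
  then have N': "(2 * real K - 1) * real N \<le> 2 * real g - 1" using N by (simp add: field_simps)
  have "g = 2 * \<nu> * ?k + g mod (2 * \<nu>)" by simp
  then have "g \<le> 2 * \<nu> * ?k + \<nu>" using \<rho> by linarith
  then have "real g \<le> real (2 * \<nu> * ?k + \<nu>)" by (simp only: of_nat_le_iff)
  then have "2 * real g \<le> (2 * real ?k + 1) * (2 * real \<nu>)" by (simp add: algebra_simps)
  also have "\<dots> \<le> (2 * real K - 1) * real N" using k \<nu> by (intro mult_mono) auto
  finally show False using N' by linarith
qed

context poly_over_odd_field
begin

text \<open>If g = (2k + 1) \<nu>, then g = 2\<nu> k + \<nu>: these k correspond to the \<nu> with g
  mod 2\<nu> equal to \<nu>. The lower bound on N puts \<nu> into the range up to N/2 for all k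
  \<ge> K.\<close>

lemma odd_divisor_sum:
  fixes a :: "int \<Rightarrow> complex"
  assumes g: "g \<ge> 1" and K: "K \<ge> 1" and N1: "2 * real g / (2 * real K + 1) \<le> real N"
    and N2: "real N \<le> (2 * real g - 1) / (2 * real K - 1)"
  shows "(\<Sum>k = K..K'. of_bool ((2 * k + 1) dvd g) / (of_nat g * (complex_of_real (real q) - 1)) *
       Phi_hat g a (1 / (2 * real k + 1)) * complex_of_real (real q powr (- (4 * real k * real g / (2 * real k + 1)))))
    = 1 / of_nat g * (\<Sum>\<nu> | \<nu> \<in> {1..N div 2} \<and> g mod (2 * \<nu>) = \<nu> \<and> g div (2 * \<nu>) \<le> K'.
       Phi_hat g a (real \<nu> / real g) * complex_of_real (dual_ratio g \<nu>))"
proof -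
  let ?F = "\<lambda>k. of_bool ((2 * k + 1) dvd g) / (of_nat g * (complex_of_real (real q) - 1)) *
       Phi_hat g a (1 / (2 * real k + 1)) * complex_of_real (real q powr (- (4 * real k * real g / (2 * real k + 1))))"
  have "(\<Sum>k = K..K'. ?F k) = (\<Sum>k | k \<in> {K..K'} \<and> (2 * k + 1) dvd g. ?F k)"
    by (rule sum.mono_neutral_right) auto
  also have "\<dots> = (\<Sum>\<nu> | \<nu> \<in> {1..N div 2} \<and> g mod (2 * \<nu>) = \<nu> \<and> g div (2 * \<nu>) \<le> K'.
       1 / of_nat g * (Phi_hat g a (real \<nu> / real g) * complex_of_real (dual_ratio g \<nu>)))"
  proof (rule sum.reindex_bij_witness[of _ "\<lambda>\<nu>. g div (2 * \<nu>)" "\<lambda>k. g div (2 * k + 1)"])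
    fix k assume k: "k \<in> {k. k \<in> {K..K'} \<and> (2 * k + 1) dvd g}"
    then obtain \<nu> where \<nu>: "g = (2 * k + 1) * \<nu>" unfolding dvd_def by blast
    have \<nu>1: "\<nu> \<ge> 1" using \<nu> g by (cases \<nu>) auto
    have gd: "g div (2 * k + 1) = \<nu>" unfolding \<nu> by (rule nonzero_mult_div_cancel_left) simp
    have "g = 2 * \<nu> * k + \<nu>" using \<nu> by (simp add: algebra_simps)
    note dm = double_div_mod_unique[OF this]
    have dm: "g div (2 * \<nu>) = k" "g mod (2 * \<nu>) = \<nu>" using dm \<nu>1 by simp_all
    show "g div (2 * (g div (2 * k + 1))) = k" unfolding gd by (rule dm)
    have gr: "real g = (2 * real k + 1) * real \<nu>" unfolding \<nu> by (simp add: distrib_right)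
    have "(2 * real K + 1) * (2 * real \<nu>) \<le> (2 * real k + 1) * (2 * real \<nu>)" using k by (intro mult_right_mono) auto
    also have "\<dots> = 2 * real g" unfolding gr by simp
    also have "\<dots> \<le> (2 * real K + 1) * real N" using N1 K by (simp add: field_simps)
    finally have "2 * real \<nu> \<le> real N" by simp
    then have "\<nu> \<le> N div 2" by linarith
    then show "g div (2 * k + 1) \<in> {\<nu>. \<nu> \<in> {1..N div 2} \<and> g mod (2 * \<nu>) = \<nu> \<and> g div (2 * \<nu>) \<le> K'}"
      unfolding gd using dm \<nu>1 k by simp
    have x: "1 / (2 * real k + 1) = real \<nu> / real g" unfolding gr using \<nu>1 by simp
    have y: "- (4 * real k * real g / (2 * real k + 1)) = 2 * real \<nu> - 2 * real g"
    proof -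
      have "4 * real k * real g / (2 * real k + 1) = 4 * real k * real \<nu>" unfolding gr by simp
      then show ?thesis unfolding gr by (simp add: algebra_simps)
    qed
    show "1 / of_nat g * (Phi_hat g a (real (g div (2 * k + 1)) / real g) * complex_of_real (dual_ratio g (g div (2 * k + 1)))) = ?F k"
      unfolding gd x y dual_ratio_cases(1)[OF \<nu>1 dm(2)] using k by simp
  next
    fix \<nu> assume \<nu>: "\<nu> \<in> {\<nu>. \<nu> \<in> {1..N div 2} \<and> g mod (2 * \<nu>) = \<nu> \<and> g div (2 * \<nu>) \<le> K'}"
    define k where "k = g div (2 * \<nu>)"
    have "g = 2 * \<nu> * k + g mod (2 * \<nu>)" by (simp add: k_def)
    then have gk: "g = (2 * k + 1) * \<nu>" using \<nu> by (simp add: algebra_simps)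
    have "g div (2 * k + 1) = \<nu>" by (subst gk, rule nonzero_mult_div_cancel_left) simp
    then show "g div (2 * (g div (2 * \<nu>)) + 1) = \<nu>" unfolding k_def .
    have "K \<le> k" unfolding k_def using \<nu> by (intro window_le_div[OF K N2]) auto
    moreover have "(2 * k + 1) dvd g" by (subst gk) (rule dvd_triv_left)
    moreover have "k \<le> K'" using \<nu> by (simp add: k_def)
    ultimately show "g div (2 * \<nu>) \<in> {k. k \<in> {K..K'} \<and> (2 * k + 1) dvd g}"
      unfolding k_def[symmetric] by simp
  qed
  finally show ?thesis unfolding sum_distrib_left[symmetric] .
qed

text \<open>The bounds on n say 0 < g - 2nk < n, so k is g div 2n. The case g = 2nk, excluded by the
  g - 1, is left to the error term. For the residue \<rho> the exponent 2\<rho> - 2g of the dual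
  term equals -4kn.\<close>

lemma window_double_sum:
  fixes a :: "int \<Rightarrow> complex"
  assumes K: "K \<ge> 1" and N2: "real N \<le> (2 * real g - 1) / (2 * real K - 1)"
  shows "(\<Sum>k = K..K'. \<Sum>n | 1 \<le> n \<and> (real g + 1) / (2 * real k + 1) \<le> real n \<and>
            real n \<le> min (real N / 2) ((real g - 1) / (2 * real k)).
        Phi_hat g a (real n / real g) * complex_of_real (real q powr (- (4 * real k * real n))))
    = - (\<Sum>\<nu> | \<nu> \<in> {1..N div 2} \<and> 0 < g mod (2 * \<nu>) \<and> g mod (2 * \<nu>) < \<nu> \<and> g div (2 * \<nu>) \<le> K'.
       Phi_hat g a (real \<nu> / real g) * complex_of_real (dual_ratio g \<nu>))"
proof -
  let ?I = "\<lambda>k. {n. 1 \<le> n \<and> (real g + 1) / (2 * real k + 1) \<le> real n \<and> real n \<le> min (real N / 2) ((real g - 1) / (2 * real k))}"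
  let ?F = "\<lambda>k n. Phi_hat g a (real n / real g) * complex_of_real (real q powr (- (4 * real k * real n)))"
  have half: "real n \<le> real N / 2 \<longleftrightarrow> n \<le> N div 2" for n by linarith
  have fin: "finite (?I k)" for k by (rule finite_subset[of _ "{..N div 2}"]) (auto simp: half)
  have window: "n \<in> ?I k \<longleftrightarrow> n \<in> {1..N div 2} \<and> 0 < g mod (2 * n) \<and> g mod (2 * n) < n \<and> g div (2 * n) = k" if k: "k \<ge> 1" for k n
  proof -
    have "(real g + 1) / (2 * real k + 1) \<le> real n \<longleftrightarrow> real (g + 1) \<le> real ((2 * k + 1) * n)"
      by (simp add: pos_divide_le_eq algebra_simps)
    moreover have "real n \<le> (real g - 1) / (2 * real k) \<longleftrightarrow> real (2 * k * n + 1) \<le> real g"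
      using k by (simp add: pos_le_divide_eq mult_ac) linarith
    ultimately have "n \<in> ?I k \<longleftrightarrow> 1 \<le> n \<and> n \<le> N div 2 \<and> g + 1 \<le> (2 * k + 1) * n \<and> 2 * k * n + 1 \<le> g"
      unfolding of_nat_le_iff by (simp only: mem_Collect_eq min.bounded_iff half) blast
    also have "\<dots> \<longleftrightarrow> n \<in> {1..N div 2} \<and> 0 < g mod (2 * n) \<and> g mod (2 * n) < n \<and> g div (2 * n) = k"
    proof
      assume h: "1 \<le> n \<and> n \<le> N div 2 \<and> g + 1 \<le> (2 * k + 1) * n \<and> 2 * k * n + 1 \<le> g"
      have e1: "(2 * k + 1) * n = 2 * n * k + n" "2 * k * n = 2 * n * k" by (simp_all add: algebra_simps)
      have "g = 2 * n * k + (g - 2 * n * k)" "g - 2 * n * k < 2 * n" using h unfolding e1 by linarith+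
      from double_div_mod_unique[OF this] show "n \<in> {1..N div 2} \<and> 0 < g mod (2 * n) \<and> g mod (2 * n) < n \<and> g div (2 * n) = k"
        using h unfolding e1 atLeastAtMost_iff by linarith
    next
      assume h: "n \<in> {1..N div 2} \<and> 0 < g mod (2 * n) \<and> g mod (2 * n) < n \<and> g div (2 * n) = k"
      have e1: "(2 * k + 1) * n = 2 * n * k + n" "2 * k * n = 2 * n * k" by (simp_all add: algebra_simps)
      have "g = 2 * n * k + g mod (2 * n)" using h by (metis mult_div_mod_eq)
      then show "1 \<le> n \<and> n \<le> N div 2 \<and> g + 1 \<le> (2 * k + 1) * n \<and> 2 * k * n + 1 \<le> g"
        using h unfolding e1 by (metis Suc_eq_plus1 Suc_leI add_less_cancel_left atLeastAtMost_iff less_add_same_cancel1)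
    qed
    finally show ?thesis .
  qed
  have "(\<Sum>k = K..K'. \<Sum>n\<in>?I k. ?F k n) = (\<Sum>(k, n)\<in>(SIGMA k:{K..K'}. ?I k). ?F k n)"
    using fin by (intro sum.Sigma) auto
  also have "\<dots> = (\<Sum>\<nu> | \<nu> \<in> {1..N div 2} \<and> 0 < g mod (2 * \<nu>) \<and> g mod (2 * \<nu>) < \<nu> \<and> g div (2 * \<nu>) \<le> K'.
       - (Phi_hat g a (real \<nu> / real g) * complex_of_real (dual_ratio g \<nu>)))"
  proof (rule sum.reindex_bij_witness[of _ "\<lambda>n. (g div (2 * n), n)" snd])
    fix p assume "p \<in> (SIGMA k:{K..K'}. ?I k)"
    then obtain k n where p: "p = (k, n)" "k \<in> {K..K'}" "n \<in> ?I k" by blast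
    have k: "k \<ge> 1" using p(2) K by simp
    have w: "n \<in> {1..N div 2}" "0 < g mod (2 * n)" "g mod (2 * n) < n" "g div (2 * n) = k" using window[OF k] p(3) by blast+
    show "(g div (2 * snd p), snd p) = p" using p w by simp
    show "snd p \<in> {\<nu>. \<nu> \<in> {1..N div 2} \<and> 0 < g mod (2 * \<nu>) \<and> g mod (2 * \<nu>) < \<nu> \<and> g div (2 * \<nu>) \<le> K'}"
      using p(1,2) w by simp
    have "g = 2 * n * k + g mod (2 * n)" using w(4) by (metis mult_div_mod_eq)
    then have "real g = real (2 * n * k + g mod (2 * n))" by (simp only:)
    then have "2 * real (g mod (2 * n)) - 2 * real g = - (4 * real k * real n)" by (simp add: algebra_simps)
    moreover have "dual_ratio g n = - (real q powr (2 * real (g mod (2 * n)) - 2 * real g))" using w by (intro dual_ratio_cases(2)) auto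
    ultimately have "dual_ratio g n = - (real q powr (- (4 * real k * real n)))" by simp
    then show "- (Phi_hat g a (real (snd p) / real g) * complex_of_real (dual_ratio g (snd p))) = (case p of (k, n) \<Rightarrow> ?F k n)"
      unfolding p(1) by simp
  next
    fix n assume n: "n \<in> {\<nu>. \<nu> \<in> {1..N div 2} \<and> 0 < g mod (2 * \<nu>) \<and> g mod (2 * \<nu>) < \<nu> \<and> g div (2 * \<nu>) \<le> K'}"
    show "snd (g div (2 * n), n) = n" by simp
    have "K \<le> g div (2 * n)" using n by (intro window_le_div[OF K N2]) auto
    moreover have "n \<in> ?I (g div (2 * n))" using window[of "g div (2 * n)" n] n calculation K by simp
    moreover have "g div (2 * n) \<le> K'" using n by blast
    ultimately show "(g div (2 * n), n) \<in> (SIGMA k:{K..K'}. ?I k)" by (intro SigmaI) (simp only: atLeastAtMost_iff)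
  qed
  finally show ?thesis by (simp only: sum_negf)
qed

lemma dual_ratio_abs_le:
  assumes "\<nu> \<ge> 1" "g mod (2 * \<nu>) \<le> \<nu>"
  shows "\<bar>dual_ratio g \<nu>\<bar> \<le> 2 * real q powr (2 * real \<nu> - 2 * real g - 1)"
    and "\<bar>dual_ratio g \<nu>\<bar> \<le> real q powr (2 * real \<nu> - 2 * real g)"
proof -
  have q3: "real q \<ge> 3" using order_ge_3 by simp
  have pm: "real q powr (2 * real \<nu> - 2 * real g - 1) = real q powr (2 * real \<nu> - 2 * real g) / real q"
    using q3 by (simp add: powr_diff)
  show 1: "\<bar>dual_ratio g \<nu>\<bar> \<le> 2 * real q powr (2 * real \<nu> - 2 * real g - 1)"
  proof (cases "g mod (2 * \<nu>) = \<nu>")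
    case True
    have "real q powr (2 * real \<nu> - 2 * real g) / (real q - 1) \<le> real q powr (2 * real \<nu> - 2 * real g) / (real q / 2)"
      using q3 by (intro divide_left_mono) auto
    then show ?thesis unfolding dual_ratio_cases(1)[OF assms(1) True] pm using q3 by (simp add: mult.commute)
  next
    case False
    then have lt: "g mod (2 * \<nu>) < \<nu>" using assms by simp
    then have "2 * real (g mod (2 * \<nu>)) - 2 * real g \<le> 2 * real \<nu> - 2 * real g - 1" by linarith
    then have "real q powr (2 * real (g mod (2 * \<nu>)) - 2 * real g) \<le> real q powr (2 * real \<nu> - 2 * real g - 1)"
      using q3 by (intro powr_mono) auto
    moreover have "real q powr (2 * real \<nu> - 2 * real g - 1) \<ge> 0" by simp
    moreover have "\<bar>dual_ratio g \<nu>\<bar> = real q powr (2 * real (g mod (2 * \<nu>)) - 2 * real g)"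
      unfolding dual_ratio_cases(2)[OF assms(1) lt] abs_minus_cancel by (rule abs_of_nonneg) simp
    ultimately show ?thesis by linarith
  qed
  also have "\<dots> \<le> real q powr (2 * real \<nu> - 2 * real g)" unfolding pm using q3 by (simp add: field_simps)
  finally show "\<bar>dual_ratio g \<nu>\<bar> \<le> real q powr (2 * real \<nu> - 2 * real g)" .
qed

lemma cmod_weighted_sum_le:
  assumes "\<And>\<nu>. cmod (b \<nu>) \<le> B"
  shows "cmod (1 / of_nat g * (\<Sum>\<nu>\<in>A. b \<nu> * complex_of_real (f \<nu>))) \<le> B * (1 / real g * (\<Sum>\<nu>\<in>A. \<bar>f \<nu>\<bar>))"
proof -
  have "cmod (\<Sum>\<nu>\<in>A. b \<nu> * complex_of_real (f \<nu>)) \<le> (\<Sum>\<nu>\<in>A. B * \<bar>f \<nu>\<bar>)"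
  proof (rule order_trans[OF norm_sum], rule sum_mono)
    show "cmod (b \<nu> * complex_of_real (f \<nu>)) \<le> B * \<bar>f \<nu>\<bar>" for \<nu>
      unfolding norm_mult norm_of_real using assms by (intro mult_right_mono) auto
  qed
  also have "\<dots> = B * (\<Sum>\<nu>\<in>A. \<bar>f \<nu>\<bar>)" by (simp add: sum_distrib_left)
  finally have "1 / real g * cmod (\<Sum>\<nu>\<in>A. b \<nu> * complex_of_real (f \<nu>)) \<le> 1 / real g * (B * (\<Sum>\<nu>\<in>A. \<bar>f \<nu>\<bar>))"
    by (intro mult_left_mono) auto
  moreover have "cmod (1 / of_nat g * (\<Sum>\<nu>\<in>A. b \<nu> * complex_of_real (f \<nu>))) = 1 / real g * cmod (\<Sum>\<nu>\<in>A. b \<nu> * complex_of_real (f \<nu>))"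
    by (simp add: norm_mult norm_divide)
  ultimately show ?thesis by (simp add: mult_ac)
qed

text \<open>Terms with residue 0 belong to no secondary main term and go into the first error. The
  other nonzero ones have quotient above K' and residue at least 1, so 2\<nu>(K' + 1) \<le> g - 1,
  which is the second error. Summing powers of q up to the largest exponent costs a factor
  2.\<close>

lemma leftover_bound:
  assumes g: "g \<ge> 1" and K: "K \<ge> 1" and N2: "real N \<le> (2 * real g - 1) / (2 * real K - 1)"
    and KK: "K \<le> K'" "K' \<le> g"
    and L: "L \<subseteq> {1..N div 2}" "\<And>\<nu>. \<nu> \<in> L \<Longrightarrow> 0 < g mod (2 * \<nu>) \<Longrightarrow> g mod (2 * \<nu>) \<le> \<nu> \<Longrightarrow> K' < g div (2 * \<nu>)"
    and x: "\<And>\<nu>. \<lbrakk>1 \<le> \<nu>; \<nu> \<le> N div 2; g mod (2 * \<nu>) \<le> \<nu>\<rbrakk> \<Longrightarrow> real \<nu> \<le> x"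
  shows "1 / real g * (\<Sum>\<nu>\<in>L. \<bar>dual_ratio g \<nu>\<bar>) \<le> 2 * (real q powr (x - 2 * real g - 1) / real K)
      + 2 * (real q powr ((real g - 1) / (real K' + 1) - 2 * real g) / real g)"
proof -
  have q3: "real q \<ge> 3" using order_ge_3 by simp
  have finL: "finite L" using L(1) by (rule finite_subset) simp
  let ?L0 = "{\<nu> \<in> L. g mod (2 * \<nu>) = 0}"
  let ?L1 = "{\<nu> \<in> L. 0 < g mod (2 * \<nu>) \<and> g mod (2 * \<nu>) \<le> \<nu>}"
  have "(\<Sum>\<nu>\<in>L. \<bar>dual_ratio g \<nu>\<bar>) = (\<Sum>\<nu>\<in>?L0 \<union> ?L1. \<bar>dual_ratio g \<nu>\<bar>)"
  proof (rule sum.mono_neutral_right)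
    show "\<forall>\<nu>\<in>L - (?L0 \<union> ?L1). \<bar>dual_ratio g \<nu>\<bar> = 0"
    proof
      fix \<nu> assume \<nu>: "\<nu> \<in> L - (?L0 \<union> ?L1)"
      then have "\<nu> \<ge> 1" "g mod (2 * \<nu>) > \<nu>" using L(1) by auto
      then show "\<bar>dual_ratio g \<nu>\<bar> = 0" using dual_ratio_cases(3) by simp
    qed
  qed (use finL in auto)
  also have "\<dots> = (\<Sum>\<nu>\<in>?L0. \<bar>dual_ratio g \<nu>\<bar>) + (\<Sum>\<nu>\<in>?L1. \<bar>dual_ratio g \<nu>\<bar>)"
    using finL by (intro sum.union_disjoint) auto
  also have "(\<Sum>\<nu>\<in>?L0. \<bar>dual_ratio g \<nu>\<bar>) \<le> (\<Sum>\<nu>\<in>?L0. real q ^ \<nu> * real q powr (- 2 * real g - 1))"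
  proof (rule sum_mono)
    fix \<nu> assume \<nu>: "\<nu> \<in> ?L0"
    then have \<nu>1: "\<nu> \<ge> 1" "g mod (2 * \<nu>) = 0" using L(1) by auto
    then have "dual_ratio g \<nu> = - (real q powr (- 2 * real g))" using dual_ratio_cases(2)[of \<nu> g] by simp
    then have "\<bar>dual_ratio g \<nu>\<bar> = real q powr (- 2 * real g)" by simp
    \<comment> \<open>Wasteful, but since \<nu> \<ge> 1 this fits the term q^(-2g) under the
      exponent of the first error.\<close>
    also have "\<dots> \<le> real q powr (real \<nu> + (- 2 * real g - 1))" using q3 \<nu>1 by (intro powr_mono) auto
    also have "\<dots> = real q ^ \<nu> * real q powr (- 2 * real g - 1)" using q3 by (simp only: powr_add) (simp add: powr_realpow)
    finally show "\<bar>dual_ratio g \<nu>\<bar> \<le> real q ^ \<nu> * real q powr (- 2 * real g - 1)" .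
  qed
  also have "\<dots> = (\<Sum>\<nu>\<in>?L0. real q ^ \<nu>) * real q powr (- 2 * real g - 1)" by (simp add: sum_distrib_right)
  also have "\<dots> \<le> (2 * real q powr x) * real q powr (- 2 * real g - 1)"
  proof (intro mult_right_mono sum_powr_le)
    fix \<nu> assume "\<nu> \<in> ?L0"
    then show "real \<nu> \<le> x" using L(1) by (intro x) auto
  qed (use finL in auto)
  also have "\<dots> = 2 * real q powr (x - 2 * real g - 1)" by (simp add: powr_add[symmetric] algebra_simps)
  also have "(\<Sum>\<nu>\<in>?L1. \<bar>dual_ratio g \<nu>\<bar>) \<le> (\<Sum>\<nu>\<in>?L1. real q ^ (2 * \<nu>) * real q powr (- 2 * real g))"
  proof (rule sum_mono)
    fix \<nu> assume \<nu>: "\<nu> \<in> ?L1"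
    then have "\<bar>dual_ratio g \<nu>\<bar> \<le> real q powr (2 * real \<nu> - 2 * real g)" using L(1) by (intro dual_ratio_abs_le) auto
    also have "\<dots> = real q powr (real (2 * \<nu>) + - 2 * real g)" by simp
    also have "\<dots> = real q ^ (2 * \<nu>) * real q powr (- 2 * real g)" using q3 by (simp only: powr_add) (simp only: powr_realpow)
    finally show "\<bar>dual_ratio g \<nu>\<bar> \<le> real q ^ (2 * \<nu>) * real q powr (- 2 * real g)" .
  qed
  also have "\<dots> = (\<Sum>i\<in>(\<lambda>\<nu>. 2 * \<nu>) ` ?L1. real q ^ i) * real q powr (- 2 * real g)"
    unfolding sum_distrib_right[symmetric] by (subst sum.reindex) (auto simp: inj_on_def)
  also have "\<dots> \<le> (2 * real q powr ((real g - 1) / (real K' + 1))) * real q powr (- 2 * real g)"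
  proof (intro mult_right_mono sum_powr_le)
    fix i assume "i \<in> (\<lambda>\<nu>. 2 * \<nu>) ` ?L1"
    then obtain \<nu> where \<nu>: "i = 2 * \<nu>" "\<nu> \<in> L" "0 < g mod (2 * \<nu>)" "g mod (2 * \<nu>) \<le> \<nu>" by blast
    have "K' + 1 \<le> g div (2 * \<nu>)" using L(2)[OF \<nu>(2-4)] by simp
    then have "2 * \<nu> * (K' + 1) \<le> 2 * \<nu> * (g div (2 * \<nu>))" by (rule mult_le_mono2)
    also have "\<dots> + 1 \<le> g" using \<nu>(3) mult_div_mod_eq[of "2 * \<nu>" g] by linarith
    finally have "real (2 * \<nu> * (K' + 1) + 1) \<le> real g" unfolding of_nat_le_iff by linarith
    then have "real (2 * \<nu>) * (real K' + 1) \<le> real g - 1" by (simp add: algebra_simps)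
    then show "real i \<le> (real g - 1) / (real K' + 1)" unfolding \<nu>(1) by (subst pos_le_divide_eq) auto
  qed (use finL in auto)
  also have "\<dots> = 2 * real q powr ((real g - 1) / (real K' + 1) - 2 * real g)" by (simp add: powr_add[symmetric] algebra_simps)
  finally have "(\<Sum>\<nu>\<in>L. \<bar>dual_ratio g \<nu>\<bar>) \<le> 2 * real q powr (x - 2 * real g - 1) + 2 * real q powr ((real g - 1) / (real K' + 1) - 2 * real g)" by simp
  then have "1 / real g * (\<Sum>\<nu>\<in>L. \<bar>dual_ratio g \<nu>\<bar>) \<le> 1 / real g * (2 * real q powr (x - 2 * real g - 1) + 2 * real q powr ((real g - 1) / (real K' + 1) - 2 * real g))"
    by (intro mult_left_mono) auto
  also have "\<dots> = 2 * (real q powr (x - 2 * real g - 1) / real g) + 2 * (real q powr ((real g - 1) / (real K' + 1) - 2 * real g) / real g)"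
    by (simp add: distrib_left)
  also have "real q powr (x - 2 * real g - 1) / real g \<le> real q powr (x - 2 * real g - 1) / real K"
    using KK K by (intro divide_left_mono) auto
  finally show ?thesis by simp
qed

end

lemma norm_le_of_eq_neg_diff:
  fixes x :: "'b::real_normed_vector"
  assumes "x = - u - v" shows "norm x \<le> norm u + norm v"
  using norm_triangle_ineq4[of "- u" v] assms by simp

section \<open>Assembly of the two ranges of N\<close>

context poly_over_odd_field
begin

lemma small_range:
  assumes g: "g \<ge> 1" and z: "zero_angles R g \<theta>" and \<phi>: "even_trig_poly N a \<phi>"
    and B: "\<And>n::int. cmod (Phi_hat g a (real_of_int n / (2 * real g))) \<le> B"
    and K: "K \<ge> 1" and N1: "2 * real g / (2 * real K + 1) \<le> real N"
    and N2: "real N \<le> (2 * real g - 1) / (2 * real K - 1)" and KK: "K \<le> K'" "K' \<le> g"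
  shows "cmod (complex_of_real (ensemble_avg R (2 * g + 1) (Sigma1 \<phi> g \<theta>)) -
             (Phi_hat g a 0
              - 1 / of_nat g *
                  (\<Sum>n | 1 \<le> n \<and> real n \<le> real N / 2. Phi_hat g a (real n / real g))
              + c_term R g N a
              - (\<Sum>k = K..K'. of_bool ((2 * k + 1) dvd g) / (of_nat g * (complex_of_real (real q) - 1)) *
                   Phi_hat g a (1 / (2 * real k + 1)) *
                   complex_of_real (real q powr (- (4 * real k * real g / (2 * real k + 1)))))
              + 1 / of_nat g *
                  (\<Sum>k = K..K'.
                     \<Sum>n | 1 \<le> n \<and> (real g + 1) / (2 * real k + 1) \<le> real n \<and>
                           real n \<le> min (real N / 2) ((real g - 1) / (2 * real k)).
                       Phi_hat g a (real n / real g) *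
                       complex_of_real (real q powr (- (4 * real k * real n))))))
       \<le> 3000 * B * (real q powr (min (real N / 2) ((real g - 1) / (2 * real K)) - 2 * real g - 1 / 2) / real K)
         + 3000 * B * (real q powr ((real g - 1) / (real K' + 1) - 2 * real g) / real g)"
proof -
  let ?b = "\<lambda>\<nu>::nat. Phi_hat g a (real \<nu> / real g)"
  let ?F = "\<lambda>\<nu>. ?b \<nu> * complex_of_real (dual_ratio g \<nu>)"
  let ?A = "{1..N div 2}"
  let ?G1 = "{\<nu>. \<nu> \<in> ?A \<and> g mod (2 * \<nu>) = \<nu> \<and> g div (2 * \<nu>) \<le> K'}"
  let ?G2 = "{\<nu>. \<nu> \<in> ?A \<and> 0 < g mod (2 * \<nu>) \<and> g mod (2 * \<nu>) < \<nu> \<and> g div (2 * \<nu>) \<le> K'}"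
  let ?L = "?A - (?G1 \<union> ?G2)"
  \<comment> \<open>The surviving \<nu> satisfy only \<nu> \<le> g/(2K), which exceeds (g - 1)/(2K)
    by 1/(2K) \<le> 1/2. The added 1/2 turns the -1 in the exponent of
    \<open>trace_err_sum_bound\<close> into -1/2.\<close>
  define x where "x = min (real N / 2) ((real g - 1) / (2 * real K)) + 1 / 2"
  let ?y = "real q powr (x - 2 * real g - 1)"
  let ?w = "real q powr ((real g - 1) / (real K' + 1) - 2 * real g)"
  have b: "cmod (?b \<nu>) \<le> B" for \<nu>
    using B[of "int (2 * \<nu>)"] by simp
  have B0: "B \<ge> 0" using b[of 0] norm_ge_zero order_trans by blast
  have x_le: "real \<nu> \<le> x" if \<nu>: "1 \<le> \<nu>" "\<nu> \<le> N div 2" "g mod (2 * \<nu>) \<le> \<nu>" for \<nu>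
  proof -
    have "K \<le> g div (2 * \<nu>)" by (rule window_le_div[OF K N2 \<nu>])
    then have "2 * \<nu> * K \<le> 2 * \<nu> * (g div (2 * \<nu>))" by (rule mult_le_mono2)
    also have "\<dots> \<le> g" by simp
    finally have "real (2 * \<nu> * K) \<le> real g" unfolding of_nat_le_iff .
    then have "real \<nu> \<le> real g / (2 * real K)" using K by (simp add: pos_le_divide_eq mult_ac)
    also have "\<dots> = (real g - 1) / (2 * real K) + 1 / (2 * real K)" by (simp add: diff_divide_distrib)
    also have "1 / (2 * real K) \<le> 1 / 2" using K by (simp add: field_simps)
    finally have "real \<nu> \<le> (real g - 1) / (2 * real K) + 1 / 2" by simp
    moreover have "real \<nu> \<le> real N / 2" using \<nu>(2) by linarith
    ultimately show ?thesis unfolding x_def by linarith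
  qed
  have x0: "x \<ge> 0" using g K by (simp add: x_def)
  have M: "real (N div 2) \<le> real g * (1 / real K)"
  proof -
    have K1: "2 * real K - 1 \<ge> real K" using K by simp
    have "2 * real (N div 2) \<le> (2 * real g - 1) / (2 * real K - 1)" using N2 by linarith
    also have "\<dots> \<le> (2 * real g) / real K" using K1 K g by (intro frac_le) auto
    finally show ?thesis by simp
  qed
  have "sum ?F ?A = sum ?F (?G1 \<union> ?G2) + sum ?F ?L"
    by (subst sum.subset_diff[of "?G1 \<union> ?G2"]) (auto simp: add.commute)
  also have "sum ?F (?G1 \<union> ?G2) = sum ?F ?G1 + sum ?F ?G2" by (rule sum.union_disjoint) auto
  finally have split: "sum ?F ?A = sum ?F ?G1 + sum ?F ?G2 + sum ?F ?L" .
  have "complex_of_real (ensemble_avg R (2 * g + 1) (Sigma1 \<phi> g \<theta>)) -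
      (Phi_hat g a 0 - 1 / of_nat g * sum ?b ?A + c_term R g N a
        - 1 / of_nat g * sum ?F ?G1 + 1 / of_nat g * (- sum ?F ?G2))
     = - (1 / of_nat g * sum ?F ?L) - 1 / of_nat g * (\<Sum>\<nu>\<in>?A. ?b \<nu> * complex_of_real (trace_err g \<nu>))"
    (is "?X = _")
    unfolding ensemble_avg_expansion[OF z \<phi> g] split by (simp add: distrib_left)
  then have "cmod ?X \<le> cmod (1 / of_nat g * sum ?F ?L) + cmod (1 / of_nat g * (\<Sum>\<nu>\<in>?A. ?b \<nu> * complex_of_real (trace_err g \<nu>)))"
    by (rule norm_le_of_eq_neg_diff)
  also have "\<dots> \<le> B * (1 / real g * (\<Sum>\<nu>\<in>?L. \<bar>dual_ratio g \<nu>\<bar>)) + B * (1 / real g * (\<Sum>\<nu>\<in>?A. \<bar>trace_err g \<nu>\<bar>))"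
    by (intro add_mono cmod_weighted_sum_le b)
  also have "\<dots> \<le> B * (2 * (?y / real K) + 2 * (?w / real g)) + B * (1032 * (1 / real K) * ?y)"
  proof (intro add_mono mult_left_mono B0)
    show "1 / real g * (\<Sum>\<nu>\<in>?L. \<bar>dual_ratio g \<nu>\<bar>) \<le> 2 * (?y / real K) + 2 * (?w / real g)"
    proof (rule leftover_bound[OF g K N2 KK _ _ x_le])
      fix \<nu> assume \<nu>: "\<nu> \<in> ?L" "0 < g mod (2 * \<nu>)" "g mod (2 * \<nu>) \<le> \<nu>"
      then consider "g mod (2 * \<nu>) = \<nu>" | "g mod (2 * \<nu>) < \<nu>" by linarith
      then show "K' < g div (2 * \<nu>)" by cases (use \<nu> in auto)
    qed auto
    show "1 / real g * (\<Sum>\<nu>\<in>?A. \<bar>trace_err g \<nu>\<bar>) \<le> 1032 * (1 / real K) * ?y"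
      by (rule trace_err_sum_bound[OF g _ M x0 x_le]) auto
  qed
  also have "\<dots> = 1034 * B * (?y / real K) + 2 * B * (?w / real g)" by (simp add: algebra_simps)
  \<comment> \<open>A round number above 1034 here and 2068 in \<open>large_range\<close>, so that
    one constant serves both.\<close>
  also have "\<dots> \<le> 3000 * B * (?y / real K) + 3000 * B * (?w / real g)"
    using B0 by (intro add_mono mult_right_mono) auto
  also have "x - 2 * real g - 1 = min (real N / 2) ((real g - 1) / (2 * real K)) - 2 * real g - 1 / 2" by (simp add: x_def)
  finally show ?thesis unfolding half_range odd_divisor_sum[OF g K N1 N2] window_double_sum[OF K N2] .
qed

lemma large_range:
  assumes g: "g \<ge> 1" and z: "zero_angles R g \<theta>" and \<phi>: "even_trig_poly N a \<phi>"
    and B: "\<And>n::int. cmod (Phi_hat g a (real_of_int n / (2 * real g))) \<le> B"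
    and N: "2 * g \<le> N" "N < 4 * g"
  shows "cmod (complex_of_real (ensemble_avg R (2 * g + 1) (Sigma1 \<phi> g \<theta>)) -
             (Phi_hat g a 0
              - 1 / of_nat g * (\<Sum>n = 1..g. Phi_hat g a (real n / real g))
              + c_term R g N a
              - Phi_hat g a 1 / (of_nat g * (complex_of_real (real q) - 1))))
       \<le> 3000 * B * real q powr (real N / 2 - 2 * real g - 1 / 2)"
proof -
  let ?b = "\<lambda>\<nu>::nat. Phi_hat g a (real \<nu> / real g)"
  let ?F = "\<lambda>\<nu>. ?b \<nu> * complex_of_real (dual_ratio g \<nu>)"
  let ?A = "{1..N div 2}"
  let ?y = "real q powr (real N / 2 - 2 * real g - 1)"
  have q3: "real q \<ge> 3" using order_ge_3 by simp
  have b: "cmod (?b \<nu>) \<le> B" for \<nu>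
    using B[of "int (2 * \<nu>)"] by simp
  have B0: "B \<ge> 0" using b[of 0] norm_ge_zero order_trans by blast
  have gN: "g \<le> N div 2" using N by linarith
  have A: "?A = {1..<g} \<union> {g} \<union> {g<..N div 2}" using g gN by auto
  have spl: "sum f ?A = sum f {1..<g} + f g + sum f {g<..N div 2}" for f :: "nat \<Rightarrow> complex"
    unfolding A by (subst sum.union_disjoint, (auto)[3], subst sum.union_disjoint, auto)
  have gg: "sum ?b {1..g} = sum ?b {1..<g} + ?b g"
  proof -
    have "{1..g} = insert g {1..<g}" using g by auto
    then show ?thesis by (simp add: add.commute)
  qed
  \<comment> \<open>For \<nu> > g the residue g mod 2\<nu> is g itself and the dual term is exactly
    -1. It cancels the leading 1, which is why the first sum stops at g.\<close>
  have big: "sum ?F {g<..N div 2} = - sum ?b {g<..N div 2}"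
    unfolding sum_negf[symmetric]
  proof (rule sum.cong)
    fix \<nu> assume \<nu>: "\<nu> \<in> {g<..N div 2}"
    then have m: "g mod (2 * \<nu>) = g" by simp
    have "dual_ratio g \<nu> = - (real q powr (2 * real g - 2 * real g))" using dual_ratio_cases(2)[of \<nu> g] \<nu> unfolding m by simp
    then have "dual_ratio g \<nu> = - 1" using q3 by simp
    then show "?F \<nu> = - ?b \<nu>" by simp
  qed simp
  have mid: "?F g = Phi_hat g a 1 / (complex_of_real (real q) - 1)"
  proof -
    have m: "g mod (2 * g) = g" using g by simp
    have "dual_ratio g g = real q powr (2 * real g - 2 * real g) / (real q - 1)" by (rule dual_ratio_cases(1)[OF g m])
    then have "dual_ratio g g = 1 / (real q - 1)" using q3 by simp
    then show ?thesis using g by simp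
  qed
  have "complex_of_real (ensemble_avg R (2 * g + 1) (Sigma1 \<phi> g \<theta>)) -
      (Phi_hat g a 0 - 1 / of_nat g * sum ?b {1..g} + c_term R g N a
        - Phi_hat g a 1 / (of_nat g * (complex_of_real (real q) - 1)))
     = - (1 / of_nat g * sum ?F {1..<g}) - 1 / of_nat g * (\<Sum>\<nu>\<in>?A. ?b \<nu> * complex_of_real (trace_err g \<nu>))"
    (is "?X = _")
  proof -
    have e1: "Phi_hat g a 1 / (of_nat g * (complex_of_real (real q) - 1)) = 1 / of_nat g * ?F g" unfolding mid by simp
    have "P - i * (s1 + bg + s3) + c - i * (f1 + fg + - s3) - r - (P - i * (s1 + bg) + c - i * fg) = - (i * f1) - r"
      for P i s1 bg s3 c f1 fg r :: complex by (simp add: algebra_simps)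
    then show ?thesis
      unfolding ensemble_avg_expansion[OF z \<phi> g] spl[of ?F] spl[of ?b] gg big e1 .
  qed
  then have "cmod ?X \<le> cmod (1 / of_nat g * sum ?F {1..<g}) + cmod (1 / of_nat g * (\<Sum>\<nu>\<in>?A. ?b \<nu> * complex_of_real (trace_err g \<nu>)))"
    by (rule norm_le_of_eq_neg_diff)
  also have "\<dots> \<le> B * (1 / real g * (\<Sum>\<nu>\<in>{1..<g}. \<bar>dual_ratio g \<nu>\<bar>)) + B * (1 / real g * (\<Sum>\<nu>\<in>?A. \<bar>trace_err g \<nu>\<bar>))"
    by (intro add_mono cmod_weighted_sum_le b)
  also have "\<dots> \<le> B * (4 * ?y) + B * (1032 * 2 * ?y)"
  proof (intro add_mono mult_left_mono B0)
    show "1 / real g * (\<Sum>\<nu>\<in>?A. \<bar>trace_err g \<nu>\<bar>) \<le> 1032 * 2 * ?y"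
    proof (rule trace_err_sum_bound[OF g])
      show "real (N div 2) \<le> real g * 2" using N by linarith
      show "real \<nu> \<le> real N / 2" if "\<nu> \<le> N div 2" for \<nu> using that by linarith
    qed auto
    let ?C = "{\<nu> \<in> {1..<g}. g mod (2 * \<nu>) \<le> \<nu>}"
    have "(\<Sum>\<nu>\<in>{1..<g}. \<bar>dual_ratio g \<nu>\<bar>) = (\<Sum>\<nu>\<in>?C. \<bar>dual_ratio g \<nu>\<bar>)"
    proof (rule sum.mono_neutral_right)
      show "\<forall>\<nu>\<in>{1..<g} - ?C. \<bar>dual_ratio g \<nu>\<bar> = 0"
      proof
        fix \<nu> assume "\<nu> \<in> {1..<g} - ?C"
        then have "\<nu> \<ge> 1" "g mod (2 * \<nu>) > \<nu>" by auto
        then show "\<bar>dual_ratio g \<nu>\<bar> = 0" using dual_ratio_cases(3) by simp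
      qed
    qed auto
    also have "\<dots> \<le> (\<Sum>\<nu>\<in>?C. real q ^ (2 * \<nu>) * (2 * real q powr (- 2 * real g - 1)))"
    proof (rule sum_mono)
      fix \<nu> assume "\<nu> \<in> ?C"
      then have "\<bar>dual_ratio g \<nu>\<bar> \<le> 2 * real q powr (2 * real \<nu> - 2 * real g - 1)" by (intro dual_ratio_abs_le) auto
      also have "\<dots> = 2 * real q powr (real (2 * \<nu>) + (- 2 * real g - 1))" by (simp add: algebra_simps)
      also have "\<dots> = real q ^ (2 * \<nu>) * (2 * real q powr (- 2 * real g - 1))"
        using q3 by (simp only: powr_add) (simp only: powr_realpow mult_ac)
      finally show "\<bar>dual_ratio g \<nu>\<bar> \<le> real q ^ (2 * \<nu>) * (2 * real q powr (- 2 * real g - 1))" .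
    qed
    also have "\<dots> = (\<Sum>i\<in>(\<lambda>\<nu>. 2 * \<nu>) ` ?C. real q ^ i) * (2 * real q powr (- 2 * real g - 1))"
      unfolding sum_distrib_right[symmetric] by (subst sum.reindex) (auto simp: inj_on_def)
    also have "\<dots> \<le> (2 * real q powr (real N / 2)) * (2 * real q powr (- 2 * real g - 1))"
    proof (intro mult_right_mono sum_powr_le)
      fix i assume "i \<in> (\<lambda>\<nu>. 2 * \<nu>) ` ?C"
      then obtain \<nu> where \<nu>: "i = 2 * \<nu>" "1 \<le> \<nu>" "\<nu> < g" "g mod (2 * \<nu>) \<le> \<nu>" by auto
      have "2 * \<nu> \<le> g"
      proof (rule ccontr)
        assume "\<not> 2 * \<nu> \<le> g"
        then have "g mod (2 * \<nu>) = g" by simp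
        then show False using \<nu> by linarith
      qed
      then show "real i \<le> real N / 2" unfolding \<nu>(1) using N by linarith
    qed auto
    also have "\<dots> = 4 * ?y" by (simp add: powr_add[symmetric] algebra_simps)
    finally have "(\<Sum>\<nu>\<in>{1..<g}. \<bar>dual_ratio g \<nu>\<bar>) \<le> 4 * ?y" .
    moreover have "1 / real g * (\<Sum>\<nu>\<in>{1..<g}. \<bar>dual_ratio g \<nu>\<bar>) \<le> 1 * (\<Sum>\<nu>\<in>{1..<g}. \<bar>dual_ratio g \<nu>\<bar>)"
      using g by (intro mult_right_mono sum_nonneg) auto
    ultimately show "1 / real g * (\<Sum>\<nu>\<in>{1..<g}. \<bar>dual_ratio g \<nu>\<bar>) \<le> 4 * ?y" by linarith
  qed
  also have "\<dots> = 2068 * B * ?y" by simp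
  also have "\<dots> \<le> 3000 * B * real q powr (real N / 2 - 2 * real g - 1 / 2)"
    using B0 q3 by (intro mult_mono powr_mono) auto
  finally show ?thesis .
qed

end

theorem theorem2p1:
  fixes B :: real
  shows "\<exists>C::real. \<forall>(R::'a ring) (g::nat) (N::nat) (a::int \<Rightarrow> complex) (\<phi>::real \<Rightarrow> real)
            (\<theta>::'a list \<Rightarrow> nat \<Rightarrow> real) (q::real).
    field R \<and> finite (carrier R) \<and> odd (order R) \<and> q = real (order R) \<and> g \<ge> 1 \<and> N \<ge> 1 \<and>
    even_trig_poly N a \<phi> \<and>
    (\<forall>n::int. cmod (Phi_hat g a (real_of_int n / (2 * real g))) \<le> B) \<and>
    zero_angles R g \<theta>
    \<longrightarrow>
    (\<forall>K K'::nat.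
       K \<ge> 1 \<and> 2 * real g / (2 * real K + 1) \<le> real N \<and>
       real N \<le> (2 * real g - 1) / (2 * real K - 1) \<and> K \<le> K' \<and> K' \<le> g
       \<longrightarrow>
       cmod (complex_of_real (ensemble_avg R (2 * g + 1) (Sigma1 \<phi> g \<theta>)) -
             (Phi_hat g a 0
              - 1 / of_nat g *
                  (\<Sum>n | 1 \<le> n \<and> real n \<le> real N / 2. Phi_hat g a (real n / real g))
              + c_term R g N a
              - (\<Sum>k = K..K'. of_bool ((2 * k + 1) dvd g) / (of_nat g * (complex_of_real q - 1)) *
                   Phi_hat g a (1 / (2 * real k + 1)) *
                   complex_of_real (q powr (- (4 * real k * real g / (2 * real k + 1)))))
              + 1 / of_nat g *
                  (\<Sum>k = K..K'.
                     \<Sum>n | 1 \<le> n \<and> (real g + 1) / (2 * real k + 1) \<le> real n \<and>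
                           real n \<le> min (real N / 2) ((real g - 1) / (2 * real k)).
                       Phi_hat g a (real n / real g) *
                       complex_of_real (q powr (- (4 * real k * real n))))))
       \<le> C * (q powr (min (real N / 2) ((real g - 1) / (2 * real K)) - 2 * real g - 1 / 2) / real K)
         + C * (q powr ((real g - 1) / (real K' + 1) - 2 * real g) / real g))
    \<and>
    (2 * g \<le> N \<and> N < 4 * g
       \<longrightarrow>
       cmod (complex_of_real (ensemble_avg R (2 * g + 1) (Sigma1 \<phi> g \<theta>)) -
             (Phi_hat g a 0
              - 1 / of_nat g * (\<Sum>n = 1..g. Phi_hat g a (real n / real g))
              + c_term R g N a
              - Phi_hat g a 1 / (of_nat g * (complex_of_real q - 1))))
       \<le> C * q powr (real N / 2 - 2 * real g - 1 / 2))"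
proof (rule exI[of _ "3000 * B"], intro allI impI conjI, goal_cases)
  case (1 R g N a \<phi> \<theta> q K K')
  then have "poly_over_odd_field R" by (simp add: poly_over_odd_field_def odd_finite_field_def odd_finite_field_axioms_def)
  then interpret poly_over_odd_field R .
  show ?case using 1 small_range[of g \<theta> N a \<phi> B K K'] by simp
next
  case (2 R g N a \<phi> \<theta> q)
  then have "poly_over_odd_field R" by (simp add: poly_over_odd_field_def odd_finite_field_def odd_finite_field_axioms_def)
  then interpret poly_over_odd_field R .
  show ?case using 2 large_range[of g \<theta> N a \<phi> B] by simp
qed

end
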